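(* Let the bilevel program (BLPP) without upper level constraints be simple at its local minimizer $(\bar x,\bar y)\in M$, and let $J_0:=J_0(\bar x,\bar y)$. For $\bar u\in\mathbb{R}^p$, $w\in\mathbb{R}^m$, $\xi\in\mathbb{R}^p$ consider the system $$(\ast)\quad\begin{cases}0=\nabla_xF(\bar x,\bar y)-[\nabla^2_{xy}(f+\bar u^Tg)(\bar x,\bar y)]w+\nabla_x(\xi^Tg)(\bar x,\bar y),\\ 0=\nabla_yF(\bar x,\bar y)-[\nabla^2_{yy}(f+\bar u^Tg)(\bar x,\bar y)]w+\nabla_y(\xi^Tg)(\bar x,\bar y),\\ \xi_i=0\quad\forall i\notin J_0.\end{cases}$$ The following hold. (1) Suppose $S(\bar x)=\{\bar y\}$ and $(\bar x,\bar y)$ is of Type 1. Let $\bar u$ be the unique KKT-multiplier for $L(\bar x)$ at $\bar y$. Then $(\bar x,\bar y,\bar u)$ is a local solution of $$\min_{x,y,u}F(x,y)\ \text{ s.t. }\ \nabla_yf(x,y)+\sum_{j\in J_0}u_j\nabla_yg_j(x,y)=0,\ g_j(x,y)=0\ \forall j\in J_0,$$ and the KKT condition holds for this problem at $(\bar x,\bar y,\bar u)$, i.e., there exist $w\in\mathbb{R}^m,\xi\in\mathbb{R}^p$ satisfying $(\ast)$ and $\nabla_yg_j(\bar x,\bar y)^Tw=0$ for all $j\in J_0$. (2) Suppose $S(\bar x)=\{\bar y\}$ and $(\bar x,\bar y)$ is of Type 2. Let $\bar u$ be the unique KKT-multiplier for $L(\bar x)$ at $\bar y$. Then there is a unique $q\in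 J_0$ such that $\bar u_q=0$ and $\bar u_j>0$ for $j\in J_0\setminus\{q\}$, and $(\bar x,\bar y,\bar u)$ is a local minimizer of the MPCC $$(P_q)\quad\min_{x,y,u}F(x,y)\ \text{ s.t. }\ \nabla_yf(x,y)+\sum_{j\in J_0}u_j\nabla_yg_j(x,y)=0,\ g_j(x,y)=0\ \forall j\in J_0\setminus\{q\},\ g_q(x,y)\le0,\ u_q\ge0,\ u_qg_q(x,y)=0.$$ And the strong (S-) stationary condition holds for $(P_q)$ at $(\bar x,\bar y,\bar u)$, i.e., there is $(w,\xi)\in\mathbb{R}^m\times\mathbb{R}^p$ satisfying $(\ast)$ and $$\nabla_yg_j(\bar x,\bar y)^Tw=0\ \forall j\in J_0\setminus\{q\},\quad \nabla_yg_q(\bar x,\bar y)^Tw\le0,\quad \xi_q\ge0.$$ (3) Suppose $S(\bar x)=\{\bar y\}$ and $(\bar x,\bar y)$ is of Type 4. Then $M_{\rm FJ}(\bar x,\bar y)=\{(\bar u_0,\bar u)\}$ with $\bar u_0=0$ and $\bar u_j>0$ for all $j\in J_0$. Moreover $(\bar x,\bar y,0,\bar u)$ is a local minimizer of $$\min_{x,y,u_0,u}F(x,y)\ \text{ s.t. }\ u_0\nabla_yf(x,y)+\sum_{j\in J_0}u_j\nabla_yg_j(x,y)=0,\ g_j(x,y)=0\ \forall j\in J_0,\ u_0\ge0,\ u_0+\sum_{j\in J_0}u_j=1,$$ and the KKT condition holds for this problem at $(\bar x,\bar y,0,\bar u)$, i.e., there exist $w\in\mathbb{R}^m,\xi\in\mathbb{R}^p$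 satisfying $(\ast)$ with the terms involving $f$ removed (that is, with $f+\bar u^Tg$ replaced by $\bar u^Tg$) and $$\nabla_yf(\bar x,\bar y)^Tw\le0,\quad\nabla_yg_j(\bar x,\bar y)^Tw=0\ \forall j\in J_0.$$ (4) Suppose $S(\bar x)=\{\bar y\}$ and $(\bar x,\bar y)$ is of Type 5-1. Then there exist a unique KKT-multiplier $\bar u$ and an index $q\in J_0$ with $\bar u_q=0$, $\bar u_j>0$ for all $j\in J_0\setminus\{q\}$, and $\bar\mu$ with $\bar\mu_j>0$ for all $j\in J_0$ (and $\bar\mu_j=0$ for $j\notin J_0$), such that $M_{\rm KKT}(\bar x,\bar y)=\bar u+\mathbb{R}_+\bar\mu$. The point $(\bar x,\bar y,\bar u)$ is a local solution of the MPCC $(P_q)$ displayed in (2), and the S-stationary condition of (2) holds for $(P_q)$ at $(\bar x,\bar y,\bar u)$ with $w=0$. Furthermore, $(\bar x,\bar y)$ is a local solution of $$\min_{x,y}F(x,y)\ \text{ s.t. }\ g_j(x,y)=0\ \forall j\in J_0\setminus\{q\},\ g_q(x,y)\le0,$$ and the KKT condition for this problem holds, i.e., there exists $\xi\in\mathbb{R}^p$ with $0=\nabla F(\bar x,\bar y)+\nabla(\xi^Tg)(\bar x,\bar y)$, $\xi_i=0$ for all $i\notin J_0$, and $\xi_q\ge0$. (5) Suppose $S(\bar x)=\{\bar y\}$ and $(\bar x,\bar y)$ is of Type 5-2. Then there exists a unique pair $q,r\in J_0$, $q\ne r$, such that there are $\bar u^1,\bar u^2\in M_{\rm KKT}(\bar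 x,\bar y)$ satisfying $$\bar u^1_q=0,\ \bar u^1_j>0\ \forall j\in J_0\setminus\{q\};\qquad \bar u^2_r=0,\ \bar u^2_j>0\ \forall j\in J_0\setminus\{r\},$$ and $M_{\rm KKT}(\bar x,\bar y)$ is the line segment joining $\bar u^1$ and $\bar u^2$. Moreover, for any $\bar u\in M_{\rm KKT}(\bar x,\bar y)$, $(\bar x,\bar y,\bar u)$ is a local solution of the MPCC $$\begin{aligned}\min_{x,y,u}\ &F(x,y)\\ \text{s.t. }&\nabla_yf(x,y)+\sum_{j\in J_0}u_j\nabla_yg_j(x,y)=0,\ g_j(x,y)=0\ \forall j\in J_0\setminus\{q,r\},\\ &g_k(x,y)\le0,\ u_k\ge0,\ u_kg_k(x,y)=0\ \forall k\in\{q,r\},\end{aligned}$$ and the S-stationary condition holds for this problem at $(\bar x,\bar y,\bar u)$. Moreover, the S-stationary condition reduces to the existence of $\xi\in\mathbb{R}^p$ such that $0=\nabla F(\bar x,\bar y)+\nabla(\xi^Tg)(\bar x,\bar y)$, $\xi_i=0$ for all $i\notin J_0$, $\xi_q\ge0$ if $\bar u=\bar u^1$, and $\xi_r\ge0$ if $\bar u=\bar u^2$. (6) Suppose Case II holds: $S(\bar x)=\{\bar y_1,\bar y_2\}$, with $\bar y=\bar y_1$. Let $y_1(x),y_2(x)$ be the unique local minimizers for $L(x)$ in a neighborhood of $\bar x$ with $y_k(\bar x)=\bar y_k$, and let $\bar u^k$ be the unique KKT-multiplier for $L(\bar x)$ at $\bar y_k$, $k=1,2$. Then $V(x)=\min\{f(x,y_1(x)),f(x,y_2(x))\}$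 for all $x$ in a neighbourhood of $\bar x$. Let $\bar u:=\bar u^1$. Then $\bar u_j>0$ for all $j\in J_0$, and $(\bar x,\bar y,\bar u)$ is, for some $\mu>0$, a local solution of the nonsmooth problem $$\min_{x,y,u}F(x,y)+\mu(f(x,y)-V(x))\ \text{ s.t. }\ \nabla_yf(x,y)+\sum_{i=1}^pu_i\nabla_yg_i(x,y)=0,\ g_j(x,y)=0\ \forall j\in J_0,$$ and the nonsmooth KKT condition holds for this problem at $(\bar x,\bar y,\bar u)$, that is, there exist $\lambda^k\ge0$ with $\lambda^1+\lambda^2=1$, $w\in\mathbb{R}^m$, $\xi\in\mathbb{R}^p$ and $\mu>0$ such that $$\begin{aligned} 0&=\nabla_xF(\bar x,\bar y)+\mu\sum_{k=1}^2\lambda^k\Big(\nabla_xf(\bar x,\bar y)-\nabla_xf(\bar x,\bar y_k)-\sum_{i=1}^p\bar u^k_i\nabla_xg_i(\bar x,\bar y_k)\Big)-[\nabla^2_{xy}(f+\bar u^Tg)(\bar x,\bar y)]w+\nabla_x(\xi^Tg)(\bar x,\bar y),\\ 0&=\nabla_yF(\bar x,\bar y)+\mu\nabla_yf(\bar x,\bar y)-[\nabla^2_{yy}(f+\bar u^Tg)(\bar x,\bar y)]w+\nabla_y(\xi^Tg)(\bar x,\bar y),\\ &\xi_i=0\ \forall i\notin J_0,\qquad\nabla_yg_j(\bar x,\bar y)^Tw=0\ \forall j\in J_0. \end{aligned}$$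
   Context: Setting: $x\in\mathbb{R}$ (dimension $n=1$), $y\in\mathbb{R}^m$; $F:\mathbb{R}^{1+m}\to\mathbb{R}$ is continuously differentiable; $f:\mathbb{R}^{1+m}\to\mathbb{R}$ and $g:\mathbb{R}^{1+m}\to\mathbb{R}^p$ are three times continuously differentiable, and for all $(\hat x,c)\in\mathbb{R}\times\mathbb{R}$ the set $\{(x,y): |x-\hat x|\le1,\ f(x,y)\le c,\ g(x,y)\le0\}$ is compact. $L(x)$: $\min_yf(x,y)$ s.t. $g(x,y)\le0$; $S(x)$ its set of global minimizers; $V(x):=\inf_y\{f(x,y): g(x,y)\le0\}$; $M:=\{(x,y): y\in S(x)\}$. (BLPP): $\min_{x,y}F(x,y)$ s.t. $y\in S(x)$. $J_0(x,y):=\{j: g_j(x,y)=0\}$. For $w\in\mathbb{R}^m$, $[\nabla^2_{xy}h]w:=\sum_{i=1}^m\frac{\partial^2h}{\partial x\partial y_i}w_i$. $M_{\rm KKT}(x,y):=\{u\in\mathbb{R}^p: \nabla_yf+\sum_iu_i\nabla_yg_i=0,\ u\ge0,\ u^Tg=0\text{ at }(x,y)\}$ (KKT-multipliers); $M_{\rm FJ}(x,y):=\{(u_0,u)\in\mathbb{R}^{1+p}: u_0\nabla_yf+\sum_iu_i\nabla_yg_i=0,\ (u_0,u)\ge0,\ \|(u_0,u)\|_1=1,\ u^Tg=0\text{ at }(x,y)\}$ (FJ-multipliers). Types of a point $(\bar x,\bar y)$, where $\bar y$ is feasible for $L(\bar x)$ and there is $(u_0,u)\neq0$ with $u_0\nabla_yf+\sum_{j\in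 J_0}u_j\nabla_yg_j=0$ at $(\bar x,\bar y)$, $J_0=J_0(\bar x,\bar y)$. LICQ: $\nabla_yg_j(\bar x,\bar y)$, $j\in J_0$, are linearly independent (then there are unique $\bar u_j$, $j\in J_0$, with $\nabla_yf+\sum_{j\in J_0}\bar u_j\nabla_yg_j=0$; set $\bar u_j=0$ otherwise). $T:=\{\zeta\in\mathbb{R}^m:\nabla_yg_j(\bar x,\bar y)^T\zeta=0,\ j\in J_0\}$; for a symmetric matrix $H$ and subspace $W$, "$H$ nonsingular on $W$" means $B^THB$ nonsingular for a matrix $B$ whose columns form a basis of $W$. - Type 1: LICQ; $\bar u_j\ne0$ for $j\in J_0$ (SC); $\nabla^2_{yy}(f+\bar u^Tg)(\bar x,\bar y)$ nonsingular on $T$ (SOC). - Type 2: LICQ; exactly one $\bar u_q$, $q\in J_0$, vanishes; $\nabla^2_{yy}(f+\bar u^Tg)(\bar x,\bar y)$ is nonsingular on $T$ and on $\{\zeta:\nabla_yg_j^T\zeta=0,\ j\in J_0\setminus\{q\}\}$; and $\frac{d}{dx}g_q(x,\widetilde y(x))|_{x=\bar x}\neq0$, where $(\widetilde y,\widetilde u)$ is the $C^2$ solution near $\bar x$ of $\nabla_yf(x,y)+\sum_{j\in J_0\setminus\{q\}}u_j\nabla_yg_j(x,y)=0$, $g_j(x,y)=0$ ($j\in J_0\setminus\{q\}$), through $(\bar y,\bar u)$. - Type 4: $|J_0|\ge1$; $\{\nabla_yg_j(\bar x,\bar y)\}_{j\in J_0}$ has rank $|J_0|-1<m$; the nonzero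 solution $\lambda$ (unique up to scaling) of $\sum_{j\in J_0}\lambda_j\nabla_yg_j=0$ has $\lambda_j\neq0$ for all $j\in J_0$; $\sum_{j\in J_0}\lambda_j\nabla_xg_j\neq0$; with $B$ a basis matrix of $T$, $A:=B^T\nabla^2_{yy}(\sum_{j\in J_0}\lambda_jg_j)B$ is nonsingular and $b:=B^T\nabla_yf$ satisfies $b^TA^{-1}b\ne0$ (all at $(\bar x,\bar y)$; in particular the KKT condition fails). - Type 5: $|J_0|=m+1$; the full gradients $\nabla g_j(\bar x,\bar y)$, $j\in J_0$, are linearly independent; any $m$ of the vectors $\nabla_yg_j(\bar x,\bar y)$, $j\in J_0$, are linearly independent; for each $i\in J_0$ the unique numbers $u^{(i)}_j$, $j\in J_0\setminus\{i\}$, with $\nabla_yf+\sum_{j\in J_0\setminus\{i\}}u^{(i)}_j\nabla_yg_j=0$ are all nonzero. It is Type 5-1 if MFCQ (existence of $d$ with $\nabla_yg_j^Td<0$ for all $j\in J_0$) fails but the KKT condition holds, and Type 5-2 if MFCQ holds. (BLPP) is simple at $(\bar x,\bar y)\in M$ if either Case I: $S(\bar x)=\{\bar y\}$ and $(\bar x,\bar y)$ is of Type 1, 2, 4, 5-1 or 5-2; or Case II: $S(\bar x)=\{\bar y_1,\bar y_2\}$ (two distinct points), $(\bar x,\bar y_1),(\bar x,\bar y_2)$ are both of Type 1, and $\frac{d}{dx}[f(x,y_2(x))-f(x,y_1(x))]|_{x=\bar x}\neq0$, where $y_k(x)$ is the unique local minimizer of $L(x)$ near $\bar y_k$ for $x$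 near $\bar x$, $y_k(\bar x)=\bar y_k$. S-stationary condition for the MPCC in (5) at $(\bar x,\bar y,\bar u)$: there is $(w,\xi)\in\mathbb{R}^m\times\mathbb{R}^p$ satisfying the system $(\ast)$ of the claim with $\nabla_yg_j(\bar x,\bar y)^Tw=0$ for $j\in J_0\setminus\{q,r\}$ and, for $k\in\{q,r\}$: $\nabla_yg_k(\bar x,\bar y)^Tw=0$ if $\bar u_k>0$; $\nabla_yg_k(\bar x,\bar y)^Tw\le0$ and $\xi_k\ge0$ if $\bar u_k=0$.
   Formalization: In (6), the nonsmooth problem carries the extra constraint u_i = 0 for all i not in J_0; with these u_i free the local-solution claim is false, e.g. f=(y²-1)²+xy, g=y-10, F=y-x at (0,1). *)

theory Defs
  imports "HOL-Analysis.Analysis"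
begin

section \<open>Smoothness and partial derivatives\<close>

text \<open>\<open>Ck_on k f U\<close> is meant for open \<open>U\<close>, where \<^const>\<open>frechet_derivative\<close> is uniquely determined.\<close>

fun Ck_on :: "nat \<Rightarrow> ('a::euclidean_space \<Rightarrow> 'b::real_normed_vector) \<Rightarrow> 'a set \<Rightarrow> bool" where
  "Ck_on 0 f U \<longleftrightarrow> continuous_on U f"
| "Ck_on (Suc k) f U \<longleftrightarrow>
     (\<forall>z\<in>U. f differentiable (at z)) \<and>
     (\<forall>b\<in>Basis. Ck_on k (\<lambda>z. frechet_derivative f (at z) b) U)"

definition grad_x :: "(real \<times> (real^'m) \<Rightarrow> real) \<Rightarrow> real \<times> (real^'m) \<Rightarrow> real" where
  "grad_x h z = deriv (\<lambda>t. h (t, snd z)) (fst z)"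

definition grad_y :: "(real \<times> (real^'m) \<Rightarrow> real) \<Rightarrow> real \<times> (real^'m) \<Rightarrow> real^'m" where
  "grad_y h z = (\<chi> i. frechet_derivative (\<lambda>v. h (fst z, v)) (at (snd z)) (axis i 1))"

definition grad :: "(real \<times> (real^'m) \<Rightarrow> real) \<Rightarrow> real \<times> (real^'m) \<Rightarrow> real \<times> (real^'m)" where
  "grad h z = (grad_x h z, grad_y h z)"

text \<open>\<open>hess_xy h z\<close> is the row of the mixed derivatives of \<open>h\<close> in \<open>x\<close> and \<open>y\<^sub>i\<close>; the paper's
  \<open>[\<nabla>\<^sup>2\<^sub>x\<^sub>y h] w\<close> is therefore \<open>hess_xy h z \<bullet> w\<close>.\<close>

definition hess_xy :: "(real \<times> (real^'m) \<Rightarrow> real) \<Rightarrow> real \<times> (real^'m) \<Rightarrow> real^'m" where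
  "hess_xy h z = (\<chi> i. grad_x (\<lambda>z'. grad_y h z' $ i) z)"

definition hess_yy :: "(real \<times> (real^'m) \<Rightarrow> real) \<Rightarrow> real \<times> (real^'m) \<Rightarrow> real^'m^'m" where
  "hess_yy h z = (\<chi> i j. grad_y (\<lambda>z'. grad_y h z' $ i) z $ j)"

definition local_min_on :: "('a::metric_space \<Rightarrow> 'b::linorder) \<Rightarrow> 'a set \<Rightarrow> 'a \<Rightarrow> bool" where
  "local_min_on h A z \<longleftrightarrow> z \<in> A \<and> (\<exists>e>0. \<forall>z'\<in>A. dist z' z < e \<longrightarrow> h z \<le> h z')"


section \<open>Linear algebra on subspaces\<close>

definition indep_family :: "('i \<Rightarrow> 'a::real_vector) \<Rightarrow> 'i set \<Rightarrow> bool" where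
  "indep_family v J \<longleftrightarrow> inj_on v J \<and> independent (v ` J)"

text \<open>The size of \<open>B\<^sup>T H B\<close> depends on the dimension of the subspace, so such matrices are
  functions on \<open>I \<times> I\<close> for a finite index set \<open>I\<close>. The basis matrix \<open>B\<close> is represented by the set
  \<open>Bs\<close> of its columns, and that set also serves as the index set; it may be empty.\<close>

definition inverse_matrices_on ::
    "'i set \<Rightarrow> ('i \<Rightarrow> 'i \<Rightarrow> real) \<Rightarrow> ('i \<Rightarrow> 'i \<Rightarrow> real) \<Rightarrow> bool" where
  "inverse_matrices_on I A A' \<longleftrightarrow>
     (\<forall>i\<in>I. \<forall>j\<in>I. (\<Sum>k\<in>I. A i k * A' k j) = (if i = j then 1 else 0) \<and>
                    (\<Sum>k\<in>I. A' i k * A k j) = (if i = j then 1 else 0))"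

definition basis_of :: "(real^'m) set \<Rightarrow> (real^'m) set \<Rightarrow> bool" where
  "basis_of Bs W \<longleftrightarrow> independent Bs \<and> span Bs = W"

definition restricted_matrix :: "real^'m^'m \<Rightarrow> real^'m \<Rightarrow> real^'m \<Rightarrow> real" where
  "restricted_matrix H b b' = b \<bullet> (H *v b')"

definition nonsingular_on :: "real^'m^'m \<Rightarrow> (real^'m) set \<Rightarrow> bool" where
  "nonsingular_on H W \<longleftrightarrow>
     (\<exists>Bs A'. basis_of Bs W \<and> inverse_matrices_on Bs (restricted_matrix H) A')"


section \<open>The lower level problem\<close>

definition feasible :: "(real \<times> (real^'m) \<Rightarrow> real^'p) \<Rightarrow> real \<Rightarrow> (real^'m) set" where
  "feasible g x = {y. \<forall>j. g (x, y) $ j \<le> 0}"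

definition sol_set ::
    "(real \<times> (real^'m) \<Rightarrow> real) \<Rightarrow> (real \<times> (real^'m) \<Rightarrow> real^'p) \<Rightarrow> real \<Rightarrow> (real^'m) set" where
  "sol_set f g x = {y \<in> feasible g x. \<forall>v \<in> feasible g x. f (x, y) \<le> f (x, v)}"

definition sol_graph ::
    "(real \<times> (real^'m) \<Rightarrow> real) \<Rightarrow> (real \<times> (real^'m) \<Rightarrow> real^'p) \<Rightarrow> (real \<times> (real^'m)) set" where
  "sol_graph f g = {(x, y). y \<in> sol_set f g x}"

text \<open>Extended-real valued, since the infimum over an empty feasible set is \<open>\<infinity>\<close>.\<close>

definition opt_value ::
    "(real \<times> (real^'m) \<Rightarrow> real) \<Rightarrow> (real \<times> (real^'m) \<Rightarrow> real^'p) \<Rightarrow> real \<Rightarrow> ereal" where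
  "opt_value f g x = (INF y\<in>feasible g x. ereal (f (x, y)))"

definition active :: "(real \<times> (real^'m) \<Rightarrow> real^'p) \<Rightarrow> real \<times> (real^'m) \<Rightarrow> 'p set" where
  "active g z = {j. g z $ j = 0}"

definition cgrad_x :: "(real \<times> (real^'m) \<Rightarrow> real^'p) \<Rightarrow> 'p \<Rightarrow> real \<times> (real^'m) \<Rightarrow> real" where
  "cgrad_x g j = grad_x (\<lambda>z. g z $ j)"

definition cgrad_y :: "(real \<times> (real^'m) \<Rightarrow> real^'p) \<Rightarrow> 'p \<Rightarrow> real \<times> (real^'m) \<Rightarrow> real^'m" where
  "cgrad_y g j = grad_y (\<lambda>z. g z $ j)"

definition cgrad :: "(real \<times> (real^'m) \<Rightarrow> real^'p) \<Rightarrow> 'p \<Rightarrow> real \<times> (real^'m) \<Rightarrow> real \<times> (real^'m)" where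
  "cgrad g j = grad (\<lambda>z. g z $ j)"

definition M_KKT ::
    "(real \<times> (real^'m) \<Rightarrow> real) \<Rightarrow> (real \<times> (real^'m) \<Rightarrow> real^'p) \<Rightarrow> real \<times> (real^'m) \<Rightarrow> (real^'p) set" where
  "M_KKT f g z = {u. grad_y f z + (\<Sum>i\<in>UNIV. u $ i *\<^sub>R cgrad_y g i z) = 0 \<and>
                     (\<forall>i. 0 \<le> u $ i) \<and> u \<bullet> g z = 0}"

definition M_FJ ::
    "(real \<times> (real^'m) \<Rightarrow> real) \<Rightarrow> (real \<times> (real^'m) \<Rightarrow> real^'p) \<Rightarrow> real \<times> (real^'m) \<Rightarrow> (real \<times> (real^'p)) set" where
  "M_FJ f g z = {(u0, u). u0 *\<^sub>R grad_y f z + (\<Sum>i\<in>UNIV. u $ i *\<^sub>R cgrad_y g i z) = 0 \<and>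
                     0 \<le> u0 \<and> (\<forall>i. 0 \<le> u $ i) \<and>
                     \<bar>u0\<bar> + (\<Sum>i\<in>UNIV. \<bar>u $ i\<bar>) = 1 \<and> u \<bullet> g z = 0}"

definition lagrangian ::
    "(real \<times> (real^'m) \<Rightarrow> real) \<Rightarrow> (real \<times> (real^'m) \<Rightarrow> real^'p) \<Rightarrow> real^'p \<Rightarrow> real \<times> (real^'m) \<Rightarrow> real" where
  "lagrangian f g u = (\<lambda>z. f z + u \<bullet> g z)"


section \<open>Types of generalized critical points\<close>

definition gc_point ::
    "(real \<times> (real^'m) \<Rightarrow> real) \<Rightarrow> (real \<times> (real^'m) \<Rightarrow> real^'p) \<Rightarrow> real \<times> (real^'m) \<Rightarrow> bool" where
  "gc_point f g z \<longleftrightarrow>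
     snd z \<in> feasible g (fst z) \<and>
     (\<exists>u0 u. (u0 \<noteq> 0 \<or> (\<exists>j\<in>active g z. u $ j \<noteq> 0)) \<and>
             u0 *\<^sub>R grad_y f z + (\<Sum>j\<in>active g z. u $ j *\<^sub>R cgrad_y g j z) = 0)"

definition LICQ :: "(real \<times> (real^'m) \<Rightarrow> real^'p) \<Rightarrow> real \<times> (real^'m) \<Rightarrow> bool" where
  "LICQ g z \<longleftrightarrow> indep_family (\<lambda>j. cgrad_y g j z) (active g z)"

definition MFCQ :: "(real \<times> (real^'m) \<Rightarrow> real^'p) \<Rightarrow> real \<times> (real^'m) \<Rightarrow> bool" where
  "MFCQ g z \<longleftrightarrow> (\<exists>d. \<forall>j\<in>active g z. cgrad_y g j z \<bullet> d < 0)"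

text \<open>Multipliers of arbitrary sign, extended by 0 outside the active set; unique under LICQ.\<close>

definition crit_multiplier ::
    "(real \<times> (real^'m) \<Rightarrow> real) \<Rightarrow> (real \<times> (real^'m) \<Rightarrow> real^'p) \<Rightarrow> real \<times> (real^'m) \<Rightarrow> real^'p \<Rightarrow> bool" where
  "crit_multiplier f g z u \<longleftrightarrow>
     grad_y f z + (\<Sum>j\<in>active g z. u $ j *\<^sub>R cgrad_y g j z) = 0 \<and> (\<forall>j. j \<notin> active g z \<longrightarrow> u $ j = 0)"

definition tangent_y :: "(real \<times> (real^'m) \<Rightarrow> real^'p) \<Rightarrow> 'p set \<Rightarrow> real \<times> (real^'m) \<Rightarrow> (real^'m) set" where
  "tangent_y g J z = {\<zeta>. \<forall>j\<in>J. cgrad_y g j z \<bullet> \<zeta> = 0}"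

definition type1 ::
    "(real \<times> (real^'m) \<Rightarrow> real) \<Rightarrow> (real \<times> (real^'m) \<Rightarrow> real^'p) \<Rightarrow> real \<times> (real^'m) \<Rightarrow> bool" where
  "type1 f g z \<longleftrightarrow>
     gc_point f g z \<and> LICQ g z \<and>
     (\<exists>u. crit_multiplier f g z u \<and>
          (\<forall>j\<in>active g z. u $ j \<noteq> 0) \<and>
          nonsingular_on (hess_yy (lagrangian f g u) z) (tangent_y g (active g z) z))"

text \<open>\<open>(y, u)\<close> is the solution path through \<open>(ybar, ubar)\<close> of the system in which constraint \<open>q\<close> is
  dropped; its germ at \<open>xbar\<close> is unique by the implicit function theorem.\<close>

definition reduced_path ::
    "(real \<times> (real^'m) \<Rightarrow> real) \<Rightarrow> (real \<times> (real^'m) \<Rightarrow> real^'p) \<Rightarrow> 'p set \<Rightarrow>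
     real \<times> (real^'m) \<Rightarrow> real^'p \<Rightarrow> (real \<Rightarrow> real^'m) \<Rightarrow> (real \<Rightarrow> real^'p) \<Rightarrow> bool" where
  "reduced_path f g J z ubar y u \<longleftrightarrow>
     y (fst z) = snd z \<and> u (fst z) = ubar \<and>
     (\<exists>U. open U \<and> fst z \<in> U \<and> Ck_on 2 y U \<and> Ck_on 2 u U \<and>
        (\<forall>x\<in>U. grad_y f (x, y x) + (\<Sum>j\<in>J. u x $ j *\<^sub>R cgrad_y g j (x, y x)) = 0 \<and>
               (\<forall>j\<in>J. g (x, y x) $ j = 0) \<and> (\<forall>j. j \<notin> J \<longrightarrow> u x $ j = 0)))"

definition type2 ::
    "(real \<times> (real^'m) \<Rightarrow> real) \<Rightarrow> (real \<times> (real^'m) \<Rightarrow> real^'p) \<Rightarrow> real \<times> (real^'m) \<Rightarrow> bool" where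
  "type2 f g z \<longleftrightarrow>
     gc_point f g z \<and> LICQ g z \<and>
     (\<exists>ubar q. crit_multiplier f g z ubar \<and>
        q \<in> active g z \<and> ubar $ q = 0 \<and> (\<forall>j\<in>active g z - {q}. ubar $ j \<noteq> 0) \<and>
        nonsingular_on (hess_yy (lagrangian f g ubar) z) (tangent_y g (active g z) z) \<and>
        nonsingular_on (hess_yy (lagrangian f g ubar) z) (tangent_y g (active g z - {q}) z) \<and>
        (\<exists>y u D. reduced_path f g (active g z - {q}) z ubar y u \<and>
           ((\<lambda>x. g (x, y x) $ q) has_real_derivative D) (at (fst z)) \<and> D \<noteq> 0))"

definition type4 ::
    "(real \<times> (real^'m) \<Rightarrow> real) \<Rightarrow> (real \<times> (real^'m) \<Rightarrow> real^'p) \<Rightarrow> real \<times> (real^'m) \<Rightarrow> bool" where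
  "type4 f g z \<longleftrightarrow>
     gc_point f g z \<and>
     card (active g z) \<ge> 1 \<and>
     dim ((\<lambda>j. cgrad_y g j z) ` active g z) = card (active g z) - 1 \<and>
     card (active g z) - 1 < CARD('m) \<and>
     (\<exists>lam :: real^'p.
        (\<Sum>j\<in>active g z. lam $ j *\<^sub>R cgrad_y g j z) = 0 \<and>
        (\<forall>j\<in>active g z. lam $ j \<noteq> 0) \<and>
        (\<Sum>j\<in>active g z. lam $ j * cgrad_x g j z) \<noteq> 0 \<and>
        (\<exists>Bs A'. basis_of Bs (tangent_y g (active g z) z) \<and>
           inverse_matrices_on Bs
             (restricted_matrix (hess_yy (\<lambda>z'. \<Sum>j\<in>active g z. lam $ j * g z' $ j) z)) A' \<and>
           (\<Sum>b\<in>Bs. \<Sum>b'\<in>Bs. (b \<bullet> grad_y f z) * A' b b' * (b' \<bullet> grad_y f z)) \<noteq> 0))"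

definition type5 ::
    "(real \<times> (real^'m) \<Rightarrow> real) \<Rightarrow> (real \<times> (real^'m) \<Rightarrow> real^'p) \<Rightarrow> real \<times> (real^'m) \<Rightarrow> bool" where
  "type5 f g z \<longleftrightarrow>
     gc_point f g z \<and>
     card (active g z) = CARD('m) + 1 \<and>
     indep_family (\<lambda>j. cgrad g j z) (active g z) \<and>
     (\<forall>K \<subseteq> active g z. card K = CARD('m) \<longrightarrow> indep_family (\<lambda>j. cgrad_y g j z) K) \<and>
     (\<forall>i\<in>active g z. \<exists>u :: real^'p.
        grad_y f z + (\<Sum>j\<in>active g z - {i}. u $ j *\<^sub>R cgrad_y g j z) = 0 \<and>
        (\<forall>j\<in>active g z - {i}. u $ j \<noteq> 0))"

definition type5_1 ::
    "(real \<times> (real^'m) \<Rightarrow> real) \<Rightarrow> (real \<times> (real^'m) \<Rightarrow> real^'p) \<Rightarrow> real \<times> (real^'m) \<Rightarrow> bool" where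
  "type5_1 f g z \<longleftrightarrow> type5 f g z \<and> \<not> MFCQ g z \<and> M_KKT f g z \<noteq> {}"

definition type5_2 ::
    "(real \<times> (real^'m) \<Rightarrow> real) \<Rightarrow> (real \<times> (real^'m) \<Rightarrow> real^'p) \<Rightarrow> real \<times> (real^'m) \<Rightarrow> bool" where
  "type5_2 f g z \<longleftrightarrow> type5 f g z \<and> MFCQ g z"


section \<open>Simple bilevel programs\<close>

text \<open>For \<open>x\<close> near \<open>xbar\<close>, \<open>y x\<close> is the only local minimizer of the lower level problem in some
  fixed neighbourhood of \<open>ybar\<close>.\<close>

definition local_min_branch ::
    "(real \<times> (real^'m) \<Rightarrow> real) \<Rightarrow> (real \<times> (real^'m) \<Rightarrow> real^'p) \<Rightarrow> real \<Rightarrow> real^'m \<Rightarrow>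
     (real \<Rightarrow> real^'m) \<Rightarrow> bool" where
  "local_min_branch f g xbar ybar y \<longleftrightarrow>
     y xbar = ybar \<and>
     (\<exists>U N. open U \<and> xbar \<in> U \<and> open N \<and> ybar \<in> N \<and>
        (\<forall>x\<in>U. {v \<in> N. local_min_on (\<lambda>v. f (x, v)) (feasible g x) v} = {y x}))"

definition case_I ::
    "(real \<times> (real^'m) \<Rightarrow> real) \<Rightarrow> (real \<times> (real^'m) \<Rightarrow> real^'p) \<Rightarrow> real \<Rightarrow> real^'m \<Rightarrow> bool" where
  "case_I f g xbar ybar \<longleftrightarrow>
     sol_set f g xbar = {ybar} \<and>
     (type1 f g (xbar, ybar) \<or> type2 f g (xbar, ybar) \<or> type4 f g (xbar, ybar) \<or>
      type5_1 f g (xbar, ybar) \<or> type5_2 f g (xbar, ybar))"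

definition case_II ::
    "(real \<times> (real^'m) \<Rightarrow> real) \<Rightarrow> (real \<times> (real^'m) \<Rightarrow> real^'p) \<Rightarrow> real \<Rightarrow> real^'m \<Rightarrow> real^'m \<Rightarrow> bool" where
  "case_II f g xbar ybar1 ybar2 \<longleftrightarrow>
     sol_set f g xbar = {ybar1, ybar2} \<and> ybar1 \<noteq> ybar2 \<and>
     type1 f g (xbar, ybar1) \<and> type1 f g (xbar, ybar2) \<and>
     (\<exists>y1 y2 D. local_min_branch f g xbar ybar1 y1 \<and> local_min_branch f g xbar ybar2 y2 \<and>
        ((\<lambda>x. f (x, y2 x) - f (x, y1 x)) has_real_derivative D) (at xbar) \<and> D \<noteq> 0)"

definition simple_blpp ::
    "(real \<times> (real^'m) \<Rightarrow> real) \<Rightarrow> (real \<times> (real^'m) \<Rightarrow> real^'p) \<Rightarrow> real \<Rightarrow> real^'m \<Rightarrow> bool" where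
  "simple_blpp f g xbar ybar \<longleftrightarrow>
     (xbar, ybar) \<in> sol_graph f g \<and>
     (case_I f g xbar ybar \<or> (\<exists>ybar2. case_II f g xbar ybar ybar2))"


section \<open>Single level problems and stationarity\<close>

text \<open>The system \<open>(\<star>)\<close> of the paper, with \<open>h\<close> standing for the function whose second derivatives
  enter, i.e. \<open>f + ubar\<^sup>T g\<close>, or \<open>ubar\<^sup>T g\<close> when the terms involving \<open>f\<close> are removed.\<close>

definition star_system ::
    "(real \<times> (real^'m) \<Rightarrow> real) \<Rightarrow> (real \<times> (real^'m) \<Rightarrow> real) \<Rightarrow> (real \<times> (real^'m) \<Rightarrow> real^'p) \<Rightarrow>
     real \<times> (real^'m) \<Rightarrow> real^'m \<Rightarrow> real^'p \<Rightarrow> bool" where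
  "star_system F h g z w \<xi> \<longleftrightarrow>
     0 = grad_x F z - hess_xy h z \<bullet> w + grad_x (\<lambda>z'. \<xi> \<bullet> g z') z \<and>
     0 = grad_y F z - hess_yy h z *v w + grad_y (\<lambda>z'. \<xi> \<bullet> g z') z \<and>
     (\<forall>i. i \<notin> active g z \<longrightarrow> \<xi> $ i = 0)"

text \<open>The MPCC in which the constraints \<open>k \<in> K\<close> are complementary to their multipliers and those in
  \<open>J - K\<close> are equations: \<open>K = {q}\<close> gives \<open>(P\<^sub>q)\<close>, \<open>K = {q, r}\<close> the problem with two
  complementarity pairs. \<open>J\<close> is the active set at the reference point.\<close>

definition mpcc_set ::
    "(real \<times> (real^'m) \<Rightarrow> real) \<Rightarrow> (real \<times> (real^'m) \<Rightarrow> real^'p) \<Rightarrow> 'p set \<Rightarrow> 'p set \<Rightarrow>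
     (real \<times> (real^'m) \<times> (real^'p)) set" where
  "mpcc_set f g J K = {(x, y, u).
     grad_y f (x, y) + (\<Sum>j\<in>J. u $ j *\<^sub>R cgrad_y g j (x, y)) = 0 \<and>
     (\<forall>j\<in>J - K. g (x, y) $ j = 0) \<and>
     (\<forall>k\<in>K. g (x, y) $ k \<le> 0 \<and> 0 \<le> u $ k \<and> u $ k * g (x, y) $ k = 0)}"

definition S_stationary ::
    "(real \<times> (real^'m) \<Rightarrow> real) \<Rightarrow> (real \<times> (real^'m) \<Rightarrow> real) \<Rightarrow> (real \<times> (real^'m) \<Rightarrow> real^'p) \<Rightarrow>
     real \<times> (real^'m) \<Rightarrow> real^'p \<Rightarrow> 'p set \<Rightarrow> real^'m \<Rightarrow> real^'p \<Rightarrow> bool" where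
  "S_stationary F f g z ubar K w \<xi> \<longleftrightarrow>
     star_system F (lagrangian f g ubar) g z w \<xi> \<and>
     (\<forall>j\<in>active g z - K. cgrad_y g j z \<bullet> w = 0) \<and>
     (\<forall>k\<in>K. (ubar $ k > 0 \<longrightarrow> cgrad_y g k z \<bullet> w = 0) \<and>
             (ubar $ k = 0 \<longrightarrow> cgrad_y g k z \<bullet> w \<le> 0 \<and> 0 \<le> \<xi> $ k))"

text \<open>In the nonsmooth problem of Case II the sum runs over all constraint indices, and the components
  \<open>u\<^sub>i\<close> with \<open>i\<close> outside the active set \<open>J\<close> are fixed at 0, as for the multipliers of the Type
  definitions. Were they free, a constraint inactive at the reference point could contribute its
  gradient to the stationarity equation, and the stated optimality condition, which demands
  \<open>\<nabla>\<^sub>y g\<^sub>j \<bullet> w = 0\<close> for active \<open>j\<close> only, would not be the KKT condition of the problem.\<close>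

definition nonsmooth_set ::
    "(real \<times> (real^'m) \<Rightarrow> real) \<Rightarrow> (real \<times> (real^'m) \<Rightarrow> real^'p) \<Rightarrow> 'p set \<Rightarrow>
     (real \<times> (real^'m) \<times> (real^'p)) set" where
  "nonsmooth_set f g J = {(x, y, u).
     grad_y f (x, y) + (\<Sum>i\<in>UNIV. u $ i *\<^sub>R cgrad_y g i (x, y)) = 0 \<and>
     (\<forall>j\<in>J. g (x, y) $ j = 0) \<and> (\<forall>i. i \<notin> J \<longrightarrow> u $ i = 0)}"

end

theory Submission
  imports Defs
begin

text \<open>Near the reference point every point that is feasible for one of the single level problems has
  its \<open>y\<close> component in the solution set of the lower level problem: solutions for nearby \<open>x\<close> converge
  to \<open>ybar\<close>, their Fritz John multipliers accumulate at multipliers of \<open>(xbar, ybar)\<close>, and the type of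
  this point forbids two different nearby points of this kind, as the normalised differences of
  two such sequences would tend to a nonzero solution of the linearised system. Hence a local minimizer
  of the bilevel program yields a local minimizer of the single level problem. The stationarity
  conditions follow because the linearised constraint maps are surjective, so that every direction is
  the derivative of a curve along which the constraints vary as prescribed. In Case II the value
  function is the minimum of two differentiable functions with different slopes at \<open>xbar\<close>, which
  makes the penalty \<open>f - V\<close> exact on the side where the branch through \<open>ybar\<close> is not optimal.\<close>

section \<open>Calculus\<close>

text \<open>The level-set curves constructed below have a derivative at the reference point only.
  That suffices for first order conditions, but not for comparing two nearby points of one
  constraint system; such a comparison therefore divides by the joint norm of the differences in
  \<open>y\<close> and in whatever multipliers are compared, so that the limit direction has norm 1.
  Inequalities and complementarity enter the multiplier rule as a set \<open>C\<close> of right-hand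
  sides along which the equations may be perturbed: each generator of \<open>C\<close> fixes the
  sign of one multiplier. Most of the single level problems leave the multipliers of inactive
  constraints free. They are set to 0 by hand whenever multiplier sequences are compared, and they
  become coordinates of the constraint map whenever surjectivity is needed. Fritz John rather than
  KKT multipliers are followed to the limit because their normalisation bounds them without any
  constraint qualification; the type decides afterwards whether the limit can have
  \<open>u0 = 0\<close>.\<close>

lemma mvt_inner:
  fixes h :: "'a::real_inner \<Rightarrow> real"
  assumes "\<And>z. (h has_derivative (\<lambda>v. G z \<bullet> v)) (at z)"
  shows "\<exists>\<zeta>\<in>closed_segment a b. h b - h a = G \<zeta> \<bullet> (b - a)"
proof -
  have "((\<lambda>t. h (a + t *\<^sub>R (b - a))) has_derivative (\<lambda>t. G (a + t0 *\<^sub>R (b - a)) \<bullet> (t *\<^sub>R (b - a)))) (at t0 within {0..1})"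
    for t0 :: real
  proof -
    have "((\<lambda>t. a + t *\<^sub>R (b - a)) has_derivative (\<lambda>t. t *\<^sub>R (b - a))) (at t0 within {0..1})"
      by (auto intro!: derivative_eq_intros)
    from has_derivative_compose[OF this assms] show ?thesis by simp
  qed
  then obtain t :: real where t: "t \<in> {0..1}" "h (a + 1 *\<^sub>R (b - a)) - h (a + 0 *\<^sub>R (b - a)) = G (a + t *\<^sub>R (b - a)) \<bullet> ((1 - 0) *\<^sub>R (b - a))"
    using mvt_very_simple[of 0 1 "\<lambda>t. h (a + t *\<^sub>R (b - a))" "\<lambda>t0 t. G (a + t0 *\<^sub>R (b - a)) \<bullet> (t *\<^sub>R (b - a))"]
    by fastforce
  moreover have "a + t *\<^sub>R (b - a) \<in> closed_segment a b"
    using t(1) by (auto simp: in_segment algebra_simps intro!: exI[of _ t])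
  ultimately show ?thesis by auto
qed

text \<open>Strict differentiability, in a form suited to the compactness arguments below.\<close>

lemma difference_quotient_tendsto:
  fixes h :: "'a::real_inner \<Rightarrow> real"
  assumes h: "\<And>z. (h has_derivative (\<lambda>v. G z \<bullet> v)) (at z)" and G: "isCont G p"
    and s: "s \<longlonglongrightarrow> p" "s' \<longlonglongrightarrow> p"
    and d: "(\<lambda>n. (s n - s' n) /\<^sub>R R n) \<longlonglongrightarrow> d"
  shows "(\<lambda>n. (h (s n) - h (s' n)) / R n) \<longlonglongrightarrow> G p \<bullet> d"
proof -
  have "\<forall>n. \<exists>\<zeta>\<in>closed_segment (s' n) (s n). h (s n) - h (s' n) = G \<zeta> \<bullet> (s n - s' n)"
    using mvt_inner[OF h] by blast
  then obtain \<zeta> where \<zeta>: "\<And>n. \<zeta> n \<in> closed_segment (s' n) (s n)"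
    and eq: "\<And>n. h (s n) - h (s' n) = G (\<zeta> n) \<bullet> (s n - s' n)"
    by metis
  have "(\<lambda>n. s n - s' n) \<longlonglongrightarrow> p - p"
    by (intro tendsto_intros s)
  then have lim: "(\<lambda>n. norm (s n - s' n)) \<longlonglongrightarrow> 0"
    by (simp add: tendsto_norm_zero)
  have "(\<lambda>n. \<zeta> n - s' n) \<longlonglongrightarrow> 0"
  proof (rule Lim_null_comparison[OF _ lim])
    show "\<forall>\<^sub>F n in sequentially. norm (\<zeta> n - s' n) \<le> norm (s n - s' n)"
      using segment_bound1[OF \<zeta>] by simp
  qed
  from tendsto_add[OF this s(2)] have "\<zeta> \<longlonglongrightarrow> p" by simp
  then have "(\<lambda>n. G (\<zeta> n)) \<longlonglongrightarrow> G p"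
    using G isCont_tendsto_compose by blast
  from tendsto_inner[OF this d] show ?thesis
    by (simp add: eq divide_inverse mult.commute)
qed

lemma Ck_on_Suc_imp: "Ck_on (Suc k) f U \<Longrightarrow> Ck_on k f U"
proof (induction k arbitrary: f)
  case 0
  then show ?case
    using differentiable_imp_continuous_on[of f U] differentiable_at_imp_differentiable_on[of U f]
    by simp
next
  case (Suc k)
  then show ?case
    unfolding Ck_on.simps(2)[of "Suc k"] Ck_on.simps(2)[of k] by blast
qed

lemma Ck_on_component:
  fixes g :: "'a::euclidean_space \<Rightarrow> real^'p"
  assumes "Ck_on k g UNIV"
  shows "Ck_on k (\<lambda>z. g z $ j) UNIV"
  using assms
proof (induction k arbitrary: g)
  case 0
  then show ?case by (auto intro: continuous_intros)
next
  case (Suc k)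
  have d: "((\<lambda>z. g z $ j) has_derivative (\<lambda>v. frechet_derivative g (at z) v $ j)) (at z)" for z
    using Suc.prems by (auto simp: frechet_derivative_works
        intro: bounded_linear.has_derivative[OF bounded_linear_vec_nth])
  then have "frechet_derivative (\<lambda>z. g z $ j) (at z) = (\<lambda>v. frechet_derivative g (at z) v $ j)" for z
    by (metis frechet_derivative_at)
  then show ?case
    using Suc d by (auto simp: differentiable_def)
qed

text \<open>The partial derivatives are defined through the slices \<open>h (t, snd z)\<close> and
  \<open>h (fst z, v)\<close>. The chain rule along the two affine embeddings identifies them with
  values of the Frechet derivative, and additivity in the two factors reassembles the inner product
  with \<open>grad h z\<close>.\<close>

lemma has_derivative_grad:
  fixes h :: "real \<times> (real^'m) \<Rightarrow> real"
  assumes "h differentiable (at z)"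
  shows "(h has_derivative (\<lambda>v. grad h z \<bullet> v)) (at z)"
    and "grad_x h z = frechet_derivative h (at z) (1, 0)"
    and "grad_y h z $ i = frechet_derivative h (at z) (0, axis i 1)"
proof -
  let ?D = "frechet_derivative h (at z)"
  have D: "(h has_derivative ?D) (at (fst z, snd z))"
    using assms by (simp add: frechet_derivative_works)
  interpret D: bounded_linear ?D
    using D has_derivative_bounded_linear by blast
  have "((\<lambda>t. h (t, snd z)) has_derivative (\<lambda>t. ?D (t, 0))) (at (fst z))"
    by (rule has_derivative_compose[where f = "\<lambda>t. (t, snd z)" and f' = "\<lambda>t. (t, 0)", OF _ D])
      (intro has_derivative_Pair has_derivative_ident has_derivative_const)
  moreover have "(\<lambda>t. ?D (t, 0)) = (*) (?D (1, 0))"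
  proof
    fix t
    show "?D (t, 0) = ?D (1, 0) * t" using D.scaleR[of t "(1, 0)"] by (simp add: mult.commute)
  qed
  ultimately have "((\<lambda>t. h (t, snd z)) has_real_derivative ?D (1, 0)) (at (fst z))"
    unfolding has_field_derivative_def by metis
  then show x: "grad_x h z = ?D (1, 0)"
    unfolding grad_x_def by (rule DERIV_imp_deriv)
  have y': "((\<lambda>v. h (fst z, v)) has_derivative (\<lambda>v. ?D (0, v))) (at (snd z))"
    by (rule has_derivative_compose[where f = "\<lambda>v. (fst z, v)" and f' = "\<lambda>v. (0, v)", OF _ D])
      (intro has_derivative_Pair has_derivative_ident has_derivative_const)
  show y: "grad_y h z $ i = ?D (0, axis i 1)" for i
    unfolding grad_y_def using frechet_derivative_at[OF y'] by (simp add: fun_eq_iff)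
  have "?D v = grad h z \<bullet> v" for v
  proof -
    obtain a b where v: "v = (a, b)" by (cases v)
    interpret E: bounded_linear "\<lambda>v. ?D (0, v)"
      using y' has_derivative_bounded_linear by blast
    have "?D (0, b) = ?D (0, \<Sum>i\<in>UNIV. b $ i *\<^sub>R axis i 1)"
      using basis_expansion[of b] by (simp add: scalar_mult_eq_scaleR)
    also have "\<dots> = (\<Sum>i\<in>UNIV. b $ i * ?D (0, axis i 1))"
      by (simp only: E.sum E.scaleR real_scaleR_def)
    also have "\<dots> = grad_y h z \<bullet> b"
      unfolding inner_vec_def y by (simp add: mult.commute)
    finally have "?D (0, b) = grad_y h z \<bullet> b" .
    moreover have "?D (a, 0) = grad_x h z * a"
      unfolding x using D.scaleR[of a "(1, 0)"] by (simp add: mult.commute)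
    moreover have "?D v = ?D (a, 0) + ?D (0, b)"
      using D.add[of "(a, 0)" "(0, b)"] by (simp add: v)
    ultimately show ?thesis
      by (simp add: grad_def v)
  qed
  then have "?D = (\<lambda>v. grad h z \<bullet> v)" by (rule ext)
  with D show "(h has_derivative (\<lambda>v. grad h z \<bullet> v)) (at z)"
    by (metis prod.collapse)
qed

lemma grad_eqI:
  fixes h :: "real \<times> (real^'m) \<Rightarrow> real"
  assumes "(h has_derivative (\<lambda>v. G \<bullet> v)) (at z)"
  shows "grad h z = G"
proof -
  have "(h has_derivative (\<lambda>v. grad h z \<bullet> v)) (at z)"
    using assms by (intro has_derivative_grad) (auto simp: differentiable_def)
  from has_derivative_unique[OF this assms] show ?thesis
    by (metis inner_commute vector_eq_ldot)
qed

lemma Ck_on_grad: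
  fixes h :: "real \<times> (real^'m) \<Rightarrow> real"
  assumes "Ck_on (Suc k) h UNIV"
  shows "h differentiable (at z)" "Ck_on k (grad_x h) UNIV" "Ck_on k (\<lambda>z. grad_y h z $ i) UNIV"
proof -
  show d: "h differentiable (at z)" for z
    using assms unfolding Ck_on.simps(2) by blast
  have "(1, 0) \<in> (Basis :: (real \<times> (real^'m)) set)" "(0, axis i 1) \<in> (Basis :: (real \<times> (real^'m)) set)"
    by (auto simp: Basis_prod_def Basis_vec_def)
  then have *: "Ck_on k (\<lambda>z. frechet_derivative h (at z) (1, 0)) UNIV"
    "Ck_on k (\<lambda>z. frechet_derivative h (at z) (0, axis i 1)) UNIV"
    using assms by auto
  have "grad_x h = (\<lambda>z. frechet_derivative h (at z) (1, 0))"
    "(\<lambda>z. grad_y h z $ i) = (\<lambda>z. frechet_derivative h (at z) (0, axis i 1))"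
    using has_derivative_grad(2,3)[OF d] by auto
  then show "Ck_on k (grad_x h) UNIV" "Ck_on k (\<lambda>z. grad_y h z $ i) UNIV"
    using * by simp_all
qed

lemma continuous_on_vecI:
  fixes h :: "'a::topological_space \<Rightarrow> real^'n"
  assumes "\<And>i. continuous_on U (\<lambda>z. h z $ i)"
  shows "continuous_on U h"
  using continuous_on_vec_lambda[of U "\<lambda>i z. h z $ i"] assms by simp

lemma continuous_on_grad:
  fixes h :: "real \<times> (real^'m) \<Rightarrow> real"
  assumes "Ck_on 1 h UNIV"
  shows "continuous_on UNIV (grad h)" "continuous_on UNIV (grad_x h)" "continuous_on UNIV (grad_y h)"
proof -
  have "Ck_on (Suc 0) h UNIV" using assms by simp
  from Ck_on_grad(2,3)[OF this] show "continuous_on UNIV (grad_x h)" "continuous_on UNIV (grad_y h)"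
    by (auto intro: continuous_on_vecI)
  then show "continuous_on UNIV (grad h)"
    unfolding grad_def[abs_def] by (intro continuous_on_Pair)
qed

lemma has_derivative_grad_y:
  fixes h :: "real \<times> (real^'m) \<Rightarrow> real"
  assumes "Ck_on 2 h UNIV"
  shows "(grad_y h has_derivative (\<lambda>v. fst v *\<^sub>R hess_xy h z + hess_yy h z *v snd v)) (at z)"
proof -
  have "Ck_on (Suc 1) h UNIV" using assms by (simp add: numeral_2_eq_2)
  from Ck_on_grad(3)[OF this] have "(\<lambda>z. grad_y h z $ i) differentiable (at z)" for i
    unfolding One_nat_def by (rule Ck_on_grad(1))
  then have D: "((\<lambda>z. grad_y h z $ i) has_derivative (\<lambda>v. grad (\<lambda>z. grad_y h z $ i) z \<bullet> v)) (at z)" for i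
    by (rule has_derivative_grad)
  have eq: "(\<lambda>v. grad (\<lambda>z. grad_y h z $ i) z \<bullet> v) = (\<lambda>v. (fst v *\<^sub>R hess_xy h z + hess_yy h z *v snd v) $ i)"
    for i
  proof
    fix v :: "real \<times> (real^'m)"
    obtain a b where v: "v = (a, b)" by (cases v)
    show "grad (\<lambda>z. grad_y h z $ i) z \<bullet> v = (fst v *\<^sub>R hess_xy h z + hess_yy h z *v snd v) $ i"
      unfolding v grad_def hess_xy_def hess_yy_def matrix_vector_mult_def
      by (simp add: inner_vec_def mult.commute)
  qed
  show ?thesis
  proof (rule has_derivative_componentwise_within[THEN iffD2], rule ballI)
    fix b :: "real^'m"
    assume "b \<in> Basis"
    then obtain i where b: "b = axis i 1" unfolding Basis_vec_def by auto
    have "v \<bullet> b = v $ i" for v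
      unfolding b by (simp add: inner_axis)
    then show "((\<lambda>z. grad_y h z \<bullet> b) has_derivative
        (\<lambda>v. (fst v *\<^sub>R hess_xy h z + hess_yy h z *v snd v) \<bullet> b)) (at z)"
      using D[of i] unfolding eq by presburger
  qed
qed

text \<open>Both points move, so differentiability at \<open>p\<close> alone would not suffice: each
  component of the gradient is C1, and \<open>difference_quotient_tendsto\<close> applies to it.
  \<open>R\<close> is an arbitrary scaling, chosen later as the norm of a larger difference.\<close>

lemma grad_y_quotient_tendsto:
  fixes h :: "real \<times> (real^'m) \<Rightarrow> real"
  assumes h: "Ck_on 2 h UNIV"
    and s: "s \<longlonglongrightarrow> p" "s' \<longlonglongrightarrow> p"
    and d: "(\<lambda>n. (s n - s' n) /\<^sub>R R n) \<longlonglongrightarrow> d"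
  shows "(\<lambda>n. (grad_y h (s n) - grad_y h (s' n)) /\<^sub>R R n) \<longlonglongrightarrow>
           fst d *\<^sub>R hess_xy h p + hess_yy h p *v snd d"
proof (rule vec_tendstoI)
  fix i
  have "Ck_on (Suc 1) h UNIV" using h by (simp add: numeral_2_eq_2)
  from Ck_on_grad(3)[OF this] have C1: "Ck_on 1 (\<lambda>z. grad_y h z $ i) UNIV" by simp
  have "isCont (grad (\<lambda>z. grad_y h z $ i)) p"
    using continuous_on_grad(1)[OF C1] by (metis continuous_on_eq_continuous_at open_UNIV UNIV_I)
  moreover have "((\<lambda>z. grad_y h z $ i) has_derivative (\<lambda>v. grad (\<lambda>z. grad_y h z $ i) z \<bullet> v)) (at z)" for z
    using C1 unfolding One_nat_def by (intro has_derivative_grad Ck_on_grad(1))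
  ultimately have "(\<lambda>n. (grad_y h (s n) $ i - grad_y h (s' n) $ i) / R n)
      \<longlonglongrightarrow> grad (\<lambda>z. grad_y h z $ i) p \<bullet> d"
    by (intro difference_quotient_tendsto s d)
  moreover have "grad (\<lambda>z. grad_y h z $ i) p \<bullet> d = (fst d *\<^sub>R hess_xy h p + hess_yy h p *v snd d) $ i"
    by (cases d) (simp add: grad_def hess_xy_def hess_yy_def matrix_vector_mult_def inner_vec_def)
  ultimately show "(\<lambda>n. ((grad_y h (s n) - grad_y h (s' n)) /\<^sub>R R n) $ i)
      \<longlonglongrightarrow> (fst d *\<^sub>R hess_xy h p + hess_yy h p *v snd d) $ i"
    by (simp add: divide_inverse mult.commute)
qed

lemma C2_imp_C1: "Ck_on 2 h UNIV \<Longrightarrow> Ck_on 1 h UNIV"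
  using Ck_on_Suc_imp[of 1 h UNIV] by (simp add: numeral_2_eq_2)

lemma C1_has_derivative_grad:
  fixes h :: "real \<times> (real^'m) \<Rightarrow> real"
  shows "Ck_on 1 h UNIV \<Longrightarrow> (h has_derivative (\<lambda>v. grad h z \<bullet> v)) (at z)"
  unfolding One_nat_def by (intro has_derivative_grad Ck_on_grad(1))

lemma C1_quotient_tendsto:
  fixes h :: "real \<times> (real^'m) \<Rightarrow> real"
  assumes h: "Ck_on 1 h UNIV"
    and s: "s \<longlonglongrightarrow> p" "s' \<longlonglongrightarrow> p"
    and d: "(\<lambda>n. (s n - s' n) /\<^sub>R R n) \<longlonglongrightarrow> d"
  shows "(\<lambda>n. (h (s n) - h (s' n)) / R n) \<longlonglongrightarrow> grad h p \<bullet> d"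
  using continuous_on_grad(1)[OF h]
  by (intro difference_quotient_tendsto[OF C1_has_derivative_grad[OF h] _ s d])
    (metis continuous_on_eq_continuous_at open_UNIV UNIV_I)

lemma C1_has_derivative_y:
  fixes h :: "real \<times> (real^'m) \<Rightarrow> real"
  assumes h: "Ck_on 1 h UNIV"
  shows "((\<lambda>t. h (x, a + t *\<^sub>R v)) has_real_derivative grad_y h (x, a + t *\<^sub>R v) \<bullet> v) (at t within S)"
proof -
  have "((\<lambda>t. (x, a + t *\<^sub>R v)) has_derivative (\<lambda>t. (0, t *\<^sub>R v))) (at t within S)"
    by (auto intro!: derivative_eq_intros)
  from has_derivative_compose[OF this C1_has_derivative_grad[OF h]] show ?thesis
    by (simp add: has_field_derivative_def grad_def mult_commute_abs)
qed

text \<open>Cauchy's mean value theorem against \<open>t\<^sup>2\<close> reduces this to strict differentiability of the gradient.\<close>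

lemma second_order_quotient_tendsto:
  fixes h :: "real \<times> (real^'m) \<Rightarrow> real"
  assumes h: "Ck_on 2 h UNIV" and x: "x \<longlonglongrightarrow> x0" and y: "y \<longlonglongrightarrow> y0" "y' \<longlonglongrightarrow> y0"
    and d: "(\<lambda>n. (y n - y' n) /\<^sub>R R n) \<longlonglongrightarrow> d"
  shows "(\<lambda>n. (h (x n, y n) - h (x n, y' n) - grad_y h (x n, y' n) \<bullet> (y n - y' n)) / (R n)\<^sup>2)
           \<longlonglongrightarrow> (d \<bullet> (hess_yy h (x0, y0) *v d)) / 2"
proof -
  note C1 = C2_imp_C1[OF h]
  define \<Delta> where "\<Delta> n = y n - y' n" for n
  have "\<exists>t\<in>{0<..<1}. 2 * t * (h (x n, y n) - h (x n, y' n) - grad_y h (x n, y' n) \<bullet> \<Delta> n)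
      = (grad_y h (x n, y' n + t *\<^sub>R \<Delta> n) - grad_y h (x n, y' n)) \<bullet> \<Delta> n" for n
  proof -
    let ?\<phi> = "\<lambda>t. h (x n, y' n + t *\<^sub>R \<Delta> n) - t * (grad_y h (x n, y' n) \<bullet> \<Delta> n)"
    have \<phi>: "(?\<phi> has_real_derivative (grad_y h (x n, y' n + t *\<^sub>R \<Delta> n) - grad_y h (x n, y' n)) \<bullet> \<Delta> n) (at t)" for t
      by (auto intro!: derivative_eq_intros C1_has_derivative_y[OF C1] simp: inner_diff_left)
    have "\<exists>c. 0 < c \<and> c < 1 \<and> (?\<phi> 1 - ?\<phi> 0) * (2 * c) =
        (1\<^sup>2 - 0\<^sup>2) * ((grad_y h (x n, y' n + c *\<^sub>R \<Delta> n) - grad_y h (x n, y' n)) \<bullet> \<Delta> n)"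
    proof (rule GMVT'[where g = "\<lambda>t. t\<^sup>2"])
      show "isCont ?\<phi> t" for t by (rule DERIV_isCont[OF \<phi>])
      show "((\<lambda>t. t\<^sup>2) has_real_derivative 2 * t) (at t)" for t :: real
        by (auto intro!: derivative_eq_intros)
    qed (auto intro!: \<phi> continuous_intros)
    then obtain c where c: "0 < c" "c < 1" "(?\<phi> 1 - ?\<phi> 0) * (2 * c) =
        (1\<^sup>2 - 0\<^sup>2) * ((grad_y h (x n, y' n + c *\<^sub>R \<Delta> n) - grad_y h (x n, y' n)) \<bullet> \<Delta> n)" by blast
    have \<phi>1: "?\<phi> 1 - ?\<phi> 0 = h (x n, y n) - h (x n, y' n) - grad_y h (x n, y' n) \<bullet> \<Delta> n"
      by (simp add: \<Delta>_def)
    have "2 * c * (h (x n, y n) - h (x n, y' n) - grad_y h (x n, y' n) \<bullet> \<Delta> n)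
      = (grad_y h (x n, y' n + c *\<^sub>R \<Delta> n) - grad_y h (x n, y' n)) \<bullet> \<Delta> n"
      using c(3) unfolding \<phi>1 by (subst mult.commute) simp
    then show ?thesis
      using c(1,2) by (intro bexI[of _ c]) auto
  qed
  then obtain t where t: "\<And>n. 0 < t n" "\<And>n. t n < 1"
    and eq: "\<And>n. 2 * t n * (h (x n, y n) - h (x n, y' n) - grad_y h (x n, y' n) \<bullet> \<Delta> n)
      = (grad_y h (x n, y' n + t n *\<^sub>R \<Delta> n) - grad_y h (x n, y' n)) \<bullet> \<Delta> n"
    unfolding Bex_def greaterThanLessThan_iff by metis
  have "\<Delta> \<longlonglongrightarrow> y0 - y0" unfolding \<Delta>_def by (intro tendsto_intros y)
  then have "(\<lambda>n. norm (\<Delta> n)) \<longlonglongrightarrow> 0" by (simp add: tendsto_norm_zero)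
  moreover have "norm (t n *\<^sub>R \<Delta> n) \<le> norm (\<Delta> n)" for n
    unfolding norm_scaleR using t(1,2)[of n] by (intro mult_left_le_one_le) auto
  then have "\<forall>\<^sub>F n in sequentially. norm (t n *\<^sub>R \<Delta> n) \<le> norm (\<Delta> n)"
    by (rule always_eventually[OF allI])
  ultimately have "(\<lambda>n. t n *\<^sub>R \<Delta> n) \<longlonglongrightarrow> 0"
    by (rule Lim_null_comparison[rotated])
  from tendsto_add[OF y(2) this] have y't: "(\<lambda>n. y' n + t n *\<^sub>R \<Delta> n) \<longlonglongrightarrow> y0" by simp
  \<comment> \<open>The intermediate point differs from \<open>y' n\<close> by \<open>t n\<close>
    times the full difference. Scaling by \<open>t n * R n\<close> removes the unknown
    \<open>t n\<close> here, and the factor \<open>2 * t n\<close> from Cauchy's theorem removes it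
    on the other side.\<close>
  have "(\<lambda>n. ((x n, y' n + t n *\<^sub>R \<Delta> n) - (x n, y' n)) /\<^sub>R (t n * R n)) \<longlonglongrightarrow> (0, d)"
  proof -
    have "t n \<noteq> 0" for n using t(1)[of n] by simp
    then have "((x n, y' n + t n *\<^sub>R \<Delta> n) - (x n, y' n)) /\<^sub>R (t n * R n) = (0, (y n - y' n) /\<^sub>R R n)" for n
      by (simp add: \<Delta>_def)
    with d show ?thesis by (simp only: tendsto_Pair tendsto_const)
  qed
  from grad_y_quotient_tendsto[OF h tendsto_Pair[OF x y't] tendsto_Pair[OF x y(2)] this]
  have "(\<lambda>n. (grad_y h (x n, y' n + t n *\<^sub>R \<Delta> n) - grad_y h (x n, y' n)) /\<^sub>R (t n * R n))
      \<longlonglongrightarrow> hess_yy h (x0, y0) *v d" by simp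
  from tendsto_inner[OF this d]
  have "(\<lambda>n. (((grad_y h (x n, y' n + t n *\<^sub>R \<Delta> n) - grad_y h (x n, y' n)) /\<^sub>R (t n * R n)) \<bullet> ((y n - y' n) /\<^sub>R R n)) / 2)
      \<longlonglongrightarrow> ((hess_yy h (x0, y0) *v d) \<bullet> d) / 2" by (rule tendsto_divide) simp_all
  moreover
  have "(((grad_y h (x n, y' n + t n *\<^sub>R \<Delta> n) - grad_y h (x n, y' n)) /\<^sub>R (t n * R n)) \<bullet> ((y n - y' n) /\<^sub>R R n)) / 2
      = (h (x n, y n) - h (x n, y' n) - grad_y h (x n, y' n) \<bullet> (y n - y' n)) / (R n)\<^sup>2" for n
  proof -
    have "t n \<noteq> 0" using t(1)[of n] by simp
    then have "inverse (t n * R n) * (inverse (R n) * (2 * t n * q)) / 2 = q / (R n)\<^sup>2" for q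
      by (simp add: power2_eq_square inverse_eq_divide)
    then show ?thesis
      unfolding \<Delta>_def[symmetric] inner_scaleR_left inner_scaleR_right eq[symmetric]
      by (simp only: mult.left_commute[of "inverse (R n)"])
  qed
  ultimately show ?thesis unfolding inner_commute[of d "hess_yy h (x0, y0) *v d"] by (simp only:)
qed

text \<open>Schwarz's theorem through the mixed second difference \<open>D a b\<close>, which is
  symmetric in \<open>a\<close> and \<open>b\<close>. The mean value theorem in direction
  \<open>a\<close> turns it into a difference of gradients over the step \<open>t n\<close> in
  direction \<open>b\<close>, whose scaled limit is the Hessian applied to \<open>b\<close>.\<close>

lemma hess_yy_symmetric:
  fixes h :: "real \<times> (real^'m) \<Rightarrow> real"
  assumes h: "Ck_on 2 h UNIV"
  shows "a \<bullet> (hess_yy h p *v b) = b \<bullet> (hess_yy h p *v a)"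
proof -
  note C1 = C2_imp_C1[OF h]
  obtain x0 y0 where p: "p = (x0, y0)" by (cases p)
  define t where "t n = inverse (real (Suc n))" for n
  have t: "t \<longlonglongrightarrow> 0" "\<And>n. t n > 0"
    unfolding t_def by (rule LIMSEQ_inverse_real_of_nat) simp
  define D where "D a b n = h (x0, y0 + t n *\<^sub>R a + t n *\<^sub>R b) - h (x0, y0 + t n *\<^sub>R a)
      - h (x0, y0 + t n *\<^sub>R b) + h (x0, y0)" for a b n
  have lim: "(\<lambda>n. D a b n / (t n)\<^sup>2) \<longlonglongrightarrow> a \<bullet> (hess_yy h p *v b)" for a b
  proof -
    have "\<exists>\<xi>\<in>{0<..<t n}. D a b n =
        t n * ((grad_y h (x0, y0 + \<xi> *\<^sub>R a + t n *\<^sub>R b) - grad_y h (x0, y0 + \<xi> *\<^sub>R a)) \<bullet> a)" for n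
    proof -
      let ?k = "\<lambda>\<xi>. h (x0, (y0 + t n *\<^sub>R b) + \<xi> *\<^sub>R a) - h (x0, y0 + \<xi> *\<^sub>R a)"
      let ?k' = "\<lambda>\<xi>. grad_y h (x0, (y0 + t n *\<^sub>R b) + \<xi> *\<^sub>R a) \<bullet> a - grad_y h (x0, y0 + \<xi> *\<^sub>R a) \<bullet> a"
      have der: "(?k has_real_derivative ?k' \<xi>) (at \<xi>)" if "0 \<le> \<xi>" "\<xi> \<le> t n" for \<xi>
        by (rule DERIV_diff[OF C1_has_derivative_y[OF C1] C1_has_derivative_y[OF C1]])
      have "\<exists>\<xi>>0. \<xi> < t n \<and> ?k (t n) - ?k 0 = (t n - 0) * ?k' \<xi>"
        by (rule MVT2[of 0 "t n" ?k ?k', OF t(2)]) (rule der)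
      then obtain \<xi> where \<xi>: "\<xi> > 0" "\<xi> < t n" and eq: "?k (t n) - ?k 0 = (t n - 0) * ?k' \<xi>"
        by (elim exE conjE)
      have comm: "y0 + t n *\<^sub>R b + s *\<^sub>R a = y0 + s *\<^sub>R a + t n *\<^sub>R b" for s 
        by (metis add.assoc add.commute)
      have "D a b n = ?k (t n) - ?k 0"
        unfolding D_def comm by simp
      also have "\<dots> = t n * ((grad_y h (x0, y0 + \<xi> *\<^sub>R a + t n *\<^sub>R b) - grad_y h (x0, y0 + \<xi> *\<^sub>R a)) \<bullet> a)"
        unfolding eq unfolding comm by (simp add: inner_diff_left)
      finally show ?thesis using \<xi> by (intro bexI[of _ \<xi>]) simp_all
    qed
    then obtain \<xi> where \<xi>: "\<And>n. 0 < \<xi> n" "\<And>n. \<xi> n < t n"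
      and eq: "\<And>n. D a b n = t n * ((grad_y h (x0, y0 + \<xi> n *\<^sub>R a + t n *\<^sub>R b) - grad_y h (x0, y0 + \<xi> n *\<^sub>R a)) \<bullet> a)"
      unfolding Bex_def greaterThanLessThan_iff by metis
    have \<xi>0: "\<xi> \<longlonglongrightarrow> 0"
      by (rule tendsto_sandwich[OF _ _ tendsto_const t(1)]) (auto intro!: eventuallyI less_imp_le \<xi>)
    have "(\<lambda>n. y0 + \<xi> n *\<^sub>R a + t n *\<^sub>R b) \<longlonglongrightarrow> y0 + 0 *\<^sub>R a + 0 *\<^sub>R b"
      "(\<lambda>n. y0 + \<xi> n *\<^sub>R a) \<longlonglongrightarrow> y0 + 0 *\<^sub>R a"
      by (intro tendsto_intros \<xi>0 t)+
    then have l: "(\<lambda>n. (x0, y0 + \<xi> n *\<^sub>R a + t n *\<^sub>R b)) \<longlonglongrightarrow> p" "(\<lambda>n. (x0, y0 + \<xi> n *\<^sub>R a)) \<longlonglongrightarrow> p"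
      by (auto simp: p intro!: tendsto_Pair)
    have "(\<lambda>n. ((x0, y0 + \<xi> n *\<^sub>R a + t n *\<^sub>R b) - (x0, y0 + \<xi> n *\<^sub>R a)) /\<^sub>R t n) \<longlonglongrightarrow> (0, b)"
      using t(2) by (simp add: less_imp_neq[THEN not_sym])
    from tendsto_inner[OF grad_y_quotient_tendsto[OF h l this] tendsto_const[of a]]
    have "(\<lambda>n. ((grad_y h (x0, y0 + \<xi> n *\<^sub>R a + t n *\<^sub>R b) - grad_y h (x0, y0 + \<xi> n *\<^sub>R a)) \<bullet> a) / t n)
        \<longlonglongrightarrow> (hess_yy h p *v b) \<bullet> a"
      by (simp add: divide_inverse_commute)
    moreover have "t n \<noteq> 0" for n using t(2)[of n] by simp
    ultimately have "(\<lambda>n. D a b n / (t n)\<^sup>2) \<longlonglongrightarrow> (hess_yy h p *v b) \<bullet> a"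
      by (simp add: eq power2_eq_square)
    then show ?thesis by (simp add: inner_commute)
  qed
  have "y0 + t n *\<^sub>R a + t n *\<^sub>R b = y0 + t n *\<^sub>R b + t n *\<^sub>R a" for n by simp
  then have "D a b n = D b a n" for n by (simp only: D_def)
  then have "(\<lambda>n. D a b n / (t n)\<^sup>2) \<longlonglongrightarrow> b \<bullet> (hess_yy h p *v a)"
    using lim[of b a] by simp
  with lim[of a b] show ?thesis by (rule LIMSEQ_unique)
qed

section \<open>Curves in level sets and multipliers\<close>

text \<open>Surjectivity is stated in its dual form, that no nonzero \<open>c\<close> annihilates
  the range, because this is what the nondegeneracy conditions below deliver: a homogeneous
  multiplier system with only the trivial solution.\<close>

lemma linear_right_inverse:
  fixes A :: "'a::euclidean_space \<Rightarrow> 'b::euclidean_space"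
  assumes A: "linear A" and surj: "\<And>c. (\<And>v. c \<bullet> A v = 0) \<Longrightarrow> c = 0"
  shows "\<exists>B. linear B \<and> A \<circ> B = id"
proof -
  have "range A = UNIV"
  proof (rule ccontr)
    assume "range A \<noteq> UNIV"
    moreover have "subspace (range A)"
      using A linear_subspace_image subspace_UNIV by blast
    ultimately have "span (range A) \<subset> span UNIV"
      by (auto simp: span_eq_iff[THEN iffD2])
    then obtain c where "c \<noteq> 0" "\<And>x. x \<in> span (range A) \<Longrightarrow> orthogonal c x"
      by (rule orthogonal_to_subspace_exists_gen) blast
    then show False using surj[of c] by (auto simp: orthogonal_def span_base)
  qed
  then show ?thesis
    using linear_surjective_right_inverse[OF A] by blast
qed

text \<open>The auxiliary map has the identity as its derivative at \<open>z\<close> and is carried to \<open>\<Phi>\<close> by \<open>A\<close>, so a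
  local right inverse of it, which exists by Sussmann's open mapping theorem, yields the curve.\<close>

lemma curve_in_level_set:
  fixes \<Phi> :: "'a::euclidean_space \<Rightarrow> 'b::euclidean_space"
  assumes cont: "continuous_on UNIV \<Phi>" and der: "(\<Phi> has_derivative A) (at z)"
    and surj: "\<And>c. (\<And>v. c \<bullet> A v = 0) \<Longrightarrow> c = 0"
  obtains \<gamma> where "\<gamma> 0 = z" "(\<gamma> has_vector_derivative d) (at 0)"
    "\<forall>\<^sub>F t in nhds 0. \<Phi> (\<gamma> t) = \<Phi> z + t *\<^sub>R A d"
proof -
  have A: "linear A" using der has_derivative_linear by blast
  obtain B where B: "linear B" "A \<circ> B = id"
    using linear_right_inverse[OF A surj] by blast
  have AB: "A (B w) = w" for w using B(2) by (simp add: fun_eq_iff)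
  define \<phi> where "\<phi> y = (y - z) + B (\<Phi> y - \<Phi> z - A (y - z))" for y
  have A\<phi>: "A (\<phi> y) = \<Phi> y - \<Phi> z" for y
    unfolding \<phi>_def linear_add[OF A] AB by simp
  have \<phi>z: "\<phi> z = 0"
    unfolding \<phi>_def by (simp add: linear_0[OF A] linear_0[OF B(1)])
  have bl: "bounded_linear A" "bounded_linear B"
    using A B(1) linear_linear by blast+
  have der\<phi>: "(\<phi> has_derivative (\<lambda>v. v)) (at z)"
  proof -
    have "((\<lambda>y. (y - z) + B (\<Phi> y - \<Phi> z - A (y - z))) has_derivative
        (\<lambda>v. (v - 0) + B (A v - 0 - A (v - 0)))) (at z)"
      by (intro has_derivative_add has_derivative_diff has_derivative_ident has_derivative_const der
          bounded_linear.has_derivative[OF bl(1)] bounded_linear.has_derivative[OF bl(2)])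
    then show ?thesis unfolding \<phi>_def by (simp add: linear_0[OF B(1)])
  qed
  have cont\<phi>: "continuous_on UNIV \<phi>"
    unfolding \<phi>_def
    by (intro continuous_intros cont bounded_linear.continuous_on[OF bl(1)]
        bounded_linear.continuous_on[OF bl(2)])
  have onto: "\<forall>\<^sub>F w in nhds 0. \<exists>y. dist y z < r \<and> \<phi> y = w" if "r > 0" for r
  proof -
    have "\<phi> z \<in> interior (\<phi> ` ball z r)"
      using that
      by (intro sussmann_open_mapping[OF open_UNIV cont\<phi> _ der\<phi>, of id]) (auto simp: comp_def interior_open id_def)
    then have "\<forall>\<^sub>F w in nhds (\<phi> z). w \<in> interior (\<phi> ` ball z r)"
      by (intro eventually_nhds_in_open) auto
    then have "\<forall>\<^sub>F w in nhds 0. w \<in> interior (\<phi> ` ball z r)" unfolding \<phi>z .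
    then show ?thesis
      by eventually_elim (use interior_subset in \<open>fastforce simp: dist_commute\<close>)
  qed
  have small: "\<exists>r>0. \<forall>y. dist y z < r \<longrightarrow> norm (\<phi> y - (y - z)) \<le> e * norm (y - z)" if "e > 0" for e
    using der\<phi>[unfolded has_derivative_at_alt] that by (auto simp: dist_norm \<phi>z)
  \<comment> \<open>A derivative equal to the identity bounds \<open>norm (y - z)\<close> by
    \<open>2 * norm (\<phi> y)\<close> near \<open>z\<close>. So any preimage chosen within
    \<open>r0\<close> tends to \<open>z\<close> at a linear rate, although \<open>SOME\<close> picks
    it without any continuity.\<close>
  from small[of "1/2"] obtain r0 where r0: "r0 > 0"
    "\<And>y. dist y z < r0 \<Longrightarrow> norm (\<phi> y - (y - z)) \<le> 1/2 * norm (y - z)" by auto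
  have r0': "norm (y - z) \<le> 2 * norm (\<phi> y)" if "dist y z < r0" for y
    using r0(2)[OF that] norm_triangle_ineq[of "\<phi> y" "- (\<phi> y - (y - z))"]
    by (simp add: norm_minus_commute)
  define \<psi> where "\<psi> w = (if w = 0 then z else SOME y. dist y z < r0 \<and> \<phi> y = w)" for w
  have \<psi>: "\<forall>\<^sub>F w in nhds 0. dist (\<psi> w) z < r0 \<and> \<phi> (\<psi> w) = w"
    using onto[OF r0(1)]
  proof eventually_elim
    case (elim w)
    then show ?case
      using someI_ex[OF elim] by (auto simp: \<psi>_def \<phi>z r0(1))
  qed
  define \<gamma> where "\<gamma> t = \<psi> (t *\<^sub>R d)" for t :: real
  have "((\<lambda>t. t *\<^sub>R d) \<longlongrightarrow> 0 *\<^sub>R d) (nhds 0)"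
    by (intro tendsto_intros) (auto simp: filterlim_ident)
  then have lim: "filterlim (\<lambda>t. t *\<^sub>R d) (nhds 0) (nhds (0::real))" by simp
  from filterlim_iff[THEN iffD1, OF lim, rule_format, OF \<psi>]
  have \<gamma>: "\<forall>\<^sub>F t in nhds 0. dist (\<gamma> t) z < r0 \<and> \<phi> (\<gamma> t) = t *\<^sub>R d"
    unfolding \<gamma>_def .
  have "\<forall>\<^sub>F t in nhds 0. \<Phi> (\<gamma> t) = \<Phi> z + t *\<^sub>R A d"
    using \<gamma>
  proof eventually_elim
    case (elim t)
    then have "\<Phi> (\<gamma> t) - \<Phi> z = A (t *\<^sub>R d)" using A\<phi> by metis
    then show ?case by (simp add: linear_scale[OF A] algebra_simps)
  qed
  moreover have \<gamma>0: "\<gamma> 0 = z" by (simp add: \<gamma>_def \<psi>_def)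
  moreover have "(\<gamma> has_vector_derivative d) (at 0)"
    unfolding has_vector_derivative_def has_derivative_at_alt
  proof (intro conjI allI impI)
    show "bounded_linear (\<lambda>t. t *\<^sub>R d)" by (rule bounded_linear_scaleR_left)
    fix e :: real assume e: "e > 0"
    \<comment> \<open>The residual of \<open>\<phi>\<close> is measured against
      \<open>norm (\<gamma> t - z)\<close>, itself at most \<open>2 * norm (t *\<^sub>R d)\<close>;
      the summand 1 keeps the denominator positive when \<open>d = 0\<close>.\<close>
    define e' where "e' = e / (2 * norm d + 1)"
    have e': "e' > 0" "e' * (2 * norm d) \<le> e"
      using e unfolding e'_def by (auto simp: field_simps add_pos_nonneg)
    from small[OF e'(1)] obtain r where r: "r > 0"
      "\<And>y. dist y z < r \<Longrightarrow> norm (\<phi> y - (y - z)) \<le> e' * norm (y - z)" by auto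
    have "((\<lambda>t. 2 * norm (t *\<^sub>R d)) \<longlongrightarrow> 2 * norm (0 *\<^sub>R d)) (nhds (0::real))"
      by (intro tendsto_intros) (auto simp: filterlim_ident)
    then have "\<forall>\<^sub>F t in nhds (0::real). 2 * norm (t *\<^sub>R d) < r"
      using r(1) by (intro order_tendstoD) auto
    with \<gamma> have "\<forall>\<^sub>F t in nhds 0. norm (\<gamma> t - z - t *\<^sub>R d) \<le> e * norm t"
    proof eventually_elim
      case (elim t)
      have le: "norm (\<gamma> t - z) \<le> 2 * norm (t *\<^sub>R d)"
        using r0'[of "\<gamma> t"] elim by simp
      have "norm (t *\<^sub>R d - (\<gamma> t - z)) \<le> e' * norm (\<gamma> t - z)"
        using r(2)[of "\<gamma> t"] le elim by (simp add: dist_norm)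
      also have "\<dots> \<le> e' * (2 * norm (t *\<^sub>R d))" using le e'(1) by (intro mult_left_mono) auto
      also have "\<dots> = (e' * (2 * norm d)) * norm t" by simp
      also have "\<dots> \<le> e * norm t" using e'(2) by (intro mult_right_mono) auto
      finally show ?case by (simp add: norm_minus_commute)
    qed
    then show "\<exists>\<delta>>0. \<forall>t. norm (t - 0) < \<delta> \<longrightarrow> norm (\<gamma> t - \<gamma> 0 - (t - 0) *\<^sub>R d) \<le> e * norm (t - 0)"
      unfolding eventually_nhds_metric \<gamma>0 by (auto simp: dist_norm)
  qed
  ultimately show ?thesis using that by blast
qed

text \<open>\<open>C\<close> collects the right-hand sides that may be added to the constraint value
  without leaving the feasible set: 0 for the equations themselves, and one generator for each
  one-sided freedom. If \<open>A d\<close> lies in \<open>C\<close>, a curve with velocity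
  \<open>d\<close> is feasible for \<open>t \<ge> 0\<close>, hence \<open>0 \<le> F' d\<close>. As
  \<open>0 \<in> C\<close>, this applies to \<open>d\<close> and \<open>- d\<close> in the kernel of
  \<open>A\<close>; so \<open>F'\<close> vanishes there and factors through
  \<open>A\<close>.\<close>

lemma multiplier_rule:
  fixes \<Phi> :: "'a::euclidean_space \<Rightarrow> 'b::euclidean_space" and F :: "'a \<Rightarrow> real"
  assumes cont: "continuous_on UNIV \<Phi>" and der: "(\<Phi> has_derivative A) (at z)"
    and surj: "\<And>c. (\<And>v. c \<bullet> A v = 0) \<Longrightarrow> c = 0"
    and F: "(F has_derivative F') (at z)"
    and C: "0 \<in> C"
    and min: "\<And>e. e \<in> C \<Longrightarrow> \<forall>\<^sub>F z' in nhds z. (\<exists>t\<ge>0. \<Phi> z' = \<Phi> z + t *\<^sub>R e) \<longrightarrow> F z \<le> F z'"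
  obtains c where "\<And>v. F' v = c \<bullet> A v" "\<And>e. e \<in> C \<Longrightarrow> 0 \<le> c \<bullet> e"
proof -
  have A: "linear A" and F': "linear F'"
    using der F has_derivative_linear by blast+
  have nonneg: "0 \<le> F' d" if e: "A d \<in> C" for d
  proof -
    obtain \<gamma> where \<gamma>: "\<gamma> 0 = z" "(\<gamma> has_vector_derivative d) (at 0)"
      "\<forall>\<^sub>F t in nhds 0. \<Phi> (\<gamma> t) = \<Phi> z + t *\<^sub>R A d"
      using curve_in_level_set[OF cont der surj] by blast
    have "isCont \<gamma> 0"
      using \<gamma>(2) has_vector_derivative_continuous by blast
    then have "filterlim \<gamma> (nhds z) (nhds 0)"
      using \<gamma>(1) tendsto_at_iff_tendsto_nhds[of \<gamma> 0] by (simp add: isCont_def)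
    from filterlim_iff[THEN iffD1, OF this, rule_format, OF min[OF e]] \<gamma>(3)
    have "\<forall>\<^sub>F t in nhds 0. 0 \<le> t \<longrightarrow> F z \<le> F (\<gamma> t)"
      by eventually_elim auto
    then have ev: "\<forall>\<^sub>F t in at_right 0. 0 \<le> (F (\<gamma> t) - F (\<gamma> 0)) / (t - 0)"
      unfolding eventually_at_filter
      by eventually_elim (auto simp: \<gamma>(1))
    have "((\<lambda>t. F (\<gamma> t)) has_derivative (\<lambda>t. F' (t *\<^sub>R d))) (at 0)"
      using has_derivative_compose[OF \<gamma>(2)[unfolded has_vector_derivative_def], of F F'] F \<gamma>(1) by simp
    then have "((\<lambda>t. F (\<gamma> t)) has_real_derivative F' d) (at 0)"
      by (simp add: has_field_derivative_def linear_scale[OF F'] mult_commute_abs)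
    then have "((\<lambda>t. (F (\<gamma> t) - F (\<gamma> 0)) / (t - 0)) \<longlongrightarrow> F' d) (at 0)"
      by (simp add: has_field_derivative_iff)
    then have "((\<lambda>t. (F (\<gamma> t) - F (\<gamma> 0)) / (t - 0)) \<longlongrightarrow> F' d) (at_right 0)"
      by (rule filterlim_mono) (simp_all add: at_within_le_at)
    then show ?thesis
      by (rule tendsto_lowerbound[OF _ ev]) simp
  qed
  have ker: "F' d = 0" if "A d = 0" for d
    using nonneg[of d] nonneg[of "- d"] that C by (simp add: linear_neg[OF A] linear_neg[OF F'])
  obtain B where B: "linear B" "A \<circ> B = id"
    using linear_right_inverse[OF A surj] by blast
  have AB: "A (B w) = w" for w using B(2) by (simp add: fun_eq_iff)
  \<comment> \<open>The adjoint at 1 is the Riesz representative of the functional that sends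
    \<open>w\<close> to \<open>F' (B w)\<close>.\<close>
  define c where "c = adjoint (\<lambda>w. F' (B w)) 1"
  have "linear (\<lambda>w. F' (B w))"
    using linear_compose[OF B(1) F'] by (simp add: comp_def)
  from adjoint_works[OF this, of _ 1] have c: "c \<bullet> w = F' (B w)" for w
    unfolding c_def by (simp add: inner_commute)
  have "F' v = c \<bullet> A v" for v
  proof -
    have "A (v - B (A v)) = 0" by (simp add: linear_diff[OF A] AB)
    from ker[OF this] show ?thesis by (simp add: c linear_diff[OF F'])
  qed
  moreover have "0 \<le> c \<bullet> e" if "e \<in> C" for e
    unfolding c using nonneg[of "B e"] that by (simp add: AB)
  ultimately show ?thesis using that by blast
qed

section \<open>Linear algebra\<close>

lemma indep_family_iff:
  assumes "finite J"
  shows "indep_family v J \<longleftrightarrow> (\<forall>c. (\<Sum>j\<in>J. c j *\<^sub>R v j) = 0 \<longrightarrow> (\<forall>j\<in>J. c j = 0))"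
proof
  assume v: "indep_family v J"
  show "\<forall>c. (\<Sum>j\<in>J. c j *\<^sub>R v j) = 0 \<longrightarrow> (\<forall>j\<in>J. c j = 0)"
  proof (intro allI impI)
    fix c assume c: "(\<Sum>j\<in>J. c j *\<^sub>R v j) = 0"
    have inj: "inj_on v J" and ind: "independent (v ` J)" using v by (auto simp: indep_family_def)
    have "(\<Sum>x\<in>v ` J. c (the_inv_into J v x) *\<^sub>R x) = (\<Sum>j\<in>J. c j *\<^sub>R v j)"
      unfolding sum.reindex[OF inj] by (intro sum.cong) (auto simp: the_inv_into_f_f[OF inj])
    then have "\<forall>x\<in>v ` J. c (the_inv_into J v x) = 0"
      using ind c dependent_finite[of "v ` J"] assms by auto
    then show "\<forall>j\<in>J. c j = 0" by (simp add: the_inv_into_f_f[OF inj])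
  qed
next
  assume *: "\<forall>c. (\<Sum>j\<in>J. c j *\<^sub>R v j) = 0 \<longrightarrow> (\<forall>j\<in>J. c j = 0)"
  have inj: "inj_on v J"
  proof (rule inj_onI, rule ccontr)
    fix i j assume ij: "i \<in> J" "j \<in> J" "v i = v j" "i \<noteq> j"
    \<comment> \<open>Coefficients 1 at \<open>i\<close> and -1 at \<open>j\<close> form a
      nontrivial relation when the two vectors are equal.\<close>
    have "(\<Sum>k\<in>J. (of_bool (k = i) - of_bool (k = j)) *\<^sub>R v k)
        = (\<Sum>k\<in>J. if k = i then v k else 0) - (\<Sum>k\<in>J. if k = j then v k else 0)"
      unfolding sum_subtractf[symmetric] by (intro sum.cong) auto
    also have "\<dots> = 0" using ij assms by (simp add: sum.delta')
    finally have "of_bool (i = i) - of_bool (i = j) = (0::real)"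
      using *[rule_format, OF _ ij(1), of "\<lambda>k. of_bool (k = i) - of_bool (k = j)"] by blast
    then show False using ij(4) by simp
  qed
  moreover have "independent (v ` J)"
  proof
    assume "dependent (v ` J)"
    then obtain u where u: "\<exists>x\<in>v ` J. u x \<noteq> 0" "(\<Sum>x\<in>v ` J. u x *\<^sub>R x) = 0"
      using dependent_finite[of "v ` J"] assms by auto
    then show False
      using *[rule_format, of "\<lambda>j. u (v j)"] unfolding sum.reindex[OF inj] by auto
  qed
  ultimately show "indep_family v J" by (simp add: indep_family_def)
qed

lemma dependent_family:
  fixes v :: "'i \<Rightarrow> 'a::euclidean_space"
  assumes "finite J" "DIM('a) < card J"
  obtains c where "(\<Sum>j\<in>J. c j *\<^sub>R v j) = 0" "\<exists>j\<in>J. c j \<noteq> 0"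
proof -
  have "\<not> indep_family v J"
  proof
    assume "indep_family v J"
    then have "card (v ` J) = card J" "independent (v ` J)"
      by (auto simp: indep_family_def card_image)
    then show False using independent_bound[of "v ` J"] assms(2) by linarith
  qed
  then show ?thesis using that unfolding indep_family_iff[OF assms(1)] by blast
qed

text \<open>Gordan's theorem of the alternative: if 0 lay outside the convex hull of the vectors, a
  separating hyperplane would provide a \<open>d\<close> having negative inner product with all of
  them.\<close>

lemma gordan:
  fixes v :: "'i \<Rightarrow> 'a::euclidean_space"
  assumes I: "finite I" and no: "\<And>d. \<exists>i\<in>I. 0 \<le> v i \<bullet> d"
  obtains c where "\<And>i. i \<in> I \<Longrightarrow> 0 \<le> c i" "(\<Sum>i\<in>I. c i) = 1" "(\<Sum>i\<in>I. c i *\<^sub>R v i) = 0"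
proof -
  \<comment> \<open>The coefficients are indexed by \<open>I\<close> rather than by the vectors, so
    repeated vectors need no separate treatment.\<close>
  define K where "K = {(\<Sum>i\<in>I. c i *\<^sub>R v i) | c. (\<forall>i\<in>I. 0 \<le> c i) \<and> (\<Sum>i\<in>I. c i) = 1}"
  have "convex K"
  proof (rule convexI)
    fix x y and s t :: real
    assume x: "x \<in> K" and y: "y \<in> K" and st: "0 \<le> s" "0 \<le> t" "s + t = 1"
    obtain c where c: "x = (\<Sum>i\<in>I. c i *\<^sub>R v i)" "\<forall>i\<in>I. 0 \<le> c i" "(\<Sum>i\<in>I. c i) = 1"
      using x unfolding K_def by blast
    obtain d where d: "y = (\<Sum>i\<in>I. d i *\<^sub>R v i)" "\<forall>i\<in>I. 0 \<le> d i" "(\<Sum>i\<in>I. d i) = 1"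
      using y unfolding K_def by blast
    have "s *\<^sub>R x + t *\<^sub>R y = (\<Sum>i\<in>I. (s * c i + t * d i) *\<^sub>R v i)"
      unfolding c(1) d(1) by (simp add: scaleR_sum_right scaleR_add_left sum.distrib)
    moreover have "\<forall>i\<in>I. 0 \<le> s * c i + t * d i" using c(2) d(2) st by simp
    moreover have "(\<Sum>i\<in>I. s * c i + t * d i) = 1"
      by (simp add: sum.distrib sum_distrib_left[symmetric] c(3) d(3) st(3))
    ultimately show "s *\<^sub>R x + t *\<^sub>R y \<in> K"
      unfolding K_def by (intro CollectI exI[of _ "\<lambda>i. s * c i + t * d i"]) auto
  qed
  moreover have vK: "v ` I \<subseteq> K"
  proof
    fix x assume "x \<in> v ` I"
    then obtain i where i: "i \<in> I" "x = v i" by blast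
    have "(\<Sum>k\<in>I. of_bool (k = i) *\<^sub>R v k) = (\<Sum>k\<in>I. if k = i then v k else 0)"
      by (intro sum.cong) auto
    then have "x = (\<Sum>k\<in>I. of_bool (k = i) *\<^sub>R v k)" using i I by (simp add: sum.delta')
    moreover have "(\<Sum>k\<in>I. of_bool (k = i)) = (1::real)" using i I by (simp add: of_bool_def sum.delta')
    ultimately show "x \<in> K" unfolding K_def by (intro CollectI exI[of _ "\<lambda>k. of_bool (k = i)"]) auto
  qed
  ultimately have hull: "convex hull (v ` I) \<subseteq> K" by (simp add: hull_minimal)
  have "0 \<in> convex hull (v ` I)"
  proof (rule ccontr)
    assume "0 \<notin> convex hull (v ` I)"
    moreover have "closed (convex hull (v ` I))"
      using I by (simp add: finite_imp_compact_convex_hull compact_imp_closed)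
    ultimately obtain a b where "0 < b" "\<And>x. x \<in> convex hull (v ` I) \<Longrightarrow> a \<bullet> x > b"
      using separating_hyperplane_closed_0[OF convex_convex_hull] by blast
    then have "v i \<bullet> - a < 0" if "i \<in> I" for i
      using hull_inc[of "v i" "v ` I" convex] that by (fastforce simp: inner_commute)
    then show False using no[of "- a"] by fastforce
  qed
  then obtain c where "(\<forall>i\<in>I. 0 \<le> c i)" "(\<Sum>i\<in>I. c i) = 1" "0 = (\<Sum>i\<in>I. c i *\<^sub>R v i)"
    using hull unfolding K_def by blast
  then show ?thesis by (intro that[of c]) auto
qed

text \<open>In coordinates of the basis \<open>Bs\<close> the equation is a square linear system,
  solved by the inverse matrix. With \<open>s = 0\<close> this is injectivity on \<open>W\<close>;
  with \<open>s \<noteq> 0\<close> it brings in the quadratic form of the inverse, by which Type 4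
  is defined.\<close>

lemma restricted_system_solution:
  assumes Bs: "basis_of Bs W" and inv: "inverse_matrices_on Bs (restricted_matrix H) A'"
    and d: "d \<in> W" and eq: "\<And>e. e \<in> W \<Longrightarrow> e \<bullet> (H *v d) = s * (e \<bullet> b)"
  shows "d = (\<Sum>i\<in>Bs. (s * (\<Sum>k\<in>Bs. A' i k * (k \<bullet> b))) *\<^sub>R i)"
proof -
  have fin: "finite Bs" and sp: "span Bs = W"
    using Bs independent_imp_finite by (auto simp: basis_of_def)
  obtain c where c: "d = (\<Sum>i\<in>Bs. c i *\<^sub>R i)"
    using d sp span_finite[OF fin] by auto
  have *: "(\<Sum>j\<in>Bs. restricted_matrix H k j * c j) = s * (k \<bullet> b)" if "k \<in> Bs" for k
  proof -
    have "k \<in> W" using sp that span_base by blast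
    then have "k \<bullet> (H *v d) = s * (k \<bullet> b)" by (rule eq)
    moreover have "k \<bullet> (H *v d) = (\<Sum>j\<in>Bs. restricted_matrix H k j * c j)"
      unfolding c by (simp add: linear_sum[OF matrix_vector_mul_linear] linear_scale[OF matrix_vector_mul_linear]
          inner_sum_right restricted_matrix_def mult.commute)
    ultimately show ?thesis by simp
  qed
  have "c i = s * (\<Sum>k\<in>Bs. A' i k * (k \<bullet> b))" if i: "i \<in> Bs" for i
  proof -
    have "s * (\<Sum>k\<in>Bs. A' i k * (k \<bullet> b)) = (\<Sum>k\<in>Bs. A' i k * (\<Sum>j\<in>Bs. restricted_matrix H k j * c j))"
      unfolding sum_distrib_left[of s] by (intro sum.cong) (auto simp: *)
    also have "\<dots> = (\<Sum>j\<in>Bs. (\<Sum>k\<in>Bs. A' i k * restricted_matrix H k j) * c j)"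
      unfolding sum_distrib_left sum_distrib_right by (subst sum.swap) (simp add: mult.assoc)
    also have "\<dots> = (\<Sum>j\<in>Bs. (if i = j then 1 else 0) * c j)"
      using inv i unfolding inverse_matrices_on_def by (intro sum.cong) auto
    also have "\<dots> = (\<Sum>j\<in>Bs. if i = j then c j else 0)" by (intro sum.cong) auto
    also have "\<dots> = c i" using i fin by (simp add: sum.delta)
    finally show ?thesis by simp
  qed
  then show ?thesis unfolding c by (intro sum.cong) auto
qed

lemma nonsingular_onD:
  assumes "nonsingular_on H W" "d \<in> W" "\<And>e. e \<in> W \<Longrightarrow> e \<bullet> (H *v d) = 0"
  shows "d = 0"
proof -
  obtain Bs A' where "basis_of Bs W" "inverse_matrices_on Bs (restricted_matrix H) A'"
    using assms(1) unfolding nonsingular_on_def by blast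
  from restricted_system_solution[OF this assms(2), of 0 0] assms(3) show ?thesis by simp
qed

text \<open>A vector on which a positive semidefinite form vanishes minimises the form, so it is
  orthogonal to all of \<open>W\<close> in the bilinear form, and nonsingularity makes it 0. The
  nonsingularity required by the types is thereby upgraded to definiteness.\<close>

lemma nonsingular_on_positive_definite:
  fixes H :: "real^'m^'m"
  assumes sym: "\<And>a b. a \<bullet> (H *v b) = b \<bullet> (H *v a)" and W: "subspace W"
    and psd: "\<And>d. d \<in> W \<Longrightarrow> 0 \<le> d \<bullet> (H *v d)"
    and ns: "nonsingular_on H W" and d: "d \<in> W" "d \<bullet> (H *v d) \<le> 0"
  shows "d = 0"
proof (rule nonsingular_onD[OF ns d(1)])
  fix e assume e: "e \<in> W"
  define b where "b = e \<bullet> (H *v d)"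
  define q where "q = e \<bullet> (H *v e)"
  have d0: "d \<bullet> (H *v d) = 0" using d psd[OF d(1)] by simp
  have q: "q \<ge> 0" unfolding q_def by (rule psd[OF e])
  have *: "0 \<le> 2 * t * b + t\<^sup>2 * q" for t
  proof -
    have "0 \<le> (d + t *\<^sub>R e) \<bullet> (H *v (d + t *\<^sub>R e))"
      using W d(1) e by (intro psd subspace_add subspace_scale)
    also have "\<dots> = 2 * t * b + t\<^sup>2 * q"
      unfolding linear_add[OF matrix_vector_mul_linear] linear_scale[OF matrix_vector_mul_linear]
        inner_add_left inner_add_right inner_scaleR_left inner_scaleR_right d0 sym[of d e]
      by (simp add: b_def q_def power2_eq_square algebra_simps)
    finally show ?thesis .
  qed
  \<comment> \<open>This step length replaces the minimiser \<open>- b / q\<close> of the quadratic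
    and is defined for \<open>q = 0\<close> as well.\<close>
  have "0 \<le> 2 * (- b / (q + 1)) * b + (- b / (q + 1))\<^sup>2 * q" by (rule *)
  also have "\<dots> = - (b\<^sup>2 * (q + 2)) / (q + 1)\<^sup>2"
    using q by (simp add: divide_simps power2_eq_square add_nonneg_eq_0_iff) (simp add: algebra_simps)
  finally have "b\<^sup>2 * (q + 2) \<le> 0" using q by (simp add: divide_simps split: if_splits)
  then have "b = 0" using q by (simp add: mult_le_0_iff)
  then show "e \<bullet> (H *v d) = 0" by (simp add: b_def)
qed

text \<open>Subtracting a multiple of \<open>lam\<close> kills the coefficient at \<open>i\<close>.
  If a coefficient at some \<open>k\<close> survived, both \<open>v i\<close> and \<open>v k\<close>
  would lie in the span of the remaining \<open>card J - 2\<close> vectors, which contradicts the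
  rank.\<close>

lemma relation_unique_of_rank:
  fixes v :: "'i \<Rightarrow> 'a::euclidean_space"
  assumes J: "finite J" and rank: "dim (v ` J) = card J - 1"
    and lam: "(\<Sum>j\<in>J. lam j *\<^sub>R v j) = 0" "\<And>j. j \<in> J \<Longrightarrow> lam j \<noteq> 0"
    and c: "(\<Sum>j\<in>J. c j *\<^sub>R v j) = 0"
  obtains t where "\<And>j. j \<in> J \<Longrightarrow> c j = t * lam j"
proof (cases "J = {}")
  case True
  then show ?thesis using that by blast
next
  case False
  then obtain i where i: "i \<in> J" by blast
  have solve: "v i \<in> span (v ` (K - {i}))" if "(\<Sum>j\<in>K. a j *\<^sub>R v j) = 0" "a i \<noteq> 0" "i \<in> K" "finite K"
    for a i and K :: "'i set"
  proof -
    have "a i *\<^sub>R v i = - (\<Sum>j\<in>K - {i}. a j *\<^sub>R v j)"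
      using that by (simp add: sum.remove eq_neg_iff_add_eq_0)
    also have "\<dots> \<in> span (v ` (K - {i}))"
      by (intro span_neg span_sum span_scale span_base) auto
    finally have "inverse (a i) *\<^sub>R (a i *\<^sub>R v i) \<in> span (v ` (K - {i}))" by (rule span_scale)
    then show ?thesis using \<open>a i \<noteq> 0\<close> by simp
  qed
  define b where "b j = c j - (c i / lam i) * lam j" for j
  have b0: "b i = 0" using lam(2)[OF i] by (simp add: b_def)
  have bsum: "(\<Sum>j\<in>J. b j *\<^sub>R v j) = 0"
  proof -
    have "(\<Sum>j\<in>J. b j *\<^sub>R v j) = (\<Sum>j\<in>J. c j *\<^sub>R v j) - (c i / lam i) *\<^sub>R (\<Sum>j\<in>J. lam j *\<^sub>R v j)"
      by (simp add: b_def scaleR_diff_left sum_subtractf scaleR_sum_right)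
    then show ?thesis by (simp add: c lam)
  qed
  have "b k = 0" if k: "k \<in> J" for k
  proof (rule ccontr)
    assume bk: "b k \<noteq> 0"
    then have ik: "k \<noteq> i" using b0 by auto
    have "(\<Sum>j\<in>J - {i}. b j *\<^sub>R v j) = 0"
      using bsum b0 J i by (simp add: sum.remove)
    from solve[OF this bk] have 1: "v k \<in> span (v ` (J - {i} - {k}))"
      using ik k J by auto
    have "v i \<in> span (v ` (J - {i}))"
      using solve[OF lam(1) lam(2)[OF i] i J] .
    also have "v ` (J - {i}) = insert (v k) (v ` (J - {i} - {k}))" using k ik by auto
    also have "span \<dots> = span (v ` (J - {i} - {k}))" using 1 by (rule span_redundant)
    finally have 2: "v i \<in> span (v ` (J - {i} - {k}))" .
    have "v ` J \<subseteq> span (v ` (J - {i} - {k}))"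
    proof
      fix x assume "x \<in> v ` J"
      then obtain j where "j \<in> J" "x = v j" by blast
      then show "x \<in> span (v ` (J - {i} - {k}))"
        using 1 2 by (cases "j = i \<or> j = k") (auto intro: span_base)
    qed
    then have "dim (v ` J) \<le> card (v ` (J - {i} - {k}))"
      by (intro dim_le_card) (use J in auto)
    also have "\<dots> \<le> card (J - {i} - {k})" using J by (intro card_image_le) auto
    also have "\<dots> = card J - 2" using i k ik J by simp
    finally have "card J - 1 \<le> card J - 2" using rank by simp
    \<comment> \<open>Subtraction on naturals truncates; only \<open>card J \<ge> 2\<close> makes
      the bound \<open>card J - 1 \<le> card J - 2\<close> contradictory.\<close>
    moreover have "card {i, k} \<le> card J" using i k J by (intro card_mono) auto
    ultimately show False using ik by simp
  qed
  then show ?thesis by (intro that[of "c i / lam i"]) (simp add: b_def)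
qed

section \<open>Necessary conditions for the lower level problem\<close>

lemma seq_compact_subseq:
  fixes s :: "nat \<Rightarrow> 'a::heine_borel"
  assumes "bounded (range s)"
  obtains r l where "strict_mono r" "(s \<circ> r) \<longlonglongrightarrow> l"
  using bounded_imp_convergent_subsequence[OF assms] by blast

lemma C1_isCont:
  fixes h :: "real \<times> (real^'m) \<Rightarrow> real"
  assumes "Ck_on 1 h UNIV"
  shows "isCont h z" "isCont (grad_y h) z"
  using has_derivative_continuous[OF C1_has_derivative_grad[OF assms]]
    continuous_on_eq_continuous_at[OF open_UNIV, THEN iffD1, rule_format, OF continuous_on_grad(3)[OF assms] UNIV_I]
  by blast+

text \<open>Only regularity is assumed here; compactness of the level sets joins in
  \<open>bilevel_lower_level\<close>, where solutions for nearby \<open>x\<close> are needed.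
  Smoothness of \<open>g\<close> is stated componentwise, the form in which the calculus of scalar
  gradients consumes it.\<close>

locale lower_level =
  fixes f :: "real \<times> (real^'m) \<Rightarrow> real" and g :: "real \<times> (real^'m) \<Rightarrow> real^'p"
  assumes f_C2: "Ck_on 2 f UNIV" and g_C2: "\<And>j. Ck_on 2 (\<lambda>z. g z $ j) UNIV"
begin

lemma f_C1: "Ck_on 1 f UNIV" and g_C1: "Ck_on 1 (\<lambda>z. g z $ j) UNIV"
  using C2_imp_C1 f_C2 g_C2 by blast+

lemma tendsto_f: "(s \<longlongrightarrow> z) F \<Longrightarrow> ((\<lambda>n. f (s n)) \<longlongrightarrow> f z) F"
  by (rule isCont_tendsto_compose[OF C1_isCont(1)[OF f_C1]])

lemma tendsto_g: "(s \<longlongrightarrow> z) F \<Longrightarrow> ((\<lambda>n. g (s n) $ j) \<longlongrightarrow> g z $ j) F"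
  by (rule isCont_tendsto_compose[OF C1_isCont(1)[OF g_C1]])

lemma tendsto_grad_f: "(s \<longlongrightarrow> z) F \<Longrightarrow> ((\<lambda>n. grad_y f (s n)) \<longlongrightarrow> grad_y f z) F"
  by (rule isCont_tendsto_compose[OF C1_isCont(2)[OF f_C1]])

lemma tendsto_grad_g: "(s \<longlongrightarrow> z) F \<Longrightarrow> ((\<lambda>n. cgrad_y g j (s n)) \<longlongrightarrow> cgrad_y g j z) F"
  unfolding cgrad_y_def by (rule isCont_tendsto_compose[OF C1_isCont(2)[OF g_C1]])

text \<open>Feasibility and nonnegativity give all products the same sign, so a vanishing sum leaves
  no nonzero term.\<close>

lemma complementarity:
  assumes "snd z \<in> feasible g (fst z)" "\<forall>i. 0 \<le> u $ i" "u \<bullet> g z = 0"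
  shows "u $ j * g z $ j = 0"
proof -
  have nonneg: "0 \<le> - (u $ i * g z $ i)" for i
    using assms(1,2) by (simp add: feasible_def mult_nonneg_nonpos)
  have "(\<Sum>i\<in>UNIV. - (u $ i * g z $ i)) = 0"
    using assms(3) by (simp add: inner_vec_def sum_negf)
  then have "- (u $ j * g z $ j) = 0"
    using sum_nonneg_eq_0_iff[OF finite_class.finite_UNIV, of "\<lambda>i. - (u $ i * g z $ i)"] nonneg
    by (metis UNIV_I)
  then show ?thesis by (simp only: neg_equal_0_iff_equal)
qed

lemma sum_active:
  fixes v :: "'p \<Rightarrow> 'z::real_vector"
  assumes "\<forall>j. j \<notin> J \<longrightarrow> u $ j = 0"
  shows "(\<Sum>i\<in>UNIV. u $ i *\<^sub>R v i) = (\<Sum>j\<in>J. u $ j *\<^sub>R v j)"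
  using assms by (intro sum.mono_neutral_right) auto

text \<open>Complementarity moves all sums to the active set and nonnegativity removes the absolute
  values; in this form multipliers at different points become comparable.\<close>

lemma mem_M_FJ:
  assumes z: "snd z \<in> feasible g (fst z)"
  shows "(u0, u) \<in> M_FJ f g z \<longleftrightarrow>
    u0 *\<^sub>R grad_y f z + (\<Sum>j\<in>active g z. u $ j *\<^sub>R cgrad_y g j z) = 0 \<and> 0 \<le> u0 \<and> (\<forall>j. 0 \<le> u $ j) \<and>
    u0 + (\<Sum>j\<in>active g z. u $ j) = 1 \<and> (\<forall>j. j \<notin> active g z \<longrightarrow> u $ j = 0)"
    (is "?L \<longleftrightarrow> ?R")
proof
  assume L: ?L
  have 0: "\<forall>j. j \<notin> active g z \<longrightarrow> u $ j = 0"
    using complementarity[OF z, of u] L unfolding M_FJ_def active_def by auto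
  with L sum_active[OF 0, of "\<lambda>_. 1::real"] show ?R
    unfolding M_FJ_def by (auto simp: sum_active[OF 0])
next
  assume R: ?R
  then have 0: "\<forall>j. j \<notin> active g z \<longrightarrow> u $ j = 0" by blast
  have "u $ j * g z $ j = 0" for j using 0 by (auto simp: active_def)
  then have "u \<bullet> g z = 0"
    unfolding inner_vec_def inner_real_def by (intro sum.neutral ballI)
  with R sum_active[OF 0, of "\<lambda>_. 1::real"] show ?L
    unfolding M_FJ_def by (auto simp: sum_active[OF 0])
qed

lemma mem_M_KKT:
  assumes z: "snd z \<in> feasible g (fst z)"
  shows "u \<in> M_KKT f g z \<longleftrightarrow> crit_multiplier f g z u \<and> (\<forall>j. 0 \<le> u $ j)"
    (is "?L \<longleftrightarrow> ?R")
proof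
  assume L: ?L
  have 0: "\<forall>j. j \<notin> active g z \<longrightarrow> u $ j = 0"
    using complementarity[OF z, of u] L unfolding M_KKT_def active_def by auto
  with L show ?R
    unfolding M_KKT_def crit_multiplier_def by (auto simp: sum_active[OF 0])
next
  assume R: ?R
  then have 0: "\<forall>j. j \<notin> active g z \<longrightarrow> u $ j = 0" by (auto simp: crit_multiplier_def)
  have "u $ j * g z $ j = 0" for j using 0 by (auto simp: active_def)
  then have "u \<bullet> g z = 0"
    unfolding inner_vec_def inner_real_def by (intro sum.neutral ballI)
  with R show ?L
    unfolding M_KKT_def crit_multiplier_def by (auto simp: sum_active[OF 0])
qed

lemma KKT_of_FJ:
  assumes z: "snd z \<in> feasible g (fst z)" and "(u0, u) \<in> M_FJ f g z" "u0 \<noteq> 0"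
  shows "(1 / u0) *\<^sub>R u \<in> M_KKT f g z"
proof -
  have eq: "u0 *\<^sub>R grad_y f z + (\<Sum>j\<in>active g z. u $ j *\<^sub>R cgrad_y g j z) = 0" "0 < u0" "\<forall>j. 0 \<le> u $ j"
    "\<forall>j. j \<notin> active g z \<longrightarrow> u $ j = 0"
    using assms(2,3) unfolding mem_M_FJ[OF z] by auto
  have "grad_y f z + (\<Sum>j\<in>active g z. ((1 / u0) *\<^sub>R u) $ j *\<^sub>R cgrad_y g j z)
      = (1 / u0) *\<^sub>R (u0 *\<^sub>R grad_y f z + (\<Sum>j\<in>active g z. u $ j *\<^sub>R cgrad_y g j z))"
    using eq(2) by (simp add: scaleR_add_right scaleR_sum_right)
  then show ?thesis
    unfolding mem_M_KKT[OF z] crit_multiplier_def using eq by simp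
qed

lemma descent_direction:
  assumes h: "Ck_on 1 h UNIV" and d: "grad_y h (x, y) \<bullet> d < 0"
  shows "\<forall>\<^sub>F t in at_right 0. h (x, y + t *\<^sub>R d) < h (x, y)"
proof -
  have "((\<lambda>t. h (x, y + t *\<^sub>R d)) has_real_derivative grad_y h (x, y + 0 *\<^sub>R d) \<bullet> d) (at 0)"
    by (rule C1_has_derivative_y[OF h])
  then have "\<exists>e>0. \<forall>t>0. t < e \<longrightarrow> h (x, y + (0 + t) *\<^sub>R d) < h (x, y + 0 *\<^sub>R d)"
    by (rule DERIV_neg_dec_right) (use d in simp)
  then show ?thesis by (auto simp: eventually_at_right_field)
qed

lemma tendsto_along: "((\<lambda>t. (x, y + t *\<^sub>R d)) \<longlongrightarrow> (x, y)) (at_right 0)" for y :: "real^'m" and x :: real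
proof -
  have "((\<lambda>t. (x, y + t *\<^sub>R d)) \<longlongrightarrow> (x, y + 0 *\<^sub>R d)) (at_right 0)" by (intro tendsto_intros)
  then show ?thesis by simp
qed

lemma inactive_eventually:
  assumes z: "snd z \<in> feasible g (fst z)" and s: "(s \<longlongrightarrow> z) F"
  shows "\<forall>\<^sub>F n in F. \<forall>j. j \<notin> active g z \<longrightarrow> g (s n) $ j < 0"
proof -
  have "\<forall>\<^sub>F n in F. j \<notin> active g z \<longrightarrow> g (s n) $ j < 0" for j
  proof (cases "j \<in> active g z")
    case False
    then have "g z $ j < 0" using z by (cases z) (force simp: feasible_def active_def less_le)
    then show ?thesis using order_tendstoD(2)[OF tendsto_g[OF s]] by (auto elim: eventually_mono)
  qed simp
  then show ?thesis by (simp add: eventually_all_finite)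
qed

text \<open>Fritz John's theorem. Without multipliers, Gordan's alternative would give a direction
  that decreases \<open>f\<close> and every active constraint to first order, while inactive
  constraints stay negative by continuity: short steps would be feasible and better.\<close>

lemma M_FJ_nonempty:
  assumes y: "local_min_on (\<lambda>v. f (x, v)) (feasible g x) y"
  shows "M_FJ f g (x, y) \<noteq> {}"
proof -
  let ?J = "active g (x, y)"
  have feas: "y \<in> feasible g x" using y by (simp add: local_min_on_def)
  then have feas': "snd (x, y) \<in> feasible g (fst (x, y))" by simp
  \<comment> \<open>The objective is indexed by \<open>None\<close>, so that its coefficient becomes
    the multiplier \<open>u0\<close>.\<close>
  define v where "v i = (case i of None \<Rightarrow> grad_y f (x, y) | Some j \<Rightarrow> cgrad_y g j (x, y))" for i
  have no: "\<exists>i\<in>insert None (Some ` ?J). 0 \<le> v i \<bullet> d" for d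
  proof (rule ccontr)
    assume "\<not> ?thesis"
    then have d: "grad_y f (x, y) \<bullet> d < 0" "\<And>j. j \<in> ?J \<Longrightarrow> cgrad_y g j (x, y) \<bullet> d < 0"
      unfolding v_def by (force simp: not_le)+
    have "\<forall>\<^sub>F t in at_right 0. j \<in> ?J \<longrightarrow> g (x, y + t *\<^sub>R d) $ j < 0" for j
      using descent_direction[OF g_C1, of j x y d] d(2)[of j]
      by (cases "j \<in> ?J") (auto simp: cgrad_y_def active_def)
    then have act: "\<forall>\<^sub>F t in at_right 0. \<forall>j. j \<in> ?J \<longrightarrow> g (x, y + t *\<^sub>R d) $ j < 0"
      by (simp add: eventually_all_finite)
    obtain e where e: "e > 0" "\<And>v. v \<in> feasible g x \<Longrightarrow> dist v y < e \<Longrightarrow> f (x, y) \<le> f (x, v)"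
      using y by (auto simp: local_min_on_def)
    have near: "\<forall>\<^sub>F t in at_right 0. dist (x, y + t *\<^sub>R d) (x, y) < e"
      using tendstoD[OF tendsto_along e(1)] by simp
    have "\<forall>\<^sub>F t in at_right (0::real). False"
      using descent_direction[OF f_C1 d(1)] act inactive_eventually[OF feas' tendsto_along[of x y d]] near
    proof eventually_elim
      case (elim t)
      then have "g (x, y + t *\<^sub>R d) $ j < 0" for j by (cases "j \<in> ?J") auto
      then have "y + t *\<^sub>R d \<in> feasible g x" unfolding feasible_def by (simp add: less_imp_le)
      then show False using e(2) elim by (fastforce simp: dist_prod_def)
    qed
    then show False by (simp add: trivial_limit_at_right_real eventually_False)
  qed
  obtain c where c: "\<And>i. i \<in> insert None (Some ` ?J) \<Longrightarrow> 0 \<le> c i" "(\<Sum>i\<in>insert None (Some ` ?J). c i) = 1"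
    "(\<Sum>i\<in>insert None (Some ` ?J). c i *\<^sub>R v i) = 0"
    by (rule gordan[OF finite no]) blast
  have sum: "(\<Sum>i\<in>insert None (Some ` ?J). k i) = k None + (\<Sum>j\<in>?J. k (Some j))" for k :: "_ \<Rightarrow> 'z::ab_group_add"
    by (subst sum.insert) (auto simp: sum.reindex)
  define u :: "real^'p" where "u = (\<chi> j. if j \<in> ?J then c (Some j) else 0)"
  have "(\<Sum>j\<in>?J. u $ j) = (\<Sum>j\<in>?J. c (Some j))"
    "(\<Sum>j\<in>?J. u $ j *\<^sub>R cgrad_y g j (x, y)) = (\<Sum>j\<in>?J. c (Some j) *\<^sub>R cgrad_y g j (x, y))"
    by (auto simp: u_def intro!: sum.cong)
  then have "(c None, u) \<in> M_FJ f g (x, y)"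
    using c feas unfolding sum by (subst mem_M_FJ) (auto simp: u_def v_def)
  then show ?thesis by blast
qed

lemma sol_set_imp_local_min: "y \<in> sol_set f g x \<Longrightarrow> local_min_on (\<lambda>v. f (x, v)) (feasible g x) y"
  unfolding sol_set_def local_min_on_def by (auto intro: exI[of _ 1])

text \<open>The normalisation bounds the multipliers by 1 in norm, whether or not a constraint
  qualification holds, and all defining relations are closed under limits.\<close>

lemma M_FJ_limit:
  assumes s: "s \<longlonglongrightarrow> z" and m: "\<And>n. m n \<in> M_FJ f g (s n)"
  obtains r l where "strict_mono r" "(m \<circ> r) \<longlonglongrightarrow> l" "l \<in> M_FJ f g z"
proof -
  have "norm (m n) \<le> 1" for n
  proof -
    obtain u0 u where m': "m n = (u0, u)" by (cases "m n")
    have "norm (m n) \<le> norm u0 + norm u" unfolding m' by (rule norm_Pair_le)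
    also have "norm u \<le> (\<Sum>i\<in>UNIV. \<bar>u $ i\<bar>)" by (rule norm_le_l1_cart)
    also have "norm u0 + (\<Sum>i\<in>UNIV. \<bar>u $ i\<bar>) = 1"
      using m[of n] unfolding m' M_FJ_def real_norm_def by blast
    finally show ?thesis by simp
  qed
  then have "bounded (range m)" by (auto simp: bounded_iff)
  from seq_compact_subseq[OF this] obtain r l where r: "strict_mono r" "(m \<circ> r) \<longlonglongrightarrow> l" by blast
  obtain l0 l1 where l: "l = (l0, l1)" by (cases l)
  define u0 u where "u0 n = fst (m (r n))" and "u n = snd (m (r n))" for n
  have lim0: "u0 \<longlonglongrightarrow> l0" and lim: "u \<longlonglongrightarrow> l1"
    using tendsto_fst[OF r(2)] tendsto_snd[OF r(2)] by (auto simp: u0_def[abs_def] u_def[abs_def] l comp_def)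
  note limi = tendsto_vec_nth[OF lim]
  have sr: "(\<lambda>n. s (r n)) \<longlonglongrightarrow> z" using LIMSEQ_subseq_LIMSEQ[OF s r(1)] by (simp add: comp_def)
  have mem: "u0 n *\<^sub>R grad_y f (s (r n)) + (\<Sum>i\<in>UNIV. u n $ i *\<^sub>R cgrad_y g i (s (r n))) = 0"
    "0 \<le> u0 n" "0 \<le> u n $ i" "\<bar>u0 n\<bar> + (\<Sum>i\<in>UNIV. \<bar>u n $ i\<bar>) = 1" "u n \<bullet> g (s (r n)) = 0" for n i
    using m[of "r n"] unfolding M_FJ_def u0_def u_def by (auto simp: case_prod_beta)
  have "(\<lambda>n. u0 n *\<^sub>R grad_y f (s (r n)) + (\<Sum>i\<in>UNIV. u n $ i *\<^sub>R cgrad_y g i (s (r n))))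
      \<longlonglongrightarrow> l0 *\<^sub>R grad_y f z + (\<Sum>i\<in>UNIV. l1 $ i *\<^sub>R cgrad_y g i z)"
    by (intro tendsto_intros lim0 limi tendsto_grad_f tendsto_grad_g sr)
  then have 1: "l0 *\<^sub>R grad_y f z + (\<Sum>i\<in>UNIV. l1 $ i *\<^sub>R cgrad_y g i z) = 0"
    unfolding mem by (simp add: LIMSEQ_const_iff)
  have 2: "0 \<le> l0" "0 \<le> l1 $ i" for i
    using LIMSEQ_le_const[OF lim0] LIMSEQ_le_const[OF limi] mem by auto
  have "(\<lambda>n. \<bar>u0 n\<bar> + (\<Sum>i\<in>UNIV. \<bar>u n $ i\<bar>)) \<longlonglongrightarrow> \<bar>l0\<bar> + (\<Sum>i\<in>UNIV. \<bar>l1 $ i\<bar>)"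
    by (intro tendsto_intros lim0 limi)
  then have 3: "\<bar>l0\<bar> + (\<Sum>i\<in>UNIV. \<bar>l1 $ i\<bar>) = 1"
    unfolding mem by (simp add: LIMSEQ_const_iff)
  have "(\<lambda>n. g (s (r n))) \<longlonglongrightarrow> g z" by (intro vec_tendstoI tendsto_g sr)
  from tendsto_inner[OF lim this] have 4: "l1 \<bullet> g z = 0"
    unfolding mem by (simp add: LIMSEQ_const_iff)
  have "l \<in> M_FJ f g z" unfolding l M_FJ_def using 1 2 3 4 by simp
  then show ?thesis using that r by blast
qed

end

section \<open>Derivatives of linear combinations, in particular of Lagrangians\<close>

lemma Ck_on_lincomb2:
  fixes h k :: "'a::euclidean_space \<Rightarrow> real"
  assumes "Ck_on n h UNIV" "Ck_on n k UNIV"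
  shows "Ck_on n (\<lambda>z. a * h z + b * k z) UNIV"
  using assms
proof (induction n arbitrary: h k)
  case 0
  then show ?case by (auto intro!: continuous_intros)
next
  case (Suc n)
  have d: "h differentiable (at z)" "k differentiable (at z)" for z
    using Suc.prems unfolding Ck_on.simps by blast+
  have D: "((\<lambda>z. a * h z + b * k z) has_derivative
      (\<lambda>v. a * frechet_derivative h (at z) v + b * frechet_derivative k (at z) v)) (at z)" for z
    by (intro has_derivative_add has_derivative_mult_right)
      (use d in \<open>simp_all only: frechet_derivative_works\<close>)
  then have F: "frechet_derivative (\<lambda>z. a * h z + b * k z) (at z) =
      (\<lambda>v. a * frechet_derivative h (at z) v + b * frechet_derivative k (at z) v)" for z
    by (metis frechet_derivative_at)
  show ?case
    unfolding Ck_on.simps(2) F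
  proof (intro conjI ballI)
    show "(\<lambda>z. a * h z + b * k z) differentiable (at z)" for z
      using D unfolding differentiable_def by blast
    show "Ck_on n (\<lambda>z. a * frechet_derivative h (at z) v + b * frechet_derivative k (at z) v) UNIV"
      if "v \<in> Basis" for v
      using Suc.prems that unfolding Ck_on.simps by (intro Suc.IH) blast+
  qed
qed

context
  fixes h :: "real \<times> (real^'m) \<Rightarrow> real" and k :: "'i \<Rightarrow> real \<times> (real^'m) \<Rightarrow> real"
    and I :: "'i set" and a :: real and u :: "'i \<Rightarrow> real"
  assumes h: "Ck_on 2 h UNIV" and k: "\<And>j. j \<in> I \<Longrightarrow> Ck_on 2 (k j) UNIV" and I: "finite I"
begin

lemma C2_lincomb: "Ck_on 2 (\<lambda>z. a * h z + (\<Sum>j\<in>I. u j * k j z)) UNIV"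
  using I k
proof (induction I)
  case empty
  then show ?case using Ck_on_lincomb2[OF h h, of a 0] by simp
next
  case (insert j I)
  have "Ck_on 2 (\<lambda>z. 1 * (a * h z + (\<Sum>j\<in>I. u j * k j z)) + u j * k j z) UNIV"
    using insert by (intro Ck_on_lincomb2) auto
  then show ?case using insert(1,2) by (simp add: add.assoc add.commute[of "u j * _"])
qed

lemma grad_lincomb:
  "grad (\<lambda>z. a * h z + (\<Sum>j\<in>I. u j * k j z)) z = a *\<^sub>R grad h z + (\<Sum>j\<in>I. u j *\<^sub>R grad (k j) z)"
proof (rule grad_eqI)
  have "((\<lambda>z. a * h z + (\<Sum>j\<in>I. u j * k j z)) has_derivative
      (\<lambda>v. a * (grad h z \<bullet> v) + (\<Sum>j\<in>I. u j * (grad (k j) z \<bullet> v)))) (at z)"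
    using h k by (intro has_derivative_add has_derivative_sum has_derivative_mult_right
        C1_has_derivative_grad C2_imp_C1)
  then show "((\<lambda>z. a * h z + (\<Sum>j\<in>I. u j * k j z)) has_derivative
      (\<lambda>v. (a *\<^sub>R grad h z + (\<Sum>j\<in>I. u j *\<^sub>R grad (k j) z)) \<bullet> v)) (at z)"
    by (simp add: inner_add_left inner_sum_left)
qed

lemma grad_y_lincomb:
  "grad_y (\<lambda>z. a * h z + (\<Sum>j\<in>I. u j * k j z)) z = a *\<^sub>R grad_y h z + (\<Sum>j\<in>I. u j *\<^sub>R grad_y (k j) z)"
  using arg_cong[OF grad_lincomb, of snd z] by (simp add: grad_def snd_sum)

lemma grad_x_lincomb:
  "grad_x (\<lambda>z. a * h z + (\<Sum>j\<in>I. u j * k j z)) z = a * grad_x h z + (\<Sum>j\<in>I. u j * grad_x (k j) z)"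
  using arg_cong[OF grad_lincomb, of fst z] by (simp add: grad_def fst_sum)

text \<open>The derivative of the gradient of the combination is computed in two ways. Uniqueness in
  the direction \<open>(s, w)\<close> gives mixed and pure second derivatives at once; they are
  separated afterwards by \<open>s = 0\<close> and \<open>w = 0\<close>.\<close>

lemma hess_lincomb_aux:
  "s *\<^sub>R hess_xy (\<lambda>z. a * h z + (\<Sum>j\<in>I. u j * k j z)) z + hess_yy (\<lambda>z. a * h z + (\<Sum>j\<in>I. u j * k j z)) z *v w
    = a *\<^sub>R (s *\<^sub>R hess_xy h z + hess_yy h z *v w) + (\<Sum>j\<in>I. u j *\<^sub>R (s *\<^sub>R hess_xy (k j) z + hess_yy (k j) z *v w))"
proof -
  have "(grad_y (\<lambda>z. a * h z + (\<Sum>j\<in>I. u j * k j z)) has_derivative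
      (\<lambda>v. a *\<^sub>R (fst v *\<^sub>R hess_xy h z + hess_yy h z *v snd v)
        + (\<Sum>j\<in>I. u j *\<^sub>R (fst v *\<^sub>R hess_xy (k j) z + hess_yy (k j) z *v snd v)))) (at z)"
    unfolding grad_y_lincomb[abs_def] using h k
    by (intro has_derivative_add has_derivative_sum has_derivative_scaleR_right has_derivative_grad_y)
  from fun_cong[OF has_derivative_unique[OF this has_derivative_grad_y[OF C2_lincomb]], of "(s, w)"]
  show ?thesis by simp
qed

lemma hess_yy_lincomb:
  "hess_yy (\<lambda>z. a * h z + (\<Sum>j\<in>I. u j * k j z)) z *v w
    = a *\<^sub>R (hess_yy h z *v w) + (\<Sum>j\<in>I. u j *\<^sub>R (hess_yy (k j) z *v w))"
  using hess_lincomb_aux[of 0] by simp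

lemma hess_xy_lincomb:
  "hess_xy (\<lambda>z. a * h z + (\<Sum>j\<in>I. u j * k j z)) z
    = a *\<^sub>R hess_xy h z + (\<Sum>j\<in>I. u j *\<^sub>R hess_xy (k j) z)"
  using hess_lincomb_aux[of 1 _ 0] by simp

end

text \<open>Compactness of the unit sphere. The uniqueness arguments below contradict
  \<open>norm d = 1\<close> by deriving \<open>d = 0\<close> from a linearised system.\<close>

lemma unit_direction:
  fixes a :: "nat \<Rightarrow> 'e::euclidean_space"
  assumes "\<And>n. a n \<noteq> 0"
  obtains r d where "strict_mono r" "norm d = 1" "(\<lambda>n. a (r n) /\<^sub>R norm (a (r n))) \<longlonglongrightarrow> d"
proof -
  define b where "b n = a n /\<^sub>R norm (a n)" for n
  have b: "norm (b n) = 1" for n using assms by (simp add: b_def)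
  then have "bounded (range b)" by (intro boundedI[of _ 1]) auto
  then obtain r d where r: "strict_mono r" "(b \<circ> r) \<longlonglongrightarrow> d"
    by (rule seq_compact_subseq)
  have "(\<lambda>n. norm ((b \<circ> r) n)) \<longlonglongrightarrow> norm d" by (rule tendsto_norm[OF r(2)])
  then have "norm d = 1" using b by (simp add: LIMSEQ_const_iff)
  then show ?thesis using that[OF r(1)] r(2) unfolding b_def comp_def by blast
qed

text \<open>In a first countable space a neighbourhood property fails along a sequence if it fails
  at all, so a statement about all points near \<open>p\<close> reduces to refuting one convergent
  sequence of violators.\<close>

lemma seq_in_eventually_nhds:
  fixes p :: "'e::first_countable_topology"
  assumes "\<And>s. (\<And>n. s n \<in> A) \<Longrightarrow> s \<longlonglongrightarrow> p \<Longrightarrow> (\<And>n. \<not> P (s n)) \<Longrightarrow> False"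
  shows "\<forall>\<^sub>F q in nhds p. q \<in> A \<longrightarrow> P q"
proof -
  have "\<forall>\<^sub>F q in inf (nhds p) (principal {q \<in> A. \<not> P q}). False"
    by (rule sequentially_imp_eventually_nhds_within) (use assms in blast)
  then show ?thesis by (auto simp: eventually_inf_principal)
qed

text \<open>The first conclusion has the shape that the multiplier rule asks for, the second is the
  local minimality to be claimed. \<open>\<pi>\<close> drops the multipliers or is the
  identity.\<close>

lemma local_min_transfer:
  fixes \<pi> :: "'e::metric_space \<Rightarrow> 'd::metric_space"
  assumes F: "local_min_on F B (\<pi> p)" and p: "p \<in> A" and cont: "isCont \<pi> p"
    and ev: "\<forall>\<^sub>F q in nhds p. q \<in> A \<longrightarrow> \<pi> q \<in> B"
  shows "\<forall>\<^sub>F q in nhds p. q \<in> A \<longrightarrow> F (\<pi> p) \<le> F (\<pi> q)" "local_min_on (\<lambda>q. F (\<pi> q)) A p"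
proof -
  obtain e where e: "e > 0" "\<And>w. w \<in> B \<Longrightarrow> dist w (\<pi> p) < e \<Longrightarrow> F (\<pi> p) \<le> F w"
    using F by (auto simp: local_min_on_def)
  have "\<forall>\<^sub>F q in nhds p. dist (\<pi> q) (\<pi> p) < e"
    using cont e(1) by (auto simp: isCont_def tendsto_at_iff_tendsto_nhds intro: tendstoD)
  with ev show *: "\<forall>\<^sub>F q in nhds p. q \<in> A \<longrightarrow> F (\<pi> p) \<le> F (\<pi> q)"
    by eventually_elim (use e(2) in blast)
  then show "local_min_on (\<lambda>q. F (\<pi> q)) A p"
    using p unfolding local_min_on_def eventually_nhds_metric by blast
qed

context lower_level
begin

text \<open>\<open>u0 = 1\<close> gives \<open>f + u\<^sup>T g\<close> and \<open>u0 = 0\<close>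
  gives \<open>u\<^sup>T g\<close>, so the Fritz John system of Type 4 and the KKT systems of the
  other types share one calculus.\<close>

abbreviation lag :: "real \<Rightarrow> real^'p \<Rightarrow> real \<times> (real^'m) \<Rightarrow> real" where
  "lag u0 u \<equiv> \<lambda>z. u0 * f z + (\<Sum>j\<in>UNIV. u $ j * g z $ j)"

lemma lagrangian_eq: "lagrangian f g u = lag 1 u" and inner_eq: "(\<lambda>z. u \<bullet> g z) = lag 0 u"
  by (simp_all add: lagrangian_def fun_eq_iff inner_vec_def)

lemmas lag_C2 = C2_lincomb[OF f_C2 g_C2 finite]
  and grad_lag = grad_lincomb[OF f_C2 g_C2 finite]
  and grad_x_lag = grad_x_lincomb[OF f_C2 g_C2 finite, folded cgrad_x_def]
  and grad_y_lag = grad_y_lincomb[OF f_C2 g_C2 finite, folded cgrad_y_def]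
  and hess_yy_lag = hess_yy_lincomb[OF f_C2 g_C2 finite]
  and hess_xy_lag = hess_xy_lincomb[OF f_C2 g_C2 finite]

text \<open>The second derivatives are weighted by the multipliers at the base point, which vanish
  off \<open>J\<close>. Hence the part in \<open>(x, y)\<close> is the Hessian of the full
  Lagrangian although the sum runs over \<open>J\<close> only.\<close>

lemma stat_has_derivative:
  assumes u: "\<forall>j. j \<notin> J \<longrightarrow> u $ j = 0"
  shows "((\<lambda>(x, y, u0, u). u0 *\<^sub>R grad_y f (x, y) + (\<Sum>j\<in>J. u $ j *\<^sub>R cgrad_y g j (x, y))) has_derivative
    (\<lambda>(a, v, w0, w). (a *\<^sub>R hess_xy (lag u0 u) (x, y) + hess_yy (lag u0 u) (x, y) *v v)
       + (w0 *\<^sub>R grad_y f (x, y) + (\<Sum>j\<in>J. w $ j *\<^sub>R cgrad_y g j (x, y))))) (at (x, y, u0, u))"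
proof -
  let ?p = "(x, y, u0, u)"
  let ?xy = "\<lambda>q::real \<times> (real^'m) \<times> real \<times> (real^'p). (fst q, fst (snd q))"
  have xy: "(?xy has_derivative ?xy) (at ?p)"
    by (intro has_derivative_Pair has_derivative_fst has_derivative_snd has_derivative_ident)
  let ?Df = "\<lambda>q. fst q *\<^sub>R hess_xy f (x, y) + hess_yy f (x, y) *v fst (snd q)"
  let ?Dg = "\<lambda>j q. fst q *\<^sub>R hess_xy (\<lambda>z. g z $ j) (x, y) + hess_yy (\<lambda>z. g z $ j) (x, y) *v fst (snd q)"
  have xyp: "?xy ?p = (x, y)" by simp
  have f': "((\<lambda>q. grad_y f (?xy q)) has_derivative ?Df) (at ?p)"
    using has_derivative_compose[OF xy, of "grad_y f", unfolded xyp, OF has_derivative_grad_y[OF f_C2]]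
    by (simp only: fst_conv snd_conv)
  have g': "((\<lambda>q. cgrad_y g j (?xy q)) has_derivative ?Dg j) (at ?p)" for j
    using has_derivative_compose[OF xy, of "cgrad_y g j", unfolded xyp cgrad_y_def, OF has_derivative_grad_y[OF g_C2]]
    by (simp only: fst_conv snd_conv cgrad_y_def)
  have u0: "((\<lambda>q::real \<times> (real^'m) \<times> real \<times> (real^'p). fst (snd (snd q))) has_derivative
      (\<lambda>q. fst (snd (snd q)))) (at ?p)"
    by (intro has_derivative_fst has_derivative_snd has_derivative_ident)
  have uj: "((\<lambda>q::real \<times> (real^'m) \<times> real \<times> (real^'p). snd (snd (snd q)) $ j) has_derivative
      (\<lambda>q. snd (snd (snd q)) $ j)) (at ?p)" for j
    by (intro bounded_linear.has_derivative[OF bounded_linear_vec_nth] has_derivative_snd has_derivative_ident)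
  have D: "((\<lambda>q. fst (snd (snd q)) *\<^sub>R grad_y f (?xy q)
        + (\<Sum>j\<in>J. snd (snd (snd q)) $ j *\<^sub>R cgrad_y g j (?xy q))) has_derivative
      (\<lambda>q. (fst (snd (snd ?p)) *\<^sub>R ?Df q + fst (snd (snd q)) *\<^sub>R grad_y f (?xy ?p))
        + (\<Sum>j\<in>J. snd (snd (snd ?p)) $ j *\<^sub>R ?Dg j q + snd (snd (snd q)) $ j *\<^sub>R cgrad_y g j (?xy ?p)))) (at ?p)"
    by (intro has_derivative_add has_derivative_sum has_derivative_scaleR[OF u0 f'] has_derivative_scaleR[OF uj g'])
  show ?thesis
    unfolding case_prod_beta
  proof (rule has_derivative_eq_rhs[OF D], rule ext)
    fix q :: "real \<times> (real^'m) \<times> real \<times> (real^'p)"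
    obtain a v w0 w where q: "q = (a, v, w0, w)" by (cases q)
    have "(u0 *\<^sub>R (a *\<^sub>R hess_xy f (x, y) + hess_yy f (x, y) *v v) + w0 *\<^sub>R grad_y f (x, y))
        + (\<Sum>j\<in>J. u $ j *\<^sub>R (a *\<^sub>R hess_xy (\<lambda>z. g z $ j) (x, y) + hess_yy (\<lambda>z. g z $ j) (x, y) *v v)
          + w $ j *\<^sub>R cgrad_y g j (x, y))
      = (a *\<^sub>R (u0 *\<^sub>R hess_xy f (x, y) + (\<Sum>j\<in>J. u $ j *\<^sub>R hess_xy (\<lambda>z. g z $ j) (x, y)))
        + (u0 *\<^sub>R (hess_yy f (x, y) *v v) + (\<Sum>j\<in>J. u $ j *\<^sub>R (hess_yy (\<lambda>z. g z $ j) (x, y) *v v))))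
        + (w0 *\<^sub>R grad_y f (x, y) + (\<Sum>j\<in>J. w $ j *\<^sub>R cgrad_y g j (x, y)))"
      by (simp add: scaleR_add_right sum.distrib scaleR_sum_right mult.commute)
    then show "(fst (snd (snd ?p)) *\<^sub>R ?Df q + fst (snd (snd q)) *\<^sub>R grad_y f (?xy ?p))
        + (\<Sum>j\<in>J. snd (snd (snd ?p)) $ j *\<^sub>R ?Dg j q + snd (snd (snd q)) $ j *\<^sub>R cgrad_y g j (?xy ?p))
      = (fst q *\<^sub>R hess_xy (lag u0 u) (x, y) + hess_yy (lag u0 u) (x, y) *v fst (snd q))
        + (fst (snd (snd q)) *\<^sub>R grad_y f (x, y) + (\<Sum>j\<in>J. snd (snd (snd q)) $ j *\<^sub>R cgrad_y g j (x, y)))"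
      unfolding q fst_conv snd_conv hess_xy_lag hess_yy_lag sum_active[OF u] .
  qed
qed

text \<open>Both stationarity equations are taken at the same \<open>x n\<close>, so no mixed
  derivative survives their subtraction. Each product difference is split as
  \<open>a v - a' v' = a (v - v') + (a - a') v'\<close>, which separates the Hessian part from the
  increments of the multipliers.\<close>

lemma stat_quotient:
  assumes lim: "x \<longlonglongrightarrow> x0" "y \<longlonglongrightarrow> y0" "y' \<longlonglongrightarrow> y0" "u0 \<longlonglongrightarrow> l0" "u \<longlonglongrightarrow> l"
    and l: "\<forall>j. j \<notin> J \<longrightarrow> l $ j = 0"
    and d: "(\<lambda>n. (y n - y' n) /\<^sub>R R n) \<longlonglongrightarrow> dy" "(\<lambda>n. (u0 n - u0' n) / R n) \<longlonglongrightarrow> d0"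
      "(\<lambda>n. (u n - u' n) /\<^sub>R R n) \<longlonglongrightarrow> du"
    and s: "\<And>n. u0 n *\<^sub>R grad_y f (x n, y n) + (\<Sum>j\<in>J. u n $ j *\<^sub>R cgrad_y g j (x n, y n)) = 0"
    and s': "\<And>n. u0' n *\<^sub>R grad_y f (x n, y' n) + (\<Sum>j\<in>J. u' n $ j *\<^sub>R cgrad_y g j (x n, y' n)) = 0"
  shows "hess_yy (lag l0 l) (x0, y0) *v dy + (d0 *\<^sub>R grad_y f (x0, y0) + (\<Sum>j\<in>J. du $ j *\<^sub>R cgrad_y g j (x0, y0))) = 0"
proof -
  have p: "(\<lambda>n. (x n, y n)) \<longlonglongrightarrow> (x0, y0)" and p': "(\<lambda>n. (x n, y' n)) \<longlonglongrightarrow> (x0, y0)"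
    by (intro tendsto_Pair lim)+
  have q: "(\<lambda>n. ((x n, y n) - (x n, y' n)) /\<^sub>R R n) \<longlonglongrightarrow> (0, dy)"
    using tendsto_Pair[OF tendsto_const d(1)] by simp
  have f': "(\<lambda>n. (grad_y f (x n, y n) - grad_y f (x n, y' n)) /\<^sub>R R n) \<longlonglongrightarrow> hess_yy f (x0, y0) *v dy"
    using grad_y_quotient_tendsto[OF f_C2 p p' q] by simp
  have g': "(\<lambda>n. (cgrad_y g j (x n, y n) - cgrad_y g j (x n, y' n)) /\<^sub>R R n)
      \<longlonglongrightarrow> hess_yy (\<lambda>z. g z $ j) (x0, y0) *v dy" for j
    unfolding cgrad_y_def using grad_y_quotient_tendsto[OF g_C2 p p' q] by simp
  have du: "(\<lambda>n. (u n $ j - u' n $ j) / R n) \<longlonglongrightarrow> du $ j" for j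
    using tendsto_vec_nth[OF d(3), of j] by (simp add: divide_inverse_commute)
  have "(\<lambda>n. (u0 n *\<^sub>R ((grad_y f (x n, y n) - grad_y f (x n, y' n)) /\<^sub>R R n)
          + ((u0 n - u0' n) / R n) *\<^sub>R grad_y f (x n, y' n))
        + (\<Sum>j\<in>J. u n $ j *\<^sub>R ((cgrad_y g j (x n, y n) - cgrad_y g j (x n, y' n)) /\<^sub>R R n)
          + ((u n $ j - u' n $ j) / R n) *\<^sub>R cgrad_y g j (x n, y' n)))
      \<longlonglongrightarrow> (l0 *\<^sub>R (hess_yy f (x0, y0) *v dy) + d0 *\<^sub>R grad_y f (x0, y0))
        + (\<Sum>j\<in>J. l $ j *\<^sub>R (hess_yy (\<lambda>z. g z $ j) (x0, y0) *v dy) + du $ j *\<^sub>R cgrad_y g j (x0, y0))"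
    by (intro tendsto_add tendsto_sum tendsto_scaleR lim f' g' d du tendsto_vec_nth[OF lim(5)]
        tendsto_grad_f tendsto_grad_g p')
  moreover have "(u0 n *\<^sub>R ((grad_y f (x n, y n) - grad_y f (x n, y' n)) /\<^sub>R R n)
          + ((u0 n - u0' n) / R n) *\<^sub>R grad_y f (x n, y' n))
        + (\<Sum>j\<in>J. u n $ j *\<^sub>R ((cgrad_y g j (x n, y n) - cgrad_y g j (x n, y' n)) /\<^sub>R R n)
          + ((u n $ j - u' n $ j) / R n) *\<^sub>R cgrad_y g j (x n, y' n)) = 0" for n
  proof -
    have *: "a *\<^sub>R ((v - v') /\<^sub>R r) + ((a - a') / r) *\<^sub>R v' = (a *\<^sub>R v - a' *\<^sub>R v') /\<^sub>R r"
      for a a' r :: real and v v' :: "real^'m"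
    proof -
      have "a *\<^sub>R ((v - v') /\<^sub>R r) + ((a - a') / r) *\<^sub>R v' = (a *\<^sub>R (v - v') + (a - a') *\<^sub>R v') /\<^sub>R r"
        by (simp add: scaleR_add_right divide_inverse mult.commute)
      also have "a *\<^sub>R (v - v') + (a - a') *\<^sub>R v' = a *\<^sub>R v - a' *\<^sub>R v'"
        by (simp add: scaleR_diff_left scaleR_diff_right)
      finally show ?thesis .
    qed
    have "(u0 n *\<^sub>R grad_y f (x n, y n) - u0' n *\<^sub>R grad_y f (x n, y' n))
        + (\<Sum>j\<in>J. u n $ j *\<^sub>R cgrad_y g j (x n, y n) - u' n $ j *\<^sub>R cgrad_y g j (x n, y' n))
      = (u0 n *\<^sub>R grad_y f (x n, y n) + (\<Sum>j\<in>J. u n $ j *\<^sub>R cgrad_y g j (x n, y n)))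
        - (u0' n *\<^sub>R grad_y f (x n, y' n) + (\<Sum>j\<in>J. u' n $ j *\<^sub>R cgrad_y g j (x n, y' n)))"
      by (simp only: sum_subtractf add_diff_add)
    also have "\<dots> = 0" unfolding s s' by (rule diff_self)
    finally show ?thesis
      unfolding * scaleR_sum_right[symmetric] scaleR_add_right[symmetric] by (simp only: scaleR_zero_right)
  qed
  ultimately have "(l0 *\<^sub>R (hess_yy f (x0, y0) *v dy) + d0 *\<^sub>R grad_y f (x0, y0))
        + (\<Sum>j\<in>J. l $ j *\<^sub>R (hess_yy (\<lambda>z. g z $ j) (x0, y0) *v dy) + du $ j *\<^sub>R cgrad_y g j (x0, y0)) = 0"
    by (simp add: LIMSEQ_const_iff)
  then show ?thesis
    by (simp add: hess_yy_lag sum_active[OF l] sum.distrib add_ac)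
qed

lemma g_quotient:
  assumes lim: "x \<longlonglongrightarrow> x0" "y \<longlonglongrightarrow> y0" "y' \<longlonglongrightarrow> y0" and d: "(\<lambda>n. (y n - y' n) /\<^sub>R R n) \<longlonglongrightarrow> dy"
  shows "(\<lambda>n. (g (x n, y n) $ j - g (x n, y' n) $ j) / R n) \<longlonglongrightarrow> cgrad_y g j (x0, y0) \<bullet> dy"
    and "(\<lambda>n. (f (x n, y n) - f (x n, y' n)) / R n) \<longlonglongrightarrow> grad_y f (x0, y0) \<bullet> dy"
proof -
  have p: "(\<lambda>n. (x n, y n)) \<longlonglongrightarrow> (x0, y0)" and p': "(\<lambda>n. (x n, y' n)) \<longlonglongrightarrow> (x0, y0)"
    by (intro tendsto_Pair lim)+
  have q: "(\<lambda>n. ((x n, y n) - (x n, y' n)) /\<^sub>R R n) \<longlonglongrightarrow> (0, dy)"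
    using tendsto_Pair[OF tendsto_const d] by simp
  show "(\<lambda>n. (g (x n, y n) $ j - g (x n, y' n) $ j) / R n) \<longlonglongrightarrow> cgrad_y g j (x0, y0) \<bullet> dy"
    "(\<lambda>n. (f (x n, y n) - f (x n, y' n)) / R n) \<longlonglongrightarrow> grad_y f (x0, y0) \<bullet> dy"
    using C1_quotient_tendsto[OF g_C1 p p' q] C1_quotient_tendsto[OF f_C1 p p' q]
    by (simp_all add: grad_def cgrad_y_def)
qed

text \<open>Constraints inactive at \<open>z\<close> stay inactive, which kills their multipliers; a
  multiplier with positive limit is eventually positive, which keeps its constraint active. Fritz
  John points near \<open>z\<close> thus satisfy the equations of the single level problems, with
  the active set frozen at \<open>z\<close>.\<close>

lemma FJ_near:
  assumes z: "snd z \<in> feasible g (fst z)" and s: "s \<longlonglongrightarrow> z"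
    and feas: "\<And>n. snd (s n) \<in> feasible g (fst (s n))" and m: "\<And>n. (u0 n, u n) \<in> M_FJ f g (s n)"
    and l: "u \<longlonglongrightarrow> l"
  shows "\<forall>\<^sub>F n in sequentially. (\<forall>j. j \<notin> active g z \<longrightarrow> u n $ j = 0) \<and> (\<forall>j. 0 < l $ j \<longrightarrow> g (s n) $ j = 0) \<and>
    u0 n *\<^sub>R grad_y f (s n) + (\<Sum>j\<in>active g z. u n $ j *\<^sub>R cgrad_y g j (s n)) = 0 \<and>
    u0 n + (\<Sum>j\<in>active g z. u n $ j) = 1"
proof -
  have "\<forall>\<^sub>F n in sequentially. 0 < l $ j \<longrightarrow> 0 < u n $ j" for j
  proof (cases "0 < l $ j")
    case True
    from order_tendstoD(1)[OF tendsto_vec_nth[OF l] this] show ?thesis by eventually_elim simp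
  qed simp
  then have "\<forall>\<^sub>F n in sequentially. \<forall>j. 0 < l $ j \<longrightarrow> 0 < u n $ j"
    by (rule eventually_all_finite)
  with inactive_eventually[OF z s] show ?thesis
  proof eventually_elim
    case (elim n)
    have M: "u0 n *\<^sub>R grad_y f (s n) + (\<Sum>j\<in>active g (s n). u n $ j *\<^sub>R cgrad_y g j (s n)) = 0"
      "u0 n + (\<Sum>j\<in>active g (s n). u n $ j) = 1" "\<forall>j. j \<notin> active g (s n) \<longrightarrow> u n $ j = 0"
      using m[of n] unfolding mem_M_FJ[OF feas] by blast+
    have off: "\<forall>j. j \<notin> active g z \<longrightarrow> u n $ j = 0"
    proof (intro allI impI)
      fix j assume "j \<notin> active g z"
      then have "g (s n) $ j < 0" using elim(1) by blast
      then show "u n $ j = 0" using M(3) by (simp add: active_def)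
    qed
    have on: "\<forall>j. 0 < l $ j \<longrightarrow> g (s n) $ j = 0"
    proof (intro allI impI)
      fix j assume "0 < l $ j"
      then have "0 < u n $ j" using elim(2) by blast
      then have "j \<in> active g (s n)" using M(3) by fastforce
      then show "g (s n) $ j = 0" by (simp add: active_def)
    qed
    have eq1: "(\<Sum>j\<in>active g (s n). u n $ j *\<^sub>R v j) = (\<Sum>j\<in>active g z. u n $ j *\<^sub>R v j)"
      for v :: "'p \<Rightarrow> real^'m"
      using sum_active[OF off, of v] sum_active[OF M(3), of v] by (rule trans[OF sym, rotated])
    have eq2: "(\<Sum>j\<in>active g (s n). u n $ j) = (\<Sum>j\<in>active g z. u n $ j)"
      using sum_active[OF off, of "\<lambda>_. 1::real"] sum_active[OF M(3), of "\<lambda>_. 1::real"] by simp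
    show ?case using off on M(1,2) unfolding eq1 eq2 by blast
  qed
qed

end

lemma vector_derivative_quotient:
  fixes \<gamma> :: "real \<Rightarrow> 'e::real_normed_vector"
  assumes \<gamma>: "(\<gamma> has_vector_derivative d) (at 0)" and t: "t \<longlonglongrightarrow> 0" "\<And>n. t n > 0"
  shows "(\<lambda>n. (\<gamma> (t n) - \<gamma> 0) /\<^sub>R t n) \<longlonglongrightarrow> d"
proof (rule tendstoI)
  fix e :: real assume e: "e > 0"
  from \<gamma>[unfolded has_vector_derivative_def has_derivative_at_alt, THEN conjunct2, rule_format, of "e / 2"] e
  obtain \<delta> where \<delta>: "\<delta> > 0" "\<And>s. norm (s - 0) < \<delta> \<Longrightarrow> norm (\<gamma> s - \<gamma> 0 - (s - 0) *\<^sub>R d) \<le> e / 2 * norm (s - 0)"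
    by auto
  have "\<forall>\<^sub>F n in sequentially. t n < \<delta>" using order_tendstoD(2)[OF t(1) \<delta>(1)] .
  then show "\<forall>\<^sub>F n in sequentially. dist ((\<gamma> (t n) - \<gamma> 0) /\<^sub>R t n) d < e"
  proof eventually_elim
    case (elim n)
    have "(\<gamma> (t n) - \<gamma> 0) /\<^sub>R t n - d = (\<gamma> (t n) - \<gamma> 0 - t n *\<^sub>R d) /\<^sub>R t n"
      using t(2)[of n] by (simp add: scaleR_diff_right)
    then have "norm ((\<gamma> (t n) - \<gamma> 0) /\<^sub>R t n - d) = inverse (t n) * norm (\<gamma> (t n) - \<gamma> 0 - t n *\<^sub>R d)"
      using t(2)[of n] by simp
    also have "\<dots> \<le> inverse (t n) * (e / 2 * t n)"
      using \<delta>(2)[of "t n"] elim t(2)[of n] by (intro mult_left_mono) auto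
    also have "\<dots> < e" using t(2)[of n] e by simp
    finally show ?case by (simp add: dist_norm)
  qed
qed

lemma inner_vec_if:
  fixes c :: "real^'p"
  shows "c \<bullet> (\<chi> j. if j \<in> J then a j else b j) = (\<Sum>j\<in>J. c $ j * a j) + (\<Sum>j\<in>-J. c $ j * b j)"
proof -
  have "c \<bullet> (\<chi> j. if j \<in> J then a j else b j) = (\<Sum>j\<in>UNIV. if j \<in> J then c $ j * a j else c $ j * b j)"
    by (auto simp: inner_vec_def intro!: sum.cong)
  also have "\<dots> = (\<Sum>j\<in>J. c $ j * a j) + (\<Sum>j\<in>-J. c $ j * b j)"
    by (simp add: sum.If_cases)
  finally show ?thesis .
qed

section \<open>First and second order necessary conditions under LICQ, and local uniqueness of
  complementarity solutions\<close>

context lower_level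
begin

lemma indep_LICQ:
  assumes "LICQ g z" "(\<Sum>j\<in>active g z. c j *\<^sub>R cgrad_y g j z) = 0" "j \<in> active g z"
  shows "c j = 0"
  using assms indep_family_iff[of "active g z" "\<lambda>j. cgrad_y g j z"] unfolding LICQ_def by auto

lemma crit_multiplier_unique:
  assumes "LICQ g z" "crit_multiplier f g z u" "crit_multiplier f g z v"
  shows "u = v"
proof -
  have "(\<Sum>j\<in>active g z. u $ j *\<^sub>R cgrad_y g j z) = - grad_y f z"
    "(\<Sum>j\<in>active g z. v $ j *\<^sub>R cgrad_y g j z) = - grad_y f z"
    using assms(2,3) unfolding crit_multiplier_def by (simp_all add: eq_neg_iff_add_eq_0 add.commute)
  then have "(\<Sum>j\<in>active g z. (u $ j - v $ j) *\<^sub>R cgrad_y g j z) = 0"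
    by (simp add: scaleR_diff_left sum_subtractf)
  then have "u $ j - v $ j = 0" if "j \<in> active g z" for j
    using indep_LICQ[OF assms(1), of "\<lambda>j. u $ j - v $ j"] that by blast
  then show ?thesis
    using assms(2,3) unfolding crit_multiplier_def vec_eq_iff by (metis right_minus_eq)
qed

lemma LICQ_M_FJ_pos:
  assumes z: "snd z \<in> feasible g (fst z)" and L: "LICQ g z" and m: "(u0, u) \<in> M_FJ f g z"
  shows "0 < u0"
proof (rule ccontr)
  assume "\<not> 0 < u0"
  then have 0: "u0 = 0" using m unfolding mem_M_FJ[OF z] by simp
  then have "(\<Sum>j\<in>active g z. u $ j *\<^sub>R cgrad_y g j z) = 0"
    using m unfolding mem_M_FJ[OF z] by simp
  then have "\<And>j. j \<in> active g z \<Longrightarrow> u $ j = 0" using indep_LICQ[OF L] by blast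
  then have "(\<Sum>j\<in>active g z. u $ j) = 0" by simp
  then show False using m 0 unfolding mem_M_FJ[OF z] by simp
qed

text \<open>\<open>crit_multiplier\<close> allows any sign. Minimality supplies a Fritz John
  multiplier, LICQ makes its \<open>u0\<close> positive, and after division it is a KKT multiplier;
  uniqueness identifies it with \<open>u\<close>, which inherits its sign.\<close>

lemma M_KKT_LICQ:
  assumes y: "local_min_on (\<lambda>v. f (x, v)) (feasible g x) y" and L: "LICQ g (x, y)"
    and u: "crit_multiplier f g (x, y) u"
  shows "M_KKT f g (x, y) = {u}" "\<And>j. 0 \<le> u $ j"
proof -
  have z: "snd (x, y) \<in> feasible g (fst (x, y))" using y by (simp add: local_min_on_def)
  obtain v0 v where m: "(v0, v) \<in> M_FJ f g (x, y)" using M_FJ_nonempty[OF y] by auto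
  from KKT_of_FJ[OF z m] LICQ_M_FJ_pos[OF z L m] have w: "(1 / v0) *\<^sub>R v \<in> M_KKT f g (x, y)" by simp
  have *: "w = u" if "w \<in> M_KKT f g (x, y)" for w
    using that crit_multiplier_unique[OF L _ u] unfolding mem_M_KKT[OF z] by blast
  show "M_KKT f g (x, y) = {u}" using w * by blast
  then show "0 \<le> u $ j" for j unfolding mem_M_KKT[OF z] using mem_M_KKT[OF z, of u] by blast
qed

text \<open>Active slots carry constraints, inactive slots carry the multipliers of the same index.
  Sharing one vector of type \<open>real^'p\<close> avoids a type that depends on the active
  set.\<close>

lemma constraint_map_has_derivative:
  fixes J :: "'p set"
  shows "((\<lambda>q. (\<chi> j. if j \<in> J then g (fst q, fst (snd q)) $ j else snd (snd q) $ j)) has_derivative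
    (\<lambda>q. (\<chi> j. if j \<in> J then cgrad_x g j z * fst q + cgrad_y g j z \<bullet> fst (snd q) else snd (snd q) $ j)))
    (at (fst z, snd z, w))"
proof (rule has_derivative_componentwise_within[THEN iffD2], rule ballI)
  fix b :: "real^'p" assume "b \<in> Basis"
  then obtain i where b: "b = axis i 1" unfolding Basis_vec_def by auto
  have vb: "v \<bullet> b = v $ i" for v unfolding b by (simp add: inner_axis)
  show "((\<lambda>q. (\<chi> j. if j \<in> J then g (fst q, fst (snd q)) $ j else snd (snd q) $ j) \<bullet> b) has_derivative
    (\<lambda>q. (\<chi> j. if j \<in> J then cgrad_x g j z * fst q + cgrad_y g j z \<bullet> fst (snd q) else snd (snd q) $ j) \<bullet> b))
    (at (fst z, snd z, w))"
  proof (cases "i \<in> J")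
    case True
    have xy: "((\<lambda>q::real \<times> (real^'m) \<times> (real^'p). (fst q, fst (snd q))) has_derivative
        (\<lambda>q. (fst q, fst (snd q)))) (at (fst z, snd z, w))"
      by (intro has_derivative_Pair has_derivative_fst has_derivative_snd has_derivative_ident)
    have "((\<lambda>z. g z $ i) has_derivative (\<lambda>v. grad (\<lambda>z. g z $ i) z \<bullet> v)) (at z)"
      by (rule C1_has_derivative_grad[OF g_C1])
    then have D: "((\<lambda>z. g z $ i) has_derivative (\<lambda>v. grad (\<lambda>z. g z $ i) z \<bullet> v))
        (at (fst (fst z, snd z, w), fst (snd (fst z, snd z, w))))"
      by (simp only: fst_conv snd_conv prod.collapse)
    from has_derivative_compose[OF xy D] show ?thesis
      unfolding vb using True by (simp add: grad_def cgrad_x_def cgrad_y_def)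
  next
    case False
    then show ?thesis unfolding vb
      by (simp add: bounded_linear.has_derivative[OF bounded_linear_vec_nth] has_derivative_snd)
  qed
qed

lemma continuous_on_g: "continuous_on S (\<lambda>z. g z $ j)" and continuous_on_f: "continuous_on S f"
  using C1_isCont(1)[OF g_C1] C1_isCont(1)[OF f_C1] by (auto intro: continuous_at_imp_continuous_on)

lemma continuous_on_constraint_map:
  fixes J :: "'p set"
  shows "continuous_on UNIV (\<lambda>q::real \<times> (real^'m) \<times> (real^'p).
    (\<chi> j. if j \<in> J then g (fst q, fst (snd q)) $ j else snd (snd q) $ j))"
proof (rule continuous_on_vecI)
  fix i
  have "continuous_on UNIV (\<lambda>q::real \<times> (real^'m) \<times> (real^'p). g (fst q, fst (snd q)) $ i)"
    by (rule continuous_on_compose2[OF continuous_on_g[of UNIV]]) (auto intro!: continuous_intros)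
  moreover have "continuous_on UNIV (\<lambda>q::real \<times> (real^'m) \<times> (real^'p). snd (snd q) $ i)"
    by (intro continuous_intros)
  ultimately show "continuous_on UNIV (\<lambda>q::real \<times> (real^'m) \<times> (real^'p).
      (\<chi> j. if j \<in> J then g (fst q, fst (snd q)) $ j else snd (snd q) $ j) $ i)"
    by (cases "i \<in> J") simp_all
qed

text \<open>Fixing \<open>x\<close> as a further coordinate and adding the components outside the active set makes the
  active constraints part of a square system, in which the curve realizing \<open>d\<close> is found.\<close>

lemma second_order_necessary:
  assumes y: "local_min_on (\<lambda>v. f (x, v)) (feasible g x) y" and L: "LICQ g (x, y)"
    and u: "crit_multiplier f g (x, y) u"
    and d: "\<And>j. j \<in> active g (x, y) \<Longrightarrow> cgrad_y g j (x, y) \<bullet> d \<le> 0"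
      "\<And>j. j \<in> active g (x, y) \<Longrightarrow> u $ j \<noteq> 0 \<Longrightarrow> cgrad_y g j (x, y) \<bullet> d = 0"
  shows "0 \<le> d \<bullet> (hess_yy (lagrangian f g u) (x, y) *v d)"
proof -
  let ?J = "active g (x, y)"
  let ?z = "(x, y)"
  have z: "snd (x, y) \<in> feasible g (fst (x, y))" using y by (simp add: local_min_on_def)
  let ?\<Phi> = "\<lambda>q::real \<times> (real^'m) \<times> (real^'p).
    (fst q, (\<chi> j. if j \<in> ?J then g (fst q, fst (snd q)) $ j else snd (snd q) $ j))"
  let ?A = "\<lambda>q::real \<times> (real^'m) \<times> (real^'p).
    (fst q, (\<chi> j. if j \<in> ?J then cgrad_x g j ?z * fst q + cgrad_y g j ?z \<bullet> fst (snd q) else snd (snd q) $ j))"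
  have cont: "continuous_on UNIV ?\<Phi>"
    by (intro continuous_on_Pair continuous_on_constraint_map continuous_on_fst continuous_on_id)
  have der: "(?\<Phi> has_derivative ?A) (at (x, y, 0))"
    using constraint_map_has_derivative[of ?J ?z 0] unfolding fst_conv snd_conv
    by (intro has_derivative_Pair has_derivative_fst has_derivative_ident)
  have surj: "c = 0" if "\<And>q. c \<bullet> ?A q = 0" for c :: "real \<times> (real^'p)"
  proof -
    obtain c1 c2 where cc: "c = (c1, c2)" by (cases c)
    have c: "c1 * a + ((\<Sum>j\<in>?J. c2 $ j * (cgrad_x g j ?z * a + cgrad_y g j ?z \<bullet> v)) + (\<Sum>j\<in>-?J. c2 $ j * w $ j)) = 0"
      for a v w
      using that[of "(a, v, w)"] by (simp add: cc inner_vec_if)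
    have off: "c2 $ j = 0" if "j \<notin> ?J" for j
    proof -
      have "(\<Sum>i\<in>-?J. c2 $ i * axis j 1 $ i) = (\<Sum>i\<in>-?J. if i = j then c2 $ i else 0)"
        by (intro sum.cong) (auto simp: axis_def)
      then show ?thesis using c[of 0 0 "axis j 1"] that by (simp add: sum.delta')
    qed
    have "(\<Sum>j\<in>?J. c2 $ j *\<^sub>R cgrad_y g j ?z) \<bullet> v = 0" for v
      using c[of 0 v 0] by (simp add: inner_sum_left)
    then have "(\<Sum>j\<in>?J. c2 $ j *\<^sub>R cgrad_y g j ?z) = 0" using inner_eq_zero_iff by blast
    from indep_LICQ[OF L this] off have c2: "c2 = 0" by (auto simp: vec_eq_iff)
    then show ?thesis using c[of 1 0 0] by (simp add: cc zero_prod_def)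
  qed
  obtain \<gamma> where \<gamma>: "\<gamma> 0 = (x, y, 0)" "(\<gamma> has_vector_derivative (0, d, 0)) (at 0)"
    "\<forall>\<^sub>F t in nhds 0. ?\<Phi> (\<gamma> t) = ?\<Phi> (x, y, 0) + t *\<^sub>R ?A (0, d, 0)"
    by (rule curve_in_level_set[OF cont der surj]) blast
  define t where "t n = inverse (real (Suc n))" for n
  have t: "t \<longlonglongrightarrow> 0" "\<And>n. t n > 0"
    unfolding t_def by (rule LIMSEQ_inverse_real_of_nat) simp
  have t0: "filterlim t (nhds 0) sequentially" using t(1) .
  define Y where "Y n = fst (snd (\<gamma> (t n)))" for n
  have dY: "(\<lambda>n. (Y n - y) /\<^sub>R t n) \<longlonglongrightarrow> d"
    using tendsto_fst[OF tendsto_snd[OF vector_derivative_quotient[OF \<gamma>(2) t]]] by (simp add: Y_def \<gamma>(1))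
  have "(\<lambda>n. y + t n *\<^sub>R ((Y n - y) /\<^sub>R t n)) \<longlonglongrightarrow> y + 0 *\<^sub>R d" by (intro tendsto_intros t dY)
  then have Y: "Y \<longlonglongrightarrow> y" using t(2) by (simp add: less_imp_neq[THEN not_sym])
  then have p: "(\<lambda>n. (x, Y n)) \<longlonglongrightarrow> (x, y)" by (intro tendsto_intros)
  \<comment> \<open>Along the curve each active constraint is \<open>t\<close> times its slope in
    direction \<open>d\<close>: nonpositive, so the points are feasible, and 0 where the multiplier
    does not vanish, so the Lagrangian changes by exactly as much as \<open>f\<close>.\<close>
  have Yg: "\<forall>\<^sub>F n in sequentially. \<forall>j\<in>?J. g (x, Y n) $ j = t n * (cgrad_y g j ?z \<bullet> d)"
    using filterlim_iff[THEN iffD1, OF t0, rule_format, OF \<gamma>(3)]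
  proof eventually_elim
    case (elim n)
    have 1: "fst (\<gamma> (t n)) = x" using arg_cong[OF elim, of fst] by simp
    have 2: "(\<chi> j. if j \<in> ?J then g (fst (\<gamma> (t n)), fst (snd (\<gamma> (t n)))) $ j else snd (snd (\<gamma> (t n))) $ j)
        = (\<chi> j. if j \<in> ?J then g (x, y) $ j else 0) + t n *\<^sub>R (\<chi> j. if j \<in> ?J then cgrad_y g j ?z \<bullet> d else 0)"
      using arg_cong[OF elim, of snd] by (simp cong: if_cong)
    show ?case
    proof
      fix j assume j: "j \<in> ?J"
      then have "g (x, y) $ j = 0" by (simp add: active_def)
      then show "g (x, Y n) $ j = t n * (cgrad_y g j ?z \<bullet> d)"
        using arg_cong[OF 2, of "\<lambda>v. v $ j"] j unfolding 1 by (simp add: Y_def)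
    qed
  qed
  obtain e where e: "e > 0" "\<And>v. v \<in> feasible g x \<Longrightarrow> dist v y < e \<Longrightarrow> f (x, y) \<le> f (x, v)"
    using y by (auto simp: local_min_on_def)
  note inact = inactive_eventually[OF z p]
  have u_off: "\<forall>j. j \<notin> ?J \<longrightarrow> u $ j = 0" using u by (simp add: crit_multiplier_def)
  let ?L = "lagrangian f g u"
  have grad0: "grad_y ?L ?z = 0"
    using u unfolding lagrangian_eq grad_y_lag sum_active[OF u_off] crit_multiplier_def by simp
  \<comment> \<open>Since \<open>grad_y ?L ?z = 0\<close>, the quotient is the bare increment of the
    Lagrangian over the square of the step, nonnegative by minimality of \<open>y\<close>.\<close>
  have lim: "(\<lambda>n. (?L (x, Y n) - ?L (x, y) - grad_y ?L (x, y) \<bullet> (Y n - y)) / (t n)\<^sup>2)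
      \<longlonglongrightarrow> (d \<bullet> (hess_yy ?L ?z *v d)) / 2"
    by (rule second_order_quotient_tendsto[OF _ tendsto_const Y tendsto_const dY])
      (unfold lagrangian_eq, rule lag_C2)
  have "\<forall>\<^sub>F n in sequentially. 0 \<le> (?L (x, Y n) - ?L (x, y) - grad_y ?L (x, y) \<bullet> (Y n - y)) / (t n)\<^sup>2"
    using Yg inact tendstoD[OF Y e(1)]
  proof eventually_elim
    case (elim n)
    have "g (x, Y n) $ j \<le> 0" for j
      using elim(1,2) d(1)[of j] t(2)[of n] by (cases "j \<in> ?J") (auto simp: less_imp_le mult_nonneg_nonpos)
    then have "f (x, y) \<le> f (x, Y n)" using e(2)[of "Y n"] elim(3) by (simp add: feasible_def)
    moreover have a: "u $ j * g (x, Y n) $ j = 0" for j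
      using elim(1) d(2)[of j] u_off by (cases "j \<in> ?J"; cases "u $ j = 0") auto
    have "u \<bullet> g (x, Y n) = 0" unfolding inner_vec_def inner_real_def using a by (intro sum.neutral ballI)
    moreover have b: "u $ j * g (x, y) $ j = 0" for j using u_off by (auto simp: active_def)
    have "u \<bullet> g (x, y) = 0" unfolding inner_vec_def inner_real_def using b by (intro sum.neutral ballI)
    ultimately have "?L (x, y) \<le> ?L (x, Y n)" unfolding lagrangian_def by simp
    then show ?case by (simp add: grad0)
  qed
  then have "0 \<le> (d \<bullet> (hess_yy ?L ?z *v d)) / 2"
    by (rule tendsto_lowerbound[OF lim]) simp
  then show ?thesis by simp
qed

text \<open>Second-order sufficiency holds on the tangent space of the constraints with positive multiplier,
  as \<open>d\<close> and \<open>- d\<close> cannot both violate the only remaining constraint \<open>q\<close>.\<close>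

lemma positive_definite_on_tangent:
  assumes y: "local_min_on (\<lambda>v. f (x, v)) (feasible g x) y" and L: "LICQ g (x, y)"
    and u: "crit_multiplier f g (x, y) u" and K: "K \<subseteq> {q}" "\<And>k. k \<in> K \<Longrightarrow> u $ k = 0"
    and ns: "nonsingular_on (hess_yy (lagrangian f g u) (x, y)) (tangent_y g (active g (x, y) - K) (x, y))"
    and d: "d \<in> tangent_y g (active g (x, y) - K) (x, y)" "d \<bullet> (hess_yy (lagrangian f g u) (x, y) *v d) \<le> 0"
  shows "d = 0"
proof (rule nonsingular_on_positive_definite[OF _ _ _ ns d])
  let ?H = "hess_yy (lagrangian f g u) (x, y)" and ?T = "tangent_y g (active g (x, y) - K) (x, y)"
  show "a \<bullet> (?H *v b) = b \<bullet> (?H *v a)" for a b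
    unfolding lagrangian_eq by (rule hess_yy_symmetric[OF lag_C2])
  show "subspace ?T"
    by (auto simp: subspace_def tangent_y_def inner_add_right)
  fix e assume e: "e \<in> ?T"
  have *: "0 \<le> e \<bullet> (?H *v e)" if e: "e \<in> ?T" "cgrad_y g q (x, y) \<bullet> e \<le> 0" for e
  proof (rule second_order_necessary[OF y L u])
    fix j assume j: "j \<in> active g (x, y)"
    have *: "cgrad_y g j (x, y) \<bullet> e = 0" if "j \<notin> K" using e(1) j that by (simp add: tangent_y_def)
    then show "cgrad_y g j (x, y) \<bullet> e \<le> 0" using e(2) K(1) by (cases "j \<in> K") auto
    show "cgrad_y g j (x, y) \<bullet> e = 0" if "u $ j \<noteq> 0" using * K(2) that by blast
  qed
  show "0 \<le> e \<bullet> (?H *v e)"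
  proof (cases "cgrad_y g q (x, y) \<bullet> e \<le> 0")
    case False
    have "- e \<in> ?T" using e by (simp add: tangent_y_def)
    from *[OF this] False show ?thesis
      by (simp add: linear_neg[OF matrix_vector_mul_linear])
  qed (rule *[OF e])
qed

text \<open>The linearised stationarity equation is tested with \<open>dy\<close>. Constraints
  outside \<open>K\<close> contribute nothing and complementary pairs contribute a nonnegative
  product, so the quadratic form is at most 0 and \<open>pd\<close> yields \<open>dy = 0\<close>.
  LICQ then yields \<open>du = 0\<close>, against the unit norm of the limit direction.\<close>

lemma complementarity_unique:
  fixes xbar :: real and ybar :: "real^'m"
  defines "z \<equiv> (xbar, ybar)" and "J \<equiv> active g (xbar, ybar)"
  assumes L: "LICQ g z" and u: "crit_multiplier f g z ubar" and K: "K \<subseteq> J"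
    and pd: "\<And>d. d \<in> tangent_y g (J - K) z \<Longrightarrow> d \<bullet> (hess_yy (lagrangian f g ubar) z *v d) \<le> 0 \<Longrightarrow> d = 0"
    and mem: "\<And>n. (x n, y n, u n) \<in> mpcc_set f g J K" "\<And>n. (x n, y' n, u' n) \<in> mpcc_set f g J K"
    and off: "\<And>n j. j \<notin> J \<Longrightarrow> u n $ j = 0" "\<And>n j. j \<notin> J \<Longrightarrow> u' n $ j = 0"
    and lim: "x \<longlonglongrightarrow> xbar" "y \<longlonglongrightarrow> ybar" "y' \<longlonglongrightarrow> ybar" "u \<longlonglongrightarrow> ubar" "u' \<longlonglongrightarrow> ubar"
    and ne: "\<And>n. y n \<noteq> y' n"
  shows False
proof -
  have "(y n - y' n, u n - u' n) \<noteq> 0" for n using ne[of n] by (simp add: zero_prod_def)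
  then obtain r dyu where r: "strict_mono r" "norm dyu = 1"
    "(\<lambda>n. (y (r n) - y' (r n), u (r n) - u' (r n)) /\<^sub>R norm (y (r n) - y' (r n), u (r n) - u' (r n))) \<longlonglongrightarrow> dyu"
    by (rule unit_direction)
  define R where "R n = norm (y (r n) - y' (r n), u (r n) - u' (r n))" for n
  have R: "R n > 0" for n unfolding R_def zero_less_norm_iff using ne[of "r n"] by (simp add: zero_prod_def)
  obtain dy du where dyu: "dyu = (dy, du)" by (cases dyu)
  have dy: "(\<lambda>n. (y (r n) - y' (r n)) /\<^sub>R R n) \<longlonglongrightarrow> dy" and du: "(\<lambda>n. (u (r n) - u' (r n)) /\<^sub>R R n) \<longlonglongrightarrow> du"
    using tendsto_fst[OF r(3)] tendsto_snd[OF r(3)] by (simp_all add: R_def[abs_def] dyu)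
  note lim' = lim[THEN LIMSEQ_subseq_LIMSEQ, OF r(1), unfolded comp_def]
  have ubar_off: "\<forall>j. j \<notin> J \<longrightarrow> ubar $ j = 0" using u by (simp add: crit_multiplier_def z_def J_def)
  have duj: "(\<lambda>n. (u (r n) $ j - u' (r n) $ j) / R n) \<longlonglongrightarrow> du $ j" for j
    using tendsto_vec_nth[OF du, of j] by (simp add: divide_inverse_commute)
  have du_off: "du $ j = 0" if "j \<notin> J" for j
    using duj[of j] off that by (simp add: LIMSEQ_const_iff)
  have "hess_yy (lag 1 ubar) (xbar, ybar) *v dy + (0 *\<^sub>R grad_y f (xbar, ybar) + (\<Sum>j\<in>J. du $ j *\<^sub>R cgrad_y g j (xbar, ybar))) = 0"
    using mem unfolding mpcc_set_def
    by (intro stat_quotient[where ?u0.0 = "\<lambda>_. 1" and u0' = "\<lambda>_. 1", OF lim'(1-3) tendsto_const lim'(4) ubar_off dy _ du]) auto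
  then have eq: "hess_yy (lagrangian f g ubar) z *v dy + (\<Sum>j\<in>J. du $ j *\<^sub>R cgrad_y g j z) = 0"
    by (simp add: lagrangian_eq z_def)
  have gq: "(\<lambda>n. (g (x (r n), y (r n)) $ j - g (x (r n), y' (r n)) $ j) / R n) \<longlonglongrightarrow> cgrad_y g j z \<bullet> dy" for j
    unfolding z_def by (rule g_quotient[OF lim'(1-3) dy])
  have T: "cgrad_y g j z \<bullet> dy = 0" if "j \<in> J - K" for j
  proof -
    have "g (x (r n), y (r n)) $ j = 0" "g (x (r n), y' (r n)) $ j = 0" for n
      using mem[of "r n"] that unfolding mpcc_set_def by auto
    then show ?thesis using gq[of j] by (simp add: LIMSEQ_const_iff)
  qed
  \<comment> \<open>Monotonicity of the complementarity relation: \<open>(a - b) (g - h)\<close>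
    reduces to \<open>- a h - b g\<close>, where both summands are nonnegative, and the sign
    survives the limit.\<close>
  have prod: "0 \<le> du $ k * (cgrad_y g k z \<bullet> dy)" if k: "k \<in> K" for k
  proof (rule tendsto_lowerbound[OF tendsto_mult[OF duj gq]])
    have "0 \<le> (u (r n) $ k - u' (r n) $ k) / R n * ((g (x (r n), y (r n)) $ k - g (x (r n), y' (r n)) $ k) / R n)" for n
    proof -
      let ?a = "u (r n) $ k" and ?b = "u' (r n) $ k" and ?g = "g (x (r n), y (r n)) $ k" and ?h = "g (x (r n), y' (r n)) $ k"
      have "?g \<le> 0" "0 \<le> ?a" "?a * ?g = 0" "?h \<le> 0" "0 \<le> ?b" "?b * ?h = 0"
        using mem[of "r n"] k unfolding mpcc_set_def by auto
      then have "0 \<le> - (?a * ?h) - ?b * ?g"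
        using mult_nonneg_nonpos[of ?a ?h] mult_nonneg_nonpos[of ?b ?g] by linarith
      also have "\<dots> = (?a - ?b) * (?g - ?h)"
        using \<open>?a * ?g = 0\<close> \<open>?b * ?h = 0\<close> by (simp only: left_diff_distrib right_diff_distrib)
      finally have "0 \<le> ((?a - ?b) * (?g - ?h)) / (R n * R n)" using R[of n] by simp
      then show ?thesis by simp
    qed
    then show "\<forall>\<^sub>F n in sequentially. 0 \<le> (u (r n) $ k - u' (r n) $ k) / R n
        * ((g (x (r n), y (r n)) $ k - g (x (r n), y' (r n)) $ k) / R n)" by (intro always_eventually allI)
  qed simp
  have "dy \<bullet> (hess_yy (lagrangian f g ubar) z *v dy) + dy \<bullet> (\<Sum>j\<in>J. du $ j *\<^sub>R cgrad_y g j z) = 0"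
    unfolding inner_add_right[symmetric] eq by simp
  moreover have "dy \<bullet> (\<Sum>j\<in>J. du $ j *\<^sub>R cgrad_y g j z) = (\<Sum>j\<in>J. du $ j * (cgrad_y g j z \<bullet> dy))"
    by (simp add: inner_sum_right inner_commute)
  moreover have "0 \<le> (\<Sum>j\<in>J. du $ j * (cgrad_y g j z \<bullet> dy))"
  proof (rule sum_nonneg)
    fix j assume "j \<in> J"
    then show "0 \<le> du $ j * (cgrad_y g j z \<bullet> dy)" using T prod by (cases "j \<in> K") auto
  qed
  ultimately have "dy \<bullet> (hess_yy (lagrangian f g ubar) z *v dy) \<le> 0" by linarith
  moreover have "dy \<in> tangent_y g (J - K) z" using T by (simp add: tangent_y_def)
  ultimately have dy0: "dy = 0" using pd by blast
  then have "(\<Sum>j\<in>J. du $ j *\<^sub>R cgrad_y g j z) = 0" using eq by simp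
  then have "du $ j = 0" if "j \<in> J" for j
    using indep_LICQ[OF L, of "\<lambda>j. du $ j"] that by (simp add: J_def z_def)
  with du_off have "du = 0" by (auto simp: vec_eq_iff)
  with dy0 r(2) show False by (simp add: dyu)
qed

end

section \<open>Existence and convergence of lower level solutions\<close>

locale bilevel_lower_level = lower_level f g
  for f :: "real \<times> (real^'m) \<Rightarrow> real" and g :: "real \<times> (real^'m) \<Rightarrow> real^'p" +
  assumes compact_levels:
    "\<And>xhat c. compact {(x, y). \<bar>x - xhat\<bar> \<le> 1 \<and> f (x, y) \<le> c \<and> (\<forall>j. g (x, y) $ j \<le> 0)}"
begin

text \<open>The level set through \<open>v\<close>, cut at the given \<open>x\<close>, is compact
  and nonempty; points above that level cannot compete.\<close>

lemma sol_set_exists: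
  assumes v: "v \<in> feasible g x"
  obtains y where "y \<in> sol_set f g x" "f (x, y) \<le> f (x, v)"
proof -
  define K where "K = {(x', y). \<bar>x' - x\<bar> \<le> 1 \<and> f (x', y) \<le> f (x, v) \<and> (\<forall>j. g (x', y) $ j \<le> 0)} \<inter> ({x} \<times> UNIV)"
  have "compact K" unfolding K_def
    by (intro compact_Int_closed compact_levels closed_Times) auto
  moreover have "(x, v) \<in> K" using v by (simp add: K_def feasible_def)
  ultimately obtain p where p: "p \<in> K" "\<And>q. q \<in> K \<Longrightarrow> f p \<le> f q"
    using continuous_attains_inf[of K f] continuous_on_f by blast
  obtain y where y: "p = (x, y)" using p(1) by (auto simp: K_def)
  have yv: "y \<in> feasible g x" "f (x, y) \<le> f (x, v)" using p(1) by (auto simp: K_def y feasible_def)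
  have "f (x, y) \<le> f (x, w)" if w: "w \<in> feasible g x" for w
  proof (cases "f (x, w) \<le> f (x, v)")
    case True
    then show ?thesis using p(2)[of "(x, w)"] w by (simp add: K_def y feasible_def)
  qed (use yv in linarith)
  then show ?thesis using that[of y] yv by (simp add: sol_set_def)
qed

text \<open>The feasible sequence \<open>v n\<close> bounds the optimal values from above and so
  confines the minimizers to one compact level set. Passing to the limit in
  \<open>f (x n, y n) \<le> f (x n, v n)\<close> shows that every limit is optimal.\<close>

lemma sol_set_limit:
  assumes x: "x \<longlonglongrightarrow> xbar" and v: "v \<longlonglongrightarrow> v0" "\<And>n. v n \<in> feasible g (x n)" and v0: "v0 \<in> sol_set f g xbar"
    and y: "\<And>n. y n \<in> sol_set f g (x n)"
  obtains r l where "strict_mono r" "(\<lambda>n. y (r n)) \<longlonglongrightarrow> l" "l \<in> sol_set f g xbar"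
proof -
  have fv: "(\<lambda>n. f (x n, v n)) \<longlonglongrightarrow> f (xbar, v0)" by (intro tendsto_f tendsto_Pair x v)
  have "\<forall>\<^sub>F n in sequentially. f (x n, v n) < f (xbar, v0) + 1"
    by (rule order_tendstoD(2)[OF fv]) simp
  moreover have "\<forall>\<^sub>F n in sequentially. dist (x n) xbar < 1" by (rule tendstoD[OF x]) simp
  ultimately have "\<forall>\<^sub>F n in sequentially. f (x n, v n) < f (xbar, v0) + 1 \<and> dist (x n) xbar < 1"
    by (rule eventually_conj)
  then obtain N where N: "\<And>n. n \<ge> N \<Longrightarrow> f (x n, v n) < f (xbar, v0) + 1 \<and> dist (x n) xbar < 1"
    unfolding eventually_sequentially by blast
  let ?K = "{(x, y). \<bar>x - xbar\<bar> \<le> 1 \<and> f (x, y) \<le> f (xbar, v0) + 1 \<and> (\<forall>j. g (x, y) $ j \<le> 0)}"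
  have feas: "y n \<in> feasible g (x n)" and le: "f (x n, y n) \<le> f (x n, v n)" for n
    using y[of n] v(2)[of n] by (auto simp: sol_set_def)
  have "(x (n + N), y (n + N)) \<in> ?K" for n
    using N[of "n + N"] feas[of "n + N"] le[of "n + N"] by (auto simp: feasible_def dist_real_def)
  then obtain p r where p: "p \<in> ?K" and r: "strict_mono r" "(\<lambda>n. (x (r n + N), y (r n + N))) \<longlonglongrightarrow> p"
    using compact_imp_seq_compact[OF compact_levels[of xbar "f (xbar, v0) + 1"], unfolded seq_compact_def,
        rule_format, of "\<lambda>n. (x (n + N), y (n + N))"] by (auto simp: comp_def)
  define r' where "r' n = r n + N" for n
  have r': "strict_mono r'" using r(1) by (simp add: strict_mono_def r'_def)
  have xr: "(\<lambda>n. x (r' n)) \<longlonglongrightarrow> xbar" using LIMSEQ_subseq_LIMSEQ[OF x r'] by (simp add: comp_def)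
  obtain x1 l where pl: "p = (x1, l)" by (cases p)
  have "(\<lambda>n. x (r' n)) \<longlonglongrightarrow> x1" and yl: "(\<lambda>n. y (r' n)) \<longlonglongrightarrow> l"
    using tendsto_fst[OF r(2)] tendsto_snd[OF r(2)] by (simp_all add: pl r'_def)
  then have x1: "x1 = xbar" using xr LIMSEQ_unique by blast
  have lf: "l \<in> feasible g xbar" using p by (auto simp: pl x1 feasible_def)
  have "(\<lambda>n. f (x (r' n), y (r' n))) \<longlonglongrightarrow> f (xbar, l)" by (intro tendsto_f tendsto_Pair xr yl)
  moreover have "(\<lambda>n. f (x (r' n), v (r' n))) \<longlonglongrightarrow> f (xbar, v0)"
    using LIMSEQ_subseq_LIMSEQ[OF fv r'] by (simp add: comp_def)
  ultimately have "f (xbar, l) \<le> f (xbar, v0)"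
    by (rule LIMSEQ_le) (use le in blast)
  then have "l \<in> sol_set f g xbar" using v0 lf by (fastforce simp: sol_set_def)
  then show ?thesis using that[OF r' yl] by blast
qed

text \<open>A feasible point guarantees a solution at the same \<open>x\<close>, uniqueness of
  \<open>ybar\<close> makes these solutions converge to it along a subsequence, and a further
  subsequence makes their multipliers converge. The given points \<open>y n\<close> are later
  compared with this competing sequence.\<close>

lemma competing_solutions:
  assumes S: "sol_set f g xbar = {ybar}" and x: "x \<longlonglongrightarrow> xbar" and y: "y \<longlonglongrightarrow> ybar"
    and feas: "\<And>n. y n \<in> feasible g (x n)"
  obtains r ys u0 u l0 l where "strict_mono r" "\<And>n. ys n \<in> sol_set f g (x (r n))" "ys \<longlonglongrightarrow> ybar"
    "\<And>n. (u0 n, u n) \<in> M_FJ f g (x (r n), ys n)" "u0 \<longlonglongrightarrow> l0" "u \<longlonglongrightarrow> l" "(l0, l) \<in> M_FJ f g (xbar, ybar)"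
proof -
  have "\<exists>ys. ys \<in> sol_set f g (x n)" for n using sol_set_exists[OF feas[of n]] by blast
  then obtain ys where ys: "\<And>n. ys n \<in> sol_set f g (x n)" by metis
  have "ybar \<in> sol_set f g xbar" using S by simp
  from sol_set_limit[OF x y feas this ys] obtain r l
    where r: "strict_mono r" "(\<lambda>n. ys (r n)) \<longlonglongrightarrow> l" "l \<in> sol_set f g xbar" by blast
  have xr: "(\<lambda>n. x (r n)) \<longlonglongrightarrow> xbar" using LIMSEQ_subseq_LIMSEQ[OF x r(1)] by (simp add: comp_def)
  have l: "l = ybar" using r(3) S by simp
  have p: "(\<lambda>n. (x (r n), ys (r n))) \<longlonglongrightarrow> (xbar, ybar)" using r(2) xr l by (intro tendsto_Pair) auto
  have "M_FJ f g (x n, ys n) \<noteq> {}" for n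
    by (rule M_FJ_nonempty[OF sol_set_imp_local_min[OF ys]])
  then have "\<exists>m. m \<in> M_FJ f g (x n, ys n)" for n by blast
  then obtain m where m: "\<And>n. m n \<in> M_FJ f g (x n, ys n)" by metis
  from M_FJ_limit[OF p, of "\<lambda>n. m (r n)"] m obtain r' m0
    where r': "strict_mono r'" "((\<lambda>n. m (r n)) \<circ> r') \<longlonglongrightarrow> m0" "m0 \<in> M_FJ f g (xbar, ybar)" by blast
  show ?thesis
  proof (rule that[of "r \<circ> r'" "\<lambda>n. ys (r (r' n))" "\<lambda>n. fst (m (r (r' n)))" "\<lambda>n. snd (m (r (r' n)))" "fst m0" "snd m0"])
    show "strict_mono (r \<circ> r')" using r(1) r'(1) by (simp add: strict_mono_o)
    show "(\<lambda>n. ys (r (r' n))) \<longlonglongrightarrow> ybar"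
      using LIMSEQ_subseq_LIMSEQ[OF r(2) r'(1)] by (simp add: comp_def l)
    show "(\<lambda>n. fst (m (r (r' n)))) \<longlonglongrightarrow> fst m0" "(\<lambda>n. snd (m (r (r' n)))) \<longlonglongrightarrow> snd m0"
      using tendsto_fst[OF r'(2)] tendsto_snd[OF r'(2)] by (simp_all add: comp_def)
  qed (use ys m r'(3) in \<open>simp_all\<close>)
qed

end

section \<open>Types 1 and 2\<close>

lemma eventually_sequentially_shift:
  assumes "\<forall>\<^sub>F n in sequentially. P n"
  shows "\<exists>N. \<forall>n. P (n + N)"
proof -
  obtain N where "\<And>n. n \<ge> N \<Longrightarrow> P n" using assms unfolding eventually_sequentially by blast
  then show ?thesis by (intro exI[of _ N]) simp
qed

context lower_level
begin

lemma star_system_iff: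
  "star_system F h g z w \<xi> \<longleftrightarrow>
     0 = grad_x F z - hess_xy h z \<bullet> w + (\<Sum>j\<in>active g z. \<xi> $ j * cgrad_x g j z) \<and>
     0 = grad_y F z - hess_yy h z *v w + (\<Sum>j\<in>active g z. \<xi> $ j *\<^sub>R cgrad_y g j z) \<and>
     (\<forall>i. i \<notin> active g z \<longrightarrow> \<xi> $ i = 0)"
proof -
  have "grad_x (\<lambda>z'. \<xi> \<bullet> g z') z = (\<Sum>j\<in>active g z. \<xi> $ j * cgrad_x g j z)"
    "grad_y (\<lambda>z'. \<xi> \<bullet> g z') z = (\<Sum>j\<in>active g z. \<xi> $ j *\<^sub>R cgrad_y g j z)"
    if "\<forall>i. i \<notin> active g z \<longrightarrow> \<xi> $ i = 0"
    unfolding inner_eq grad_x_lag grad_y_lag sum_active[OF that]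
    using sum_active[OF that, of "\<lambda>j. cgrad_x g j z"] by simp_all
  then show ?thesis unfolding star_system_def by auto
qed

text \<open>The constraint map of the single level problems: the stationarity equation, the active constraints
  (together with the multipliers of the inactive ones, to make the system square), and one more linear
  coordinate. The identities obtained for its multipliers are those for a gradient, resp. for 0, in
  \<open>x\<close>, \<open>y\<close>, \<open>u\<^sub>j\<close> (\<open>j\<close> active) and \<open>u\<^sub>j\<close> (\<open>j\<close> inactive).\<close>

lemma kkt_map:
  fixes xbar :: real and ybar :: "real^'m" and lx :: real and lu ubar :: "real^'p"
  defines "z \<equiv> (xbar, ybar)" and "J \<equiv> active g (xbar, ybar)"
  defines "\<Phi> \<equiv> (\<lambda>q::real \<times> (real^'m) \<times> (real^'p).
      ((\<lambda>(x, y, u0, u). u0 *\<^sub>R grad_y f (x, y) + (\<Sum>j\<in>J. u $ j *\<^sub>R cgrad_y g j (x, y))) (fst q, fst (snd q), 1, snd (snd q)),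
       (\<chi> j. if j \<in> J then g (fst q, fst (snd q)) $ j else snd (snd q) $ j),
       lx * fst q + lu \<bullet> snd (snd q)))"
    and "A \<equiv> (\<lambda>q::real \<times> (real^'m) \<times> (real^'p).
      ((fst q *\<^sub>R hess_xy (lagrangian f g ubar) z + hess_yy (lagrangian f g ubar) z *v fst (snd q))
         + (\<Sum>j\<in>J. snd (snd q) $ j *\<^sub>R cgrad_y g j z),
       (\<chi> j. if j \<in> J then cgrad_x g j z * fst q + cgrad_y g j z \<bullet> fst (snd q) else snd (snd q) $ j),
       lx * fst q + lu \<bullet> snd (snd q)))"
  assumes u: "crit_multiplier f g z ubar"
    and surjo: "\<forall>c1 c2 c3. c1 \<bullet> hess_xy (lagrangian f g ubar) z + (\<Sum>j\<in>J. c2 $ j * cgrad_x g j z) + c3 * lx = 0 \<longrightarrow>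
      hess_yy (lagrangian f g ubar) z *v c1 + (\<Sum>j\<in>J. c2 $ j *\<^sub>R cgrad_y g j z) = 0 \<longrightarrow>
      (\<forall>j\<in>J. cgrad_y g j z \<bullet> c1 + c3 * lu $ j = 0) \<longrightarrow>
      (\<forall>j. j \<notin> J \<longrightarrow> c2 $ j + c3 * lu $ j = 0) \<longrightarrow> c1 = 0 \<and> c2 = 0 \<and> c3 = 0"
  shows "continuous_on UNIV \<Phi>" "(\<Phi> has_derivative A) (at (xbar, ybar, ubar))"
    "\<And>c1 c2 c3 a v w. (c1, c2, c3) \<bullet> A (a, v, w) =
      a * (c1 \<bullet> hess_xy (lagrangian f g ubar) z + (\<Sum>j\<in>J. c2 $ j * cgrad_x g j z) + c3 * lx)
      + (hess_yy (lagrangian f g ubar) z *v c1 + (\<Sum>j\<in>J. c2 $ j *\<^sub>R cgrad_y g j z)) \<bullet> v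
      + ((\<Sum>j\<in>J. (cgrad_y g j z \<bullet> c1 + c3 * lu $ j) * w $ j) + (\<Sum>j\<in>-J. (c2 $ j + c3 * lu $ j) * w $ j))"
    "\<And>a1 a2 a3 a4. (\<And>a v (w::real^'p). a * a1 + a2 \<bullet> v + ((\<Sum>j\<in>J. a3 j * w $ j) + (\<Sum>j\<in>-J. a4 j * w $ j)) = 0)
      \<Longrightarrow> a1 = 0 \<and> (a2::real^'m) = 0 \<and> (\<forall>j\<in>J. a3 j = 0) \<and> (\<forall>j\<in>-J. a4 j = 0)"
    "\<And>c. (\<And>q. c \<bullet> A q = 0) \<Longrightarrow> c = 0"
    "\<Phi> (xbar, ybar, ubar) = (0, 0, lx * xbar + lu \<bullet> ubar)"
proof -
  have surj: "c1 = 0 \<and> c2 = 0 \<and> c3 = 0"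
    if "c1 \<bullet> hess_xy (lagrangian f g ubar) z + (\<Sum>j\<in>J. c2 $ j * cgrad_x g j z) + c3 * lx = 0"
      "hess_yy (lagrangian f g ubar) z *v c1 + (\<Sum>j\<in>J. c2 $ j *\<^sub>R cgrad_y g j z) = 0"
      "\<And>j. j \<in> J \<Longrightarrow> cgrad_y g j z \<bullet> c1 + c3 * lu $ j = 0" "\<And>j. j \<notin> J \<Longrightarrow> c2 $ j + c3 * lu $ j = 0" for c1 c2 c3
    by (rule surjo[rule_format, OF that(1,2)]) (use that(3,4) in blast)+
  let ?E = "\<lambda>q::real \<times> (real^'m) \<times> (real^'p). (fst q, fst (snd q), 1::real, snd (snd q))"
  let ?S = "\<lambda>(x, y, u0, u). u0 *\<^sub>R grad_y f (x, y) + (\<Sum>j\<in>J. u $ j *\<^sub>R cgrad_y g j (x, y))"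
  let ?H = "hess_yy (lagrangian f g ubar) z" and ?h = "hess_xy (lagrangian f g ubar) z"
  let ?S' = "\<lambda>q::real \<times> (real^'m) \<times> (real^'p). (fst q *\<^sub>R ?h + ?H *v fst (snd q)) + (\<Sum>j\<in>J. snd (snd q) $ j *\<^sub>R cgrad_y g j z)"
  let ?G = "\<lambda>q::real \<times> (real^'m) \<times> (real^'p). (\<chi> j. if j \<in> J then g (fst q, fst (snd q)) $ j else snd (snd q) $ j)"
  let ?G' = "\<lambda>q::real \<times> (real^'m) \<times> (real^'p).
    (\<chi> j. if j \<in> J then cgrad_x g j z * fst q + cgrad_y g j z \<bullet> fst (snd q) else snd (snd q) $ j)"
  let ?l = "\<lambda>q::real \<times> (real^'m) \<times> (real^'p). lx * fst q + lu \<bullet> snd (snd q)"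
  let ?p = "(xbar, ybar, ubar)"
  let ?\<Phi> = "\<lambda>q. (?S (?E q), ?G q, ?l q)"
  let ?A = "\<lambda>q. (?S' q, ?G' q, ?l q)"
  have u_off: "\<forall>j. j \<notin> J \<longrightarrow> ubar $ j = 0" using u by (simp add: crit_multiplier_def J_def z_def)
  have E: "(?E has_derivative (\<lambda>q. (fst q, fst (snd q), 0, snd (snd q)))) (at q)" for q
    by (intro has_derivative_Pair has_derivative_fst has_derivative_snd has_derivative_ident has_derivative_const)
  have "((\<lambda>q. ?S (?E q)) has_derivative ?S') (at ?p)"
    using has_derivative_compose[OF E[of ?p], unfolded fst_conv snd_conv, OF stat_has_derivative[OF u_off]]
    by (simp only: case_prod_conv scaleR_zero_left add_0_left lagrangian_eq z_def)
  moreover have "(?G has_derivative ?G') (at ?p)"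
    using constraint_map_has_derivative[of J z ubar] by (simp add: z_def cong: if_cong)
  moreover have "(?l has_derivative ?l) (at ?p)"
    by (intro has_derivative_add has_derivative_mult_right has_derivative_inner_right has_derivative_fst
        has_derivative_snd has_derivative_ident)
  ultimately have der: "(?\<Phi> has_derivative ?A) (at ?p)" by (intro has_derivative_Pair)
  have contS: "continuous_on UNIV (\<lambda>q. ?S (?E q))"
  proof -
    have "isCont (\<lambda>q. ?S (?E q)) q" for q :: "real \<times> (real^'m) \<times> (real^'p)"
      unfolding isCont_def case_prod_conv
      by (intro tendsto_intros tendsto_grad_f tendsto_grad_g)
    then show ?thesis by (simp add: continuous_at_imp_continuous_on)
  qed
  have cont: "continuous_on UNIV ?\<Phi>"
    by (intro continuous_on_Pair contS continuous_on_constraint_map continuous_intros)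
  \<comment> \<open>The adjoint of the derivative, sorted by the increments \<open>a\<close>,
    \<open>v\<close> and \<open>w\<close>; symmetry of the Hessian moves it from \<open>v\<close>
    onto \<open>c1\<close>.\<close>
  have inner: "(c1, c2, c3) \<bullet> ?A (a, v, w) = a * (c1 \<bullet> ?h + (\<Sum>j\<in>J. c2 $ j * cgrad_x g j z) + c3 * lx)
      + (?H *v c1 + (\<Sum>j\<in>J. c2 $ j *\<^sub>R cgrad_y g j z)) \<bullet> v
      + ((\<Sum>j\<in>J. (cgrad_y g j z \<bullet> c1 + c3 * lu $ j) * w $ j) + (\<Sum>j\<in>-J. (c2 $ j + c3 * lu $ j) * w $ j))"
    for c1 :: "real^'m" and c2 :: "real^'p" and c3 a :: real and v :: "real^'m" and w :: "real^'p"
  proof -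
    have H: "c1 \<bullet> (?H *v v) = (?H *v c1) \<bullet> v"
    proof -
      have "c1 \<bullet> (?H *v v) = v \<bullet> (?H *v c1)"
        unfolding lagrangian_eq by (rule hess_yy_symmetric[OF lag_C2])
      also have "\<dots> = (?H *v c1) \<bullet> v" by (rule inner_commute)
      finally show ?thesis .
    qed
    have 1: "c1 \<bullet> ?S' (a, v, w) = a * (c1 \<bullet> ?h) + (?H *v c1) \<bullet> v + (\<Sum>j\<in>J. (cgrad_y g j z \<bullet> c1) * w $ j)"
      by (simp add: inner_add_right inner_sum_right H inner_commute[of c1 "cgrad_y g _ z"] mult.commute)
    have 2: "c2 \<bullet> ?G' (a, v, w) = a * (\<Sum>j\<in>J. c2 $ j * cgrad_x g j z)
        + (\<Sum>j\<in>J. c2 $ j *\<^sub>R cgrad_y g j z) \<bullet> v + (\<Sum>j\<in>-J. c2 $ j * w $ j)"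
      unfolding inner_vec_if
      by (simp add: distrib_left sum.distrib inner_sum_left sum_distrib_left ac_simps)
    have "UNIV = J \<union> - J" by blast
    then have "lu \<bullet> w = (\<Sum>j\<in>J. lu $ j * w $ j) + (\<Sum>j\<in>-J. lu $ j * w $ j)"
      unfolding inner_vec_def inner_real_def by (metis sum.union_disjoint finite Compl_disjoint)
    then have 3: "c3 * ?l (a, v, w) = a * (c3 * lx) + (\<Sum>j\<in>J. (c3 * lu $ j) * w $ j) + (\<Sum>j\<in>-J. (c3 * lu $ j) * w $ j)"
      by (simp add: distrib_left sum_distrib_left mult.assoc)
    have "(c1, c2, c3) \<bullet> ?A (a, v, w) = c1 \<bullet> ?S' (a, v, w) + c2 \<bullet> ?G' (a, v, w) + c3 * ?l (a, v, w)"
      by simp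
    also have "\<dots> = a * (c1 \<bullet> ?h + (\<Sum>j\<in>J. c2 $ j * cgrad_x g j z) + c3 * lx)
      + (?H *v c1 + (\<Sum>j\<in>J. c2 $ j *\<^sub>R cgrad_y g j z)) \<bullet> v
      + ((\<Sum>j\<in>J. (cgrad_y g j z \<bullet> c1 + c3 * lu $ j) * w $ j) + (\<Sum>j\<in>-J. (c2 $ j + c3 * lu $ j) * w $ j))"
      unfolding 1 2 3 by (simp add: distrib_left distrib_right sum.distrib inner_add_left)
    finally show ?thesis .
  qed
  have components: "a1 = 0 \<and> a2 = 0 \<and> (\<forall>j\<in>J. a3 j = 0) \<and> (\<forall>j\<in>-J. a4 j = 0)"
    if H: "\<And>a v w. a * a1 + a2 \<bullet> v + ((\<Sum>j\<in>J. a3 j * w $ j) + (\<Sum>j\<in>-J. a4 j * w $ j)) = 0"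
    for a1 :: real and a2 :: "real^'m" and a3 a4 :: "'p \<Rightarrow> real"
  proof (intro conjI ballI)
    show "a1 = 0" using H[of 1 0 0] by simp
    have "a2 \<bullet> a2 = 0" using H[of 0 a2 0] by simp
    then show "a2 = 0" by simp
    have ax: "(\<Sum>i\<in>K. a i * axis j 1 $ i) = (if j \<in> K then a j else 0)" for K :: "'p set" and a :: "'p \<Rightarrow> real" and j :: 'p
    proof -
      have "(\<Sum>i\<in>K. a i * axis j 1 $ i) = (\<Sum>i\<in>K. if i = j then a i else 0)"
        by (intro sum.cong) (auto simp: axis_def)
      then show ?thesis by (simp add: sum.delta')
    qed
    show "a3 j = 0" if j: "j \<in> J" for j using H[of 0 0 "axis j 1"] j unfolding ax by simp
    show "a4 j = 0" if j: "j \<in> - J" for j using H[of 0 0 "axis j 1"] j unfolding ax by simp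
  qed
  have surj': "c = 0" if c: "\<And>q. c \<bullet> ?A q = 0" for c :: "(real^'m) \<times> (real^'p) \<times> real"
  proof -
    obtain c1 c2 c3 where cc: "c = (c1, c2, c3)" by (cases c)
    have "a * (c1 \<bullet> ?h + (\<Sum>j\<in>J. c2 $ j * cgrad_x g j z) + c3 * lx)
      + (?H *v c1 + (\<Sum>j\<in>J. c2 $ j *\<^sub>R cgrad_y g j z)) \<bullet> v
      + ((\<Sum>j\<in>J. (cgrad_y g j z \<bullet> c1 + c3 * lu $ j) * w $ j) + (\<Sum>j\<in>-J. (c2 $ j + c3 * lu $ j) * w $ j)) = 0" for a v w
      using c[of "(a, v, w)"] unfolding cc inner .
    from components[OF this] have "c1 = 0 \<and> c2 = 0 \<and> c3 = 0" by (intro surj) auto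
    then show ?thesis by (simp add: cc zero_prod_def)
  qed
  have \<Phi>p: "?\<Phi> ?p = (0, 0, ?l ?p)"
    using u u_off by (auto simp: crit_multiplier_def z_def J_def vec_eq_iff active_def)
  show "continuous_on UNIV \<Phi>" unfolding \<Phi>_def by (rule cont)
  show "(\<Phi> has_derivative A) (at ?p)" unfolding \<Phi>_def A_def by (rule der)
  show "(c1, c2, c3) \<bullet> A (a, v, w) =
      a * (c1 \<bullet> ?h + (\<Sum>j\<in>J. c2 $ j * cgrad_x g j z) + c3 * lx) + (?H *v c1 + (\<Sum>j\<in>J. c2 $ j *\<^sub>R cgrad_y g j z)) \<bullet> v
      + ((\<Sum>j\<in>J. (cgrad_y g j z \<bullet> c1 + c3 * lu $ j) * w $ j) + (\<Sum>j\<in>-J. (c2 $ j + c3 * lu $ j) * w $ j))" for c1 c2 c3 a v w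
    unfolding A_def by (rule inner)
  show "a1 = 0 \<and> a2 = 0 \<and> (\<forall>j\<in>J. a3 j = 0) \<and> (\<forall>j\<in>-J. a4 j = 0)"
    if "\<And>a v (w::real^'p). a * a1 + a2 \<bullet> v + ((\<Sum>j\<in>J. a3 j * w $ j) + (\<Sum>j\<in>-J. a4 j * w $ j)) = 0"
    for a1 and a2 :: "real^'m" and a3 a4 by (rule components[OF that])
  show "c = 0" if "\<And>q. c \<bullet> A q = 0" for c by (rule surj'[OF that[unfolded A_def]])
  show "\<Phi> (xbar, ybar, ubar) = (0, 0, lx * xbar + lu \<bullet> ubar)" unfolding \<Phi>_def using \<Phi>p by (simp only: fst_conv snd_conv)
qed

text \<open>Perturbations in \<open>C\<close> leave the stationarity equation intact:
  \<open>e2\<close> moves active constraints or inactive multipliers, \<open>e3\<close> moves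
  \<open>lx * x + lu \<bullet> u\<close>. This extra coordinate is the one degree of freedom left by
  the equations: \<open>x\<close> itself, or the multiplier of a constraint about to become
  inactive. The choice of \<open>C\<close> says which sides of it are admissible.\<close>

lemma kkt_multipliers:
  fixes xbar :: real and ybar :: "real^'m" and lx :: real and lu :: "real^'p"
    and C :: "((real^'m) \<times> (real^'p) \<times> real) set"
  defines "z \<equiv> (xbar, ybar)" and "J \<equiv> active g (xbar, ybar)"
  assumes u: "crit_multiplier f g z ubar" and F: "Ck_on 1 F UNIV"
    and surj: "\<And>c1 c2 c3. c1 \<bullet> hess_xy (lagrangian f g ubar) z + (\<Sum>j\<in>J. c2 $ j * cgrad_x g j z) + c3 * lx = 0 \<Longrightarrow>
      hess_yy (lagrangian f g ubar) z *v c1 + (\<Sum>j\<in>J. c2 $ j *\<^sub>R cgrad_y g j z) = 0 \<Longrightarrow>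
      (\<And>j. j \<in> J \<Longrightarrow> cgrad_y g j z \<bullet> c1 + c3 * lu $ j = 0) \<Longrightarrow>
      (\<And>j. j \<notin> J \<Longrightarrow> c2 $ j + c3 * lu $ j = 0) \<Longrightarrow> c1 = 0 \<and> c2 = 0 \<and> c3 = 0"
    and C: "0 \<in> C"
    and min: "\<And>e2 e3. (0, e2, e3) \<in> C \<Longrightarrow> \<forall>\<^sub>F (x, y, u) in nhds (xbar, ybar, ubar).
      (\<exists>t\<ge>0. grad_y f (x, y) + (\<Sum>j\<in>J. u $ j *\<^sub>R cgrad_y g j (x, y)) = 0 \<and> (\<forall>j\<in>J. g (x, y) $ j = t * e2 $ j) \<and>
        (\<forall>j. j \<notin> J \<longrightarrow> u $ j = t * e2 $ j) \<and> lx * (x - xbar) + lu \<bullet> (u - ubar) = t * e3) \<longrightarrow> F z \<le> F (x, y)"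
    and C0: "\<And>e. e \<in> C \<Longrightarrow> fst e = 0"
  obtains c1 c2 c3 where
    "grad_x F z = c1 \<bullet> hess_xy (lagrangian f g ubar) z + (\<Sum>j\<in>J. c2 $ j * cgrad_x g j z) + c3 * lx"
    "grad_y F z = hess_yy (lagrangian f g ubar) z *v c1 + (\<Sum>j\<in>J. c2 $ j *\<^sub>R cgrad_y g j z)"
    "\<And>j. j \<in> J \<Longrightarrow> cgrad_y g j z \<bullet> c1 + c3 * lu $ j = 0"
    "\<And>j. j \<notin> J \<Longrightarrow> c2 $ j + c3 * lu $ j = 0"
    "\<And>e2 e3. (0, e2, e3) \<in> C \<Longrightarrow> 0 \<le> c2 \<bullet> e2 + c3 * e3"
proof -
  let ?E = "\<lambda>q::real \<times> (real^'m) \<times> (real^'p). (fst q, fst (snd q), 1::real, snd (snd q))"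
  let ?S = "\<lambda>(x, y, u0, u). u0 *\<^sub>R grad_y f (x, y) + (\<Sum>j\<in>J. u $ j *\<^sub>R cgrad_y g j (x, y))"
  let ?H = "hess_yy (lagrangian f g ubar) z" and ?h = "hess_xy (lagrangian f g ubar) z"
  let ?S' = "\<lambda>q::real \<times> (real^'m) \<times> (real^'p). (fst q *\<^sub>R ?h + ?H *v fst (snd q)) + (\<Sum>j\<in>J. snd (snd q) $ j *\<^sub>R cgrad_y g j z)"
  let ?G = "\<lambda>q::real \<times> (real^'m) \<times> (real^'p). (\<chi> j. if j \<in> J then g (fst q, fst (snd q)) $ j else snd (snd q) $ j)"
  let ?G' = "\<lambda>q::real \<times> (real^'m) \<times> (real^'p).
    (\<chi> j. if j \<in> J then cgrad_x g j z * fst q + cgrad_y g j z \<bullet> fst (snd q) else snd (snd q) $ j)"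
  let ?l = "\<lambda>q::real \<times> (real^'m) \<times> (real^'p). lx * fst q + lu \<bullet> snd (snd q)"
  let ?p = "(xbar, ybar, ubar)"
  let ?\<Phi> = "\<lambda>q. (?S (?E q), ?G q, ?l q)"
  let ?A = "\<lambda>q. (?S' q, ?G' q, ?l q)"
  have surjo: "\<forall>c1 c2 c3. c1 \<bullet> hess_xy (lagrangian f g ubar) z + (\<Sum>j\<in>J. c2 $ j * cgrad_x g j z) + c3 * lx = 0 \<longrightarrow>
      hess_yy (lagrangian f g ubar) z *v c1 + (\<Sum>j\<in>J. c2 $ j *\<^sub>R cgrad_y g j z) = 0 \<longrightarrow>
      (\<forall>j\<in>J. cgrad_y g j z \<bullet> c1 + c3 * lu $ j = 0) \<longrightarrow>
      (\<forall>j. j \<notin> J \<longrightarrow> c2 $ j + c3 * lu $ j = 0) \<longrightarrow> c1 = 0 \<and> c2 = 0 \<and> c3 = 0"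
    by (intro allI impI, rule surj) blast+
  note map = kkt_map[where lx = lx and lu = lu, OF u[unfolded z_def] surjo[unfolded z_def J_def], folded z_def J_def]
  note cont = map(1) and der = map(2) and inner = map(3) and components = map(4) and surj' = map(5)
  have Fder: "((\<lambda>q::real \<times> (real^'m) \<times> (real^'p). F (fst q, fst (snd q))) has_derivative
      (\<lambda>q. grad F z \<bullet> (fst q, fst (snd q)))) (at ?p)"
  proof -
    have xy: "((\<lambda>q::real \<times> (real^'m) \<times> (real^'p). (fst q, fst (snd q))) has_derivative
        (\<lambda>q. (fst q, fst (snd q)))) (at ?p)"
      by (intro has_derivative_Pair has_derivative_fst has_derivative_snd has_derivative_ident)
    show ?thesis
      using has_derivative_compose[OF xy, unfolded fst_conv snd_conv, OF C1_has_derivative_grad[OF F]]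
      by (simp only: z_def)
  qed
  have \<Phi>p: "?\<Phi> ?p = (0, 0, ?l ?p)" unfolding fst_conv snd_conv by (rule map(6)[unfolded fst_conv snd_conv])
  have min': "\<forall>\<^sub>F q in nhds ?p. (\<exists>t\<ge>0. ?\<Phi> q = ?\<Phi> ?p + t *\<^sub>R e) \<longrightarrow>
      F (fst ?p, fst (snd ?p)) \<le> F (fst q, fst (snd q))" if e: "e \<in> C" for e
  proof -
    obtain e2 e3 where ee: "e = (0, e2, e3)" using C0[OF e] by (cases e) auto
    from min[OF e[unfolded ee]] show ?thesis
    proof eventually_elim
      case (elim q)
      obtain x y v where q: "q = (x, y, v)" by (cases q)
      show ?case
      proof
        assume "\<exists>t\<ge>0. ?\<Phi> q = ?\<Phi> ?p + t *\<^sub>R e"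
        then obtain t where t: "t \<ge> 0" "?\<Phi> q = ?\<Phi> ?p + t *\<^sub>R e" by blast
        have eq: "grad_y f (x, y) + (\<Sum>j\<in>J. v $ j *\<^sub>R cgrad_y g j (x, y)) = 0"
          "?G q = t *\<^sub>R e2" "?l q = ?l ?p + t * e3"
          using t(2)[unfolded \<Phi>p] unfolding ee q by simp_all
        have "g (x, y) $ j = t * e2 $ j" if "j \<in> J" for j
          using arg_cong[OF eq(2), of "\<lambda>v. v $ j"] that by (simp add: q)
        moreover have "v $ j = t * e2 $ j" if "j \<notin> J" for j
          using arg_cong[OF eq(2), of "\<lambda>v. v $ j"] that by (simp add: q)
        moreover have "lx * (x - xbar) + lu \<bullet> (v - ubar) = t * e3"
          using eq(3) by (simp add: q right_diff_distrib inner_diff_right)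
        ultimately show "F (fst ?p, fst (snd ?p)) \<le> F (fst q, fst (snd q))"
          using elim t(1) eq(1) by (auto simp: q z_def)
      qed
    qed
  qed
  obtain c where c: "\<And>q. grad F z \<bullet> (fst q, fst (snd q)) = c \<bullet> ?A q" "\<And>e. e \<in> C \<Longrightarrow> 0 \<le> c \<bullet> e"
    using multiplier_rule[OF cont der surj' Fder C min'] by blast
  obtain c1 c2 c3 where cc: "c = (c1, c2, c3)" by (cases c)
  have "a * (c1 \<bullet> ?h + (\<Sum>j\<in>J. c2 $ j * cgrad_x g j z) + c3 * lx - grad_x F z)
      + (?H *v c1 + (\<Sum>j\<in>J. c2 $ j *\<^sub>R cgrad_y g j z) - grad_y F z) \<bullet> v
      + ((\<Sum>j\<in>J. (cgrad_y g j z \<bullet> c1 + c3 * lu $ j) * w $ j) + (\<Sum>j\<in>-J. (c2 $ j + c3 * lu $ j) * w $ j)) = 0" for a v w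
  proof -
    have "a * (c1 \<bullet> ?h + (\<Sum>j\<in>J. c2 $ j * cgrad_x g j z) + c3 * lx) + (?H *v c1 + (\<Sum>j\<in>J. c2 $ j *\<^sub>R cgrad_y g j z)) \<bullet> v
        + ((\<Sum>j\<in>J. (cgrad_y g j z \<bullet> c1 + c3 * lu $ j) * w $ j) + (\<Sum>j\<in>-J. (c2 $ j + c3 * lu $ j) * w $ j))
        = (c1, c2, c3) \<bullet> ?A (a, v, w)" by (rule inner[symmetric])
    also have "\<dots> = grad F z \<bullet> (fst (a, v, w), fst (snd (a, v, w)))" by (rule c(1)[of "(a, v, w)", symmetric, unfolded cc])
    also have "\<dots> = a * grad_x F z + grad_y F z \<bullet> v" by (simp add: grad_def mult.commute)
    finally show ?thesis unfolding right_diff_distrib inner_diff_left by linarith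
  qed
  note comp = components[OF this]
  show ?thesis
  proof (rule that[of c1 c2 c3])
    show "0 \<le> c2 \<bullet> e2 + c3 * e3" if "(0, e2, e3) \<in> C" for e2 e3
      using c(2)[OF that] by (simp add: cc)
  qed (use comp in auto)
qed

end

context bilevel_lower_level
begin

text \<open>The competitor \<open>yt n\<close> need only be a local minimizer, so the same argument
  serves the branches of Case II. By LICQ its Fritz John multipliers tend, along a subsequence, to a
  positive multiple of \<open>ubar\<close>; after division by \<open>u0\<close> it solves the same
  complementarity system as \<open>y n\<close>, and \<open>complementarity_unique\<close>
  applies.\<close>

lemma mpcc_FJ_unique:
  fixes xbar :: real and ybar :: "real^'m"
  defines "z \<equiv> (xbar, ybar)" and "J \<equiv> active g (xbar, ybar)"
  assumes lm: "local_min_on (\<lambda>v. f (xbar, v)) (feasible g xbar) ybar" and L: "LICQ g z" and u: "crit_multiplier f g z ubar"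
    and K: "K \<subseteq> J" "K \<subseteq> {q}" "\<And>k. k \<in> K \<Longrightarrow> ubar $ k = 0" "\<And>j. j \<in> J - K \<Longrightarrow> ubar $ j \<noteq> 0"
    and ns: "nonsingular_on (hess_yy (lagrangian f g ubar) z) (tangent_y g (J - K) z)"
    and lim: "x \<longlonglongrightarrow> xbar" "y \<longlonglongrightarrow> ybar" "v \<longlonglongrightarrow> ubar" and sm: "\<And>n. (x n, y n, v n) \<in> mpcc_set f g J K"
    and yt: "yt \<longlonglongrightarrow> ybar" "\<And>n. local_min_on (\<lambda>v. f (x n, v)) (feasible g (x n)) (yt n)" and ne: "\<And>n. y n \<noteq> yt n"
  shows False
proof -
  have zf: "snd z \<in> feasible g (fst z)" using lm by (simp add: z_def local_min_on_def)
  have nonneg: "0 \<le> ubar $ j" for j by (rule M_KKT_LICQ(2)[OF lm L[unfolded z_def] u[unfolded z_def]])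
  define mm where "mm n = (SOME m. m \<in> M_FJ f g (x n, yt n))" for n
  have mm: "mm n \<in> M_FJ f g (x n, yt n)" for n
    using M_FJ_nonempty[OF yt(2)[of n]] unfolding mm_def by (simp add: some_in_eq)
  have "(\<lambda>n. (x n, yt n)) \<longlonglongrightarrow> z" unfolding z_def by (intro tendsto_Pair lim yt)
  from M_FJ_limit[OF this mm] obtain r' ll where r': "strict_mono r'" and ll: "(mm \<circ> r') \<longlonglongrightarrow> ll" "ll \<in> M_FJ f g z" .
  define l0 l u0 w ys where "l0 = fst ll" and "l = snd ll" and "u0 n = fst (mm (r' n))" and "w n = snd (mm (r' n))" and "ys n = yt (r' n)" for n
  have l: "(l0, l) \<in> M_FJ f g (xbar, ybar)" using ll(2) by (simp add: l0_def l_def z_def)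
  have m: "(u0 n, w n) \<in> M_FJ f g (x (r' n), ys n)" for n using mm[of "r' n"] by (simp add: u0_def w_def ys_def)
  have mlim: "u0 \<longlonglongrightarrow> l0" "w \<longlonglongrightarrow> l"
    using tendsto_fst[OF ll(1)] tendsto_snd[OF ll(1)] by (simp_all add: u0_def[abs_def] w_def[abs_def] l0_def l_def comp_def)
  have ys: "ys \<longlonglongrightarrow> ybar" using LIMSEQ_subseq_LIMSEQ[OF yt(1) r'] by (simp add: ys_def[abs_def] comp_def)
  note lim' = lim[THEN LIMSEQ_subseq_LIMSEQ, OF r', unfolded comp_def]
  have l0: "0 < l0" using LICQ_M_FJ_pos[OF zf L] l by (simp add: z_def)
  have "(1 / l0) *\<^sub>R l \<in> M_KKT f g z" using KKT_of_FJ[OF zf] l l0 by (simp add: z_def)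
  then have lu: "(1 / l0) *\<^sub>R l = ubar"
    using M_KKT_LICQ(1)[OF lm L[unfolded z_def] u[unfolded z_def]] by (simp add: z_def)
  have p': "(\<lambda>n. (x (r' n), ys n)) \<longlonglongrightarrow> z" unfolding z_def by (intro tendsto_Pair lim' ys)
  have ysf: "snd (x (r' n), ys n) \<in> feasible g (fst (x (r' n), ys n))" for n
    using yt(2)[of "r' n"] by (simp add: ys_def local_min_on_def)
  have "\<forall>\<^sub>F n in sequentially. 0 < u0 n" using order_tendstoD(1)[OF mlim(1) l0] .
  with FJ_near[OF zf p' ysf m mlim(2)]
  have "\<forall>\<^sub>F n in sequentially. 0 < u0 n \<and> (\<forall>j. j \<notin> active g z \<longrightarrow> w n $ j = 0) \<and> (\<forall>j. 0 < l $ j \<longrightarrow> g (x (r' n), ys n) $ j = 0) \<and>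
    u0 n *\<^sub>R grad_y f (x (r' n), ys n) + (\<Sum>j\<in>active g z. w n $ j *\<^sub>R cgrad_y g j (x (r' n), ys n)) = 0"
    by eventually_elim blast
  from eventually_sequentially_shift[OF this] obtain N' where N': "\<And>n. 0 < u0 (n + N') \<and> (\<forall>j. j \<notin> J \<longrightarrow> w (n + N') $ j = 0) \<and>
    (\<forall>j. 0 < l $ j \<longrightarrow> g (x (r' (n + N')), ys (n + N')) $ j = 0) \<and>
    u0 (n + N') *\<^sub>R grad_y f (x (r' (n + N')), ys (n + N')) + (\<Sum>j\<in>J. w (n + N') $ j *\<^sub>R cgrad_y g j (x (r' (n + N')), ys (n + N'))) = 0"
    unfolding J_def z_def by blast
  define k where "k n = n + N'" for n
  have k: "strict_mono k" by (simp add: strict_mono_def k_def)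
  define w' where "w' n = (1 / u0 n) *\<^sub>R w n" for n
  \<comment> \<open>\<open>mpcc_set\<close> leaves the components outside \<open>J\<close> free.
    They are cut off because the linearised system determines only the increments of the multipliers
    in \<open>J\<close>.\<close>
  define v' where "v' n = (\<chi> j. if j \<in> J then v n $ j else 0)" for n
  have w': "w' \<longlonglongrightarrow> ubar"
    unfolding w'_def lu[symmetric] using l0 by (intro tendsto_intros mlim) simp
  have u_off: "\<forall>j. j \<notin> J \<longrightarrow> ubar $ j = 0" using u by (simp add: crit_multiplier_def J_def z_def)
  have v': "v' \<longlonglongrightarrow> ubar"
  proof (rule vec_tendstoI)
    fix j show "(\<lambda>n. v' n $ j) \<longlonglongrightarrow> ubar $ j"
      using tendsto_vec_nth[OF lim(3), of j] u_off by (cases "j \<in> J") (simp_all add: v'_def)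
  qed
  show False
  proof (rule complementarity_unique[OF L[unfolded z_def] u[unfolded z_def] K(1)[unfolded J_def]])
    show "d = 0" if "d \<in> tangent_y g (active g (xbar, ybar) - K) (xbar, ybar)"
      "d \<bullet> (hess_yy (lagrangian f g ubar) (xbar, ybar) *v d) \<le> 0" for d
      by (rule positive_definite_on_tangent[OF lm L[unfolded z_def] u[unfolded z_def] K(2,3) ns[unfolded z_def J_def] that])
    show "(x (r' (k n)), y (r' (k n)), v' (r' (k n))) \<in> mpcc_set f g (active g (xbar, ybar)) K" for n
      using sm[of "r' (k n)"] K(1) unfolding J_def[symmetric] by (auto simp: mpcc_set_def v'_def cong: sum.cong)
    show "(x (r' (k n)), ys (k n), w' (k n)) \<in> mpcc_set f g (active g (xbar, ybar)) K" for n
      unfolding J_def[symmetric] mpcc_set_def mem_Collect_eq case_prod_conv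
    proof (intro conjI ballI)
      note * = N'[of n, folded k_def]
      have "grad_y f (x (r' (k n)), ys (k n)) + (\<Sum>j\<in>J. w' (k n) $ j *\<^sub>R cgrad_y g j (x (r' (k n)), ys (k n)))
        = (1 / u0 (k n)) *\<^sub>R (u0 (k n) *\<^sub>R grad_y f (x (r' (k n)), ys (k n)) + (\<Sum>j\<in>J. w (k n) $ j *\<^sub>R cgrad_y g j (x (r' (k n)), ys (k n))))"
        using *[THEN conjunct1] by (simp add: scaleR_add_right scaleR_sum_right w'_def)
      then show "grad_y f (x (r' (k n)), ys (k n)) + (\<Sum>j\<in>J. w' (k n) $ j *\<^sub>R cgrad_y g j (x (r' (k n)), ys (k n))) = 0"
        using * by simp
      show "g (x (r' (k n)), ys (k n)) $ j = 0" if "j \<in> J - K" for j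
      proof -
        have "0 < ubar $ j" using K(4)[OF that] nonneg[of j] by simp
        then have "0 < l $ j" using l0 unfolding lu[symmetric] by (simp add: zero_less_divide_iff)
        then show ?thesis using * by blast
      qed
      fix i assume "i \<in> K"
      show "g (x (r' (k n)), ys (k n)) $ i \<le> 0" using ysf[of "k n"] by (simp add: feasible_def)
      note M = m[of "k n"]
      have wn: "\<forall>j. 0 \<le> w (k n) $ j" "w (k n) \<bullet> g (x (r' (k n)), ys (k n)) = 0"
        using M by (simp_all add: M_FJ_def)
      show "0 \<le> w' (k n) $ i" using wn(1) * by (simp add: w'_def)
      show "w' (k n) $ i * g (x (r' (k n)), ys (k n)) $ i = 0"
        using complementarity[OF ysf wn, of i] by (simp add: w'_def)
    qed
    show "v' (r' (k n)) $ j = 0" if "j \<notin> active g (xbar, ybar)" for n j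
      using that by (simp add: v'_def J_def)
    show "w' (k n) $ j = 0" if "j \<notin> active g (xbar, ybar)" for n j
      using that N'[of n, folded k_def] by (simp add: w'_def J_def)
    show "(\<lambda>n. x (r' (k n))) \<longlonglongrightarrow> xbar" "(\<lambda>n. y (r' (k n))) \<longlonglongrightarrow> ybar"
      using lim'(1,2)[THEN LIMSEQ_subseq_LIMSEQ, OF k] by (simp_all add: comp_def)
    show "(\<lambda>n. v' (r' (k n))) \<longlonglongrightarrow> ubar"
      using LIMSEQ_subseq_LIMSEQ[OF LIMSEQ_subseq_LIMSEQ[OF v' r'] k] by (simp add: comp_def)
    show "(\<lambda>n. ys (k n)) \<longlonglongrightarrow> ybar" "(\<lambda>n. w' (k n)) \<longlonglongrightarrow> ubar"
      using ys[THEN LIMSEQ_subseq_LIMSEQ, OF k] w'[THEN LIMSEQ_subseq_LIMSEQ, OF k] by (simp_all add: comp_def)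
    show "y (r' (k n)) \<noteq> ys (k n)" for n
      using ne[of "r' (k n)"] by (simp add: ys_def)
  qed
qed

text \<open>Constraints outside \<open>J\<close> stay inactive, so a point of the MPCC near the
  reference point is feasible for the lower level problem. A solution at the same \<open>x\<close>
  then exists close to \<open>ybar\<close>, and uniqueness makes the two \<open>y\<close> components
  equal.\<close>

lemma mpcc_near_solution:
  fixes xbar :: real and ybar :: "real^'m"
  defines "z \<equiv> (xbar, ybar)" and "J \<equiv> active g (xbar, ybar)"
  assumes S: "sol_set f g xbar = {ybar}" and L: "LICQ g z" and u: "crit_multiplier f g z ubar"
    and K: "K \<subseteq> J" "K \<subseteq> {q}" "\<And>k. k \<in> K \<Longrightarrow> ubar $ k = 0" "\<And>j. j \<in> J - K \<Longrightarrow> ubar $ j \<noteq> 0"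
    and ns: "nonsingular_on (hess_yy (lagrangian f g ubar) z) (tangent_y g (J - K) z)"
  shows "\<forall>\<^sub>F p in nhds (xbar, ybar, ubar). p \<in> mpcc_set f g J K \<longrightarrow> (fst p, fst (snd p)) \<in> sol_graph f g"
proof (rule seq_in_eventually_nhds)
  fix s assume mem: "\<And>n. s n \<in> mpcc_set f g J K" and s: "s \<longlonglongrightarrow> (xbar, ybar, ubar)"
    and no: "\<And>n. (fst (s n), fst (snd (s n))) \<notin> sol_graph f g"
  have ysol: "ybar \<in> sol_set f g xbar" using S by simp
  note lm = sol_set_imp_local_min[OF ysol]
  have zf: "snd z \<in> feasible g (fst z)" using ysol by (simp add: z_def sol_set_def)
  define x y v where "x n = fst (s n)" and "y n = fst (snd (s n))" and "v n = snd (snd (s n))" for n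
  have lim: "x \<longlonglongrightarrow> xbar" "y \<longlonglongrightarrow> ybar" "v \<longlonglongrightarrow> ubar"
    using tendsto_fst[OF s] tendsto_fst[OF tendsto_snd[OF s]] tendsto_snd[OF tendsto_snd[OF s]]
    by (simp_all add: x_def[abs_def] y_def[abs_def] v_def[abs_def])
  have sm: "(x n, y n, v n) \<in> mpcc_set f g J K" for n using mem[of n] by (simp add: x_def y_def v_def)
  have "(\<lambda>n. (x n, y n)) \<longlonglongrightarrow> z" unfolding z_def by (intro tendsto_Pair lim)
  from eventually_sequentially_shift[OF inactive_eventually[OF zf this]] obtain N
    where "\<forall>n j. j \<notin> active g z \<longrightarrow> g (x (n + N), y (n + N)) $ j < 0" by blast
  then have N: "\<And>n j. j \<notin> J \<Longrightarrow> g (x (n + N), y (n + N)) $ j < 0"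
    by (simp add: J_def z_def)
  have feas: "y (n + N) \<in> feasible g (x (n + N))" for n
    unfolding feasible_def
  proof (intro CollectI allI)
    fix j show "g (x (n + N), y (n + N)) $ j \<le> 0"
      using N[of j n] sm[of "n + N"] K(1) unfolding mpcc_set_def by (cases "j \<in> J"; cases "j \<in> K") auto
  qed
  obtain r ys u0 w l0 l where r: "strict_mono r" and ys: "\<And>n. ys n \<in> sol_set f g (x (r n + N))" "ys \<longlonglongrightarrow> ybar"
    and m: "\<And>n. (u0 n, w n) \<in> M_FJ f g (x (r n + N), ys n)" "u0 \<longlonglongrightarrow> l0" "w \<longlonglongrightarrow> l"
    and l: "(l0, l) \<in> M_FJ f g (xbar, ybar)"
    using competing_solutions[OF S LIMSEQ_ignore_initial_segment[OF lim(1), of N] LIMSEQ_ignore_initial_segment[OF lim(2), of N] feas]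
    by blast
  define r' where "r' n = r n + N" for n
  have r': "strict_mono r'" using r by (simp add: strict_mono_def r'_def)
  note lim' = lim[THEN LIMSEQ_subseq_LIMSEQ, OF r', unfolded comp_def]
  have ys': "ys n \<in> sol_set f g (x (r' n))" for n using ys(1) by (simp add: r'_def)
  show False
  proof (rule mpcc_FJ_unique[OF lm L[unfolded z_def] u[unfolded z_def] K[unfolded J_def] ns[unfolded z_def J_def] lim' sm[unfolded J_def] ys(2)])
    show "local_min_on (\<lambda>v. f (x (r' n), v)) (feasible g (x (r' n))) (ys n)" for n
      by (rule sol_set_imp_local_min[OF ys'])
    show "y (r' n) \<noteq> ys n" for n
      using no[of "r' n"] ys'[of n] by (auto simp: sol_graph_def x_def y_def)
  qed
qed

end

context bilevel_lower_level
begin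

lemma type1_data:
  assumes y: "local_min_on (\<lambda>v. f (x, v)) (feasible g x) y" and t: "type1 f g (x, y)"
  obtains u where "M_KKT f g (x, y) = {u}" "crit_multiplier f g (x, y) u" "LICQ g (x, y)"
    "\<And>j. j \<in> active g (x, y) \<Longrightarrow> 0 < u $ j" "\<And>j. j \<notin> active g (x, y) \<Longrightarrow> u $ j = 0"
    "nonsingular_on (hess_yy (lagrangian f g u) (x, y)) (tangent_y g (active g (x, y)) (x, y))"
    "\<And>d. d \<in> tangent_y g (active g (x, y)) (x, y) \<Longrightarrow> d \<bullet> (hess_yy (lagrangian f g u) (x, y) *v d) \<le> 0 \<Longrightarrow> d = 0"
proof -
  obtain u where L: "LICQ g (x, y)" and u: "crit_multiplier f g (x, y) u" "\<forall>j\<in>active g (x, y). u $ j \<noteq> 0"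
    and ns: "nonsingular_on (hess_yy (lagrangian f g u) (x, y)) (tangent_y g (active g (x, y)) (x, y))"
    using t unfolding type1_def by blast
  note K = M_KKT_LICQ[OF y L u(1)]
  show ?thesis
  proof (rule that[OF K(1) u(1) L])
    show "0 < u $ j" if "j \<in> active g (x, y)" for j using K(2)[of j] u(2) that by (simp add: less_le)
    show "u $ j = 0" if "j \<notin> active g (x, y)" for j using u(1) that by (simp add: crit_multiplier_def)
    show "d = 0" if "d \<in> tangent_y g (active g (x, y)) (x, y)" "d \<bullet> (hess_yy (lagrangian f g u) (x, y) *v d) \<le> 0" for d
      using positive_definite_on_tangent[OF y L u(1), of "{}"] ns that by simp
  qed (rule ns)
qed

text \<open>Testing the second equation with \<open>c1\<close>, which is tangent by the third,
  leaves the quadratic form; definiteness gives \<open>c1 = 0\<close>, LICQ gives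
  \<open>c2 = 0\<close>, and the \<open>x\<close>-equation is then \<open>c3 = 0\<close>.\<close>

lemma kkt_surjective:
  assumes L: "LICQ g z"
    and pd: "\<And>d. d \<in> tangent_y g (active g z) z \<Longrightarrow> d \<bullet> (hess_yy (lagrangian f g u) z *v d) \<le> 0 \<Longrightarrow> d = 0"
    and 1: "c1 \<bullet> hess_xy (lagrangian f g u) z + (\<Sum>j\<in>active g z. c2 $ j * cgrad_x g j z) + c3 * 1 = 0"
    and 2: "hess_yy (lagrangian f g u) z *v c1 + (\<Sum>j\<in>active g z. c2 $ j *\<^sub>R cgrad_y g j z) = 0"
    and 3: "\<And>j. j \<in> active g z \<Longrightarrow> cgrad_y g j z \<bullet> c1 = 0" and 4: "\<And>j. j \<notin> active g z \<Longrightarrow> c2 $ j = 0"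
  shows "c1 = 0 \<and> c2 = 0 \<and> c3 = 0"
proof -
  have "c1 \<bullet> (hess_yy (lagrangian f g u) z *v c1) + c1 \<bullet> (\<Sum>j\<in>active g z. c2 $ j *\<^sub>R cgrad_y g j z) = 0"
    unfolding inner_add_right[symmetric] 2 by simp
  moreover have "c1 \<bullet> (\<Sum>j\<in>active g z. c2 $ j *\<^sub>R cgrad_y g j z) = 0"
    unfolding inner_sum_right inner_scaleR_right inner_commute[of c1] using 3 by simp
  ultimately have "c1 \<bullet> (hess_yy (lagrangian f g u) z *v c1) \<le> 0" by simp
  moreover have "c1 \<in> tangent_y g (active g z) z" using 3 by (simp add: tangent_y_def)
  ultimately have c1: "c1 = 0" using pd by blast
  then have "(\<Sum>j\<in>active g z. c2 $ j *\<^sub>R cgrad_y g j z) = 0" using 2 by simp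
  from indep_LICQ[OF L this] 4 have c2: "c2 = 0" by (auto simp: vec_eq_iff)
  show ?thesis using 1 c1 c2 by simp
qed

lemma type1_case:
  fixes xbar :: real and ybar :: "real^'m"
  assumes F: "Ck_on 1 F UNIV" and min: "local_min_on F (sol_graph f g) (xbar, ybar)"
    and S: "sol_set f g xbar = {ybar}" and t: "type1 f g (xbar, ybar)"
  shows "\<exists>ubar. M_KKT f g (xbar, ybar) = {ubar} \<and>
          local_min_on (\<lambda>(x, y, u). F (x, y))
            {(x, y, u). grad_y f (x, y) + (\<Sum>j\<in>active g (xbar, ybar). u $ j *\<^sub>R cgrad_y g j (x, y)) = 0 \<and>
                        (\<forall>j\<in>active g (xbar, ybar). g (x, y) $ j = 0)}
            (xbar, ybar, ubar) \<and>
          (\<exists>w \<xi>. star_system F (lagrangian f g ubar) g (xbar, ybar) w \<xi> \<and>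
                 (\<forall>j\<in>active g (xbar, ybar). cgrad_y g j (xbar, ybar) \<bullet> w = 0))"
proof -
  let ?J = "active g (xbar, ybar)" and ?z = "(xbar, ybar)"
  have lm: "local_min_on (\<lambda>v. f (xbar, v)) (feasible g xbar) ybar"
    using S by (intro sol_set_imp_local_min) simp
  obtain u where KKT: "M_KKT f g ?z = {u}" and u: "crit_multiplier f g ?z u" and L: "LICQ g ?z"
    and pos: "\<And>j. j \<in> ?J \<Longrightarrow> 0 < u $ j" and ns: "nonsingular_on (hess_yy (lagrangian f g u) ?z) (tangent_y g ?J ?z)"
    and pd: "\<And>d. d \<in> tangent_y g ?J ?z \<Longrightarrow> d \<bullet> (hess_yy (lagrangian f g u) ?z *v d) \<le> 0 \<Longrightarrow> d = 0"
    by (rule type1_data[OF lm t]) blast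
  define A where "A = mpcc_set f g ?J {}"
  have ev: "\<forall>\<^sub>F p in nhds (xbar, ybar, u). p \<in> A \<longrightarrow> (fst p, fst (snd p)) \<in> sol_graph f g"
    unfolding A_def by (rule mpcc_near_solution[OF S L u]) (use pos ns in fastforce)+
  have A: "A = {(x, y, u). grad_y f (x, y) + (\<Sum>j\<in>?J. u $ j *\<^sub>R cgrad_y g j (x, y)) = 0 \<and> (\<forall>j\<in>?J. g (x, y) $ j = 0)}"
    by (simp add: A_def mpcc_set_def)
  have uA: "(xbar, ybar, u) \<in> A"
    using u by (simp add: A crit_multiplier_def) (simp add: active_def)
  have cont: "isCont (\<lambda>p::real \<times> (real^'m) \<times> (real^'p). (fst p, fst (snd p))) q" for q
    by (intro continuous_intros)
  have evF: "\<forall>\<^sub>F p in nhds (xbar, ybar, u). p \<in> A \<longrightarrow> F ?z \<le> F (fst p, fst (snd p))"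
    and lmA: "local_min_on (\<lambda>p. F (fst p, fst (snd p))) A (xbar, ybar, u)"
    using local_min_transfer[of F "sol_graph f g" "\<lambda>p::real \<times> (real^'m) \<times> (real^'p). (fst p, fst (snd p))" "(xbar, ybar, u)" A,
        unfolded fst_conv snd_conv, OF min uA cont ev] by blast+
  obtain c1 c2 c3 where c: "grad_x F ?z = c1 \<bullet> hess_xy (lagrangian f g u) ?z + (\<Sum>j\<in>?J. c2 $ j * cgrad_x g j ?z) + c3 * 1"
    "grad_y F ?z = hess_yy (lagrangian f g u) ?z *v c1 + (\<Sum>j\<in>?J. c2 $ j *\<^sub>R cgrad_y g j ?z)"
    "\<And>j. j \<in> ?J \<Longrightarrow> cgrad_y g j ?z \<bullet> c1 + c3 * (0::real^'p) $ j = 0"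
    "\<And>j. j \<notin> ?J \<Longrightarrow> c2 $ j + c3 * (0::real^'p) $ j = 0"
    "\<And>e2 e3. (0, e2, e3) \<in> {0, (0, 0, 1), (0, 0, -1)} \<Longrightarrow> 0 \<le> c2 \<bullet> e2 + c3 * e3"
  \<comment> \<open>The free coordinate is \<open>x\<close>. Both of its directions are admissible,
    so its multiplier \<open>c3\<close> has to vanish.\<close>
  proof (rule kkt_multipliers[OF u F, where C = "{0, (0, 0, 1), (0, 0, -1)}" and lx = 1 and lu = 0])
    show "\<forall>\<^sub>F (x, y, u) in nhds (xbar, ybar, u).
      (\<exists>t\<ge>0. grad_y f (x, y) + (\<Sum>j\<in>?J. u $ j *\<^sub>R cgrad_y g j (x, y)) = 0 \<and> (\<forall>j\<in>?J. g (x, y) $ j = t * e2 $ j) \<and>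
        (\<forall>j. j \<notin> ?J \<longrightarrow> u $ j = t * e2 $ j) \<and> 1 * (x - xbar) + 0 \<bullet> (u - u') = t * e3) \<longrightarrow> F ?z \<le> F (x, y)"
      if e: "(0, e2, e3) \<in> {0, (0, 0, 1), (0, 0, -1)}" for e2 :: "real^'p" and e3 and u'
    proof -
      have "e2 = 0" using e by (auto simp: zero_prod_def)
      then show ?thesis
        using evF by (auto elim!: eventually_mono simp: A)
    qed
    show "c1 = 0 \<and> c2 = 0 \<and> c3 = 0"
      if "c1 \<bullet> hess_xy (lagrangian f g u) ?z + (\<Sum>j\<in>?J. c2 $ j * cgrad_x g j ?z) + c3 * 1 = 0"
        "hess_yy (lagrangian f g u) ?z *v c1 + (\<Sum>j\<in>?J. c2 $ j *\<^sub>R cgrad_y g j ?z) = 0"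
        "\<And>j. j \<in> ?J \<Longrightarrow> cgrad_y g j ?z \<bullet> c1 + c3 * (0::real^'p) $ j = 0"
        "\<And>j. j \<notin> ?J \<Longrightarrow> c2 $ j + c3 * (0::real^'p) $ j = 0" for c1 c2 c3
      using that by (intro kkt_surjective[OF L pd]) simp_all
  qed (auto simp: zero_prod_def)
  have c3: "c3 = 0" using c(5)[of 0 1] c(5)[of 0 "-1"] by simp
  \<comment> \<open>The multiplier rule expresses the gradient of \<open>F\<close> by the constraint
    derivatives, whereas \<open>star_system\<close> has \<open>\<xi>\<close> on the same side as
    \<open>F\<close>; hence the sign of \<open>c2\<close>.\<close>
  have "star_system F (lagrangian f g u) g ?z c1 (- c2)"
    unfolding star_system_iff using c(1,2,4) c3 by (simp add: inner_commute sum_negf)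
  moreover have "\<forall>j\<in>?J. cgrad_y g j ?z \<bullet> c1 = 0" using c(3) by simp
  moreover have "local_min_on (\<lambda>(x, y, u). F (x, y)) A (xbar, ybar, u)"
    using lmA unfolding case_prod_beta .
  ultimately show ?thesis using KKT unfolding A by blast
qed

text \<open>Differentiating the identities that hold along the path gives the linearised system for
  \<open>y'\<close> and \<open>u'\<close>; the chain rule expresses \<open>D\<close> through
  \<open>y'\<close>.\<close>

lemma reduced_path_derivative:
  assumes p: "reduced_path f g J z ubar y u" and D: "((\<lambda>x. g (x, y x) $ q) has_real_derivative D) (at (fst z))"
  obtains y' u' where "hess_xy (lagrangian f g ubar) z + hess_yy (lagrangian f g ubar) z *v y'
      + (\<Sum>j\<in>J. u' $ j *\<^sub>R cgrad_y g j z) = 0"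
    "\<And>j. j \<in> J \<Longrightarrow> cgrad_x g j z + cgrad_y g j z \<bullet> y' = 0" "D = cgrad_x g q z + cgrad_y g q z \<bullet> y'"
proof -
  obtain U where yz: "y (fst z) = snd z" "u (fst z) = ubar" and U: "open U" "fst z \<in> U" "Ck_on 2 y U" "Ck_on 2 u U"
    and eq: "\<And>x. x \<in> U \<Longrightarrow> grad_y f (x, y x) + (\<Sum>j\<in>J. u x $ j *\<^sub>R cgrad_y g j (x, y x)) = 0"
      "\<And>x j. x \<in> U \<Longrightarrow> j \<in> J \<Longrightarrow> g (x, y x) $ j = 0" "\<And>x j. x \<in> U \<Longrightarrow> j \<notin> J \<Longrightarrow> u x $ j = 0"
    using p unfolding reduced_path_def by blast
  have "y differentiable (at (fst z))" "u differentiable (at (fst z))"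
    using U(2-4) unfolding numeral_2_eq_2 Ck_on.simps by blast+
  then obtain y' u' where "(y has_vector_derivative y') (at (fst z))" "(u has_vector_derivative u') (at (fst z))"
    unfolding vector_derivative_works by blast
  then have y': "(y has_derivative (\<lambda>t. t *\<^sub>R y')) (at (fst z))" and u': "(u has_derivative (\<lambda>t. t *\<^sub>R u')) (at (fst z))"
    by (simp_all add: has_vector_derivative_def)
  have off: "\<forall>j. j \<notin> J \<longrightarrow> ubar $ j = 0" using eq(3)[OF U(2)] yz by simp
  have z: "z = (fst z, y (fst z))" by (simp add: yz)
  have zz: "(fst z, y (fst z)) = z" by (simp add: yz)
  let ?E = "\<lambda>x. (x, y x, 1::real, u x)"
  let ?S = "\<lambda>(x, y, u0, u). u0 *\<^sub>R grad_y f (x, y) + (\<Sum>j\<in>J. u $ j *\<^sub>R cgrad_y g j (x, y))"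
  have E: "(?E has_derivative (\<lambda>t. (t, t *\<^sub>R y', 0, t *\<^sub>R u'))) (at (fst z))"
    by (intro has_derivative_Pair has_derivative_ident has_derivative_const y' u')
  have "((\<lambda>x. ?S (?E x)) has_derivative (\<lambda>t. (t *\<^sub>R hess_xy (lagrangian f g ubar) z
      + hess_yy (lagrangian f g ubar) z *v (t *\<^sub>R y')) + (0 *\<^sub>R grad_y f z + (\<Sum>j\<in>J. (t *\<^sub>R u') $ j *\<^sub>R cgrad_y g j z)))) (at (fst z))"
    using has_derivative_compose[OF E, unfolded yz, OF stat_has_derivative[OF off]]
    by (simp only: case_prod_conv lagrangian_eq prod.collapse)
  moreover have "((\<lambda>x. ?S (?E x)) has_derivative (\<lambda>t. 0)) (at (fst z))"
    by (rule has_derivative_transform_within_open[OF has_derivative_const[of 0] U(1,2)]) (simp add: eq(1))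
  ultimately have "(\<lambda>t. (t *\<^sub>R hess_xy (lagrangian f g ubar) z
      + hess_yy (lagrangian f g ubar) z *v (t *\<^sub>R y')) + (0 *\<^sub>R grad_y f z + (\<Sum>j\<in>J. (t *\<^sub>R u') $ j *\<^sub>R cgrad_y g j z))) = (\<lambda>t. 0)"
    by (rule has_derivative_unique)
  from fun_cong[OF this, of 1]
  have 1: "hess_xy (lagrangian f g ubar) z + hess_yy (lagrangian f g ubar) z *v y' + (\<Sum>j\<in>J. u' $ j *\<^sub>R cgrad_y g j z) = 0"
    by simp
  have G: "((\<lambda>x. g (x, y x) $ j) has_real_derivative cgrad_x g j z + cgrad_y g j z \<bullet> y') (at (fst z))" for j
  proof -
    have "((\<lambda>x. (x, y x)) has_derivative (\<lambda>t. (t, t *\<^sub>R y'))) (at (fst z))"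
      by (intro has_derivative_Pair has_derivative_ident y')
    from has_derivative_compose[OF this, unfolded zz, OF C1_has_derivative_grad[OF g_C1, of j]]
    have "((\<lambda>x. g (x, y x) $ j) has_derivative (\<lambda>t. (cgrad_x g j z + cgrad_y g j z \<bullet> y') * t)) (at (fst z))"
      by (simp add: grad_def cgrad_x_def cgrad_y_def algebra_simps)
    then show ?thesis by (simp add: has_field_derivative_def)
  qed
  have 2: "cgrad_x g j z + cgrad_y g j z \<bullet> y' = 0" if "j \<in> J" for j
  proof -
    have "((\<lambda>x. g (x, y x) $ j) has_real_derivative 0) (at (fst z))"
      by (rule has_field_derivative_transform_within_open[OF DERIV_const U(1,2)]) (simp add: eq(2) that)
    then show ?thesis using G DERIV_unique by blast
  qed
  show ?thesis using that[OF 1 2] DERIV_unique[OF D G] by blast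
qed

lemma type2_case:
  fixes xbar :: real and ybar :: "real^'m"
  assumes F: "Ck_on 1 F UNIV" and min: "local_min_on F (sol_graph f g) (xbar, ybar)"
    and S: "sol_set f g xbar = {ybar}" and t: "type2 f g (xbar, ybar)"
  shows "\<exists>ubar. M_KKT f g (xbar, ybar) = {ubar} \<and>
          (\<exists>q. (q \<in> active g (xbar, ybar) \<and> ubar $ q = 0 \<and>
                (\<forall>j\<in>active g (xbar, ybar) - {q}. ubar $ j > 0)) \<and>
               (\<forall>q'. q' \<in> active g (xbar, ybar) \<and> ubar $ q' = 0 \<and>
                     (\<forall>j\<in>active g (xbar, ybar) - {q'}. ubar $ j > 0) \<longrightarrow> q' = q) \<and>
               local_min_on (\<lambda>(x, y, u). F (x, y)) (mpcc_set f g (active g (xbar, ybar)) {q})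
                 (xbar, ybar, ubar) \<and>
               (\<exists>w \<xi>. star_system F (lagrangian f g ubar) g (xbar, ybar) w \<xi> \<and>
                      (\<forall>j\<in>active g (xbar, ybar) - {q}. cgrad_y g j (xbar, ybar) \<bullet> w = 0) \<and>
                      cgrad_y g q (xbar, ybar) \<bullet> w \<le> 0 \<and> 0 \<le> \<xi> $ q))"
proof -
  let ?J = "active g (xbar, ybar)" and ?z = "(xbar, ybar)"
  have lm: "local_min_on (\<lambda>v. f (xbar, v)) (feasible g xbar) ybar"
    using S by (intro sol_set_imp_local_min) simp
  obtain u q yp up D where L: "LICQ g ?z" and u: "crit_multiplier f g ?z u" and q: "q \<in> ?J" "u $ q = 0"
    and nz: "\<forall>j\<in>?J - {q}. u $ j \<noteq> 0"
    and ns: "nonsingular_on (hess_yy (lagrangian f g u) ?z) (tangent_y g (?J - {q}) ?z)"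
    and path: "reduced_path f g (?J - {q}) ?z u yp up"
      "((\<lambda>x. g (x, yp x) $ q) has_real_derivative D) (at (fst ?z))" and D: "D \<noteq> 0"
    using t unfolding type2_def by blast
  let ?H = "hess_yy (lagrangian f g u) ?z"
  note KKT = M_KKT_LICQ[OF lm L u]
  have pos: "0 < u $ j" if "j \<in> ?J - {q}" for j using KKT(2)[of j] nz that by (simp add: less_le)
  have pd: "d = 0" if "d \<in> tangent_y g (?J - {q}) ?z" "d \<bullet> (?H *v d) \<le> 0" for d
    by (rule positive_definite_on_tangent[OF lm L u _ _ ns that]) (use q in auto)
  have sym: "a \<bullet> (?H *v b) = b \<bullet> (?H *v a)" for a b
    unfolding lagrangian_eq by (rule hess_yy_symmetric[OF lag_C2])
  define A where "A = mpcc_set f g ?J {q}"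
  have ev: "\<forall>\<^sub>F p in nhds (xbar, ybar, u). p \<in> A \<longrightarrow> (fst p, fst (snd p)) \<in> sol_graph f g"
    unfolding A_def by (rule mpcc_near_solution[OF S L u _ _ _ _ ns]) (use q nz in auto)
  have uA: "(xbar, ybar, u) \<in> A"
    using u q KKT(2) unfolding A_def mpcc_set_def crit_multiplier_def by (auto simp: active_def)
  have cont: "isCont (\<lambda>p::real \<times> (real^'m) \<times> (real^'p). (fst p, fst (snd p))) q" for q
    by (intro continuous_intros)
  have evF: "\<forall>\<^sub>F p in nhds (xbar, ybar, u). p \<in> A \<longrightarrow> F ?z \<le> F (fst p, fst (snd p))"
    and lmA: "local_min_on (\<lambda>p. F (fst p, fst (snd p))) A (xbar, ybar, u)"
    using local_min_transfer[of F "sol_graph f g" "\<lambda>p::real \<times> (real^'m) \<times> (real^'p). (fst p, fst (snd p))" "(xbar, ybar, u)" A,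
        unfolded fst_conv snd_conv, OF min uA cont ev] by blast+
  obtain y' u' where y': "hess_xy (lagrangian f g u) ?z + ?H *v y' + (\<Sum>j\<in>?J - {q}. u' $ j *\<^sub>R cgrad_y g j ?z) = 0"
    "\<And>j. j \<in> ?J - {q} \<Longrightarrow> cgrad_x g j ?z + cgrad_y g j ?z \<bullet> y' = 0" "D = cgrad_x g q ?z + cgrad_y g q ?z \<bullet> y'"
    using reduced_path_derivative[OF path] by blast
  \<comment> \<open>Pairing the linearised path with \<open>c1\<close>, and the second equation with
    \<open>y'\<close>, produces the same Hessian term twice. Eliminating it with the help of the
    first equation leaves \<open>c2 $ q * D = 0\<close>, so transversality of the path to the
    dropped constraint gives \<open>c2 $ q = 0\<close>.\<close>
  have surj: "c1 = 0 \<and> c2 = 0 \<and> c3 = 0"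
    if 1: "c1 \<bullet> hess_xy (lagrangian f g u) ?z + (\<Sum>j\<in>?J. c2 $ j * cgrad_x g j ?z) + c3 * 0 = 0"
      and 2: "?H *v c1 + (\<Sum>j\<in>?J. c2 $ j *\<^sub>R cgrad_y g j ?z) = 0"
      and 3: "\<And>j. j \<in> ?J \<Longrightarrow> cgrad_y g j ?z \<bullet> c1 + c3 * axis q 1 $ j = 0"
      and 4: "\<And>j. j \<notin> ?J \<Longrightarrow> c2 $ j + c3 * axis q 1 $ j = 0"
    for c1 :: "real^'m" and c2 :: "real^'p" and c3 :: real
  proof -
    have T: "cgrad_y g j ?z \<bullet> c1 = 0" if "j \<in> ?J - {q}" for j
      using 3[of j] that by (simp add: axis_def)
    have "c1 \<bullet> (hess_xy (lagrangian f g u) ?z + ?H *v y' + (\<Sum>j\<in>?J - {q}. u' $ j *\<^sub>R cgrad_y g j ?z)) = 0"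
      unfolding y' by simp
    then have a: "c1 \<bullet> hess_xy (lagrangian f g u) ?z + c1 \<bullet> (?H *v y') = 0"
      using T by (simp add: inner_add_right inner_sum_right inner_commute[of c1 "cgrad_y g _ _"])
    have "y' \<bullet> (?H *v c1 + (\<Sum>j\<in>?J. c2 $ j *\<^sub>R cgrad_y g j ?z)) = 0" unfolding 2 by simp
    then have b: "c1 \<bullet> (?H *v y') + (\<Sum>j\<in>?J. c2 $ j * (cgrad_y g j ?z \<bullet> y')) = 0"
      by (simp add: inner_add_right inner_sum_right inner_commute[of y' "cgrad_y g _ _"] sym[of y'])
    have "(\<Sum>j\<in>?J. c2 $ j * (cgrad_x g j ?z + cgrad_y g j ?z \<bullet> y')) = 0"
      using a b 1 by (simp add: distrib_left sum.distrib)
    moreover have "(\<Sum>j\<in>?J. c2 $ j * (cgrad_x g j ?z + cgrad_y g j ?z \<bullet> y')) = c2 $ q * D"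
      using q(1) y'(2,3) by (simp add: sum.remove[of ?J q])
    ultimately have c2q: "c2 $ q = 0" using D by simp
    have "c1 \<bullet> (?H *v c1 + (\<Sum>j\<in>?J. c2 $ j *\<^sub>R cgrad_y g j ?z)) = 0" unfolding 2 by simp
    moreover have "c2 $ j * (c1 \<bullet> cgrad_y g j ?z) = 0" if "j \<in> ?J" for j
      using T[of j] c2q that by (cases "j = q") (auto simp: inner_commute)
    then have "c1 \<bullet> (\<Sum>j\<in>?J. c2 $ j *\<^sub>R cgrad_y g j ?z) = 0"
      unfolding inner_sum_right inner_scaleR_right by (intro sum.neutral ballI)
    ultimately have "c1 \<bullet> (?H *v c1) \<le> 0" by (simp add: inner_add_right)
    moreover have "c1 \<in> tangent_y g (?J - {q}) ?z" using T by (simp add: tangent_y_def)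
    ultimately have c1: "c1 = 0" using pd by blast
    then have "c3 = 0" using 3[OF q(1)] by simp
    moreover have "(\<Sum>j\<in>?J. c2 $ j *\<^sub>R cgrad_y g j ?z) = 0" using 2 c1 by simp
    from indep_LICQ[OF L this] 4 \<open>c3 = 0\<close> have "c2 = 0" by (auto simp: vec_eq_iff)
    ultimately show ?thesis using c1 by simp
  qed
  \<comment> \<open>The generators are the two branches of complementarity: \<open>u\<^sub>q\<close>
    grows while \<open>g\<^sub>q = 0\<close>, or \<open>g\<^sub>q\<close> decreases while
    \<open>u\<^sub>q = 0\<close>. The first yields \<open>c3 \<ge> 0\<close>, hence the sign of
    \<open>cgrad_y g q ?z \<bullet> c1\<close>; the second yields
    \<open>\<xi>\<^sub>q \<ge> 0\<close>.\<close>
  let ?C = "{0, (0, 0, 1), (0, - axis q 1, 0)} :: ((real^'m) \<times> (real^'p) \<times> real) set"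
  obtain c1 c2 c3 where c: "grad_x F ?z = c1 \<bullet> hess_xy (lagrangian f g u) ?z + (\<Sum>j\<in>?J. c2 $ j * cgrad_x g j ?z) + c3 * 0"
    "grad_y F ?z = ?H *v c1 + (\<Sum>j\<in>?J. c2 $ j *\<^sub>R cgrad_y g j ?z)"
    "\<And>j. j \<in> ?J \<Longrightarrow> cgrad_y g j ?z \<bullet> c1 + c3 * axis q 1 $ j = 0"
    "\<And>j. j \<notin> ?J \<Longrightarrow> c2 $ j + c3 * axis q 1 $ j = 0"
    "\<And>e2 e3. (0, e2, e3) \<in> ?C \<Longrightarrow> 0 \<le> c2 \<bullet> e2 + c3 * e3"
  proof (rule kkt_multipliers[OF u F surj, where C = ?C])
    fix e2 :: "real^'p" and e3 :: real
    assume e: "(0, e2, e3) \<in> ?C"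
    show "\<forall>\<^sub>F (x, y, v) in nhds (xbar, ybar, u).
      (\<exists>t\<ge>0. grad_y f (x, y) + (\<Sum>j\<in>?J. v $ j *\<^sub>R cgrad_y g j (x, y)) = 0 \<and> (\<forall>j\<in>?J. g (x, y) $ j = t * e2 $ j) \<and>
        (\<forall>j. j \<notin> ?J \<longrightarrow> v $ j = t * e2 $ j) \<and> 0 * (x - xbar) + axis q 1 \<bullet> (v - u) = t * e3) \<longrightarrow> F ?z \<le> F (x, y)"
      using evF
    proof eventually_elim
      case (elim p)
      obtain x y v where p: "p = (x, y, v)" by (cases p)
      have "p \<in> A" if t: "t \<ge> 0" "grad_y f (x, y) + (\<Sum>j\<in>?J. v $ j *\<^sub>R cgrad_y g j (x, y)) = 0"
        "\<forall>j\<in>?J. g (x, y) $ j = t * e2 $ j" "axis q 1 \<bullet> (v - u) = t * e3" for t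
      proof -
        have vq: "v $ q = t * e3" using t(4) q(2) by (simp add: inner_axis')
        consider "e2 = 0" "e3 \<ge> 0" | "e2 = - axis q 1" "e3 = 0" using e by (auto simp: zero_prod_def)
        then show ?thesis
        proof cases
          case 1
          then show ?thesis using t vq q(1) by (simp add: p A_def mpcc_set_def)
        next
          case 2
          then show ?thesis using t vq q(1) by (simp add: p A_def mpcc_set_def axis_def)
        qed
      qed
      then show ?case using elim unfolding p by auto
    qed
  qed (auto simp: zero_prod_def)
  have c2off: "c2 $ j = 0" if "j \<notin> ?J" for j using c(4)[OF that] q(1) that by (auto simp: axis_def split: if_splits)
  have "star_system F (lagrangian f g u) g ?z c1 (- c2)"
    unfolding star_system_iff using c(1,2) c2off by (simp add: inner_commute sum_negf)
  moreover have "\<forall>j\<in>?J - {q}. cgrad_y g j ?z \<bullet> c1 = 0"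
  proof
    fix j assume "j \<in> ?J - {q}" then show "cgrad_y g j ?z \<bullet> c1 = 0" using c(3)[of j] by (simp add: axis_def)
  qed
  moreover have "cgrad_y g q ?z \<bullet> c1 \<le> 0" using c(3)[OF q(1)] c(5)[of 0 1] by simp
  moreover have "0 \<le> (- c2) $ q" using c(5)[of "- axis q 1" 0] by (simp add: inner_axis)
  moreover have "local_min_on (\<lambda>(x, y, u). F (x, y)) A (xbar, ybar, u)"
    using lmA unfolding case_prod_beta .
  moreover have "\<forall>q'. q' \<in> ?J \<and> u $ q' = 0 \<and> (\<forall>j\<in>?J - {q'}. u $ j > 0) \<longrightarrow> q' = q"
  proof (intro allI impI, rule ccontr)
    fix q' assume "q' \<in> ?J \<and> u $ q' = 0 \<and> (\<forall>j\<in>?J - {q'}. u $ j > 0)" "q' \<noteq> q"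
    then show False using pos[of q'] by simp
  qed
  ultimately show ?thesis using KKT(1) q pos unfolding A_def by blast
qed

end

section \<open>Type 4\<close>

context bilevel_lower_level
begin

text \<open>That the quadratic form of the inverse does not vanish at the projected gradient of
  \<open>f\<close> is used twice. It keeps this gradient from being orthogonal to the tangent space,
  so no Fritz John multiplier has \<open>u0 \<noteq> 0\<close>; and it makes the linearised system
  with an increment \<open>s\<close> of \<open>u0\<close> nondegenerate. The rank condition leaves
  one relation up to scaling, whose sign and size are fixed by minimality and normalisation.\<close>

lemma type4_data:
  fixes xbar :: real and ybar :: "real^'m"
  defines "z \<equiv> (xbar, ybar)" and "J \<equiv> active g (xbar, ybar)"
  assumes y: "local_min_on (\<lambda>v. f (xbar, v)) (feasible g xbar) ybar" and t: "type4 f g z"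
  obtains u where "M_FJ f g z = {(0, u)}" "\<And>j. j \<in> J \<Longrightarrow> 0 < u $ j" "\<And>j. j \<notin> J \<Longrightarrow> u $ j = 0"
    "(\<Sum>j\<in>J. u $ j) = 1" "(\<Sum>j\<in>J. u $ j *\<^sub>R cgrad_y g j z) = 0" "(\<Sum>j\<in>J. u $ j * cgrad_x g j z) \<noteq> 0"
    "\<And>c. (\<Sum>j\<in>J. c j *\<^sub>R cgrad_y g j z) = 0 \<Longrightarrow> \<exists>t. \<forall>j\<in>J. c j = t * u $ j"
    "\<And>d s. d \<in> tangent_y g J z \<Longrightarrow> s = 0 \<or> grad_y f z \<bullet> d = 0 \<Longrightarrow>
      (\<And>e. e \<in> tangent_y g J z \<Longrightarrow> e \<bullet> (hess_yy (lag 0 u) z *v d) = s * (e \<bullet> grad_y f z)) \<Longrightarrow> d = 0 \<and> s = 0"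
proof -
  have zf: "snd z \<in> feasible g (fst z)" using y by (simp add: local_min_on_def z_def)
  have Jz: "active g z = J" by (simp add: J_def z_def)
  note T = t[unfolded type4_def Jz]
  note rank = T[THEN conjunct2, THEN conjunct2, THEN conjunct1]
  obtain lam :: "real^'p" where L: "(\<Sum>j\<in>J. lam $ j *\<^sub>R cgrad_y g j z) = 0 \<and> (\<forall>j\<in>J. lam $ j \<noteq> 0) \<and>
      (\<Sum>j\<in>J. lam $ j * cgrad_x g j z) \<noteq> 0 \<and>
      (\<exists>Bs A'. basis_of Bs (tangent_y g J z) \<and>
         inverse_matrices_on Bs (restricted_matrix (hess_yy (\<lambda>z'. \<Sum>j\<in>J. lam $ j * g z' $ j) z)) A' \<and>
         (\<Sum>b\<in>Bs. \<Sum>b'\<in>Bs. (b \<bullet> grad_y f z) * A' b b' * (b' \<bullet> grad_y f z)) \<noteq> 0)"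
    using T[THEN conjunct2, THEN conjunct2, THEN conjunct2, THEN conjunct2] by (rule exE)
  have lam: "(\<Sum>j\<in>J. lam $ j *\<^sub>R cgrad_y g j z) = 0" "\<And>j. j \<in> J \<Longrightarrow> lam $ j \<noteq> 0"
      "(\<Sum>j\<in>J. lam $ j * cgrad_x g j z) \<noteq> 0"
    using L[THEN conjunct1] L[THEN conjunct2, THEN conjunct1] L[THEN conjunct2, THEN conjunct2, THEN conjunct1]
    by blast+
  obtain Bs A' where Bs: "basis_of Bs (tangent_y g J z)"
    and inv: "inverse_matrices_on Bs (restricted_matrix (hess_yy (\<lambda>z'. \<Sum>j\<in>J. lam $ j * g z' $ j) z)) A'"
    and nd: "(\<Sum>b\<in>Bs. \<Sum>b'\<in>Bs. (b \<bullet> grad_y f z) * A' b b' * (b' \<bullet> grad_y f z)) \<noteq> 0"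
    using L by (elim conjE exE)
  have rel: "\<exists>t. \<forall>j\<in>J. c j = t * lam $ j" if c: "(\<Sum>j\<in>J. c j *\<^sub>R cgrad_y g j z) = 0" for c
  proof (rule relation_unique_of_rank[OF finite rank lam(1) _ c])
    show "lam $ j \<noteq> 0" if "j \<in> J" for j by (rule lam(2)[OF that])
    fix t assume "\<And>j. j \<in> J \<Longrightarrow> c j = t * lam $ j"
    then show ?thesis by (intro exI[of _ t] ballI)
  qed
  have Bs_sub: "b \<in> tangent_y g J z" if "b \<in> Bs" for b
    using Bs that span_base unfolding basis_of_def by blast
  have w0: "w0 = 0" if m: "(w0, w) \<in> M_FJ f g z" for w0 w
  proof (rule ccontr)
    assume w0: "w0 \<noteq> 0"
    have eq: "w0 *\<^sub>R grad_y f z + (\<Sum>j\<in>J. w $ j *\<^sub>R cgrad_y g j z) = 0"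
      using m unfolding mem_M_FJ[OF zf] by (simp add: J_def z_def)
    have "b \<bullet> grad_y f z = 0" if "b \<in> Bs" for b
    proof -
      have "b \<bullet> (w0 *\<^sub>R grad_y f z + (\<Sum>j\<in>J. w $ j *\<^sub>R cgrad_y g j z)) = 0" unfolding eq by simp
      moreover have "b \<bullet> cgrad_y g j z = 0" if "j \<in> J" for j
        using Bs_sub[OF \<open>b \<in> Bs\<close>] that by (simp add: tangent_y_def inner_commute)
      ultimately show ?thesis using w0 by (simp add: inner_add_right inner_sum_right)
    qed
    then show False using nd by simp
  qed
  obtain u0 u where m: "(u0, u) \<in> M_FJ f g z" using M_FJ_nonempty[OF y] by (auto simp: z_def)
  have u: "(\<Sum>j\<in>J. u $ j *\<^sub>R cgrad_y g j z) = 0" "\<And>j. 0 \<le> u $ j" "(\<Sum>j\<in>J. u $ j) = 1" "\<And>j. j \<notin> J \<Longrightarrow> u $ j = 0"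
    using m w0[OF m] unfolding mem_M_FJ[OF zf] by (simp_all add: J_def z_def)
  obtain t where t: "\<And>j. j \<in> J \<Longrightarrow> u $ j = t * lam $ j" using rel[OF u(1)] by blast
  have t0: "t \<noteq> 0"
  proof
    assume "t = 0"
    then have "(\<Sum>j\<in>J. u $ j) = 0" using t by simp
    then show False using u(3) by simp
  qed
  have pos: "0 < u $ j" if "j \<in> J" for j
  proof -
    have "u $ j \<noteq> 0" unfolding t[OF that] using t0 lam(2)[OF that] by simp
    then show ?thesis using u(2)[of j] by linarith
  qed
  have rel': "\<exists>t. \<forall>j\<in>J. c j = t * u $ j" if c: "(\<Sum>j\<in>J. c j *\<^sub>R cgrad_y g j z) = 0" for c
  proof -
    obtain s where "\<And>j. j \<in> J \<Longrightarrow> c j = s * lam $ j" using rel[OF c] by blast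
    then show ?thesis using t t0 by (intro exI[of _ "s / t"]) simp
  qed
  have FJ: "M_FJ f g z = {(0, u)}"
  proof -
    have "p = (0, u)" if "p \<in> M_FJ f g z" for p
    proof -
      obtain v0 v where p: "p = (v0, v)" by (cases p)
      have v0: "v0 = 0" using w0 that unfolding p by blast
      have v: "(\<Sum>j\<in>J. v $ j *\<^sub>R cgrad_y g j z) = 0" "(\<Sum>j\<in>J. v $ j) = 1" "\<And>j. j \<notin> J \<Longrightarrow> v $ j = 0"
        using that v0 unfolding p mem_M_FJ[OF zf] by (simp_all add: J_def z_def)
      obtain s where s: "\<forall>j\<in>J. v $ j = s * u $ j" using rel'[OF v(1)] by blast
      then have "(\<Sum>j\<in>J. v $ j) = s * (\<Sum>j\<in>J. u $ j)" by (simp add: sum_distrib_left)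
      then have "s = 1" using v(2) u(3) by simp
      then have "v = u" using s v(3) u(4) by (auto simp: vec_eq_iff)
      then show ?thesis by (simp add: p v0)
    qed
    moreover have "(0, u) \<in> M_FJ f g z" using m w0[OF m] by simp
    ultimately show ?thesis by blast
  qed
  have "(\<Sum>j\<in>J. u $ j * cgrad_x g j z) = t * (\<Sum>j\<in>J. lam $ j * cgrad_x g j z)"
    by (simp add: t sum_distrib_left mult.assoc)
  then have gx: "(\<Sum>j\<in>J. u $ j * cgrad_x g j z) \<noteq> 0" using t0 lam(3) by simp
  let ?Hl = "hess_yy (\<lambda>z'. \<Sum>j\<in>J. lam $ j * g z' $ j) z"
  have H: "hess_yy (lag 0 u) z *v d = t *\<^sub>R (?Hl *v d)" for d
  proof -
    have "hess_yy (\<lambda>z'. 0 * f z' + (\<Sum>j\<in>J. lam $ j * g z' $ j)) z *v d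
        = 0 *\<^sub>R (hess_yy f z *v d) + (\<Sum>j\<in>J. lam $ j *\<^sub>R (hess_yy (\<lambda>z. g z $ j) z *v d))"
      by (rule hess_yy_lincomb[OF f_C2 g_C2 finite])
    then have "?Hl *v d = (\<Sum>j\<in>J. lam $ j *\<^sub>R (hess_yy (\<lambda>z. g z $ j) z *v d))"
      by simp
    moreover have "hess_yy (lag 0 u) z *v d = (\<Sum>j\<in>J. u $ j *\<^sub>R (hess_yy (\<lambda>z. g z $ j) z *v d))"
      unfolding hess_yy_lag using u(4) by (subst sum_active[of J]) auto
    ultimately show ?thesis by (simp add: t scaleR_sum_right)
  qed
  \<comment> \<open>Solving the projected equation expresses \<open>d\<close> as
    \<open>s / t\<close> times the inverse matrix applied to the projected gradient of
    \<open>f\<close>. Its pairing with that gradient is \<open>s / t\<close> times the nonzero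
    number of the Type 4 condition; if the pairing is 0, so is \<open>s\<close>.\<close>
  have nondeg: "d = 0 \<and> s = 0" if d: "d \<in> tangent_y g J z" "s = 0 \<or> grad_y f z \<bullet> d = 0"
    and eq: "\<And>e. e \<in> tangent_y g J z \<Longrightarrow> e \<bullet> (hess_yy (lag 0 u) z *v d) = s * (e \<bullet> grad_y f z)" for d s
  proof -
    have "e \<bullet> (?Hl *v d) = (s / t) * (e \<bullet> grad_y f z)" if "e \<in> tangent_y g J z" for e
    proof -
      have "t * (e \<bullet> (?Hl *v d)) = s * (e \<bullet> grad_y f z)" using eq[OF that] by (simp only: H inner_scaleR_right)
      then have "e \<bullet> (?Hl *v d) = s * (e \<bullet> grad_y f z) / t" using t0 by (simp add: nonzero_eq_divide_eq mult.commute)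
      then show ?thesis by simp
    qed
    note sol = restricted_system_solution[OF Bs inv d(1) this]
    have "d \<bullet> grad_y f z = (\<Sum>b\<in>Bs. ((s / t) * (\<Sum>b'\<in>Bs. A' b b' * (b' \<bullet> grad_y f z))) *\<^sub>R b) \<bullet> grad_y f z"
      by (rule arg_cong[OF sol])
    also have "\<dots> = (\<Sum>b\<in>Bs. (((s / t) * (\<Sum>b'\<in>Bs. A' b b' * (b' \<bullet> grad_y f z))) *\<^sub>R b) \<bullet> grad_y f z)"
      by (rule inner_sum_left)
    also have "\<dots> = (\<Sum>b\<in>Bs. (s / t) * (\<Sum>b'\<in>Bs. A' b b' * (b' \<bullet> grad_y f z)) * (b \<bullet> grad_y f z))"
      unfolding inner_scaleR_left ..
    also have "\<dots> = (s / t) * (\<Sum>b\<in>Bs. \<Sum>b'\<in>Bs. (b \<bullet> grad_y f z) * A' b b' * (b' \<bullet> grad_y f z))"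
      unfolding sum_distrib_left sum_distrib_right by (intro sum.cong refl) (simp only: ac_simps)
    finally have "s = 0" using d(2) nd t0 by (auto simp: inner_commute)
    then have "d = 0" using sol by simp
    then show ?thesis using \<open>s = 0\<close> by simp
  qed
  show ?thesis by (rule that[OF FJ pos u(4) u(3) u(1) gx rel' nondeg])
qed

text \<open>The parameter \<open>x\<close> turns around quadratically in \<open>u0\<close> along the solution curve, so it determines the
  solution with \<open>u0 \<ge> 0\<close>. In terms of difference quotients, expanding \<open>u0 f + u\<^sup>T g\<close> to second order about
  both points shows that \<open>(u0 + u0') (f (x, y) - f (x, y')) = o(R\<^sup>2)\<close>.\<close>

lemma fritz_john_unique:
  fixes xbar :: real and ybar :: "real^'m"
  defines "z \<equiv> (xbar, ybar)" and "J \<equiv> active g (xbar, ybar)"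
  assumes sum1: "(\<Sum>j\<in>J. ubar $ j) = 1" and off0: "\<forall>j. j \<notin> J \<longrightarrow> ubar $ j = 0"
    and rel: "\<And>c. (\<Sum>j\<in>J. c j *\<^sub>R cgrad_y g j z) = 0 \<Longrightarrow> \<exists>t. \<forall>j\<in>J. c j = t * ubar $ j"
    and nondeg: "\<And>d s. d \<in> tangent_y g J z \<Longrightarrow> s = 0 \<or> grad_y f z \<bullet> d = 0 \<Longrightarrow>
      (\<And>e. e \<in> tangent_y g J z \<Longrightarrow> e \<bullet> (hess_yy (lag 0 ubar) z *v d) = s * (e \<bullet> grad_y f z)) \<Longrightarrow> d = 0 \<and> s = 0"
    and stat: "\<And>n. v n *\<^sub>R grad_y f (x n, y n) + (\<Sum>j\<in>J. u n $ j *\<^sub>R cgrad_y g j (x n, y n)) = 0"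
      "\<And>n. v' n *\<^sub>R grad_y f (x n, y' n) + (\<Sum>j\<in>J. u' n $ j *\<^sub>R cgrad_y g j (x n, y' n)) = 0"
    and g0: "\<And>n j. j \<in> J \<Longrightarrow> g (x n, y n) $ j = 0" "\<And>n j. j \<in> J \<Longrightarrow> g (x n, y' n) $ j = 0"
    and v0: "\<And>n. 0 \<le> v n" "\<And>n. 0 \<le> v' n"
    and s1: "\<And>n. v n + (\<Sum>j\<in>J. u n $ j) = 1" "\<And>n. v' n + (\<Sum>j\<in>J. u' n $ j) = 1"
    and off: "\<And>n j. j \<notin> J \<Longrightarrow> u n $ j = 0" "\<And>n j. j \<notin> J \<Longrightarrow> u' n $ j = 0"
    and lim: "x \<longlonglongrightarrow> xbar" "y \<longlonglongrightarrow> ybar" "y' \<longlonglongrightarrow> ybar" "v \<longlonglongrightarrow> 0" "v' \<longlonglongrightarrow> 0" "u \<longlonglongrightarrow> ubar" "u' \<longlonglongrightarrow> ubar"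
    and ne: "\<And>n. y n \<noteq> y' n"
  shows False
proof -
  have "(y n - y' n, v n - v' n, u n - u' n) \<noteq> 0" for n using ne[of n] by (simp add: zero_prod_def)
  then obtain r D where r: "strict_mono r" "norm D = 1"
    "(\<lambda>n. (y (r n) - y' (r n), v (r n) - v' (r n), u (r n) - u' (r n))
      /\<^sub>R norm (y (r n) - y' (r n), v (r n) - v' (r n), u (r n) - u' (r n))) \<longlonglongrightarrow> D"
    by (rule unit_direction)
  define R where "R n = norm (y (r n) - y' (r n), v (r n) - v' (r n), u (r n) - u' (r n))" for n
  have R: "R n > 0" for n unfolding R_def zero_less_norm_iff using ne[of "r n"] by (simp add: zero_prod_def)
  obtain dy d0 du where D: "D = (dy, d0, du)" by (cases D)
  have dy: "(\<lambda>n. (y (r n) - y' (r n)) /\<^sub>R R n) \<longlonglongrightarrow> dy"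
    and d0: "(\<lambda>n. (v (r n) - v' (r n)) / R n) \<longlonglongrightarrow> d0"
    and du: "(\<lambda>n. (u (r n) - u' (r n)) /\<^sub>R R n) \<longlonglongrightarrow> du"
    using tendsto_fst[OF r(3)] tendsto_fst[OF tendsto_snd[OF r(3)]] tendsto_snd[OF tendsto_snd[OF r(3)]]
    by (simp_all add: R_def[abs_def] D divide_inverse_commute)
  note lim' = lim[THEN LIMSEQ_subseq_LIMSEQ, OF r(1), unfolded comp_def]
  have duj: "(\<lambda>n. (u (r n) $ j - u' (r n) $ j) / R n) \<longlonglongrightarrow> du $ j" for j
    using tendsto_vec_nth[OF du, of j] by (simp add: divide_inverse_commute)
  have du_off: "du $ j = 0" if "j \<notin> J" for j
    using duj[of j] off that by (simp add: LIMSEQ_const_iff)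
  have eq: "hess_yy (lag 0 ubar) z *v dy + (d0 *\<^sub>R grad_y f z + (\<Sum>j\<in>J. du $ j *\<^sub>R cgrad_y g j z)) = 0"
    unfolding z_def by (rule stat_quotient[OF lim'(1-4) lim'(6) off0 dy d0 du stat])
  have T: "cgrad_y g j z \<bullet> dy = 0" if "j \<in> J" for j
    using g_quotient(1)[OF lim'(1-3) dy, of j] g0 that by (simp add: LIMSEQ_const_iff z_def)
  have fq: "(\<lambda>n. (f (x (r n), y (r n)) - f (x (r n), y' (r n))) / R n) \<longlonglongrightarrow> grad_y f z \<bullet> dy"
    unfolding z_def by (rule g_quotient(2)[OF lim'(1-3) dy])
  \<comment> \<open>The normalisation is what excludes, at the end, an increment \<open>du\<close>
    proportional to \<open>ubar\<close>.\<close>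
  have dsum: "d0 + (\<Sum>j\<in>J. du $ j) = 0"
  proof -
    have "(\<lambda>n. (v (r n) - v' (r n)) / R n + (\<Sum>j\<in>J. (u (r n) $ j - u' (r n) $ j) / R n)) \<longlonglongrightarrow> d0 + (\<Sum>j\<in>J. du $ j)"
      by (intro tendsto_add tendsto_sum d0 duj)
    moreover have "(v (r n) - v' (r n)) / R n + (\<Sum>j\<in>J. (u (r n) $ j - u' (r n) $ j) / R n) = 0" for n
    proof -
      have "(v (r n) - v' (r n)) / R n + (\<Sum>j\<in>J. (u (r n) $ j - u' (r n) $ j) / R n)
        = ((v (r n) + (\<Sum>j\<in>J. u (r n) $ j)) - (v' (r n) + (\<Sum>j\<in>J. u' (r n) $ j))) / R n"
        unfolding sum_divide_distrib[symmetric] sum_subtractf add_divide_distrib[symmetric] by (simp only: add_diff_add)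
      then show ?thesis unfolding s1 by simp
    qed
    ultimately show ?thesis by (simp add: LIMSEQ_const_iff)
  qed
  let ?df = "\<lambda>n. f (x (r n), y (r n)) - f (x (r n), y' (r n))"
  let ?q = "(dy \<bullet> (hess_yy (lag 0 ubar) z *v dy)) / 2"
  \<comment> \<open>Second order expansion of \<open>w f + k\<^sup>T g\<close> about
    \<open>b\<close>: stationarity at \<open>b\<close> removes the first order terms and the active
    constraints vanish at both points, so only \<open>w\<close> times the difference of
    \<open>f\<close> remains. The weight \<open>w\<close> of the Hessian of \<open>f\<close> tends
    to 0.\<close>
  have expand: "(\<lambda>n. w (r n) * (f (x (r n), a (r n)) - f (x (r n), b (r n))) / (R n)\<^sup>2) \<longlonglongrightarrow> ?q"
    if a: "(\<lambda>n. a (r n)) \<longlonglongrightarrow> ybar" and b: "(\<lambda>n. b (r n)) \<longlonglongrightarrow> ybar" and ab: "(\<lambda>n. (a (r n) - b (r n)) /\<^sub>R R n) \<longlonglongrightarrow> d"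
      and d: "d = dy \<or> d = - dy" and w: "(\<lambda>n. w (r n)) \<longlonglongrightarrow> 0" and k: "(\<lambda>n. k (r n)) \<longlonglongrightarrow> ubar"
      and st: "\<And>n. w n *\<^sub>R grad_y f (x n, b n) + (\<Sum>j\<in>J. k n $ j *\<^sub>R cgrad_y g j (x n, b n)) = 0"
      and ga: "\<And>n j. j \<in> J \<Longrightarrow> g (x n, a n) $ j = 0" and gb: "\<And>n j. j \<in> J \<Longrightarrow> g (x n, b n) $ j = 0"
    for a b :: "nat \<Rightarrow> real^'m" and w :: "nat \<Rightarrow> real" and k :: "nat \<Rightarrow> real^'p" and d
  proof -
    let ?T = "\<lambda>h n. (h (x (r n), a (r n)) - h (x (r n), b (r n)) - grad_y h (x (r n), b (r n)) \<bullet> (a (r n) - b (r n))) / (R n)\<^sup>2"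
    have L: "(\<lambda>n. w (r n) * ?T f n + (\<Sum>j\<in>J. k (r n) $ j * ?T (\<lambda>z. g z $ j) n)) \<longlonglongrightarrow>
        0 * ((d \<bullet> (hess_yy f z *v d)) / 2) + (\<Sum>j\<in>J. ubar $ j * ((d \<bullet> (hess_yy (\<lambda>z. g z $ j) z *v d)) / 2))"
      unfolding z_def
      by (intro tendsto_add tendsto_sum tendsto_mult w tendsto_vec_nth[OF k]
          second_order_quotient_tendsto[OF f_C2 lim'(1) a b ab] second_order_quotient_tendsto[OF g_C2 lim'(1) a b ab])
    have E: "w (r n) * ?T f n + (\<Sum>j\<in>J. k (r n) $ j * ?T (\<lambda>z. g z $ j) n)
        = w (r n) * (f (x (r n), a (r n)) - f (x (r n), b (r n))) / (R n)\<^sup>2" for n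
    proof -
      let ?\<Delta> = "a (r n) - b (r n)"
      have "(w (r n) *\<^sub>R grad_y f (x (r n), b (r n)) + (\<Sum>j\<in>J. k (r n) $ j *\<^sub>R cgrad_y g j (x (r n), b (r n)))) \<bullet> ?\<Delta> = 0"
        unfolding st by simp
      then have s: "(\<Sum>j\<in>J. k (r n) $ j * (cgrad_y g j (x (r n), b (r n)) \<bullet> ?\<Delta>)) = - (w (r n) * (grad_y f (x (r n), b (r n)) \<bullet> ?\<Delta>))"
        by (simp add: inner_add_left inner_sum_left eq_neg_iff_add_eq_0 add.commute)
      have "(\<Sum>j\<in>J. k (r n) $ j * ?T (\<lambda>z. g z $ j) n)
          = (\<Sum>j\<in>J. - (k (r n) $ j * (cgrad_y g j (x (r n), b (r n)) \<bullet> ?\<Delta>) / (R n)\<^sup>2))"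
        by (intro sum.cong refl) (simp add: ga gb cgrad_y_def)
      also have "\<dots> = - ((\<Sum>j\<in>J. k (r n) $ j * (cgrad_y g j (x (r n), b (r n)) \<bullet> ?\<Delta>)) / (R n)\<^sup>2)"
        by (simp add: sum_negf sum_divide_distrib)
      also have "\<dots> = w (r n) * (grad_y f (x (r n), b (r n)) \<bullet> ?\<Delta>) / (R n)\<^sup>2" unfolding s by simp
      finally show ?thesis
        by (simp add: add_divide_distrib[symmetric] distrib_left[symmetric])
    qed
    have Q: "0 * ((d \<bullet> (hess_yy f z *v d)) / 2) + (\<Sum>j\<in>J. ubar $ j * ((d \<bullet> (hess_yy (\<lambda>z. g z $ j) z *v d)) / 2)) = ?q"
    proof -
      have "hess_yy (lag 0 ubar) z *v dy = (\<Sum>j\<in>J. ubar $ j *\<^sub>R (hess_yy (\<lambda>z. g z $ j) z *v dy))"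
        unfolding hess_yy_lag sum_active[OF off0] by simp
      then have "?q = (\<Sum>j\<in>J. ubar $ j * ((dy \<bullet> (hess_yy (\<lambda>z. g z $ j) z *v dy)) / 2))"
        by (simp add: inner_sum_right sum_divide_distrib)
      then show ?thesis using d by (auto simp: linear_neg[OF matrix_vector_mul_linear])
    qed
    show ?thesis using L unfolding E Q .
  qed
  have dy': "(\<lambda>n. (y' (r n) - y (r n)) /\<^sub>R R n) \<longlonglongrightarrow> - dy"
    using tendsto_minus[OF dy] by (simp add: scaleR_minus_right[symmetric] del: scaleR_minus_right)
  have e1: "(\<lambda>n. v' (r n) * (f (x (r n), y (r n)) - f (x (r n), y' (r n))) / (R n)\<^sup>2) \<longlonglongrightarrow> ?q"
    by (rule expand[OF lim'(2,3) dy _ lim'(5,7) stat(2) g0]) simp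
  have e2: "(\<lambda>n. v (r n) * (f (x (r n), y' (r n)) - f (x (r n), y (r n))) / (R n)\<^sup>2) \<longlonglongrightarrow> ?q"
    by (rule expand[OF lim'(3,2) dy' _ lim'(4,6) stat(1) g0(2,1)]) simp
  \<comment> \<open>Expanding about either point gives the same quadratic limit, but with opposite
    signs of the difference of \<open>f\<close>; subtraction therefore adds the weights.\<close>
  have "(\<lambda>n. (v (r n) + v' (r n)) * ?df n / (R n)\<^sup>2) \<longlonglongrightarrow> ?q - ?q"
  proof -
    have "(v (r n) + v' (r n)) * ?df n / (R n)\<^sup>2 = v' (r n) * ?df n / (R n)\<^sup>2
        - v (r n) * (f (x (r n), y' (r n)) - f (x (r n), y (r n))) / (R n)\<^sup>2" for n
      unfolding diff_divide_distrib[symmetric] by (simp add: algebra_simps)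
    then show ?thesis using tendsto_diff[OF e1 e2] by simp
  qed
  from tendsto_rabs[OF this] have lim0: "(\<lambda>n. \<bar>(v (r n) + v' (r n)) * ?df n / (R n)\<^sup>2\<bar>) \<longlonglongrightarrow> 0"
    by (simp only: diff_self abs_zero)
  \<comment> \<open>The signs of \<open>v\<close> and \<open>v'\<close> bound their difference by
    their sum. So the product of the limits \<open>d0\<close> and
    \<open>grad_y f z \<bullet> dy\<close> vanishes, which is the alternative required by
    \<open>nondeg\<close> with \<open>s = - d0\<close>.\<close>
  have le: "\<bar>(v (r n) - v' (r n)) / R n * (?df n / R n)\<bar> \<le> \<bar>(v (r n) + v' (r n)) * ?df n / (R n)\<^sup>2\<bar>" for n
  proof -
    have "\<bar>v (r n) - v' (r n)\<bar> \<le> v (r n) + v' (r n)" using v0[of "r n"] by linarith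
    then have "\<bar>v (r n) - v' (r n)\<bar> \<le> \<bar>v (r n) + v' (r n)\<bar>" by linarith
    then have "\<bar>v (r n) - v' (r n)\<bar> * \<bar>?df n\<bar> / (R n)\<^sup>2 \<le> \<bar>v (r n) + v' (r n)\<bar> * \<bar>?df n\<bar> / (R n)\<^sup>2"
      by (intro divide_right_mono mult_right_mono) auto
    then show ?thesis
      unfolding abs_mult[symmetric] power2_eq_square times_divide_times_eq abs_divide by simp
  qed
  have "\<forall>\<^sub>F n in sequentially. norm ((v (r n) - v' (r n)) / R n * (?df n / R n)) \<le> \<bar>(v (r n) + v' (r n)) * ?df n / (R n)\<^sup>2\<bar>"
    unfolding real_norm_def by (intro always_eventually allI le)
  from this lim0 have "(\<lambda>n. (v (r n) - v' (r n)) / R n * (?df n / R n)) \<longlonglongrightarrow> 0"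
    by (rule Lim_null_comparison)
  then have zero: "d0 * (grad_y f z \<bullet> dy) = 0"
    using LIMSEQ_unique[OF tendsto_mult[OF d0 fq]] by blast
  have "dy = 0 \<and> - d0 = 0"
  proof (rule nondeg)
    show "dy \<in> tangent_y g J z" using T by (simp add: tangent_y_def)
    show "- d0 = 0 \<or> grad_y f z \<bullet> dy = 0" using zero by simp
    show "e \<bullet> (hess_yy (lag 0 ubar) z *v dy) = - d0 * (e \<bullet> grad_y f z)" if e: "e \<in> tangent_y g J z" for e
    proof -
      have "e \<bullet> (hess_yy (lag 0 ubar) z *v dy + (d0 *\<^sub>R grad_y f z + (\<Sum>j\<in>J. du $ j *\<^sub>R cgrad_y g j z))) = 0"
        unfolding eq by simp
      moreover have "e \<bullet> cgrad_y g j z = 0" if "j \<in> J" for j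
        using e that by (simp add: tangent_y_def inner_commute)
      then have "e \<bullet> (\<Sum>j\<in>J. du $ j *\<^sub>R cgrad_y g j z) = 0" by (simp add: inner_sum_right)
      ultimately show ?thesis unfolding inner_add_right inner_scaleR_right by linarith
    qed
  qed
  then have z0: "dy = 0" "d0 = 0" by simp_all
  then have "(\<Sum>j\<in>J. du $ j *\<^sub>R cgrad_y g j z) = 0" using eq by simp
  from rel[OF this] obtain t where t: "\<forall>j\<in>J. du $ j = t * ubar $ j" by blast
  then have "(\<Sum>j\<in>J. du $ j) = t * (\<Sum>j\<in>J. ubar $ j)" by (simp add: sum_distrib_left)
  then have "t = 0" using dsum z0 sum1 by simp
  then have "du = 0" using t du_off by (auto simp: vec_eq_iff)
  with z0 r(2) show False by (simp add: D)
qed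

end

context bilevel_lower_level
begin

text \<open>Here \<open>u0\<close> and the normalisation are two further coordinates of the
  constraint map. The only generator of \<open>C\<close> increases \<open>u0\<close>; it makes the
  multiplier of that coordinate nonnegative, and this gives the sign of \<open>grad_y f\<close>
  along \<open>w\<close>.\<close>

lemma type4_case:
  fixes xbar :: real and ybar :: "real^'m"
  assumes F: "Ck_on 1 F UNIV" and min: "local_min_on F (sol_graph f g) (xbar, ybar)"
    and S: "sol_set f g xbar = {ybar}" and t: "type4 f g (xbar, ybar)"
  shows "\<exists>ubar. M_FJ f g (xbar, ybar) = {(0, ubar)} \<and>
          (\<forall>j\<in>active g (xbar, ybar). ubar $ j > 0) \<and>
          local_min_on (\<lambda>(x, y, u0, u). F (x, y))
            {(x, y, u0, u).
               u0 *\<^sub>R grad_y f (x, y) + (\<Sum>j\<in>active g (xbar, ybar). u $ j *\<^sub>R cgrad_y g j (x, y)) = 0 \<and>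
               (\<forall>j\<in>active g (xbar, ybar). g (x, y) $ j = 0) \<and>
               0 \<le> u0 \<and> u0 + (\<Sum>j\<in>active g (xbar, ybar). u $ j) = 1}
            (xbar, ybar, 0, ubar) \<and>
          (\<exists>w \<xi>. star_system F (\<lambda>z. ubar \<bullet> g z) g (xbar, ybar) w \<xi> \<and>
                 grad_y f (xbar, ybar) \<bullet> w \<le> 0 \<and>
                 (\<forall>j\<in>active g (xbar, ybar). cgrad_y g j (xbar, ybar) \<bullet> w = 0))"
proof -
  define J where "J = active g (xbar, ybar)"
  let ?z = "(xbar, ybar)"
  have ysol: "ybar \<in> sol_set f g xbar" using S by simp
  note lm = sol_set_imp_local_min[OF ysol]
  have zf: "snd ?z \<in> feasible g (fst ?z)" using ysol by (simp add: sol_set_def)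
  obtain u where FJ: "M_FJ f g ?z = {(0, u)}" and pos: "\<And>j. j \<in> J \<Longrightarrow> 0 < u $ j" and off: "\<And>j. j \<notin> J \<Longrightarrow> u $ j = 0"
    and sum1: "(\<Sum>j\<in>J. u $ j) = 1" and ker: "(\<Sum>j\<in>J. u $ j *\<^sub>R cgrad_y g j ?z) = 0"
    and gx: "(\<Sum>j\<in>J. u $ j * cgrad_x g j ?z) \<noteq> 0"
    and rel: "\<And>c. (\<Sum>j\<in>J. c j *\<^sub>R cgrad_y g j ?z) = 0 \<Longrightarrow> \<exists>t. \<forall>j\<in>J. c j = t * u $ j"
    and nondeg: "\<And>d s. d \<in> tangent_y g J ?z \<Longrightarrow> s = 0 \<or> grad_y f ?z \<bullet> d = 0 \<Longrightarrow>
      (\<And>e. e \<in> tangent_y g J ?z \<Longrightarrow> e \<bullet> (hess_yy (lag 0 u) ?z *v d) = s * (e \<bullet> grad_y f ?z)) \<Longrightarrow> d = 0 \<and> s = 0"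
    using type4_data[OF lm t] unfolding J_def[symmetric] by blast
  have off': "\<forall>j. j \<notin> J \<longrightarrow> u $ j = 0" using off by blast
  define A where "A = {(x, y, u0, u).
               u0 *\<^sub>R grad_y f (x, y) + (\<Sum>j\<in>J. u $ j *\<^sub>R cgrad_y g j (x, y)) = 0 \<and>
               (\<forall>j\<in>J. g (x, y) $ j = 0) \<and> 0 \<le> u0 \<and> u0 + (\<Sum>j\<in>J. u $ j) = 1}"
  let ?p = "(xbar, ybar, 0::real, u)"
  let ?\<pi> = "\<lambda>p::real \<times> (real^'m) \<times> real \<times> (real^'p). (fst p, fst (snd p))"
  have ev: "\<forall>\<^sub>F p in nhds ?p. p \<in> A \<longrightarrow> ?\<pi> p \<in> sol_graph f g"
  proof (rule seq_in_eventually_nhds)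
    fix s assume mem: "\<And>n. s n \<in> A" and s: "s \<longlonglongrightarrow> ?p" and no: "\<And>n. ?\<pi> (s n) \<notin> sol_graph f g"
    define x y v0 v where "x n = fst (s n)" and "y n = fst (snd (s n))" and "v0 n = fst (snd (snd (s n)))"
      and "v n = snd (snd (snd (s n)))" for n
    have lim: "x \<longlonglongrightarrow> xbar" "y \<longlonglongrightarrow> ybar" "v0 \<longlonglongrightarrow> 0" "v \<longlonglongrightarrow> u"
      using tendsto_fst[OF s] tendsto_fst[OF tendsto_snd[OF s]] tendsto_fst[OF tendsto_snd[OF tendsto_snd[OF s]]]
        tendsto_snd[OF tendsto_snd[OF tendsto_snd[OF s]]]
      by (simp_all add: x_def[abs_def] y_def[abs_def] v_def[abs_def] v0_def[abs_def])
    have sm: "v0 n *\<^sub>R grad_y f (x n, y n) + (\<Sum>j\<in>J. v n $ j *\<^sub>R cgrad_y g j (x n, y n)) = 0"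
      "\<And>j. j \<in> J \<Longrightarrow> g (x n, y n) $ j = 0" "0 \<le> v0 n" "v0 n + (\<Sum>j\<in>J. v n $ j) = 1" for n
      using mem[of n] unfolding A_def x_def y_def v_def v0_def by (auto simp: case_prod_beta)
    have "(\<lambda>n. (x n, y n)) \<longlonglongrightarrow> ?z" by (intro tendsto_Pair lim)
    from eventually_sequentially_shift[OF inactive_eventually[OF zf this]] obtain N
      where N: "\<And>n j. j \<notin> J \<Longrightarrow> g (x (n + N), y (n + N)) $ j < 0" unfolding J_def by blast
    have feas: "y (n + N) \<in> feasible g (x (n + N))" for n
      unfolding feasible_def
    proof (intro CollectI allI)
      fix j show "g (x (n + N), y (n + N)) $ j \<le> 0"
        using N[of j n] sm(2)[of j "n + N"] by (cases "j \<in> J") auto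
    qed
    obtain r ys w0 w l0 l where r: "strict_mono r" and ys: "\<And>n. ys n \<in> sol_set f g (x (r n + N))" "ys \<longlonglongrightarrow> ybar"
      and m: "\<And>n. (w0 n, w n) \<in> M_FJ f g (x (r n + N), ys n)" "w0 \<longlonglongrightarrow> l0" "w \<longlonglongrightarrow> l"
      and l: "(l0, l) \<in> M_FJ f g (xbar, ybar)"
      using competing_solutions[OF S LIMSEQ_ignore_initial_segment[OF lim(1), of N] LIMSEQ_ignore_initial_segment[OF lim(2), of N] feas]
      by blast
    have ll: "l0 = 0" "l = u" using l unfolding FJ by simp_all
    define r' where "r' n = r n + N" for n
    have r': "strict_mono r'" using r by (simp add: strict_mono_def r'_def)
    note lim' = lim[THEN LIMSEQ_subseq_LIMSEQ, OF r', unfolded comp_def]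
    have p': "(\<lambda>n. (x (r' n), ys n)) \<longlonglongrightarrow> ?z" by (intro tendsto_Pair lim' ys)
    have ysf: "snd (x (r' n), ys n) \<in> feasible g (fst (x (r' n), ys n))" for n
      using ys(1)[of n] by (simp add: sol_set_def r'_def)
    from eventually_sequentially_shift[OF FJ_near[OF zf p' ysf m(1)[folded r'_def] m(3)]]
    obtain N' where N': "\<And>n. (\<forall>j. j \<notin> J \<longrightarrow> w (n + N') $ j = 0) \<and>
      (\<forall>j. 0 < l $ j \<longrightarrow> g (x (r' (n + N')), ys (n + N')) $ j = 0) \<and>
      w0 (n + N') *\<^sub>R grad_y f (x (r' (n + N')), ys (n + N')) + (\<Sum>j\<in>J. w (n + N') $ j *\<^sub>R cgrad_y g j (x (r' (n + N')), ys (n + N'))) = 0 \<and>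
      w0 (n + N') + (\<Sum>j\<in>J. w (n + N') $ j) = 1"
      unfolding J_def by blast
    define k where "k n = n + N'" for n
    have k: "strict_mono k" by (simp add: strict_mono_def k_def)
    note N'k = N'[folded k_def]
    define v' where "v' n = (\<chi> j. if j \<in> J then v n $ j else 0)" for n
    have v': "v' \<longlonglongrightarrow> u"
    proof (rule vec_tendstoI)
      fix j show "(\<lambda>n. v' n $ j) \<longlonglongrightarrow> u $ j"
        using tendsto_vec_nth[OF lim(4), of j] off by (cases "j \<in> J") (simp_all add: v'_def)
    qed
    have v'v: "(\<Sum>j\<in>J. v' n $ j *\<^sub>R c j) = (\<Sum>j\<in>J. v n $ j *\<^sub>R c j)" for n and c :: "'p \<Rightarrow> real^'m"
      by (intro sum.cong) (auto simp: v'_def)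
    have v'v2: "(\<Sum>j\<in>J. v' n $ j) = (\<Sum>j\<in>J. v n $ j)" for n
      by (intro sum.cong) (auto simp: v'_def)
    show False
    proof (rule fritz_john_unique[OF sum1[unfolded J_def] off'[unfolded J_def] rel[unfolded J_def] nondeg[unfolded J_def],
          where x = "\<lambda>n. x (r' (k n))" and y = "\<lambda>n. y (r' (k n))" and y' = "\<lambda>n. ys (k n)"
            and v = "\<lambda>n. v0 (r' (k n))" and v' = "\<lambda>n. w0 (k n)" and u = "\<lambda>n. v' (r' (k n))" and u' = "\<lambda>n. w (k n)"],
        unfold J_def[symmetric])
      show "v0 (r' (k n)) *\<^sub>R grad_y f (x (r' (k n)), y (r' (k n))) + (\<Sum>j\<in>J. v' (r' (k n)) $ j *\<^sub>R cgrad_y g j (x (r' (k n)), y (r' (k n)))) = 0" for n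
        unfolding v'v by (rule sm(1))
      show "w0 (k n) *\<^sub>R grad_y f (x (r' (k n)), ys (k n)) + (\<Sum>j\<in>J. w (k n) $ j *\<^sub>R cgrad_y g j (x (r' (k n)), ys (k n))) = 0" for n
        using N'k by blast
      show "g (x (r' (k n)), y (r' (k n))) $ j = 0" if "j \<in> J" for n j using sm(2) that by blast
      show "g (x (r' (k n)), ys (k n)) $ j = 0" if "j \<in> J" for n j
        using N'k[of n] pos[OF that] unfolding ll by blast
      show "0 \<le> v0 (r' (k n))" for n by (rule sm(3))
      show "0 \<le> w0 (k n)" for n using m(1)[of "k n"] by (simp add: M_FJ_def)
      show "v0 (r' (k n)) + (\<Sum>j\<in>J. v' (r' (k n)) $ j) = 1" for n unfolding v'v2 by (rule sm(4))
      show "w0 (k n) + (\<Sum>j\<in>J. w (k n) $ j) = 1" for n using N'k by blast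
      show "v' (r' (k n)) $ j = 0" if "j \<notin> J" for n j using that by (simp add: v'_def)
      show "w (k n) $ j = 0" if "j \<notin> J" for n j using that N'k by blast
      show "(\<lambda>n. x (r' (k n))) \<longlonglongrightarrow> xbar" "(\<lambda>n. y (r' (k n))) \<longlonglongrightarrow> ybar" "(\<lambda>n. v0 (r' (k n))) \<longlonglongrightarrow> 0"
        using lim'(1-3)[THEN LIMSEQ_subseq_LIMSEQ, OF k] by (simp_all add: comp_def)
      show "(\<lambda>n. v' (r' (k n))) \<longlonglongrightarrow> u"
        using LIMSEQ_subseq_LIMSEQ[OF LIMSEQ_subseq_LIMSEQ[OF v' r'] k] by (simp add: comp_def)
      show "(\<lambda>n. ys (k n)) \<longlonglongrightarrow> ybar" "(\<lambda>n. w0 (k n)) \<longlonglongrightarrow> 0" "(\<lambda>n. w (k n)) \<longlonglongrightarrow> u"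
        using ys(2)[THEN LIMSEQ_subseq_LIMSEQ, OF k] m(2,3)[THEN LIMSEQ_subseq_LIMSEQ, OF k] ll by (simp_all add: comp_def)
      show "y (r' (k n)) \<noteq> ys (k n)" for n
        using no[of "r' (k n)"] ys(1)[of "k n"] by (auto simp: sol_graph_def x_def y_def r'_def)
    qed
  qed
  have g0: "g ?z $ j = 0" if "j \<in> J" for j using that by (simp add: J_def active_def)
  have pA: "?p \<in> A" using ker sum1 g0 by (simp add: A_def)
  have cont: "isCont ?\<pi> q" for q by (intro continuous_intros)
  have evF: "\<forall>\<^sub>F p in nhds ?p. p \<in> A \<longrightarrow> F ?z \<le> F (?\<pi> p)"
    and lmA: "local_min_on (\<lambda>p. F (?\<pi> p)) A ?p"
    using local_min_transfer[of F "sol_graph f g" ?\<pi> ?p A, unfolded fst_conv snd_conv, OF min pA cont ev] by blast+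
  let ?S = "\<lambda>(x, y, u0, u). u0 *\<^sub>R grad_y f (x, y) + (\<Sum>j\<in>J. u $ j *\<^sub>R cgrad_y g j (x, y))"
  let ?H = "hess_yy (lag 0 u) ?z" and ?h = "hess_xy (lag 0 u) ?z"
  let ?S' = "\<lambda>(a, v, w0, w). (a *\<^sub>R ?h + ?H *v v) + (w0 *\<^sub>R grad_y f ?z + (\<Sum>j\<in>J. w $ j *\<^sub>R cgrad_y g j ?z))"
  let ?E = "\<lambda>q::real \<times> (real^'m) \<times> real \<times> (real^'p). (fst q, fst (snd q), snd (snd (snd q)))"
  let ?G0 = "\<lambda>q::real \<times> (real^'m) \<times> (real^'p). (\<chi> j. if j \<in> J then g (fst q, fst (snd q)) $ j else snd (snd q) $ j)"
  let ?G0' = "\<lambda>q::real \<times> (real^'m) \<times> (real^'p).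
    (\<chi> j. if j \<in> J then cgrad_x g j ?z * fst q + cgrad_y g j ?z \<bullet> fst (snd q) else snd (snd q) $ j)"
  let ?s = "\<lambda>q::real \<times> (real^'m) \<times> real \<times> (real^'p). fst (snd (snd q)) + (\<Sum>j\<in>J. snd (snd (snd q)) $ j)"
  let ?u0 = "\<lambda>q::real \<times> (real^'m) \<times> real \<times> (real^'p). fst (snd (snd q))"
  let ?\<Phi> = "\<lambda>q. (?S q, ?G0 (?E q), ?s q, ?u0 q)"
  let ?A = "\<lambda>q. (?S' q, ?G0' (?E q), ?s q, ?u0 q)"
  have E: "(?E has_derivative ?E) (at q)" for q
    by (intro has_derivative_Pair has_derivative_fst has_derivative_snd has_derivative_ident)
  have "((\<lambda>q. ?G0 (?E q)) has_derivative (\<lambda>q. ?G0' (?E q))) (at ?p)"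
  proof (rule has_derivative_compose[OF E])
    show "(?G0 has_derivative ?G0') (at (?E ?p))"
      using constraint_map_has_derivative[of J ?z u] by (simp cong: if_cong)
  qed
  moreover have "(?s has_derivative ?s) (at ?p)"
    by (intro has_derivative_add has_derivative_sum bounded_linear.has_derivative[OF bounded_linear_vec_nth]
        has_derivative_fst has_derivative_snd has_derivative_ident)
  moreover have "(?u0 has_derivative ?u0) (at ?p)"
    by (intro has_derivative_fst has_derivative_snd has_derivative_ident)
  ultimately have der: "(?\<Phi> has_derivative ?A) (at ?p)"
    by (intro has_derivative_Pair stat_has_derivative[OF off'])
  have contS: "continuous_on UNIV ?S"
  proof -
    have "isCont ?S q" for q :: "real \<times> (real^'m) \<times> real \<times> (real^'p)"
      unfolding isCont_def case_prod_beta
      by (intro tendsto_intros tendsto_grad_f tendsto_grad_g)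
    then show ?thesis by (simp add: continuous_at_imp_continuous_on)
  qed
  have cont\<Phi>: "continuous_on UNIV ?\<Phi>"
    by (intro continuous_on_Pair contS continuous_on_compose2[OF continuous_on_constraint_map] continuous_intros) auto
  have inner: "(c1, c2, c3, c4) \<bullet> ?A (a, v, w0, w) = a * (c1 \<bullet> ?h + (\<Sum>j\<in>J. c2 $ j * cgrad_x g j ?z))
      + (?H *v c1 + (\<Sum>j\<in>J. c2 $ j *\<^sub>R cgrad_y g j ?z)) \<bullet> v + w0 * (grad_y f ?z \<bullet> c1 + c3 + c4)
      + ((\<Sum>j\<in>J. (cgrad_y g j ?z \<bullet> c1 + c3) * w $ j) + (\<Sum>j\<in>-J. c2 $ j * w $ j))"
    for c1 v :: "real^'m" and c2 w :: "real^'p" and c3 c4 a w0 :: real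
  proof -
    have H: "c1 \<bullet> (?H *v v) = (?H *v c1) \<bullet> v"
    proof -
      have "c1 \<bullet> (?H *v v) = v \<bullet> (?H *v c1)" by (rule hess_yy_symmetric[OF lag_C2])
      also have "\<dots> = (?H *v c1) \<bullet> v" by (rule inner_commute)
      finally show ?thesis .
    qed
    have 1: "c1 \<bullet> ?S' (a, v, w0, w) = a * (c1 \<bullet> ?h) + (?H *v c1) \<bullet> v + w0 * (grad_y f ?z \<bullet> c1)
        + (\<Sum>j\<in>J. (cgrad_y g j ?z \<bullet> c1) * w $ j)"
      unfolding case_prod_conv inner_add_right inner_sum_right inner_scaleR_right H
      by (simp add: inner_commute[of c1 "cgrad_y g _ _"] inner_commute[of c1 "grad_y f _"] mult.commute)
    have 2: "c2 \<bullet> ?G0' (?E (a, v, w0, w)) = a * (\<Sum>j\<in>J. c2 $ j * cgrad_x g j ?z)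
        + (\<Sum>j\<in>J. c2 $ j *\<^sub>R cgrad_y g j ?z) \<bullet> v + (\<Sum>j\<in>-J. c2 $ j * w $ j)"
      unfolding inner_vec_if
      by (simp add: distrib_left sum.distrib inner_sum_left sum_distrib_left ac_simps)
    have 3: "c3 * ?s (a, v, w0, w) = w0 * c3 + (\<Sum>j\<in>J. c3 * w $ j)"
      by (simp add: distrib_left sum_distrib_left mult.commute)
    have "(c1, c2, c3, c4) \<bullet> ?A (a, v, w0, w) = c1 \<bullet> ?S' (a, v, w0, w) + (c2 \<bullet> ?G0' (?E (a, v, w0, w))
        + (c3 * ?s (a, v, w0, w) + c4 * ?u0 (a, v, w0, w)))"
      unfolding inner_Pair inner_real_def ..
    also have "\<dots> = a * (c1 \<bullet> ?h + (\<Sum>j\<in>J. c2 $ j * cgrad_x g j ?z))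
      + (?H *v c1 + (\<Sum>j\<in>J. c2 $ j *\<^sub>R cgrad_y g j ?z)) \<bullet> v + w0 * (grad_y f ?z \<bullet> c1 + c3 + c4)
      + ((\<Sum>j\<in>J. (cgrad_y g j ?z \<bullet> c1 + c3) * w $ j) + (\<Sum>j\<in>-J. c2 $ j * w $ j))"
      unfolding 1 2 3 by (simp add: distrib_left distrib_right sum.distrib inner_add_left mult.commute)
    finally show ?thesis .
  qed
  have components: "a1 = 0 \<and> a2 = 0 \<and> a0 = 0 \<and> (\<forall>j\<in>J. a3 j = 0) \<and> (\<forall>j\<in>-J. a4 j = 0)"
    if H: "\<And>a v w0 w. a * a1 + a2 \<bullet> v + w0 * a0 + ((\<Sum>j\<in>J. a3 j * w $ j) + (\<Sum>j\<in>-J. a4 j * w $ j)) = 0"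
    for a1 a0 :: real and a2 :: "real^'m" and a3 a4 :: "'p \<Rightarrow> real"
  proof (intro conjI ballI)
    show "a1 = 0" using H[of 1 0 0 0] by simp
    show "a0 = 0" using H[of 0 0 1 0] by simp
    have "a2 \<bullet> a2 = 0" using H[of 0 a2 0 0] by simp
    then show "a2 = 0" by simp
    have ax: "(\<Sum>i\<in>K. a i * axis j 1 $ i) = (if j \<in> K then a j else 0)" for K :: "'p set" and a :: "'p \<Rightarrow> real" and j :: 'p
    proof -
      have "(\<Sum>i\<in>K. a i * axis j 1 $ i) = (\<Sum>i\<in>K. if i = j then a i else 0)"
        by (intro sum.cong) (auto simp: axis_def)
      then show ?thesis by (simp add: sum.delta')
    qed
    show "a3 j = 0" if j: "j \<in> J" for j using H[of 0 0 0 "axis j 1"] j unfolding ax by simp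
    show "a4 j = 0" if j: "j \<in> - J" for j using H[of 0 0 0 "axis j 1"] j unfolding ax by simp
  qed
  \<comment> \<open>Weighting these equations by \<open>u\<close> cancels the gradients and leaves
    \<open>c3\<close>, so the normalisation has multiplier 0.\<close>
  have c3_0: "c3 = 0" if "\<And>j. j \<in> J \<Longrightarrow> cgrad_y g j ?z \<bullet> c1 + c3 = 0" for c1 c3
  proof -
    have "0 = (\<Sum>j\<in>J. u $ j * (cgrad_y g j ?z \<bullet> c1 + c3))" using that by simp
    also have "\<dots> = (\<Sum>j\<in>J. u $ j *\<^sub>R cgrad_y g j ?z) \<bullet> c1 + (\<Sum>j\<in>J. u $ j) * c3"
      by (simp add: distrib_left sum.distrib inner_sum_left sum_distrib_right)
    finally show ?thesis by (simp add: ker sum1)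
  qed
  have surj: "c = 0" if c: "\<And>q. c \<bullet> ?A q = 0" for c :: "(real^'m) \<times> (real^'p) \<times> real \<times> real"
  proof -
    obtain c1 c2 c3 c4 where cc: "c = (c1, c2, c3, c4)" by (cases c)
    have "a * (c1 \<bullet> ?h + (\<Sum>j\<in>J. c2 $ j * cgrad_x g j ?z))
      + (?H *v c1 + (\<Sum>j\<in>J. c2 $ j *\<^sub>R cgrad_y g j ?z)) \<bullet> v + w0 * (grad_y f ?z \<bullet> c1 + c3 + c4)
      + ((\<Sum>j\<in>J. (cgrad_y g j ?z \<bullet> c1 + c3) * w $ j) + (\<Sum>j\<in>-J. c2 $ j * w $ j)) = 0" for a v w0 w
      using c[of "(a, v, w0, w)"] unfolding cc inner .
    from components[OF this] have
      comp: "c1 \<bullet> ?h + (\<Sum>j\<in>J. c2 $ j * cgrad_x g j ?z) = 0"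
        "?H *v c1 + (\<Sum>j\<in>J. c2 $ j *\<^sub>R cgrad_y g j ?z) = 0" "grad_y f ?z \<bullet> c1 + c3 + c4 = 0"
      and comp4: "\<And>j. j \<in> J \<Longrightarrow> cgrad_y g j ?z \<bullet> c1 + c3 = 0" and comp5: "\<And>j. j \<notin> J \<Longrightarrow> c2 $ j = 0"
      by blast+
    have c3: "c3 = 0" by (rule c3_0[OF comp4])
    have T: "c1 \<in> tangent_y g J ?z" using comp4 c3 by (simp add: tangent_y_def)
    have "c1 = 0 \<and> (0::real) = 0"
    proof (rule nondeg[OF T])
      fix e assume e: "e \<in> tangent_y g J ?z"
      have "e \<bullet> (?H *v c1 + (\<Sum>j\<in>J. c2 $ j *\<^sub>R cgrad_y g j ?z)) = 0" unfolding comp(2) by (rule inner_zero_right)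
      moreover have "e \<bullet> cgrad_y g j ?z = 0" if "j \<in> J" for j
        using e that by (simp add: tangent_y_def inner_commute)
      then have "e \<bullet> (\<Sum>j\<in>J. c2 $ j *\<^sub>R cgrad_y g j ?z) = 0" by (simp add: inner_sum_right)
      ultimately show "e \<bullet> (?H *v c1) = 0 * (e \<bullet> grad_y f ?z)"
        unfolding inner_add_right by linarith
    qed (rule disjI1, rule refl)
    then have c1: "c1 = 0" by (rule conjunct1)
    have "(\<Sum>j\<in>J. c2 $ j *\<^sub>R cgrad_y g j ?z) = 0" using comp(2) unfolding c1 by simp
    obtain t where t': "\<forall>j\<in>J. c2 $ j = t * u $ j" using rel[OF \<open>(\<Sum>j\<in>J. c2 $ j *\<^sub>R cgrad_y g j ?z) = 0\<close>] by (rule exE)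
    note t = t'[rule_format]
    have "(\<Sum>j\<in>J. c2 $ j * cgrad_x g j ?z) = (\<Sum>j\<in>J. t * (u $ j * cgrad_x g j ?z))"
      by (intro sum.cong refl) (simp only: t mult.assoc)
    also have "\<dots> = t * (\<Sum>j\<in>J. u $ j * cgrad_x g j ?z)" by (rule sum_distrib_left[symmetric])
    finally have "t * (\<Sum>j\<in>J. u $ j * cgrad_x g j ?z) = 0" using comp(1) unfolding c1 by simp
    \<comment> \<open>All that is left of \<open>c2\<close> is a multiple of \<open>u\<close>, and
      the nonzero \<open>x\<close>-derivative of \<open>u\<^sup>T g\<close> excludes it.\<close>
    then have "t = 0" using gx by simp
    have c2: "c2 = 0"
    proof (subst vec_eq_iff, rule allI)
      fix j show "c2 $ j = 0 $ j" using t[of j] comp5[of j] \<open>t = 0\<close> by (cases "j \<in> J") simp_all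
    qed
    have "c4 = 0" using comp(3) unfolding c1 c3 by simp
    then show ?thesis unfolding cc c1 c2 c3 zero_prod_def by simp
  qed
  have Fder: "((\<lambda>q. F (?\<pi> q)) has_derivative (\<lambda>q. grad F ?z \<bullet> ?\<pi> q)) (at ?p)"
  proof (rule has_derivative_compose[where f = ?\<pi> and f' = ?\<pi>])
    show "(F has_derivative (\<lambda>q. grad F ?z \<bullet> q)) (at (?\<pi> ?p))"
      using C1_has_derivative_grad[OF F, of ?z] by simp
  qed (intro has_derivative_Pair has_derivative_fst has_derivative_snd has_derivative_ident)
  let ?C = "{0, (0, 0, 0, 1)} :: ((real^'m) \<times> (real^'p) \<times> real \<times> real) set"
  have G0p: "?G0 (?E ?p) = 0" using g0 off by (simp add: vec_eq_iff)
  have \<Phi>p: "?\<Phi> ?p = (0, 0, 1, 0)"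
    unfolding G0p using ker sum1 by simp
  have min': "\<forall>\<^sub>F q in nhds ?p. (\<exists>t\<ge>0. ?\<Phi> q = ?\<Phi> ?p + t *\<^sub>R e) \<longrightarrow> F (?\<pi> ?p) \<le> F (?\<pi> q)" if e: "e \<in> ?C" for e
    using evF
  proof eventually_elim
    case (elim q)
    show ?case
    proof
      assume "\<exists>t\<ge>0. ?\<Phi> q = ?\<Phi> ?p + t *\<^sub>R e"
      then obtain t where t: "t \<ge> 0" "?\<Phi> q = (0, 0, 1, 0) + t *\<^sub>R e" unfolding \<Phi>p by blast
      obtain t' where t': "t' \<ge> 0" "?\<Phi> q = (0, 0, 1, t')"
        using e t by (auto simp: zero_prod_def)
      have "?S q = 0" "?G0 (?E q) = 0" "?s q = 1" "?u0 q = t'" using t'(2) by simp_all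
      moreover have "g (fst q, fst (snd q)) $ j = 0" if "j \<in> J" for j
        using arg_cong[OF \<open>?G0 (?E q) = 0\<close>, of "\<lambda>v. v $ j"] that by simp
      ultimately have "q \<in> A" using t'(1) by (simp add: A_def case_prod_beta)
      then show "F (?\<pi> ?p) \<le> F (?\<pi> q)" using elim by simp
    qed
  qed
  obtain c where c: "\<And>q. grad F ?z \<bullet> ?\<pi> q = c \<bullet> ?A q" "\<And>e. e \<in> ?C \<Longrightarrow> 0 \<le> c \<bullet> e"
    using multiplier_rule[OF cont\<Phi> der surj Fder _ min'] by blast
  obtain c1 c2 c3 c4 where cc: "c = (c1, c2, c3, c4)" by (cases c)
  have "a * (c1 \<bullet> ?h + (\<Sum>j\<in>J. c2 $ j * cgrad_x g j ?z) - grad_x F ?z)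
      + (?H *v c1 + (\<Sum>j\<in>J. c2 $ j *\<^sub>R cgrad_y g j ?z) - grad_y F ?z) \<bullet> v + w0 * (grad_y f ?z \<bullet> c1 + c3 + c4)
      + ((\<Sum>j\<in>J. (cgrad_y g j ?z \<bullet> c1 + c3) * w $ j) + (\<Sum>j\<in>-J. c2 $ j * w $ j)) = 0" for a v w0 w
    using c(1)[of "(a, v, w0, w)"] unfolding cc inner
    by (simp add: grad_def right_diff_distrib inner_diff_left mult.commute)
  from components[OF this] have
    comp: "c1 \<bullet> ?h + (\<Sum>j\<in>J. c2 $ j * cgrad_x g j ?z) - grad_x F ?z = 0"
      "?H *v c1 + (\<Sum>j\<in>J. c2 $ j *\<^sub>R cgrad_y g j ?z) - grad_y F ?z = 0" "grad_y f ?z \<bullet> c1 + c3 + c4 = 0"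
    and comp4: "\<And>j. j \<in> J \<Longrightarrow> cgrad_y g j ?z \<bullet> c1 + c3 = 0" and comp5: "\<And>j. j \<notin> J \<Longrightarrow> c2 $ j = 0"
    by blast+
  have c3: "c3 = 0" by (rule c3_0[OF comp4])
  have "0 \<le> c4" using c(2)[of "(0, 0, 0, 1)"] by (simp add: cc)
  then have r1: "grad_y f ?z \<bullet> c1 \<le> 0" using comp(3) c3 by linarith
  have r2: "star_system F (\<lambda>z. u \<bullet> g z) g ?z c1 (- c2)"
  proof -
    have 1: "grad_x F ?z = c1 \<bullet> ?h + (\<Sum>j\<in>J. c2 $ j * cgrad_x g j ?z)"
      and 2: "grad_y F ?z = ?H *v c1 + (\<Sum>j\<in>J. c2 $ j *\<^sub>R cgrad_y g j ?z)"
      using comp(1,2) by (simp_all only: right_minus_eq)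
    show ?thesis
      unfolding star_system_iff inner_eq J_def[symmetric] 1 2 inner_commute[of ?h c1]
      using comp5 by (simp add: sum_negf)
  qed
  have r3: "\<forall>j\<in>J. cgrad_y g j ?z \<bullet> c1 = 0" using comp4 c3 by simp
  have r4: "local_min_on (\<lambda>(x, y, u0, u). F (x, y)) A ?p" using lmA unfolding case_prod_beta .
  show ?thesis
    unfolding J_def[symmetric] A_def[symmetric]
    by (intro exI[of _ u] exI[of _ c1] exI[of _ "- c2"] conjI ballI FJ pos r1 r2 r3[rule_format] r4)
qed

end

section \<open>Type 5\<close>

lemma orthogonal_to_basis_family:
  fixes v :: "'i \<Rightarrow> 'a::euclidean_space"
  assumes K: "indep_family v K" "card K = DIM('a)" and d: "\<And>k. k \<in> K \<Longrightarrow> v k \<bullet> d = 0"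
  shows "d = 0"
proof -
  have "independent (v ` K)" "card (v ` K) = DIM('a)"
    using K by (auto simp: indep_family_def card_image)
  then have "UNIV \<subseteq> span (v ` K)"
    by (intro card_ge_dim_independent) (simp_all add: dim_UNIV)
  then have "d \<in> span (v ` K)" by blast
  moreover have "orthogonal d x" if "x \<in> v ` K" for x
    using that d by (auto simp: orthogonal_def inner_commute)
  ultimately have "orthogonal d d" by (rule orthogonal_to_span)
  then show ?thesis by (simp add: orthogonal_def)
qed

context bilevel_lower_level
begin

text \<open>There is one vector more than the dimension, and omitting any one leaves an independent
  family: a relation exists, is unique up to scaling and has no zero coefficient. For the same
  reason a multiplier vanishing at \<open>i\<close> coincides on \<open>J - {i}\<close> with the one
  that the type definition attaches to \<open>i\<close>, hence vanishes nowhere else in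
  \<open>J\<close>.\<close>

lemma type5_data:
  fixes xbar :: real and ybar :: "real^'m"
  defines "z \<equiv> (xbar, ybar)" and "J \<equiv> active g (xbar, ybar)"
  assumes t: "type5 f g z"
  obtains \<mu> :: "real^'p" where "(\<Sum>j\<in>J. \<mu> $ j *\<^sub>R cgrad_y g j z) = 0" "\<And>j. j \<in> J \<Longrightarrow> \<mu> $ j \<noteq> 0"
    "\<And>j. j \<notin> J \<Longrightarrow> \<mu> $ j = 0"
    "\<And>c. (\<Sum>j\<in>J. c j *\<^sub>R cgrad_y g j z) = 0 \<Longrightarrow> \<exists>t. \<forall>j\<in>J. c j = t * \<mu> $ j"
    "\<And>c i j. grad_y f z + (\<Sum>j\<in>J. c j *\<^sub>R cgrad_y g j z) = 0 \<Longrightarrow> i \<in> J \<Longrightarrow> c i = 0 \<Longrightarrow> j \<in> J - {i} \<Longrightarrow> c j \<noteq> 0"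
    "\<And>i d. i \<in> J \<Longrightarrow> (\<And>j. j \<in> J - {i} \<Longrightarrow> cgrad_y g j z \<bullet> d = 0) \<Longrightarrow> d = 0"
    "\<And>c j. (\<Sum>j\<in>J. c j * cgrad_x g j z) = 0 \<Longrightarrow> (\<Sum>j\<in>J. c j *\<^sub>R cgrad_y g j z) = 0 \<Longrightarrow> j \<in> J \<Longrightarrow> c j = 0"
proof -
  have Jz: "active g z = J" by (simp add: J_def z_def)
  note T = t[unfolded type5_def Jz]
  have card: "card J = CARD('m) + 1" and full: "indep_family (\<lambda>j. cgrad g j z) J"
    and any: "\<forall>K \<subseteq> J. card K = CARD('m) \<longrightarrow> indep_family (\<lambda>j. cgrad_y g j z) K"
    and ex: "\<forall>i\<in>J. \<exists>u :: real^'p. grad_y f z + (\<Sum>j\<in>J - {i}. u $ j *\<^sub>R cgrad_y g j z) = 0 \<and> (\<forall>j\<in>J - {i}. u $ j \<noteq> 0)"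
    using T[THEN conjunct2, THEN conjunct1] T[THEN conjunct2, THEN conjunct2, THEN conjunct1]
      T[THEN conjunct2, THEN conjunct2, THEN conjunct2, THEN conjunct1]
      T[THEN conjunct2, THEN conjunct2, THEN conjunct2, THEN conjunct2]
    by simp_all
  have ind: "indep_family (\<lambda>j. cgrad_y g j z) (J - {i})" if "i \<in> J" for i
    using any card that by (simp add: card_Diff_singleton)
  have minus: "c j = 0" if "i \<in> J" "(\<Sum>j\<in>J - {i}. c j *\<^sub>R cgrad_y g j z) = 0" "j \<in> J - {i}" for c i j
    using ind[OF that(1)] that(2,3) unfolding indep_family_iff[OF finite] by blast
  have rem: "(\<Sum>j\<in>J. c j *\<^sub>R cgrad_y g j z) = (\<Sum>j\<in>J - {i}. c j *\<^sub>R cgrad_y g j z)" if "i \<in> J" "c i = 0" for c i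
    using that by (simp add: sum.remove[OF finite])
  obtain c where c: "(\<Sum>j\<in>J. c j *\<^sub>R cgrad_y g j z) = 0" "\<exists>j\<in>J. c j \<noteq> 0"
  proof -
    have "DIM(real^'m) < card J" using card by simp
    then show ?thesis by (rule dependent_family[OF finite]) (rule that)
  qed
  have cnz: "c i \<noteq> 0" if i: "i \<in> J" for i
  proof
    assume ci: "c i = 0"
    have "c j = 0" if "j \<in> J" for j
      using minus[OF i c(1)[unfolded rem[of i c, OF i ci]], of j] ci that by (cases "j = i") simp_all
    then show False using c(2) by blast
  qed
  define \<mu> :: "real^'p" where "\<mu> = (\<chi> j. if j \<in> J then c j else 0)"
  have \<mu>c: "\<mu> $ j = c j" if "j \<in> J" for j using that by (simp add: \<mu>_def)
  have \<mu>1: "(\<Sum>j\<in>J. \<mu> $ j *\<^sub>R cgrad_y g j z) = 0"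
    using c(1) \<mu>c by simp
  have \<mu>2: "\<mu> $ j \<noteq> 0" if "j \<in> J" for j using cnz[OF that] \<mu>c[OF that] by simp
  show ?thesis
  proof (rule that[OF \<mu>1 \<mu>2])
    show "\<mu> $ j = 0" if "j \<notin> J" for j using that by (simp add: \<mu>_def)
    show "\<exists>t. \<forall>j\<in>J. a j = t * \<mu> $ j" if a: "(\<Sum>j\<in>J. a j *\<^sub>R cgrad_y g j z) = 0" for a
    proof -
      obtain i where i: "i \<in> J" using c(2) by blast
      define t where "t = a i / \<mu> $ i"
      define b where "b j = a j - t * \<mu> $ j" for j
      have bi: "b i = 0" using \<mu>2[OF i] by (simp add: b_def t_def)
      have "(\<Sum>j\<in>J. b j *\<^sub>R cgrad_y g j z) = (\<Sum>j\<in>J. a j *\<^sub>R cgrad_y g j z) - t *\<^sub>R (\<Sum>j\<in>J. \<mu> $ j *\<^sub>R cgrad_y g j z)"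
        by (simp add: b_def scaleR_diff_left sum_subtractf scaleR_sum_right)
      then have "(\<Sum>j\<in>J. b j *\<^sub>R cgrad_y g j z) = 0" unfolding a \<mu>1 by simp
      note b0 = this[unfolded rem[of i b, OF i bi]]
      have "b j = 0" if "j \<in> J" for j
        using minus[OF i b0, of j] bi that by (cases "j = i") simp_all
      then show ?thesis by (intro exI[of _ t]) (simp add: b_def)
    qed
    show "a j \<noteq> 0" if a: "grad_y f z + (\<Sum>j\<in>J. a j *\<^sub>R cgrad_y g j z) = 0" and i: "i \<in> J" "a i = 0" and j: "j \<in> J - {i}" for a i j
    proof -
      obtain w :: "real^'p" where w: "grad_y f z + (\<Sum>j\<in>J - {i}. w $ j *\<^sub>R cgrad_y g j z) = 0" "\<forall>j\<in>J - {i}. w $ j \<noteq> 0"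
        using ex i(1) by blast
      have "(\<Sum>j\<in>J - {i}. a j *\<^sub>R cgrad_y g j z) = (\<Sum>j\<in>J - {i}. w $ j *\<^sub>R cgrad_y g j z)"
        using trans[OF a[unfolded rem[of i a, OF i]] w(1)[symmetric]] by (rule add_left_imp_eq)
      then have "(\<Sum>j\<in>J - {i}. (a j - w $ j) *\<^sub>R cgrad_y g j z) = 0"
        by (simp add: scaleR_diff_left sum_subtractf)
      from minus[OF i(1) this j] show ?thesis using w(2) j by simp
    qed
    show "d = 0" if i: "i \<in> J" and d: "\<And>j. j \<in> J - {i} \<Longrightarrow> cgrad_y g j z \<bullet> d = 0" for i d
      by (rule orthogonal_to_basis_family[OF ind[OF i] _ d]) (use card i in \<open>simp add: card_Diff_singleton DIM_cart\<close>)
    show "a j = 0" if a: "(\<Sum>j\<in>J. a j * cgrad_x g j z) = 0" "(\<Sum>j\<in>J. a j *\<^sub>R cgrad_y g j z) = 0" and j: "j \<in> J" for a j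
    proof -
      have "(\<Sum>j\<in>J. a j *\<^sub>R cgrad g j z) = ((\<Sum>j\<in>J. a j * cgrad_x g j z), (\<Sum>j\<in>J. a j *\<^sub>R cgrad_y g j z))"
        by (simp add: cgrad_def grad_def cgrad_x_def cgrad_y_def sum_prod)
      then have "(\<Sum>j\<in>J. a j *\<^sub>R cgrad g j z) = 0" unfolding a zero_prod_def .
      from full[unfolded indep_family_iff[OF finite], THEN spec, THEN mp, OF this] j
      show ?thesis by (rule bspec)
    qed
  qed
qed

text \<open>\<open>Q\<close> contains the indices of the active constraints that may become inactive at solutions near \<open>z\<close>.
  Two such branches at the same \<open>x\<close> are feasible on opposite sides of \<open>xbar\<close> only, by the signs of \<open>\<mu>\<close>.\<close>

lemma branch_near_solution:
  fixes xbar :: real and ybar :: "real^'m"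
  defines "z \<equiv> (xbar, ybar)" and "J \<equiv> active g (xbar, ybar)"
  assumes S: "sol_set f g xbar = {ybar}"
    and \<mu>: "(\<Sum>j\<in>J. \<mu> $ j *\<^sub>R cgrad_y g j z) = 0"
    and tang: "\<And>i d. i \<in> J \<Longrightarrow> (\<And>j. j \<in> J - {i} \<Longrightarrow> cgrad_y g j z \<bullet> d = 0) \<Longrightarrow> d = 0"
    and Q: "Q \<subseteq> J" "\<And>l0 l. (l0, l) \<in> M_FJ f g z \<Longrightarrow> \<exists>q\<in>Q. \<forall>j\<in>J - {q}. 0 < l $ j"
      "\<And>q r. q \<in> Q \<Longrightarrow> r \<in> Q \<Longrightarrow> q \<noteq> r \<Longrightarrow> \<mu> $ q * \<mu> $ r < 0"
    and q: "q \<in> Q"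
  shows "\<forall>\<^sub>F p in nhds z. p \<in> {(x, y). (\<forall>j\<in>J - {q}. g (x, y) $ j = 0) \<and> g (x, y) $ q \<le> 0} \<longrightarrow> p \<in> sol_graph f g"
proof (rule seq_in_eventually_nhds)
  fix s assume mem: "\<And>n. s n \<in> {(x, y). (\<forall>j\<in>J - {q}. g (x, y) $ j = 0) \<and> g (x, y) $ q \<le> 0}"
    and s: "s \<longlonglongrightarrow> z" and no: "\<And>n. s n \<notin> sol_graph f g"
  have ysol: "ybar \<in> sol_set f g xbar" using S by simp
  have zf: "snd z \<in> feasible g (fst z)" using ysol by (simp add: z_def sol_set_def)
  define x y where "x n = fst (s n)" and "y n = snd (s n)" for n
  have sxy: "s n = (x n, y n)" for n by (simp add: x_def y_def)
  have lim: "x \<longlonglongrightarrow> xbar" "y \<longlonglongrightarrow> ybar"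
    using tendsto_fst[OF s] tendsto_snd[OF s] by (simp_all add: x_def[abs_def] y_def[abs_def] z_def)
  have sm: "\<And>j. j \<in> J - {q} \<Longrightarrow> g (x n, y n) $ j = 0" "g (x n, y n) $ q \<le> 0" for n
    using mem[of n] unfolding sxy by simp_all
  from eventually_sequentially_shift[OF inactive_eventually[OF zf s]] obtain N
    where N: "\<And>n j. j \<notin> active g z \<Longrightarrow> g (s (n + N)) $ j < 0" by blast
  have feas: "y (n + N) \<in> feasible g (x (n + N))" for n
    unfolding feasible_def
  proof (intro CollectI allI)
    fix j show "g (x (n + N), y (n + N)) $ j \<le> 0"
    proof (cases "j \<in> J")
      case True
      then show ?thesis using sm(1)[of j "n + N"] sm(2)[of "n + N"] by (cases "j = q") simp_all
    next
      case False
      then show ?thesis using N[of j n] unfolding sxy J_def z_def by (simp add: less_imp_le)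
    qed
  qed
  obtain r ys w0 w l0 l where r: "strict_mono r" and ys: "\<And>n. ys n \<in> sol_set f g (x (r n + N))" "ys \<longlonglongrightarrow> ybar"
    and m: "\<And>n. (w0 n, w n) \<in> M_FJ f g (x (r n + N), ys n)" "w0 \<longlonglongrightarrow> l0" "w \<longlonglongrightarrow> l"
    and l: "(l0, l) \<in> M_FJ f g (xbar, ybar)"
    using competing_solutions[OF S LIMSEQ_ignore_initial_segment[OF lim(1), of N] LIMSEQ_ignore_initial_segment[OF lim(2), of N] feas]
    by blast
  \<comment> \<open>The limit of the competing multipliers leaves at most one constraint
    \<open>q'\<close> in doubt; the others in \<open>J\<close> are active at the competing solutions
    too. If \<open>q' = q\<close>, both sequences solve the same equations.\<close>
  obtain q' where q': "q' \<in> Q" "\<And>j. j \<in> J - {q'} \<Longrightarrow> 0 < l $ j" using Q(2)[of l0 l] l unfolding z_def by blast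
  define r' where "r' n = r n + N" for n
  have r': "strict_mono r'" using r by (simp add: strict_mono_def r'_def)
  note lim' = lim[THEN LIMSEQ_subseq_LIMSEQ, OF r', unfolded comp_def]
  have p': "(\<lambda>n. (x (r' n), ys n)) \<longlonglongrightarrow> z" unfolding z_def by (intro tendsto_Pair lim' ys)
  have ysf: "snd (x (r' n), ys n) \<in> feasible g (fst (x (r' n), ys n))" for n
    using ys(1)[of n] by (simp add: sol_set_def r'_def)
  from eventually_sequentially_shift[OF FJ_near[OF zf p' ysf m(1)[folded r'_def] m(3)]]
  obtain N' where N': "\<And>n j. 0 < l $ j \<Longrightarrow> g (x (r' (n + N')), ys (n + N')) $ j = 0" by blast
  define k where "k n = n + N'" for n
  have k: "strict_mono k" by (simp add: strict_mono_def k_def)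
  define X Y Y' where "X n = x (r' (k n))" and "Y n = y (r' (k n))" and "Y' n = ys (k n)" for n
  have limX: "X \<longlonglongrightarrow> xbar" and limY: "Y \<longlonglongrightarrow> ybar" and limY': "Y' \<longlonglongrightarrow> ybar"
    using lim'[THEN LIMSEQ_subseq_LIMSEQ, OF k] ys(2)[THEN LIMSEQ_subseq_LIMSEQ, OF k]
    by (simp_all add: comp_def X_def[abs_def] Y_def[abs_def] Y'_def[abs_def])
  have gY: "\<And>j. j \<in> J - {q} \<Longrightarrow> g (X n, Y n) $ j = 0" "g (X n, Y n) $ q \<le> 0" for n
    using sm by (simp_all add: X_def Y_def)
  have gY': "\<And>j. j \<in> J - {q'} \<Longrightarrow> g (X n, Y' n) $ j = 0" "g (X n, Y' n) $ q' \<le> 0" for n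
    using N'[OF q'(2), folded k_def] ysf[of "k n"] by (simp_all add: X_def Y'_def feasible_def)
  have ne: "Y n - Y' n \<noteq> 0" for n
    using no[of "r' (k n)"] ys(1)[of "k n"] unfolding sxy by (auto simp: sol_graph_def X_def Y_def Y'_def r'_def)
  then obtain \<rho> d where \<rho>: "strict_mono \<rho>" "norm d = 1" "(\<lambda>n. (Y (\<rho> n) - Y' (\<rho> n)) /\<^sub>R norm (Y (\<rho> n) - Y' (\<rho> n))) \<longlonglongrightarrow> d"
    by (rule unit_direction)
  define R where "R n = norm (Y (\<rho> n) - Y' (\<rho> n))" for n
  have R: "0 < R n" for n unfolding R_def zero_less_norm_iff by (rule ne)
  note lim2 = limX[THEN LIMSEQ_subseq_LIMSEQ, OF \<rho>(1), unfolded comp_def]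
    limY[THEN LIMSEQ_subseq_LIMSEQ, OF \<rho>(1), unfolded comp_def] limY'[THEN LIMSEQ_subseq_LIMSEQ, OF \<rho>(1), unfolded comp_def]
  have gq: "(\<lambda>n. (g (X (\<rho> n), Y (\<rho> n)) $ j - g (X (\<rho> n), Y' (\<rho> n)) $ j) / R n) \<longlonglongrightarrow> cgrad_y g j z \<bullet> d" for j
    unfolding z_def by (rule g_quotient(1)[OF lim2 \<rho>(3)[folded R_def]])
  have both: "cgrad_y g j z \<bullet> d = 0" if "j \<in> J - {q}" "j \<in> J - {q'}" for j
    using gq[of j] unfolding gY(1)[OF that(1)] gY'(1)[OF that(2)] by (simp add: LIMSEQ_const_iff)
  have qJ: "q \<in> J" "q' \<in> J" using q q'(1) Q(1) by blast+
  have "d = 0"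
  proof (cases "q' = q")
    case True
    show ?thesis by (rule tang[OF qJ(1)]) (use both True in simp)
  next
    case False
    have a: "cgrad_y g q z \<bullet> d \<le> 0"
    proof (rule tendsto_upperbound[OF gq])
      have "g (X n, Y' n) $ q = 0" for n using gY'(1)[of q n] False qJ by simp
      then have "(g (X (\<rho> n), Y (\<rho> n)) $ q - g (X (\<rho> n), Y' (\<rho> n)) $ q) / R n \<le> 0" for n
        using gY(2)[of "\<rho> n"] R[of n] by (simp add: divide_nonpos_pos)
      then show "\<forall>\<^sub>F n in sequentially. (g (X (\<rho> n), Y (\<rho> n)) $ q - g (X (\<rho> n), Y' (\<rho> n)) $ q) / R n \<le> 0"
        by (intro always_eventually allI)
    qed simp
    have b: "0 \<le> cgrad_y g q' z \<bullet> d"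
    proof (rule tendsto_lowerbound[OF gq])
      have "g (X n, Y n) $ q' = 0" for n using gY(1)[of q' n] False qJ by simp
      then have "0 \<le> (g (X (\<rho> n), Y (\<rho> n)) $ q' - g (X (\<rho> n), Y' (\<rho> n)) $ q') / R n" for n
        using gY'(2)[of "\<rho> n"] R[of n] by (simp add: divide_nonpos_pos)
      then show "\<forall>\<^sub>F n in sequentially. 0 \<le> (g (X (\<rho> n), Y (\<rho> n)) $ q' - g (X (\<rho> n), Y' (\<rho> n)) $ q') / R n"
        by (intro always_eventually allI)
    qed simp
    have neg: "\<mu> $ q * \<mu> $ q' < 0" using Q(3)[OF q q'(1)] False by simp
    \<comment> \<open>Paired with \<open>d\<close>, the relation \<open>\<mu>\<close> retains only
      the terms of \<open>q\<close> and \<open>q'\<close>. After multiplication by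
      \<open>\<mu> $ q\<close> both are nonpositive, because the two coefficients have opposite
      signs; as they sum to 0, both vanish.\<close>
    have "0 = (\<Sum>j\<in>J. \<mu> $ j *\<^sub>R cgrad_y g j z) \<bullet> d" unfolding \<mu> by simp
    also have "\<dots> = (\<Sum>j\<in>J. \<mu> $ j * (cgrad_y g j z \<bullet> d))" by (simp add: inner_sum_left)
    also have "\<dots> = (\<Sum>j\<in>{q, q'}. \<mu> $ j * (cgrad_y g j z \<bullet> d))"
      by (rule sum.mono_neutral_right) (use qJ both in auto)
    also have "\<dots> = \<mu> $ q * (cgrad_y g q z \<bullet> d) + \<mu> $ q' * (cgrad_y g q' z \<bullet> d)" using False by simp
    finally have "\<mu> $ q * (\<mu> $ q * (cgrad_y g q z \<bullet> d) + \<mu> $ q' * (cgrad_y g q' z \<bullet> d)) = 0" by simp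
    then have eq: "(\<mu> $ q * \<mu> $ q) * (cgrad_y g q z \<bullet> d) + (\<mu> $ q * \<mu> $ q') * (cgrad_y g q' z \<bullet> d) = 0"
      by (simp add: distrib_left mult.assoc)
    moreover have "(\<mu> $ q * \<mu> $ q) * (cgrad_y g q z \<bullet> d) \<le> 0" using a by (intro mult_nonneg_nonpos) simp_all
    moreover have "(\<mu> $ q * \<mu> $ q') * (cgrad_y g q' z \<bullet> d) \<le> 0"
      by (rule mult_nonpos_nonneg[OF less_imp_le[OF neg] b])
    ultimately have prod0: "(\<mu> $ q * \<mu> $ q') * (cgrad_y g q' z \<bullet> d) = 0" by linarith
    have "\<mu> $ q * \<mu> $ q' \<noteq> 0" by (rule less_imp_neq[OF neg])
    then have "cgrad_y g q' z \<bullet> d = 0" using prod0 unfolding mult_eq_0_iff by blast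
    then have "cgrad_y g j z \<bullet> d = 0" if "j \<in> J - {q}" for j using both[of j] that by (cases "j = q'") simp_all
    then show ?thesis by (rule tang[OF qJ(1)])
  qed
  then show False using \<rho>(2) by simp
qed

text \<open>Independence of the full gradients makes the active constraints a submersion in
  \<open>(x, y)\<close> alone, so no stationarity equation is involved; the third component of the
  domain only fills the inactive slots. The generator \<open>- axis q 1\<close> lets
  \<open>g\<^sub>q\<close> become negative and yields the sign of
  \<open>\<xi>\<^sub>q\<close>.\<close>

lemma branch_multipliers:
  fixes xbar :: real and ybar :: "real^'m"
  defines "z \<equiv> (xbar, ybar)" and "J \<equiv> active g (xbar, ybar)"
  assumes F: "Ck_on 1 F UNIV" and q: "q \<in> J"
    and full: "\<forall>c. (\<Sum>j\<in>J. c j * cgrad_x g j z) = 0 \<longrightarrow> (\<Sum>j\<in>J. c j *\<^sub>R cgrad_y g j z) = 0 \<longrightarrow> (\<forall>j\<in>J. c j = 0)"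
    and min: "\<forall>\<^sub>F p in nhds z. p \<in> {(x, y). (\<forall>j\<in>J - {q}. g (x, y) $ j = 0) \<and> g (x, y) $ q \<le> 0} \<longrightarrow> F z \<le> F p"
  obtains \<xi> :: "real^'p" where "0 = grad F z + grad (\<lambda>z. \<xi> \<bullet> g z) z" "\<And>i. i \<notin> J \<Longrightarrow> \<xi> $ i = 0" "0 \<le> \<xi> $ q"
proof -
  let ?p = "(xbar, ybar, 0::real^'p)"
  let ?\<pi> = "\<lambda>p::real \<times> (real^'m) \<times> (real^'p). (fst p, fst (snd p))"
  let ?G = "\<lambda>q::real \<times> (real^'m) \<times> (real^'p). (\<chi> j. if j \<in> J then g (fst q, fst (snd q)) $ j else snd (snd q) $ j)"
  let ?G' = "\<lambda>q::real \<times> (real^'m) \<times> (real^'p).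
    (\<chi> j. if j \<in> J then cgrad_x g j z * fst q + cgrad_y g j z \<bullet> fst (snd q) else snd (snd q) $ j)"
  have der: "(?G has_derivative ?G') (at ?p)"
    using constraint_map_has_derivative[of J z 0] by (simp add: z_def cong: if_cong)
  have inner: "c \<bullet> ?G' (a, v, w) = a * (\<Sum>j\<in>J. c $ j * cgrad_x g j z)
        + (\<Sum>j\<in>J. c $ j *\<^sub>R cgrad_y g j z) \<bullet> v + (\<Sum>j\<in>-J. c $ j * w $ j)" for c w :: "real^'p" and a v
    unfolding inner_vec_if
    by (simp add: distrib_left sum.distrib inner_sum_left sum_distrib_left ac_simps)
  have components: "a1 = 0 \<and> a2 = 0 \<and> (\<forall>j\<in>-J. a4 j = 0)"
    if H: "\<And>a v (w::real^'p). a * a1 + a2 \<bullet> v + (\<Sum>j\<in>-J. a4 j * w $ j) = 0"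
    for a1 :: real and a2 :: "real^'m" and a4 :: "'p \<Rightarrow> real"
  proof (intro conjI ballI)
    show "a1 = 0" using H[of 1 0 0] by simp
    have "a2 \<bullet> a2 = 0" using H[of 0 a2 0] by simp
    then show "a2 = 0" by simp
    show "a4 j = 0" if j: "j \<in> - J" for j
    proof -
      have "(\<Sum>i\<in>-J. a4 i * axis j 1 $ i) = (\<Sum>i\<in>-J. if i = j then a4 i else 0)"
        by (intro sum.cong) (auto simp: axis_def)
      also have "\<dots> = a4 j" using j by (simp add: sum.delta')
      finally show ?thesis using H[of 0 0 "axis j 1"] by simp
    qed
  qed
  have surj: "c = 0" if c: "\<And>q. c \<bullet> ?G' q = 0" for c :: "real^'p"
  proof -
    have "a * (\<Sum>j\<in>J. c $ j * cgrad_x g j z) + (\<Sum>j\<in>J. c $ j *\<^sub>R cgrad_y g j z) \<bullet> v + (\<Sum>j\<in>-J. c $ j * w $ j) = 0" for a v w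
      using c[of "(a, v, w)"] unfolding inner .
    note comp = components[OF this]
    have "c $ j = 0" for j
    proof (cases "j \<in> J")
      case True
      show ?thesis
        using full[THEN spec, of "\<lambda>j. c $ j", THEN mp, OF comp[THEN conjunct1], THEN mp, OF comp[THEN conjunct2, THEN conjunct1]] True
        by (rule bspec)
    next
      case False
      then show ?thesis using comp[THEN conjunct2, THEN conjunct2] by simp
    qed
    then show ?thesis by (simp add: vec_eq_iff)
  qed
  have Fder: "((\<lambda>q. F (?\<pi> q)) has_derivative (\<lambda>q. grad F z \<bullet> ?\<pi> q)) (at ?p)"
  proof (rule has_derivative_compose[where f = ?\<pi> and f' = ?\<pi>])
    show "(F has_derivative (\<lambda>q. grad F z \<bullet> q)) (at (?\<pi> ?p))"
      using C1_has_derivative_grad[OF F, of z] by (simp add: z_def)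
  qed (intro has_derivative_Pair has_derivative_fst has_derivative_snd has_derivative_ident)
  have Gp: "?G ?p = 0" by (simp add: vec_eq_iff J_def active_def)
  have \<pi>: "filterlim ?\<pi> (nhds z) (nhds ?p)"
  proof -
    have "isCont ?\<pi> ?p" by (intro continuous_intros)
    then show ?thesis using tendsto_at_iff_tendsto_nhds[of ?\<pi> ?p] by (simp add: isCont_def z_def)
  qed
  have min': "\<forall>\<^sub>F p in nhds ?p. (\<exists>t\<ge>0. ?G p = ?G ?p + t *\<^sub>R e) \<longrightarrow> F (?\<pi> ?p) \<le> F (?\<pi> p)" if e: "e \<in> {0, - axis q 1}" for e
    using filterlim_iff[THEN iffD1, OF \<pi>, rule_format, OF min]
  proof eventually_elim
    case (elim p)
    show ?case
    proof
      assume "\<exists>t\<ge>0. ?G p = ?G ?p + t *\<^sub>R e"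
      then obtain t where t: "t \<ge> 0" "?G p = t *\<^sub>R e" unfolding Gp by auto
      have gj: "g (?\<pi> p) $ j = t * e $ j" if "j \<in> J" for j
        using arg_cong[OF t(2), of "\<lambda>v. v $ j"] that by simp
      have "e $ j = 0" if "j \<noteq> q" for j using e that by (auto simp: axis_def)
      then have "\<forall>j\<in>J - {q}. g (?\<pi> p) $ j = 0" using gj by simp
      moreover have "e $ q \<le> 0" using e by (auto simp: axis_def)
      then have "g (?\<pi> p) $ q \<le> 0" unfolding gj[OF q] using t(1) by (rule mult_nonneg_nonpos[rotated])
      ultimately show "F (?\<pi> ?p) \<le> F (?\<pi> p)" using elim by (simp add: z_def)
    qed
  qed
  have "\<exists>c. (\<forall>q. grad F z \<bullet> ?\<pi> q = c \<bullet> ?G' q) \<and> (\<forall>e\<in>{0, - axis q 1}. 0 \<le> c \<bullet> e)"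
  proof (rule multiplier_rule[where C = "{0, - axis q 1}", OF continuous_on_constraint_map der surj Fder insertI1 min'])
    fix c assume "\<And>q. grad F z \<bullet> ?\<pi> q = c \<bullet> ?G' q" "\<And>e. e \<in> {0, - axis q 1} \<Longrightarrow> 0 \<le> c \<bullet> e"
    then show ?thesis by (intro exI[of _ c] conjI allI ballI)
  qed
  then obtain c where c: "\<forall>q. grad F z \<bullet> ?\<pi> q = c \<bullet> ?G' q" "\<forall>e\<in>{0, - axis q 1}. 0 \<le> c \<bullet> e"
    by (elim exE conjE)
  have "a * ((\<Sum>j\<in>J. c $ j * cgrad_x g j z) - grad_x F z) + ((\<Sum>j\<in>J. c $ j *\<^sub>R cgrad_y g j z) - grad_y F z) \<bullet> v
      + (\<Sum>j\<in>-J. c $ j * w $ j) = 0" for a v w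
  proof -
    have "grad_x F z * a + grad_y F z \<bullet> v = grad F z \<bullet> ?\<pi> (a, v, w)" by (simp add: grad_def)
    also have "\<dots> = c \<bullet> ?G' (a, v, w)" using c(1) by (rule spec)
    also note inner
    finally show ?thesis by (simp add: right_diff_distrib inner_diff_left mult.commute)
  qed
  note comp = components[OF this]
  note c0 = comp[THEN conjunct1] comp[THEN conjunct2, THEN conjunct1]
  have off: "c $ j = 0" if "j \<notin> J" for j using bspec[OF comp[THEN conjunct2, THEN conjunct2], of j] that by simp
  have off': "\<forall>j. j \<notin> J \<longrightarrow> (- c) $ j = 0" using off by simp
  show ?thesis
  proof (rule that[of "- c"])
    have "grad (\<lambda>z. (- c) \<bullet> g z) z = (\<Sum>j\<in>J. (- c) $ j *\<^sub>R cgrad g j z)"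
      unfolding inner_eq grad_lag cgrad_def sum_active[OF off'] by simp
    also have "\<dots> = (\<Sum>j\<in>J. - (c $ j * cgrad_x g j z, c $ j *\<^sub>R cgrad_y g j z))"
      by (intro sum.cong refl) (simp add: cgrad_def grad_def cgrad_x_def cgrad_y_def)
    also have "\<dots> = - ((\<Sum>j\<in>J. c $ j * cgrad_x g j z), (\<Sum>j\<in>J. c $ j *\<^sub>R cgrad_y g j z))"
      unfolding sum_negf sum_prod ..
    also have "\<dots> = - grad F z"
      using c0 unfolding right_minus_eq by (simp only: grad_def)
    finally show "0 = grad F z + grad (\<lambda>z. (- c) \<bullet> g z) z" by (simp only: right_minus)
    show "(- c) $ i = 0" if "i \<notin> J" for i using off[OF that] by simp
    have "0 \<le> c \<bullet> - axis q 1" using c(2) by (rule bspec) simp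
    then show "0 \<le> (- c) $ q" by (simp add: inner_axis)
  qed
qed

end

context bilevel_lower_level
begin

text \<open>Failure of MFCQ lets Gordan's alternative choose the relation with positive
  coefficients, so the KKT multipliers form a ray. Its end point loses exactly one active component
  \<open>q\<close>, and no limit of Fritz John multipliers can vanish at any other active index; a
  single branch therefore suffices.\<close>

lemma type5_1_case:
  fixes xbar :: real and ybar :: "real^'m"
  assumes F: "Ck_on 1 F UNIV" and min: "local_min_on F (sol_graph f g) (xbar, ybar)"
    and S: "sol_set f g xbar = {ybar}" and t: "type5_1 f g (xbar, ybar)"
  shows "\<exists>ubar q \<mu>bar.
          ubar \<in> M_KKT f g (xbar, ybar) \<and> q \<in> active g (xbar, ybar) \<and> ubar $ q = 0 \<and>
          (\<forall>j\<in>active g (xbar, ybar) - {q}. ubar $ j > 0) \<and>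
          (\<forall>u' q'. u' \<in> M_KKT f g (xbar, ybar) \<and> q' \<in> active g (xbar, ybar) \<and> u' $ q' = 0 \<and>
                   (\<forall>j\<in>active g (xbar, ybar) - {q'}. u' $ j > 0) \<longrightarrow> u' = ubar) \<and>
          (\<forall>j\<in>active g (xbar, ybar). \<mu>bar $ j > 0) \<and>
          (\<forall>j. j \<notin> active g (xbar, ybar) \<longrightarrow> \<mu>bar $ j = 0) \<and>
          M_KKT f g (xbar, ybar) = {ubar + t *\<^sub>R \<mu>bar | t. 0 \<le> t} \<and>
          local_min_on (\<lambda>(x, y, u). F (x, y)) (mpcc_set f g (active g (xbar, ybar)) {q})
            (xbar, ybar, ubar) \<and>
          (\<exists>\<xi>. star_system F (lagrangian f g ubar) g (xbar, ybar) 0 \<xi> \<and>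
               (\<forall>j\<in>active g (xbar, ybar) - {q}. cgrad_y g j (xbar, ybar) \<bullet> 0 = 0) \<and>
               cgrad_y g q (xbar, ybar) \<bullet> 0 \<le> 0 \<and> 0 \<le> \<xi> $ q) \<and>
          local_min_on F
            {(x, y). (\<forall>j\<in>active g (xbar, ybar) - {q}. g (x, y) $ j = 0) \<and> g (x, y) $ q \<le> 0}
            (xbar, ybar) \<and>
          (\<exists>\<xi>. 0 = grad F (xbar, ybar) + grad (\<lambda>z. \<xi> \<bullet> g z) (xbar, ybar) \<and>
               (\<forall>i. i \<notin> active g (xbar, ybar) \<longrightarrow> \<xi> $ i = 0) \<and> 0 \<le> \<xi> $ q)"
proof -
  define J where "J = active g (xbar, ybar)"
  let ?z = "(xbar, ybar)"
  have ysol: "ybar \<in> sol_set f g xbar" using S by simp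
  have zf: "snd ?z \<in> feasible g (fst ?z)" using ysol by (simp add: sol_set_def)
  have t5: "type5 f g ?z" and nM: "\<not> MFCQ g ?z" and K0: "M_KKT f g ?z \<noteq> {}" using t unfolding type5_1_def by blast+
  obtain m :: "real^'p" where m1: "(\<Sum>j\<in>J. m $ j *\<^sub>R cgrad_y g j ?z) = 0" and m2: "\<And>j. j \<in> J \<Longrightarrow> m $ j \<noteq> 0"
    and m3: "\<And>j. j \<notin> J \<Longrightarrow> m $ j = 0"
    and rel: "\<And>c. (\<Sum>j\<in>J. c j *\<^sub>R cgrad_y g j ?z) = 0 \<Longrightarrow> \<exists>t. \<forall>j\<in>J. c j = t * m $ j"
    and nz: "\<And>c i j. grad_y f ?z + (\<Sum>j\<in>J. c j *\<^sub>R cgrad_y g j ?z) = 0 \<Longrightarrow> i \<in> J \<Longrightarrow> c i = 0 \<Longrightarrow> j \<in> J - {i} \<Longrightarrow> c j \<noteq> 0"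
    and tang: "\<And>i d. i \<in> J \<Longrightarrow> (\<And>j. j \<in> J - {i} \<Longrightarrow> cgrad_y g j ?z \<bullet> d = 0) \<Longrightarrow> d = 0"
    and full: "\<And>c j. (\<Sum>j\<in>J. c j * cgrad_x g j ?z) = 0 \<Longrightarrow> (\<Sum>j\<in>J. c j *\<^sub>R cgrad_y g j ?z) = 0 \<Longrightarrow> j \<in> J \<Longrightarrow> c j = 0"
    by (fact type5_data[OF t5, folded J_def])
  have full': "\<forall>c. (\<Sum>j\<in>J. c j * cgrad_x g j ?z) = 0 \<longrightarrow> (\<Sum>j\<in>J. c j *\<^sub>R cgrad_y g j ?z) = 0 \<longrightarrow> (\<forall>j\<in>J. c j = 0)"
  proof (intro allI impI ballI)
    fix c j assume "(\<Sum>j\<in>J. c j * cgrad_x g j ?z) = 0" "(\<Sum>j\<in>J. c j *\<^sub>R cgrad_y g j ?z) = 0" "j \<in> J"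
    then show "c j = 0" by (rule full[of c j])
  qed
  have noMF: "\<exists>j\<in>J. 0 \<le> cgrad_y g j ?z \<bullet> d" for d
    using nM unfolding MFCQ_def J_def by (metis not_le)
  obtain c where c: "\<And>j. j \<in> J \<Longrightarrow> 0 \<le> c j" "(\<Sum>j\<in>J. c j) = 1" "(\<Sum>j\<in>J. c j *\<^sub>R cgrad_y g j ?z) = 0"
    by (fact gordan[OF finite noMF])
  obtain s where s: "\<forall>j\<in>J. c j = s * m $ j" using rel[OF c(3)] by (rule exE)
  have s0: "s \<noteq> 0"
  proof
    assume "s = 0"
    then have "(\<Sum>j\<in>J. c j) = 0" using s by (intro sum.neutral) simp
    then show False using c(2) by simp
  qed
  define \<mu> where "\<mu> = s *\<^sub>R m"
  have \<mu>c: "\<mu> $ j = c j" if "j \<in> J" for j using s that by (simp add: \<mu>_def)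
  have \<mu>pos: "0 < \<mu> $ j" if j: "j \<in> J" for j
  proof -
    have "\<mu> $ j \<noteq> 0" using m2[OF j] s0 by (simp add: \<mu>_def)
    then show ?thesis using c(1)[OF j] \<mu>c[OF j] by simp
  qed
  have \<mu>off: "\<mu> $ j = 0" if "j \<notin> J" for j using m3[OF that] by (simp add: \<mu>_def)
  have \<mu>ker: "(\<Sum>j\<in>J. \<mu> $ j *\<^sub>R cgrad_y g j ?z) = 0" using c(3) \<mu>c by simp
  have rel\<mu>: "\<exists>t. \<forall>j\<in>J. a j = t * \<mu> $ j" if a: "(\<Sum>j\<in>J. a j *\<^sub>R cgrad_y g j ?z) = 0" for a
  proof -
    obtain t where "\<forall>j\<in>J. a j = t * m $ j" using rel[OF a] by (rule exE)
    then show ?thesis using s0 by (intro exI[of _ "t / s"]) (simp add: \<mu>_def)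
  qed
  have Jne: "J \<noteq> {}" using c(2) by auto
  have KKT: "v \<in> M_KKT f g ?z \<longleftrightarrow> (grad_y f ?z + (\<Sum>j\<in>J. v $ j *\<^sub>R cgrad_y g j ?z) = 0 \<and> (\<forall>j. j \<notin> J \<longrightarrow> v $ j = 0)) \<and> (\<forall>j. 0 \<le> v $ j)" for v
    unfolding mem_M_KKT[OF zf] crit_multiplier_def J_def ..
  obtain v where v: "v \<in> M_KKT f g ?z" using K0 by blast
  \<comment> \<open>Ratio test: moving back from \<open>v\<close> along \<open>\<mu>\<close>, the
    component with the least quotient reaches 0 first.\<close>
  obtain q where q: "q \<in> J" "\<And>j. j \<in> J \<Longrightarrow> v $ q / \<mu> $ q \<le> v $ j / \<mu> $ j"
    using ex_is_arg_min_if_finite[OF finite Jne, of "\<lambda>j. v $ j / \<mu> $ j"] unfolding is_arg_min_linorder by blast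
  define u where "u = v - (v $ q / \<mu> $ q) *\<^sub>R \<mu>"
  have uj: "u $ j = v $ j - (v $ q / \<mu> $ q) * \<mu> $ j" for j by (simp add: u_def)
  have ueq: "grad_y f ?z + (\<Sum>j\<in>J. u $ j *\<^sub>R cgrad_y g j ?z) = 0"
  proof -
    have "(\<Sum>j\<in>J. u $ j *\<^sub>R cgrad_y g j ?z) = (\<Sum>j\<in>J. v $ j *\<^sub>R cgrad_y g j ?z) - (v $ q / \<mu> $ q) *\<^sub>R (\<Sum>j\<in>J. \<mu> $ j *\<^sub>R cgrad_y g j ?z)"
      by (simp add: uj scaleR_diff_left sum_subtractf scaleR_sum_right)
    then show ?thesis using v unfolding KKT \<mu>ker by simp
  qed
  have uq: "u $ q = 0" using \<mu>pos[OF q(1)] by (simp add: uj)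
  have uoff: "u $ j = 0" if "j \<notin> J" for j using that v \<mu>off unfolding KKT by (simp add: uj)
  have u0: "0 \<le> u $ j" for j
  proof (cases "j \<in> J")
    case True
    have "(v $ q / \<mu> $ q) * \<mu> $ j \<le> v $ j" using q(2)[OF True] \<mu>pos[OF True] by (simp only: pos_le_divide_eq)
    then show ?thesis by (simp add: uj)
  qed (simp add: uoff)
  have uK: "u \<in> M_KKT f g ?z" unfolding KKT using ueq uoff u0 by blast
  have upos: "0 < u $ j" if "j \<in> J - {q}" for j
    using nz[of "\<lambda>j. u $ j", OF ueq q(1) uq that] u0[of j] by simp
  have Mset: "M_KKT f g ?z = {u + t *\<^sub>R \<mu> | t. 0 \<le> t}"
  proof (intro set_eqI iffI)
    fix w assume w: "w \<in> M_KKT f g ?z"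
    have "(\<Sum>j\<in>J. w $ j *\<^sub>R cgrad_y g j ?z) = (\<Sum>j\<in>J. u $ j *\<^sub>R cgrad_y g j ?z)"
      using w[unfolded KKT] ueq by (metis add_left_cancel)
    then have "(\<Sum>j\<in>J. (w $ j - u $ j) *\<^sub>R cgrad_y g j ?z) = 0"
      by (simp add: scaleR_diff_left sum_subtractf)
    from rel\<mu>[OF this] obtain t where t: "\<forall>j\<in>J. w $ j - u $ j = t * \<mu> $ j" by (rule exE)
    have "w = u + t *\<^sub>R \<mu>"
    proof (subst vec_eq_iff, rule allI)
      fix j show "w $ j = (u + t *\<^sub>R \<mu>) $ j"
      proof (cases "j \<in> J")
        case True then show ?thesis using bspec[OF t True] by simp
      next
        case False then show ?thesis using w[unfolded KKT] uoff[OF False] \<mu>off[OF False] by simp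
      qed
    qed
    moreover have "0 \<le> t"
    proof -
      have "t * \<mu> $ q = w $ q" using bspec[OF t q(1)] uq by simp
      then have "0 \<le> t * \<mu> $ q" using w[unfolded KKT] by simp
      then show ?thesis using \<mu>pos[OF q(1)] by (simp add: zero_le_mult_iff)
    qed
    ultimately show "w \<in> {u + t *\<^sub>R \<mu> | t. 0 \<le> t}" by blast
  next
    fix w assume "w \<in> {u + t *\<^sub>R \<mu> | t. 0 \<le> t}"
    then obtain t where t: "w = u + t *\<^sub>R \<mu>" "0 \<le> t" by blast
    have wj: "w $ j = u $ j + t * \<mu> $ j" for j by (simp add: t(1))
    have "(\<Sum>j\<in>J. w $ j *\<^sub>R cgrad_y g j ?z) = (\<Sum>j\<in>J. u $ j *\<^sub>R cgrad_y g j ?z) + t *\<^sub>R (\<Sum>j\<in>J. \<mu> $ j *\<^sub>R cgrad_y g j ?z)"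
      by (simp add: wj scaleR_add_left sum.distrib scaleR_sum_right)
    moreover have "0 \<le> w $ j" for j
    proof (cases "j \<in> J")
      case True
      then show ?thesis unfolding wj using u0[of j] \<mu>pos[OF True] t(2) by (intro add_nonneg_nonneg mult_nonneg_nonneg) simp_all
    next
      case False
      then show ?thesis by (simp add: wj uoff \<mu>off)
    qed
    ultimately show "w \<in> M_KKT f g ?z" unfolding KKT using ueq \<mu>ker by (simp add: wj uoff \<mu>off)
  qed
  have unique: "u' = u" if u': "u' \<in> M_KKT f g ?z" "q' \<in> J" "u' $ q' = 0" for u' q'
  proof -
    obtain t where t: "u' = u + t *\<^sub>R \<mu>" "0 \<le> t" using u'(1) unfolding Mset by blast
    have "u $ q' + t * \<mu> $ q' = 0" using u'(3) by (simp add: t(1))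
    then have "t * \<mu> $ q' \<le> 0" using u0[of q'] by linarith
    then have "t \<le> 0" using \<mu>pos[OF u'(2)] by (simp add: mult_le_0_iff)
    then have "t = 0" using t(2) by simp
    then show ?thesis by (simp add: t(1))
  qed
  \<comment> \<open>Such a multiplier is either a positive multiple of \<open>\<mu>\<close> or
    rescales to a point of the ray; in both cases \<open>q\<close> is the only active index at which
    it can vanish.\<close>
  have FJpos: "\<exists>q\<in>{q}. \<forall>j\<in>J - {q}. 0 < l $ j" if l: "(l0, l) \<in> M_FJ f g ?z" for l0 l
  proof (cases "l0 = 0")
    case True
    have l': "(\<Sum>j\<in>J. l $ j *\<^sub>R cgrad_y g j ?z) = 0" "(\<Sum>j\<in>J. l $ j) = 1" "\<forall>j. 0 \<le> l $ j"
      using l unfolding mem_M_FJ[OF zf] J_def[symmetric] True by simp_all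
    obtain t where t: "\<forall>j\<in>J. l $ j = t * \<mu> $ j" using rel\<mu>[OF l'(1)] by (rule exE)
    have "t \<noteq> 0"
    proof
      assume "t = 0"
      then have "(\<Sum>j\<in>J. l $ j) = 0" using t by (intro sum.neutral) simp
      then show False using l'(2) by simp
    qed
    have "0 < l $ j" if j: "j \<in> J" for j
    proof -
      have "l $ j \<noteq> 0" using bspec[OF t j] \<open>t \<noteq> 0\<close> \<mu>pos[OF j] by simp
      moreover have "0 \<le> l $ j" using l'(3) by blast
      ultimately show ?thesis by linarith
    qed
    then show ?thesis by simp
  next
    case False
    from KKT_of_FJ[OF zf l False] obtain t where t: "(1 / l0) *\<^sub>R l = u + t *\<^sub>R \<mu>" "0 \<le> t" unfolding Mset by blast
    have l0: "0 < l0" using l False by (simp add: M_FJ_def)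
    have "0 < l $ j" if j: "j \<in> J - {q}" for j
    proof -
      have "l $ j / l0 = u $ j + t * \<mu> $ j" using arg_cong[OF t(1), of "\<lambda>v. v $ j"] by simp
      moreover have "0 < u $ j + t * \<mu> $ j"
        using upos[OF j] \<mu>pos[of j] j t(2) by (intro add_pos_nonneg mult_nonneg_nonneg) simp_all
      ultimately have "0 < l $ j / l0" by (simp only:)
      then show ?thesis using l0 unfolding zero_less_divide_iff by linarith
    qed
    then show ?thesis by simp
  qed
  define B where "B = {(x, y). (\<forall>j\<in>J - {q}. g (x, y) $ j = 0) \<and> g (x, y) $ q \<le> 0}"
  have evB: "\<forall>\<^sub>F p in nhds ?z. p \<in> B \<longrightarrow> p \<in> sol_graph f g"
    unfolding B_def J_def
    by (rule branch_near_solution[OF S \<mu>ker[unfolded J_def] tang[unfolded J_def] _ FJpos[unfolded J_def]])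
      (use q(1) in \<open>simp_all add: J_def\<close>)
  have zB: "?z \<in> B" using q(1) by (simp add: B_def J_def active_def)
  have cont_id: "isCont (\<lambda>p::real \<times> (real^'m). p) ?z" by simp
  have minB: "\<forall>\<^sub>F p in nhds ?z. p \<in> B \<longrightarrow> F ?z \<le> F p" and lmB: "local_min_on F B ?z"
    using local_min_transfer[of F "sol_graph f g" "\<lambda>p. p" ?z B, OF min zB cont_id evB] by blast+
  obtain \<xi> :: "real^'p" where \<xi>: "0 = grad F ?z + grad (\<lambda>z. \<xi> \<bullet> g z) ?z" "\<And>i. i \<notin> J \<Longrightarrow> \<xi> $ i = 0" "0 \<le> \<xi> $ q"
    using branch_multipliers[OF F q(1)[unfolded J_def] full'[unfolded J_def] minB[unfolded B_def J_def]] unfolding J_def by blast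
  let ?\<pi> = "\<lambda>p::real \<times> (real^'m) \<times> (real^'p). (fst p, fst (snd p))"
  have cont: "isCont ?\<pi> p" for p by (intro continuous_intros)
  define A where "A = mpcc_set f g J {q}"
  have uA: "(xbar, ybar, u) \<in> A"
    using ueq uq q(1) unfolding A_def mpcc_set_def by (simp add: J_def active_def)
  have AB: "?\<pi> p \<in> B" if "p \<in> A" for p
    using that unfolding A_def B_def mpcc_set_def by (auto simp: case_prod_beta)
  have \<pi>: "filterlim ?\<pi> (nhds ?z) (nhds (xbar, ybar, u))"
    using cont[of "(xbar, ybar, u)"] tendsto_at_iff_tendsto_nhds[of ?\<pi> "(xbar, ybar, u)"] by (simp add: isCont_def)
  have evA: "\<forall>\<^sub>F p in nhds (xbar, ybar, u). p \<in> A \<longrightarrow> ?\<pi> p \<in> sol_graph f g"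
    using filterlim_iff[THEN iffD1, OF \<pi>, rule_format, OF evB] by eventually_elim (use AB in blast)
  have "local_min_on (\<lambda>p. F (?\<pi> p)) A (xbar, ybar, u)"
    using local_min_transfer(2)[of F "sol_graph f g" ?\<pi> "(xbar, ybar, u)" A, unfolded fst_conv snd_conv, OF min uA cont evA] .
  then have lmA: "local_min_on (\<lambda>(x, y, u). F (x, y)) A (xbar, ybar, u)" unfolding case_prod_beta .
  \<comment> \<open>With \<open>w = 0\<close> the Hessian terms drop out, and the system becomes the
    KKT condition of the branch problem.\<close>
  have star: "star_system F (lagrangian f g u) g ?z 0 \<xi>"
    unfolding star_system_def using \<xi>(1,2) by (simp add: grad_def zero_prod_def J_def)
  show ?thesis
    unfolding J_def[symmetric]
  proof (rule exI[of _ u], rule exI[of _ q], rule exI[of _ \<mu>], intro conjI)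
    show "\<exists>\<xi>. star_system F (lagrangian f g u) g ?z 0 \<xi> \<and>
        (\<forall>j\<in>J - {q}. cgrad_y g j ?z \<bullet> 0 = 0) \<and> cgrad_y g q ?z \<bullet> 0 \<le> 0 \<and> 0 \<le> \<xi> $ q"
      using star \<xi>(3) by (intro exI[of _ \<xi>]) simp
    show "\<exists>\<xi>. 0 = grad F ?z + grad (\<lambda>z. \<xi> \<bullet> g z) ?z \<and> (\<forall>i. i \<notin> J \<longrightarrow> \<xi> $ i = 0) \<and> 0 \<le> \<xi> $ q"
      using \<xi> by (intro exI[of _ \<xi>] conjI allI impI)
    show "\<forall>u' q'. u' \<in> M_KKT f g ?z \<and> q' \<in> J \<and> u' $ q' = 0 \<and> (\<forall>j\<in>J - {q'}. u' $ j > 0) \<longrightarrow> u' = u"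
      using unique by blast
    show "local_min_on F {(x, y). (\<forall>j\<in>J - {q}. g (x, y) $ j = 0) \<and> g (x, y) $ q \<le> 0} ?z"
      using lmB unfolding B_def .
    show "u \<in> M_KKT f g ?z" by (rule uK)
    show "q \<in> J" by (rule q(1))
    show "u $ q = 0" by (rule uq)
    show "\<forall>j\<in>J - {q}. u $ j > 0" using upos by (rule ballI)
    show "\<forall>j\<in>J. \<mu> $ j > 0" using \<mu>pos by (rule ballI)
    show "\<forall>j. j \<notin> J \<longrightarrow> \<mu> $ j = 0" using \<mu>off by (intro allI impI)
    show "M_KKT f g ?z = {u + t *\<^sub>R \<mu> | t. 0 \<le> t}" by (rule Mset)
    show "local_min_on (\<lambda>(x, y, u). F (x, y)) (mpcc_set f g J {q}) (xbar, ybar, u)"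
      using lmA unfolding A_def .
  qed
qed

text \<open>MFCQ rules out \<open>u0 = 0\<close> and forces both signs in the relation
  \<open>m\<close>, so \<open>v + t *\<^sub>R m\<close> stays nonnegative exactly on a compact
  interval of \<open>t\<close>, with one end for each sign. At a KKT multiplier at most one of
  \<open>u\<^sub>q\<close>, \<open>u\<^sub>r\<close> vanishes, and complementarity keeps the
  constraint of the other active nearby, which reduces the two pairs to a single branch.\<close>

lemma type5_2_case:
  fixes xbar :: real and ybar :: "real^'m"
  assumes F: "Ck_on 1 F UNIV" and min: "local_min_on F (sol_graph f g) (xbar, ybar)"
    and S: "sol_set f g xbar = {ybar}" and t: "type5_2 f g (xbar, ybar)"
  shows "\<exists>q r u1 u2.
          (q \<in> active g (xbar, ybar) \<and> r \<in> active g (xbar, ybar) \<and> q \<noteq> r \<and>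
           u1 \<in> M_KKT f g (xbar, ybar) \<and> u2 \<in> M_KKT f g (xbar, ybar) \<and>
           u1 $ q = 0 \<and> (\<forall>j\<in>active g (xbar, ybar) - {q}. u1 $ j > 0) \<and>
           u2 $ r = 0 \<and> (\<forall>j\<in>active g (xbar, ybar) - {r}. u2 $ j > 0)) \<and>
          (\<forall>q' r' u1' u2'.
             q' \<in> active g (xbar, ybar) \<and> r' \<in> active g (xbar, ybar) \<and> q' \<noteq> r' \<and>
             u1' \<in> M_KKT f g (xbar, ybar) \<and> u2' \<in> M_KKT f g (xbar, ybar) \<and>
             u1' $ q' = 0 \<and> (\<forall>j\<in>active g (xbar, ybar) - {q'}. u1' $ j > 0) \<and>
             u2' $ r' = 0 \<and> (\<forall>j\<in>active g (xbar, ybar) - {r'}. u2' $ j > 0)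
             \<longrightarrow> {q', r'} = {q, r}) \<and>
          M_KKT f g (xbar, ybar) = closed_segment u1 u2 \<and>
          (\<forall>ubar\<in>M_KKT f g (xbar, ybar).
             local_min_on (\<lambda>(x, y, u). F (x, y)) (mpcc_set f g (active g (xbar, ybar)) {q, r})
               (xbar, ybar, ubar) \<and>
             (\<exists>w \<xi>. S_stationary F f g (xbar, ybar) ubar {q, r} w \<xi>) \<and>
             (\<forall>\<xi>. (\<exists>w. S_stationary F f g (xbar, ybar) ubar {q, r} w \<xi>) \<longleftrightarrow>
                  0 = grad F (xbar, ybar) + grad (\<lambda>z. \<xi> \<bullet> g z) (xbar, ybar) \<and>
                  (\<forall>i. i \<notin> active g (xbar, ybar) \<longrightarrow> \<xi> $ i = 0) \<and>
                  (ubar = u1 \<longrightarrow> 0 \<le> \<xi> $ q) \<and> (ubar = u2 \<longrightarrow> 0 \<le> \<xi> $ r)))"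
proof -
  define J where "J = active g (xbar, ybar)"
  let ?z = "(xbar, ybar)"
  have ysol: "ybar \<in> sol_set f g xbar" using S by simp
  note lm = sol_set_imp_local_min[OF ysol]
  have zf: "snd ?z \<in> feasible g (fst ?z)" using ysol by (simp add: sol_set_def)
  have t5: "type5 f g ?z" and "MFCQ g ?z" using t unfolding type5_2_def by blast+
  then obtain e where e: "\<And>j. j \<in> J \<Longrightarrow> cgrad_y g j ?z \<bullet> e < 0" unfolding MFCQ_def J_def by blast
  obtain m :: "real^'p" where m1: "(\<Sum>j\<in>J. m $ j *\<^sub>R cgrad_y g j ?z) = 0" and m2: "\<And>j. j \<in> J \<Longrightarrow> m $ j \<noteq> 0"
    and m3: "\<And>j. j \<notin> J \<Longrightarrow> m $ j = 0"
    and rel: "\<And>c. (\<Sum>j\<in>J. c j *\<^sub>R cgrad_y g j ?z) = 0 \<Longrightarrow> \<exists>t. \<forall>j\<in>J. c j = t * m $ j"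
    and nz: "\<And>c i j. grad_y f ?z + (\<Sum>j\<in>J. c j *\<^sub>R cgrad_y g j ?z) = 0 \<Longrightarrow> i \<in> J \<Longrightarrow> c i = 0 \<Longrightarrow> j \<in> J - {i} \<Longrightarrow> c j \<noteq> 0"
    and tang: "\<And>i d. i \<in> J \<Longrightarrow> (\<And>j. j \<in> J - {i} \<Longrightarrow> cgrad_y g j ?z \<bullet> d = 0) \<Longrightarrow> d = 0"
    and full: "\<And>c j. (\<Sum>j\<in>J. c j * cgrad_x g j ?z) = 0 \<Longrightarrow> (\<Sum>j\<in>J. c j *\<^sub>R cgrad_y g j ?z) = 0 \<Longrightarrow> j \<in> J \<Longrightarrow> c j = 0"
    by (fact type5_data[OF t5, folded J_def])
  have full': "\<forall>c. (\<Sum>j\<in>J. c j * cgrad_x g j ?z) = 0 \<longrightarrow> (\<Sum>j\<in>J. c j *\<^sub>R cgrad_y g j ?z) = 0 \<longrightarrow> (\<forall>j\<in>J. c j = 0)"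
  proof (intro allI impI ballI)
    fix c j assume "(\<Sum>j\<in>J. c j * cgrad_x g j ?z) = 0" "(\<Sum>j\<in>J. c j *\<^sub>R cgrad_y g j ?z) = 0" "j \<in> J"
    then show "c j = 0" by (rule full[of c j])
  qed
  have KKT: "v \<in> M_KKT f g ?z \<longleftrightarrow> (grad_y f ?z + (\<Sum>j\<in>J. v $ j *\<^sub>R cgrad_y g j ?z) = 0 \<and> (\<forall>j. j \<notin> J \<longrightarrow> v $ j = 0)) \<and> (\<forall>j. 0 \<le> v $ j)" for v
    unfolding mem_M_KKT[OF zf] crit_multiplier_def J_def ..
  \<comment> \<open>With \<open>u0 = 0\<close>, pairing the relation with the MFCQ direction
    \<open>e\<close> gives a zero sum of terms of one sign, so all coefficients vanish, against the
    normalisation.\<close>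
  have l0pos: "l0 \<noteq> 0" if l: "(l0, l) \<in> M_FJ f g ?z" for l0 l
  proof
    assume l0: "l0 = 0"
    have l': "(\<Sum>j\<in>J. l $ j *\<^sub>R cgrad_y g j ?z) = 0" "(\<Sum>j\<in>J. l $ j) = 1" "\<forall>j. 0 \<le> l $ j"
      using l unfolding mem_M_FJ[OF zf] J_def[symmetric] l0 by simp_all
    have "(\<Sum>j\<in>J. l $ j * - (cgrad_y g j ?z \<bullet> e)) = - ((\<Sum>j\<in>J. l $ j *\<^sub>R cgrad_y g j ?z) \<bullet> e)"
      by (simp add: inner_sum_left sum_negf)
    then have 0: "(\<Sum>j\<in>J. l $ j * - (cgrad_y g j ?z \<bullet> e)) = 0" unfolding l' by simp
    have "l $ j * - (cgrad_y g j ?z \<bullet> e) = 0" if j: "j \<in> J" for j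
      using sum_nonneg_0[OF finite _ 0 j] l'(3) e by (simp add: mult_nonneg_nonpos less_imp_le)
    then have "l $ j = 0" if j: "j \<in> J" for j using e[OF j] j by fastforce
    then have "(\<Sum>j\<in>J. l $ j) = 0" by (intro sum.neutral) blast
    then show False using l'(2) by simp
  qed
  obtain v where v: "v \<in> M_KKT f g ?z"
  proof -
    obtain l0 l where l: "(l0, l) \<in> M_FJ f g ?z" using M_FJ_nonempty[OF lm] by fastforce
    show ?thesis by (rule that[OF KKT_of_FJ[OF zf l l0pos[OF l]]])
  qed
  have msum: "(\<Sum>j\<in>J. m $ j * (cgrad_y g j ?z \<bullet> e)) = 0"
    using arg_cong[OF m1, of "\<lambda>v. v \<bullet> e"] by (simp add: inner_sum_left)
  define P where "P = {j\<in>J. 0 < m $ j}"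
  define N where "N = {j\<in>J. m $ j < 0}"
  have Jne: "J \<noteq> {}" using t5 unfolding type5_def J_def by fastforce
  have P: "P \<noteq> {}"
  proof
    assume "P = {}"
    have "0 < m $ j * (cgrad_y g j ?z \<bullet> e)" if j: "j \<in> J" for j
    proof -
      have "\<not> 0 < m $ j" using \<open>P = {}\<close> j unfolding P_def by blast
      then have "m $ j < 0" using m2[OF j] by linarith
      then show ?thesis using e[OF j] by (rule mult_neg_neg)
    qed
    then have "0 < (\<Sum>j\<in>J. m $ j * (cgrad_y g j ?z \<bullet> e))" by (intro sum_pos finite Jne)
    then show False using msum by simp
  qed
  have N: "N \<noteq> {}"
  proof
    assume "N = {}"
    have "0 < m $ j * - (cgrad_y g j ?z \<bullet> e)" if j: "j \<in> J" for j
    proof -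
      have "\<not> m $ j < 0" using \<open>N = {}\<close> j unfolding N_def by blast
      then have "0 < m $ j" using m2[OF j] by linarith
      then show ?thesis using e[OF j] by (intro mult_pos_pos) simp_all
    qed
    then have "0 < (\<Sum>j\<in>J. m $ j * - (cgrad_y g j ?z \<bullet> e))" by (intro sum_pos finite Jne)
    then show False using msum by (simp add: sum_negf)
  qed
  \<comment> \<open>Positive components of \<open>m\<close> bound \<open>t\<close> from below and
    negative ones from above; \<open>q\<close> and \<open>r\<close> attain the tightest of these
    bounds, \<open>a\<close> and \<open>b\<close>.\<close>
  obtain q where q: "q \<in> P" "\<And>j. j \<in> P \<Longrightarrow> v $ q / m $ q \<le> v $ j / m $ j"
    using ex_is_arg_min_if_finite[OF finite P, of "\<lambda>j. v $ j / m $ j"] unfolding is_arg_min_linorder by blast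
  obtain r where r: "r \<in> N" "\<And>j. j \<in> N \<Longrightarrow> - (v $ r / m $ r) \<le> - (v $ j / m $ j)"
    using ex_is_arg_min_if_finite[OF finite N, of "\<lambda>j. - (v $ j / m $ j)"] unfolding is_arg_min_linorder by blast
  have qJ: "q \<in> J" "0 < m $ q" and rJ: "r \<in> J" "m $ r < 0" using q(1) r(1) by (simp_all add: P_def N_def)
  then have qr: "q \<noteq> r" by auto
  define a b where "a = - (v $ q / m $ q)" and "b = - (v $ r / m $ r)"
  have mem: "v + t *\<^sub>R m \<in> M_KKT f g ?z \<longleftrightarrow> a \<le> t \<and> t \<le> b" for t
  proof -
    have wj: "(v + t *\<^sub>R m) $ j = v $ j + t * m $ j" for j by simp
    have "(\<Sum>j\<in>J. (v + t *\<^sub>R m) $ j *\<^sub>R cgrad_y g j ?z) = (\<Sum>j\<in>J. v $ j *\<^sub>R cgrad_y g j ?z) + t *\<^sub>R (\<Sum>j\<in>J. m $ j *\<^sub>R cgrad_y g j ?z)"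
      by (simp add: scaleR_add_left sum.distrib scaleR_sum_right)
    then have s: "(\<Sum>j\<in>J. (v + t *\<^sub>R m) $ j *\<^sub>R cgrad_y g j ?z) = (\<Sum>j\<in>J. v $ j *\<^sub>R cgrad_y g j ?z)" unfolding m1 by simp
    have off: "(v + t *\<^sub>R m) $ j = 0" if "j \<notin> J" for j using v[unfolded KKT] m3[OF that] that by simp
    have "v + t *\<^sub>R m \<in> M_KKT f g ?z \<longleftrightarrow> (\<forall>j. 0 \<le> (v + t *\<^sub>R m) $ j)"
      unfolding KKT s using v[unfolded KKT] off by blast
    also have "\<dots> \<longleftrightarrow> a \<le> t \<and> t \<le> b"
    proof
      assume all: "\<forall>j. 0 \<le> (v + t *\<^sub>R m) $ j"
      have "0 \<le> v $ q + t * m $ q" "0 \<le> v $ r + t * m $ r" using all wj by metis+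
      then have "- v $ q \<le> t * m $ q" "- v $ r \<le> t * m $ r" by simp_all
      then show "a \<le> t \<and> t \<le> b"
        using qJ(2) rJ(2) unfolding a_def b_def minus_divide_left by (simp only: pos_divide_le_eq neg_le_divide_eq)
    next
      assume ab: "a \<le> t \<and> t \<le> b"
      show "\<forall>j. 0 \<le> (v + t *\<^sub>R m) $ j"
      proof
        fix j
        consider "j \<notin> J" | "j \<in> P" | "j \<in> N" using m2[of j] unfolding P_def N_def by fastforce
        then show "0 \<le> (v + t *\<^sub>R m) $ j"
        proof cases
          case 1
          show ?thesis unfolding off[OF 1] by simp
        next
          case 2
          then have "- (v $ j) / m $ j \<le> t" using q(2)[OF 2] ab unfolding a_def by simp
          moreover have "0 < m $ j" using 2 by (simp add: P_def)
          ultimately have "- (v $ j) \<le> t * m $ j" by (simp only: pos_divide_le_eq)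
          then show ?thesis unfolding wj by linarith
        next
          case 3
          then have "t \<le> - (v $ j) / m $ j" using r(2)[OF 3] ab unfolding b_def by simp
          moreover have "m $ j < 0" using 3 by (simp add: N_def)
          ultimately have "- (v $ j) \<le> t * m $ j" by (simp only: neg_le_divide_eq)
          then show ?thesis unfolding wj by linarith
        qed
      qed
    qed
    finally show ?thesis .
  qed
  have all: "\<exists>t. w = v + t *\<^sub>R m" if w: "w \<in> M_KKT f g ?z" for w
  proof -
    have "(\<Sum>j\<in>J. w $ j *\<^sub>R cgrad_y g j ?z) = (\<Sum>j\<in>J. v $ j *\<^sub>R cgrad_y g j ?z)"
      using w[unfolded KKT] v[unfolded KKT] by (metis add_left_cancel)
    then have "(\<Sum>j\<in>J. (w $ j - v $ j) *\<^sub>R cgrad_y g j ?z) = 0"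
      by (simp add: scaleR_diff_left sum_subtractf)
    from rel[OF this] obtain t where t: "\<forall>j\<in>J. w $ j - v $ j = t * m $ j" by (rule exE)
    have "w = v + t *\<^sub>R m"
    proof (subst vec_eq_iff, rule allI)
      fix j show "w $ j = (v + t *\<^sub>R m) $ j"
      proof (cases "j \<in> J")
        case True then show ?thesis using bspec[OF t True] by simp
      next
        case False then show ?thesis using w[unfolded KKT] v[unfolded KKT] m3[OF False] by simp
      qed
    qed
    then show ?thesis by (rule exI)
  qed
  have ab: "a \<le> b" using mem[of 0] v by simp
  define u1 u2 where "u1 = v + a *\<^sub>R m" and "u2 = v + b *\<^sub>R m"
  have uK: "u1 \<in> M_KKT f g ?z" "u2 \<in> M_KKT f g ?z" unfolding u1_def u2_def mem using ab by simp_all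
  have u1q: "u1 $ q = 0" using qJ(2) by (simp add: u1_def a_def)
  have u2r: "u2 $ r = 0" using rJ(2) by (simp add: u2_def b_def)
  have zero_one: "0 < w $ j" if w: "w \<in> M_KKT f g ?z" and i: "i \<in> J" "w $ i = 0" and j: "j \<in> J - {i}" for w i j
  proof -
    have w': "grad_y f ?z + (\<Sum>j\<in>J. w $ j *\<^sub>R cgrad_y g j ?z) = 0" "0 \<le> w $ j" using w[unfolded KKT] by blast+
    have "w $ j \<noteq> 0" by (rule nz[of "\<lambda>j. w $ j", OF w'(1) i j])
    then show ?thesis using w'(2) by linarith
  qed
  note u1pos = zero_one[OF uK(1) qJ(1) u1q] and u2pos = zero_one[OF uK(2) rJ(1) u2r]
  have seg: "M_KKT f g ?z = closed_segment u1 u2"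
  proof (intro set_eqI iffI)
    fix w assume w: "w \<in> M_KKT f g ?z"
    obtain t where t: "w = v + t *\<^sub>R m" using all[OF w] by (rule exE)
    have tab: "a \<le> t" "t \<le> b" using w unfolding t mem by simp_all
    then have "t \<in> closed_segment a b" using ab by (simp add: closed_segment_eq_real_ivl)
    then obtain s where s: "0 \<le> s" "s \<le> 1" "t = (1 - s) * a + s * b" by (auto simp: in_segment)
    have "w = (1 - s) *\<^sub>R u1 + s *\<^sub>R u2"
      unfolding t u1_def u2_def s(3) by (simp add: algebra_simps)
    then show "w \<in> closed_segment u1 u2" using s(1,2) unfolding in_segment by blast
  next
    fix w assume "w \<in> closed_segment u1 u2"
    then obtain s where s: "0 \<le> s" "s \<le> 1" "w = (1 - s) *\<^sub>R u1 + s *\<^sub>R u2" by (auto simp: in_segment)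
    have w: "w = v + ((1 - s) * a + s * b) *\<^sub>R m"
      unfolding s(3) u1_def u2_def by (simp add: algebra_simps)
    have "(1 - s) * a + s * b \<in> closed_segment a b" unfolding in_segment using s(1,2) by auto
    then show "w \<in> M_KKT f g ?z" unfolding w mem using ab by (simp add: closed_segment_eq_real_ivl)
  qed
  \<comment> \<open>\<open>u1\<close> vanishes in \<open>J\<close> only at \<open>q\<close> and
    \<open>u2\<close> only at \<open>r\<close>. A proper convex combination is thus positive
    throughout \<open>J\<close>, and zeros occur at the end points alone.\<close>
  have zero_idx: "(i = q \<and> w = u1) \<or> (i = r \<and> w = u2)" if w: "w \<in> M_KKT f g ?z" and i: "i \<in> J" "w $ i = 0" for w i
  proof -
    obtain s where s: "0 \<le> s" "s \<le> 1" "w = (1 - s) *\<^sub>R u1 + s *\<^sub>R u2" using w unfolding seg in_segment by blast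
    have wi: "(1 - s) * u1 $ i + s * u2 $ i = 0" using i(2) by (simp add: s(3))
    have nn: "0 \<le> u1 $ i" "0 \<le> u2 $ i" using uK[unfolded KKT] by blast+
    have "0 \<le> (1 - s) * u1 $ i" "0 \<le> s * u2 $ i" using nn s by simp_all
    then have z: "(1 - s) * u1 $ i = 0" "s * u2 $ i = 0" using wi by linarith+
    show ?thesis
    proof (cases "i = q")
      case True
      then have "0 < u2 $ i" using u2pos[of i] qJ qr by simp
      then have "s = 0" using z(2) by simp
      then show ?thesis using True by (simp add: s(3))
    next
      case False
      then have "0 < u1 $ i" using u1pos[of i] i(1) by simp
      then have s1: "s = 1" using z(1) by simp
      then have "u2 $ i = 0" using z(2) by simp
      then have "i = r" using u2pos[of i] i(1) by fastforce
      then show ?thesis using s1 by (simp add: s(3))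
    qed
  qed
  have FJpos: "\<exists>i\<in>{q, r}. \<forall>j\<in>J - {i}. 0 < l $ j" if l: "(l0, l) \<in> M_FJ f g ?z" for l0 l
  proof -
    have l0: "0 < l0" using l l0pos[OF l] by (simp add: M_FJ_def)
    have w: "(1 / l0) *\<^sub>R l \<in> M_KKT f g ?z" by (rule KKT_of_FJ[OF zf l l0pos[OF l]])
    have pos: "0 < l $ j" if "0 < ((1 / l0) *\<^sub>R l) $ j" for j using that l0 by (simp add: zero_less_divide_iff)
    show ?thesis
    proof (cases "((1 / l0) *\<^sub>R l) $ q = 0")
      case True
      then show ?thesis using pos zero_one[OF w qJ(1) True] by blast
    next
      case False
      have "0 < ((1 / l0) *\<^sub>R l) $ j" if j: "j \<in> J - {r}" for j
      proof (rule ccontr)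
        assume n: "\<not> 0 < ((1 / l0) *\<^sub>R l) $ j"
        have "0 \<le> ((1 / l0) *\<^sub>R l) $ j" using w unfolding KKT by blast
        then have "((1 / l0) *\<^sub>R l) $ j = 0" using n by linarith
        from zero_idx[OF w _ this] j False \<open>((1 / l0) *\<^sub>R l) $ j = 0\<close> show False by auto
      qed
      then show ?thesis using pos by blast
    qed
  qed
  define B where "B i = {(x, y). (\<forall>j\<in>J - {i}. g (x, y) $ j = 0) \<and> g (x, y) $ i \<le> 0}" for i
  have sign: "m $ i * m $ k < 0" if "i \<in> {q, r}" "k \<in> {q, r}" "i \<noteq> k" for i k
    using that qJ(2) rJ(2) by (auto simp: mult_less_0_iff)
  have evB: "\<forall>\<^sub>F p in nhds ?z. p \<in> B i \<longrightarrow> p \<in> sol_graph f g" if "i \<in> {q, r}" for i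
    unfolding B_def J_def
    by (rule branch_near_solution[OF S m1[unfolded J_def] tang[unfolded J_def] _ FJpos[unfolded J_def] sign that])
      (use qJ(1) rJ(1) in \<open>simp_all add: J_def\<close>)
  have multB: "\<exists>\<xi>::real^'p. 0 = grad F ?z + grad (\<lambda>z. \<xi> \<bullet> g z) ?z \<and> (\<forall>i. i \<notin> J \<longrightarrow> \<xi> $ i = 0) \<and> 0 \<le> \<xi> $ i" if i: "i \<in> {q, r}" for i
  proof -
    have iJ: "i \<in> J" using i qJ(1) rJ(1) by blast
    have zB: "?z \<in> B i" using iJ by (simp add: B_def J_def active_def)
    have cont_id: "isCont (\<lambda>p::real \<times> (real^'m). p) ?z" by simp
    have minB: "\<forall>\<^sub>F p in nhds ?z. p \<in> B i \<longrightarrow> F ?z \<le> F p"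
      using local_min_transfer(1)[of F "sol_graph f g" "\<lambda>p. p" ?z "B i", OF min zB cont_id evB[OF i]] .
    show ?thesis
      using branch_multipliers[OF F iJ[unfolded J_def] full'[unfolded J_def] minB[unfolded B_def J_def]] unfolding J_def by blast
  qed
  let ?\<pi> = "\<lambda>p::real \<times> (real^'m) \<times> (real^'p). (fst p, fst (snd p))"
  have cont: "isCont ?\<pi> p" for p by (intro continuous_intros)
  define A where "A = mpcc_set f g J {q, r}"
  have lmA: "local_min_on (\<lambda>(x, y, u). F (x, y)) A (xbar, ybar, u)" if u: "u \<in> M_KKT f g ?z" for u
  proof -
    have uA: "(xbar, ybar, u) \<in> A"
      using u[unfolded KKT] qJ(1) rJ(1) unfolding A_def mpcc_set_def by (simp add: J_def active_def)
    \<comment> \<open>\<open>k\<close> is an index of the pair whose multiplier is positive at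
      \<open>u\<close>. It stays positive nearby, so complementarity gives
      \<open>g\<^sub>k = 0\<close> and the point lies on the branch of \<open>i\<close>.\<close>
    obtain i k where ik: "i \<in> {q, r}" "k \<in> {q, r}" "{q, r} = {i, k}" "i \<noteq> k" "0 < u $ k"
    proof (cases "u $ q = 0")
      case True
      have "0 < u $ r" using zero_one[OF u qJ(1) True, of r] rJ(1) qr by simp
      then show ?thesis by (intro that[of q r] qr refl) simp_all
    next
      case False
      have "0 < u $ q" using False u[unfolded KKT] by (metis order_less_le)
      then show ?thesis by (intro that[of r q] qr[symmetric] insert_commute) simp_all
    qed
    have "((\<lambda>p::real \<times> (real^'m) \<times> (real^'p). snd (snd p) $ k) \<longlongrightarrow> snd (snd (xbar, ybar, u)) $ k) (nhds (xbar, ybar, u))"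
      by (intro tendsto_vec_nth tendsto_snd) (simp add: filterlim_ident)
    then have evk: "\<forall>\<^sub>F p in nhds (xbar, ybar, u). 0 < snd (snd p) $ k"
      using order_tendstoD(1) ik(5) by fastforce
    have \<pi>: "filterlim ?\<pi> (nhds ?z) (nhds (xbar, ybar, u))"
      using cont[of "(xbar, ybar, u)"] tendsto_at_iff_tendsto_nhds[of ?\<pi> "(xbar, ybar, u)"] by (simp add: isCont_def)
    have evA: "\<forall>\<^sub>F p in nhds (xbar, ybar, u). p \<in> A \<longrightarrow> ?\<pi> p \<in> sol_graph f g"
      using filterlim_iff[THEN iffD1, OF \<pi>, rule_format, OF evB[OF ik(1)]] evk
    proof eventually_elim
      case (elim p)
      show ?case
      proof
        assume p: "p \<in> A"
        obtain x y w where pxy: "p = (x, y, w)" by (cases p)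
        have A: "\<forall>j\<in>J - {i, k}. g (x, y) $ j = 0" "\<forall>k\<in>{i, k}. g (x, y) $ k \<le> 0 \<and> w $ k * g (x, y) $ k = 0"
          using p unfolding A_def pxy mpcc_set_def ik(3) by blast+
        have "g (x, y) $ k = 0" using A(2) elim(2) by (simp add: pxy)
        then have "g (x, y) $ j = 0" if "j \<in> J - {i}" for j using A(1) that by (cases "j = k") simp_all
        then have "?\<pi> p \<in> B i" using A(2) by (simp add: B_def pxy)
        then show "?\<pi> p \<in> sol_graph f g" using elim(1) by blast
      qed
    qed
    have "local_min_on (\<lambda>p. F (?\<pi> p)) A (xbar, ybar, u)"
      using local_min_transfer(2)[of F "sol_graph f g" ?\<pi> "(xbar, ybar, u)" A, unfolded fst_conv snd_conv, OF min uA cont evA] .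
    then show ?thesis unfolding case_prod_beta .
  qed
  have S_iff: "(\<exists>w. S_stationary F f g ?z u {q, r} w \<xi>) \<longleftrightarrow>
      0 = grad F ?z + grad (\<lambda>z. \<xi> \<bullet> g z) ?z \<and> (\<forall>i. i \<notin> J \<longrightarrow> \<xi> $ i = 0) \<and> (u = u1 \<longrightarrow> 0 \<le> \<xi> $ q) \<and> (u = u2 \<longrightarrow> 0 \<le> \<xi> $ r)"
    if u: "u \<in> M_KKT f g ?z" for u \<xi>
  proof
    assume "\<exists>w. S_stationary F f g ?z u {q, r} w \<xi>"
    then obtain w where st: "star_system F (lagrangian f g u) g ?z w \<xi>"
      and w1: "\<And>j. j \<in> J - {q, r} \<Longrightarrow> cgrad_y g j ?z \<bullet> w = 0"
      and w2: "\<And>k. k \<in> {q, r} \<Longrightarrow> 0 < u $ k \<Longrightarrow> cgrad_y g k ?z \<bullet> w = 0"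
      and w3: "\<And>k. k \<in> {q, r} \<Longrightarrow> u $ k = 0 \<Longrightarrow> 0 \<le> \<xi> $ k"
      unfolding S_stationary_def J_def by blast
    \<comment> \<open>At least one of \<open>u\<^sub>q\<close>, \<open>u\<^sub>r\<close> is
      positive, so \<open>w\<close> is orthogonal to all active gradients but one, and these span
      the space.\<close>
    have w: "w = 0"
    proof (cases "u $ q = 0")
      case True
      have "cgrad_y g r ?z \<bullet> w = 0" using w2[of r] zero_one[OF u qJ(1) True, of r] rJ(1) qr by simp
      then have "cgrad_y g j ?z \<bullet> w = 0" if "j \<in> J - {q}" for j using w1[of j] that by (cases "j = r") simp_all
      then show ?thesis by (rule tang[OF qJ(1)])
    next
      case False
      have "0 < u $ q" using False u[unfolded KKT] by (metis order_less_le)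
      then have "cgrad_y g q ?z \<bullet> w = 0" using w2[of q] by simp
      then have "cgrad_y g j ?z \<bullet> w = 0" if "j \<in> J - {r}" for j using w1[of j] that by (cases "j = q") simp_all
      then show ?thesis by (rule tang[OF rJ(1)])
    qed
    have "0 = grad F ?z + grad (\<lambda>z. \<xi> \<bullet> g z) ?z" "\<forall>i. i \<notin> J \<longrightarrow> \<xi> $ i = 0"
      using st unfolding star_system_def w J_def by (simp_all add: grad_def zero_prod_def)
    then show "0 = grad F ?z + grad (\<lambda>z. \<xi> \<bullet> g z) ?z \<and> (\<forall>i. i \<notin> J \<longrightarrow> \<xi> $ i = 0) \<and> (u = u1 \<longrightarrow> 0 \<le> \<xi> $ q) \<and> (u = u2 \<longrightarrow> 0 \<le> \<xi> $ r)"
      using w3 u1q u2r by blast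
  next
    assume R: "0 = grad F ?z + grad (\<lambda>z. \<xi> \<bullet> g z) ?z \<and> (\<forall>i. i \<notin> J \<longrightarrow> \<xi> $ i = 0) \<and> (u = u1 \<longrightarrow> 0 \<le> \<xi> $ q) \<and> (u = u2 \<longrightarrow> 0 \<le> \<xi> $ r)"
    have "star_system F (lagrangian f g u) g ?z 0 \<xi>"
      unfolding star_system_def using R by (simp add: grad_def zero_prod_def J_def)
    moreover have "0 \<le> \<xi> $ k" if k: "k \<in> {q, r}" "u $ k = 0" for k
    proof -
      have "k \<in> J" using k(1) qJ(1) rJ(1) by blast
      from zero_idx[OF u this k(2)] show ?thesis using R by blast
    qed
    ultimately have "S_stationary F f g ?z u {q, r} 0 \<xi>"
      unfolding S_stationary_def by simp
    then show "\<exists>w. S_stationary F f g ?z u {q, r} w \<xi>" by (rule exI)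
  qed
  have S_ex: "\<exists>w \<xi>. S_stationary F f g ?z u {q, r} w \<xi>" if u: "u \<in> M_KKT f g ?z" for u
  proof -
    have "u1 \<noteq> u2" using u1q u2pos[of q] qJ(1) qr by auto
    \<comment> \<open>Only the end points impose a sign. The two end points differ, so the branch of
      \<open>q\<close> serves \<open>u1\<close> and the branch of \<open>r\<close> serves all other
      multipliers.\<close>
    define k where "k = (if u = u1 then q else r)"
    have "k \<in> {q, r}" by (simp add: k_def)
    from multB[OF this] obtain \<xi> :: "real^'p" where \<xi>: "0 = grad F ?z + grad (\<lambda>z. \<xi> \<bullet> g z) ?z \<and> (\<forall>i. i \<notin> J \<longrightarrow> \<xi> $ i = 0) \<and> 0 \<le> \<xi> $ k"
      by (rule exE)
    then have "\<exists>w. S_stationary F f g ?z u {q, r} w \<xi>"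
      unfolding S_iff[OF u] using \<open>u1 \<noteq> u2\<close> by (auto simp: k_def split: if_splits)
    then show ?thesis by blast
  qed
  have pair: "{q', r'} = {q, r}" if h: "q' \<in> J" "r' \<in> J" "q' \<noteq> r'" "w1 \<in> M_KKT f g ?z" "w2 \<in> M_KKT f g ?z" "w1 $ q' = 0" "w2 $ r' = 0" for q' r' w1 w2
    using zero_idx[OF h(4,1,6)] zero_idx[OF h(5,2,7)] h(3) by blast
  have pairs: "\<forall>q' r' w1 w2. q' \<in> J \<and> r' \<in> J \<and> q' \<noteq> r' \<and> w1 \<in> M_KKT f g ?z \<and> w2 \<in> M_KKT f g ?z \<and>
      w1 $ q' = 0 \<and> (\<forall>j\<in>J - {q'}. w1 $ j > 0) \<and> w2 $ r' = 0 \<and> (\<forall>j\<in>J - {r'}. w2 $ j > 0) \<longrightarrow> {q', r'} = {q, r}"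
  proof (intro allI impI, elim conjE)
    fix q' r' w1 w2
    assume "q' \<in> J" "r' \<in> J" "q' \<noteq> r'" "w1 \<in> M_KKT f g ?z" "w2 \<in> M_KKT f g ?z" "w1 $ q' = 0" "w2 $ r' = 0"
    then show "{q', r'} = {q, r}" by (rule pair)
  qed
  have u12: "q \<in> J \<and> r \<in> J \<and> q \<noteq> r \<and> u1 \<in> M_KKT f g ?z \<and> u2 \<in> M_KKT f g ?z \<and>
      u1 $ q = 0 \<and> (\<forall>j\<in>J - {q}. u1 $ j > 0) \<and> u2 $ r = 0 \<and> (\<forall>j\<in>J - {r}. u2 $ j > 0)"
    by (intro conjI ballI qJ(1) rJ(1) qr uK u1q u2r u1pos u2pos)
  have main: "\<forall>u\<in>M_KKT f g ?z. local_min_on (\<lambda>(x, y, u). F (x, y)) A (xbar, ybar, u) \<and>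
      (\<exists>w \<xi>. S_stationary F f g ?z u {q, r} w \<xi>) \<and>
      (\<forall>\<xi>. (\<exists>w. S_stationary F f g ?z u {q, r} w \<xi>) \<longleftrightarrow>
        0 = grad F ?z + grad (\<lambda>z. \<xi> \<bullet> g z) ?z \<and> (\<forall>i. i \<notin> J \<longrightarrow> \<xi> $ i = 0) \<and> (u = u1 \<longrightarrow> 0 \<le> \<xi> $ q) \<and> (u = u2 \<longrightarrow> 0 \<le> \<xi> $ r))"
  proof (rule ballI, rule conjI[OF _ conjI[OF _ allI]])
    fix u assume u: "u \<in> M_KKT f g ?z"
    show "local_min_on (\<lambda>(x, y, u). F (x, y)) A (xbar, ybar, u)" by (rule lmA[OF u])
    show "\<exists>w \<xi>. S_stationary F f g ?z u {q, r} w \<xi>" by (rule S_ex[OF u])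
    show "(\<exists>w. S_stationary F f g ?z u {q, r} w \<xi>) \<longleftrightarrow>
        0 = grad F ?z + grad (\<lambda>z. \<xi> \<bullet> g z) ?z \<and> (\<forall>i. i \<notin> J \<longrightarrow> \<xi> $ i = 0) \<and> (u = u1 \<longrightarrow> 0 \<le> \<xi> $ q) \<and> (u = u2 \<longrightarrow> 0 \<le> \<xi> $ r)" for \<xi>
      by (rule S_iff[OF u])
  qed
  show ?thesis
    unfolding J_def[symmetric]
    by (rule exI[of _ q], rule exI[of _ r], rule exI[of _ u1], rule exI[of _ u2],
        rule conjI[OF u12 conjI[OF pairs conjI[OF seg main[unfolded A_def]]]])
qed

end

section \<open>Two global solutions of the lower level problem\<close>

lemma curve_in_direction:
  fixes \<Phi> :: "'a::euclidean_space \<Rightarrow> 'b::euclidean_space"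
  assumes cont: "continuous_on UNIV \<Phi>" and der: "(\<Phi> has_derivative A) (at z)"
    and surj: "\<And>c. (\<And>v. c \<bullet> A v = 0) \<Longrightarrow> c = 0"
  obtains \<gamma> d where "\<gamma> 0 = z" "(\<gamma> has_vector_derivative d) (at 0)" "\<forall>\<^sub>F t in nhds 0. \<Phi> (\<gamma> t) = \<Phi> z + t *\<^sub>R c"
proof -
  obtain B where "A \<circ> B = id" using linear_right_inverse[OF has_derivative_linear[OF der] surj] by blast
  then have B: "A (B c) = c" by (metis comp_apply id_apply)
  obtain \<gamma> where "\<gamma> 0 = z" "(\<gamma> has_vector_derivative B c) (at 0)" "\<forall>\<^sub>F t in nhds 0. \<Phi> (\<gamma> t) = \<Phi> z + t *\<^sub>R A (B c)"
    by (rule curve_in_level_set[OF cont der surj])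
  then show ?thesis using that unfolding B by blast
qed

lemma DERIV_approx:
  fixes h :: "real \<Rightarrow> real"
  assumes "(h has_real_derivative d) (at x0)" "e > 0"
  shows "\<forall>\<^sub>F x in nhds x0. \<bar>h x - h x0 - d * (x - x0)\<bar> \<le> e * \<bar>x - x0\<bar>"
proof -
  have "\<exists>\<delta>>0. \<forall>x. norm (x - x0) < \<delta> \<longrightarrow> norm (h x - h x0 - d * (x - x0)) \<le> e * norm (x - x0)"
    using assms unfolding has_field_derivative_def has_derivative_at_alt by blast
  then show ?thesis unfolding eventually_nhds_metric by (simp add: dist_norm)
qed

context bilevel_lower_level
begin

text \<open>The last coordinate of the constraint map is \<open>x\<close>, so the curve that moves
  its value in direction \<open>(0, 0, 1)\<close> is parametrised by \<open>x - xbar\<close>. It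
  takes the place of the implicit function theorem, with a derivative at \<open>xbar\<close>
  only.\<close>

lemma type1_path:
  fixes xbar :: real and yb :: "real^'m"
  assumes u: "crit_multiplier f g (xbar, yb) u" and L: "LICQ g (xbar, yb)"
    and pd: "\<And>d. d \<in> tangent_y g (active g (xbar, yb)) (xbar, yb) \<Longrightarrow>
      d \<bullet> (hess_yy (lagrangian f g u) (xbar, yb) *v d) \<le> 0 \<Longrightarrow> d = 0"
  obtains p v p' v' where "p xbar = yb" "v xbar = u"
    "(p has_vector_derivative p') (at xbar)" "(v has_vector_derivative v') (at xbar)"
    "\<forall>\<^sub>F x in nhds xbar. (x, p x, v x) \<in> mpcc_set f g (active g (xbar, yb)) {}"
proof -
  let ?J = "active g (xbar, yb)" and ?z = "(xbar, yb)"
  let ?\<Phi> = "\<lambda>q::real \<times> (real^'m) \<times> (real^'p).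
      ((\<lambda>(x, y, u0, u). u0 *\<^sub>R grad_y f (x, y) + (\<Sum>j\<in>?J. u $ j *\<^sub>R cgrad_y g j (x, y))) (fst q, fst (snd q), 1, snd (snd q)),
       (\<chi> j. if j \<in> ?J then g (fst q, fst (snd q)) $ j else snd (snd q) $ j),
       1 * fst q + 0 \<bullet> snd (snd q))"
  let ?A = "\<lambda>q::real \<times> (real^'m) \<times> (real^'p).
      ((fst q *\<^sub>R hess_xy (lagrangian f g u) ?z + hess_yy (lagrangian f g u) ?z *v fst (snd q))
         + (\<Sum>j\<in>?J. snd (snd q) $ j *\<^sub>R cgrad_y g j ?z),
       (\<chi> j. if j \<in> ?J then cgrad_x g j ?z * fst q + cgrad_y g j ?z \<bullet> fst (snd q) else snd (snd q) $ j),
       1 * fst q + 0 \<bullet> snd (snd q))"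
  have surj: "\<forall>c1 c2 c3. c1 \<bullet> hess_xy (lagrangian f g u) ?z + (\<Sum>j\<in>?J. c2 $ j * cgrad_x g j ?z) + c3 * 1 = 0 \<longrightarrow>
      hess_yy (lagrangian f g u) ?z *v c1 + (\<Sum>j\<in>?J. c2 $ j *\<^sub>R cgrad_y g j ?z) = 0 \<longrightarrow>
      (\<forall>j\<in>?J. cgrad_y g j ?z \<bullet> c1 + c3 * (0::real^'p) $ j = 0) \<longrightarrow>
      (\<forall>j. j \<notin> ?J \<longrightarrow> c2 $ j + c3 * (0::real^'p) $ j = 0) \<longrightarrow> c1 = 0 \<and> c2 = 0 \<and> c3 = 0"
  proof (intro allI impI)
    fix c1 c2 and c3 :: real
    assume "c1 \<bullet> hess_xy (lagrangian f g u) ?z + (\<Sum>j\<in>?J. c2 $ j * cgrad_x g j ?z) + c3 * 1 = 0"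
      "hess_yy (lagrangian f g u) ?z *v c1 + (\<Sum>j\<in>?J. c2 $ j *\<^sub>R cgrad_y g j ?z) = 0"
      "\<forall>j\<in>?J. cgrad_y g j ?z \<bullet> c1 + c3 * (0::real^'p) $ j = 0" "\<forall>j. j \<notin> ?J \<longrightarrow> c2 $ j + c3 * (0::real^'p) $ j = 0"
    then show "c1 = 0 \<and> c2 = 0 \<and> c3 = 0" by (intro kkt_surjective[OF L pd]) simp_all
  qed
  note map = kkt_map[where lx = 1 and lu = 0, OF u surj]
  obtain \<gamma> d where \<gamma>: "\<gamma> 0 = (xbar, yb, u)" "(\<gamma> has_vector_derivative d) (at 0)"
    "\<forall>\<^sub>F t in nhds 0. ?\<Phi> (\<gamma> t) = ?\<Phi> (xbar, yb, u) + t *\<^sub>R (0, 0, 1)"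
  proof (rule curve_in_direction[where c = "(0, 0, 1)", OF map(1,2)])
    show "c = 0" if "\<And>q. c \<bullet> ?A q = 0" for c by (rule map(5)[OF that])
  qed (rule that, assumption+)
  have e: "?\<Phi> (xbar, yb, u) = (0, 0, 1 * xbar + 0 \<bullet> u)"
    unfolding fst_conv snd_conv by (rule map(6)[unfolded fst_conv snd_conv])
  have ev: "\<forall>\<^sub>F t in nhds 0. (xbar + t, fst (snd (\<gamma> t)), snd (snd (\<gamma> t))) \<in> mpcc_set f g ?J {}"
    using \<gamma>(3)
  proof eventually_elim
    case (elim t)
    obtain a b c where \<gamma>t: "\<gamma> t = (a, b, c)" by (cases "\<gamma> t")
    have 1: "grad_y f (a, b) + (\<Sum>j\<in>?J. c $ j *\<^sub>R cgrad_y g j (a, b)) = 0"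
      using arg_cong[OF elim[unfolded e \<gamma>t, unfolded fst_conv snd_conv case_prod_conv], of fst] by simp
    have 2: "(\<chi> j. if j \<in> ?J then g (a, b) $ j else c $ j) = 0"
      using arg_cong[OF elim[unfolded e \<gamma>t, unfolded fst_conv snd_conv case_prod_conv], of "\<lambda>q. fst (snd q)"] by simp
    have 3: "a = xbar + t"
      using arg_cong[OF elim[unfolded e \<gamma>t, unfolded fst_conv snd_conv case_prod_conv], of "\<lambda>q. snd (snd q)"] by simp
    have "g (a, b) $ j = 0" if "j \<in> ?J" for j using arg_cong[OF 2, of "\<lambda>v. v $ j"] that by simp
    then show ?case unfolding 3[symmetric] \<gamma>t mpcc_set_def using 1 by simp
  qed
  have "((\<lambda>x. x - xbar) \<longlongrightarrow> xbar - xbar) (nhds xbar)" by (intro tendsto_diff tendsto_const filterlim_ident)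
  then have sh: "filterlim (\<lambda>x. x - xbar) (nhds 0) (nhds xbar)" by simp
  have "((\<lambda>x. x - xbar) has_derivative (\<lambda>t. t)) (at xbar)" by (auto intro!: derivative_eq_intros)
  moreover have "(\<gamma> has_derivative (\<lambda>t. t *\<^sub>R d)) (at (xbar - xbar))" using \<gamma>(2) by (simp add: has_vector_derivative_def)
  ultimately have der: "((\<lambda>x. \<gamma> (x - xbar)) has_derivative (\<lambda>t. t *\<^sub>R d)) (at xbar)" by (rule has_derivative_compose)
  show ?thesis
  proof (rule that[of "\<lambda>x. fst (snd (\<gamma> (x - xbar)))" "\<lambda>x. snd (snd (\<gamma> (x - xbar)))" "fst (snd d)" "snd (snd d)"])
    show "((\<lambda>x. fst (snd (\<gamma> (x - xbar)))) has_vector_derivative fst (snd d)) (at xbar)"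
      using has_derivative_fst[OF has_derivative_snd[OF der]] by (simp add: has_vector_derivative_def)
    show "((\<lambda>x. snd (snd (\<gamma> (x - xbar)))) has_vector_derivative snd (snd d)) (at xbar)"
      using has_derivative_snd[OF has_derivative_snd[OF der]] by (simp add: has_vector_derivative_def)
    show "\<forall>\<^sub>F x in nhds xbar. (x, fst (snd (\<gamma> (x - xbar))), snd (snd (\<gamma> (x - xbar)))) \<in> mpcc_set f g ?J {}"
      using eventually_compose_filterlim[OF ev sh] by simp
  qed (simp_all add: \<gamma>)
qed

lemma has_derivative_along:
  fixes h :: "real \<times> (real^'m) \<Rightarrow> real"
  assumes h: "Ck_on 1 h UNIV" and y: "(y has_vector_derivative y') (at xbar)"
  shows "((\<lambda>x. h (x, y x)) has_real_derivative grad_x h (xbar, y xbar) + grad_y h (xbar, y xbar) \<bullet> y') (at xbar)"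
proof -
  have "((\<lambda>x. (x, y x)) has_derivative (\<lambda>t. (t, t *\<^sub>R y'))) (at xbar)"
    by (intro has_derivative_Pair has_derivative_ident y[unfolded has_vector_derivative_def])
  from has_derivative_compose[OF this C1_has_derivative_grad[OF h]]
  have "((\<lambda>x. h (x, y x)) has_derivative (\<lambda>t. (grad_x h (xbar, y xbar) + grad_y h (xbar, y xbar) \<bullet> y') * t)) (at xbar)"
    by (simp add: grad_def algebra_simps)
  then show ?thesis by (simp add: has_field_derivative_def)
qed

text \<open>\<open>local_min_branch\<close> includes no regularity of \<open>y\<close>, so
  \<open>y\<close> is first shown to agree near \<open>xbar\<close> with the KKT path
  \<open>p\<close>. The slope is then an envelope formula: stationarity, together with the
  constraints staying active along \<open>p\<close>, trades the derivative of \<open>f\<close> in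
  \<open>y\<close> for the \<open>x\<close>-derivatives of the constraints.\<close>

lemma type1_branch:
  fixes xbar :: real and yb :: "real^'m"
  assumes yb: "yb \<in> sol_set f g xbar" and S: "sol_set f g xbar \<subseteq> {yb, yc}" "yb \<noteq> yc"
    and t: "type1 f g (xbar, yb)" and u: "M_KKT f g (xbar, yb) = {u}" and br: "local_min_branch f g xbar yb y"
  obtains y' where "(y has_vector_derivative y') (at xbar)"
    "((\<lambda>x. f (x, y x)) has_real_derivative grad_x f (xbar, yb) + (\<Sum>i\<in>UNIV. u $ i * cgrad_x g i (xbar, yb))) (at xbar)"
proof -
  let ?J = "active g (xbar, yb)" and ?z = "(xbar, yb)"
  note lm = sol_set_imp_local_min[OF yb]
  have zf: "snd ?z \<in> feasible g (fst ?z)" using yb by (simp add: sol_set_def)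
  obtain v0 where v0: "M_KKT f g ?z = {v0}" "crit_multiplier f g ?z v0" and L: "LICQ g ?z"
    and pos0: "\<And>j. j \<in> ?J \<Longrightarrow> 0 < v0 $ j" and off0: "\<And>j. j \<notin> ?J \<Longrightarrow> v0 $ j = 0"
    and ns0: "nonsingular_on (hess_yy (lagrangian f g v0) ?z) (tangent_y g ?J ?z)"
    and pd0: "\<And>d. d \<in> tangent_y g ?J ?z \<Longrightarrow> d \<bullet> (hess_yy (lagrangian f g v0) ?z *v d) \<le> 0 \<Longrightarrow> d = 0"
    by (rule type1_data[OF lm t]) (rule that, assumption+)
  have "v0 = u" using v0(1) u by simp
  note cu = v0(2)[unfolded this] and pos = pos0[unfolded this] and off = off0[unfolded this]
    and ns = ns0[unfolded this] and pd = pd0[unfolded this]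
  obtain p v p' v' where p0: "p xbar = yb" "v xbar = u" and p': "(p has_vector_derivative p') (at xbar)"
    and v': "(v has_vector_derivative v') (at xbar)" and pm: "\<forall>\<^sub>F x in nhds xbar. (x, p x, v x) \<in> mpcc_set f g ?J {}"
    by (rule type1_path[OF cu L]) (erule (1) pd, rule that, assumption+)
  have plim: "filterlim p (nhds yb) (nhds xbar)" and vlim: "filterlim v (nhds u) (nhds xbar)"
    using has_vector_derivative_continuous[OF p'] has_vector_derivative_continuous[OF v']
    unfolding continuous_within tendsto_at_iff_tendsto_nhds unfolding p0 .
  obtain U N where U: "open U" "xbar \<in> U" "open N" "yb \<in> N"
    and loc: "\<And>x. x \<in> U \<Longrightarrow> {v \<in> N. local_min_on (\<lambda>v. f (x, v)) (feasible g x) v} = {y x}"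
    using br unfolding local_min_branch_def by (elim conjE exE) (rule that, assumption+, blast)
  have y0: "y xbar = yb" using br by (simp add: local_min_branch_def)
  have yp: "\<forall>\<^sub>F x in nhds xbar. x \<in> UNIV \<longrightarrow> y x = p x"
  proof (rule seq_in_eventually_nhds)
    fix s0 assume s0: "s0 \<longlonglongrightarrow> xbar" and no0: "\<And>n. y (s0 n) \<noteq> p (s0 n)"
    obtain \<rho>0 where \<rho>0: "\<rho>0 > 0" "ball yb \<rho>0 \<subseteq> N" using U by (meson openE)
    \<comment> \<open>Small enough to remain in the uniqueness neighbourhood \<open>N\<close>, and
      to keep the other global solution \<open>yc\<close> out of the closed ball.\<close>
    define \<rho> where "\<rho> = min (\<rho>0 / 2) (dist yb yc / 2)"
    have \<rho>: "0 < \<rho>" "ball yb \<rho> \<subseteq> N" "\<rho> < dist yb yc"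
    proof -
      have d: "0 < dist yb yc" using S(2) by simp
      then show "0 < \<rho>" "\<rho> < dist yb yc" using \<rho>0(1) unfolding \<rho>_def by linarith+
      have "\<rho> \<le> \<rho>0" using \<rho>0(1) unfolding \<rho>_def by linarith
      then show "ball yb \<rho> \<subseteq> N" using \<rho>0(2) subset_ball by blast
    qed
    have pl: "((\<lambda>x. (x, p x)) \<longlongrightarrow> ?z) (nhds xbar)" by (intro tendsto_Pair filterlim_ident plim)
    have "\<forall>\<^sub>F x in nhds xbar. x \<in> U \<and> (x, p x, v x) \<in> mpcc_set f g ?J {} \<and> (\<forall>j. j \<notin> ?J \<longrightarrow> g (x, p x) $ j < 0) \<and> dist (p x) yb < \<rho>"
      using eventually_nhds_in_open[OF U(1,2)] pm inactive_eventually[OF zf pl] tendstoD[OF plim \<rho>(1)]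
      by eventually_elim blast
    from eventually_sequentially_shift[OF eventually_compose_filterlim[OF this s0]] obtain N0
      where N0: "\<And>n. s0 (n + N0) \<in> U \<and> (s0 (n + N0), p (s0 (n + N0)), v (s0 (n + N0))) \<in> mpcc_set f g ?J {} \<and>
        (\<forall>j. j \<notin> ?J \<longrightarrow> g (s0 (n + N0), p (s0 (n + N0))) $ j < 0) \<and> dist (p (s0 (n + N0))) yb < \<rho>" by blast
    define s where "s n = s0 (n + N0)" for n
    have s: "s \<longlonglongrightarrow> xbar" using LIMSEQ_ignore_initial_segment[OF s0, of N0] by (simp add: s_def[abs_def])
    have no: "y (s n) \<noteq> p (s n)" for n using no0 by (simp add: s_def)
    have sU: "s n \<in> U" and sm: "(s n, p (s n), v (s n)) \<in> mpcc_set f g ?J {}"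
      and sj: "\<forall>j. j \<notin> ?J \<longrightarrow> g (s n, p (s n)) $ j < 0" and sd: "dist (p (s n)) yb < \<rho>" for n
      using N0[of n] unfolding s_def by blast+
    have pf: "p (s n) \<in> feasible g (s n)" for n
    proof -
      have "g (s n, p (s n)) $ j \<le> 0" for j
        using sm[of n] sj[of n] unfolding mpcc_set_def by (cases "j \<in> ?J") (auto simp: less_imp_le)
      then show ?thesis by (simp add: feasible_def)
    qed
    \<comment> \<open>Minimizers over the closed ball exist by compactness. Along a subsequence they
      tend to the only global solution in the ball, so they end up in its interior, are local
      minimizers without the ball constraint, and hence are values of \<open>y\<close>.\<close>
    have "\<exists>m\<in>feasible g (s n) \<inter> cball yb \<rho>. \<forall>w\<in>feasible g (s n) \<inter> cball yb \<rho>. f (s n, m) \<le> f (s n, w)" for n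
    proof (rule continuous_attains_inf)
      have cont: "continuous_on UNIV (\<lambda>w. g (s n, w) $ j)" for j
        by (intro continuous_at_imp_continuous_on ballI isCont_o2[OF _ C1_isCont(1)[OF g_C1]] continuous_intros)
      have "closed (\<Inter>j. {w. g (s n, w) $ j \<le> 0})"
        by (intro closed_INT ballI closed_Collect_le[OF cont continuous_on_const])
      moreover have "feasible g (s n) = (\<Inter>j. {w. g (s n, w) $ j \<le> 0})" unfolding feasible_def by blast
      ultimately show "compact (feasible g (s n) \<inter> cball yb \<rho>)" by (intro closed_Int_compact compact_cball) simp
      show "feasible g (s n) \<inter> cball yb \<rho> \<noteq> {}" using pf[of n] sd[of n] by (auto simp: dist_commute)
      show "continuous_on (feasible g (s n) \<inter> cball yb \<rho>) (\<lambda>w. f (s n, w))"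
        by (intro continuous_at_imp_continuous_on ballI isCont_o2[OF _ C1_isCont(1)[OF f_C1]] continuous_intros)
    qed
    then obtain m where m: "\<And>n. m n \<in> feasible g (s n) \<inter> cball yb \<rho>"
      "\<And>n w. w \<in> feasible g (s n) \<inter> cball yb \<rho> \<Longrightarrow> f (s n, m n) \<le> f (s n, w)" by metis
    have "bounded (range m)" using m(1) by (intro bounded_subset[OF bounded_cball[of yb \<rho>]]) blast
    from seq_compact_subseq[OF this] obtain r l where r: "strict_mono r" and l: "(\<lambda>n. m (r n)) \<longlonglongrightarrow> l"
      unfolding comp_def by blast
    have sr: "(\<lambda>n. s (r n)) \<longlonglongrightarrow> xbar" using LIMSEQ_subseq_LIMSEQ[OF s r] by (simp add: comp_def)
    have sl: "(\<lambda>n. (s (r n), m (r n))) \<longlonglongrightarrow> (xbar, l)" by (intro tendsto_Pair sr l)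
    have pr: "(\<lambda>n. p (s (r n))) \<longlonglongrightarrow> yb" and vr: "(\<lambda>n. v (s (r n))) \<longlonglongrightarrow> u"
      using filterlim_compose[OF plim sr] filterlim_compose[OF vlim sr] .
    have "g (xbar, l) $ j \<le> 0" for j
      by (rule LIMSEQ_le_const2[OF tendsto_g[OF sl]]) (use m(1) in \<open>auto simp: feasible_def\<close>)
    then have lf: "l \<in> feasible g xbar" by (simp add: feasible_def)
    have "f (xbar, l) \<le> f (xbar, yb)"
    proof (rule LIMSEQ_le[OF tendsto_f[OF sl] tendsto_f[OF tendsto_Pair[OF sr pr]]])
      have "f (s (r n), m (r n)) \<le> f (s (r n), p (s (r n)))" for n
        using pf[of "r n"] sd[of "r n"] by (intro m(2)) (simp add: dist_commute)
      then show "\<exists>N. \<forall>n\<ge>N. f (s (r n), m (r n)) \<le> f (s (r n), p (s (r n)))" by blast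
    qed
    then have "l \<in> sol_set f g xbar" using yb lf unfolding sol_set_def by force
    moreover have "dist yb l \<le> \<rho>"
      by (rule LIMSEQ_le_const2[OF tendsto_dist[OF tendsto_const l]]) (use m(1) in auto)
    ultimately have "l = yb" using S(1) \<rho>(3) by force
    from eventually_sequentially_shift[OF tendstoD[OF l[unfolded this] \<rho>(1)]] obtain N1
      where N1: "\<And>n. dist (m (r (n + N1))) yb < \<rho>" by blast
    define k where "k n = r (n + N1)" for n
    have ml: "local_min_on (\<lambda>w. f (s (k n), w)) (feasible g (s (k n))) (m (k n))" for n
      unfolding local_min_on_def
    proof (intro conjI exI[of _ "\<rho> - dist (m (k n)) yb"] ballI impI)
      show "m (k n) \<in> feasible g (s (k n))" using m(1) by blast
      show "0 < \<rho> - dist (m (k n)) yb" using N1[of n] by (simp add: k_def)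
      fix w assume w: "w \<in> feasible g (s (k n))" "dist w (m (k n)) < \<rho> - dist (m (k n)) yb"
      have "dist yb w \<le> \<rho>" using w(2) dist_triangle[of w yb "m (k n)"] by (simp add: dist_commute)
      then show "f (s (k n), m (k n)) \<le> f (s (k n), w)" using w(1) by (intro m(2)) simp
    qed
    have "m (k n) \<in> ball yb \<rho>" for n using N1[of n] by (simp add: k_def dist_commute)
    then have my: "m (k n) = y (s (k n))" for n using loc[OF sU[of "k n"]] ml[of n] \<rho>(2) by blast
    show False
    proof (rule mpcc_FJ_unique[where K = "{}" and x = "\<lambda>n. s (k n)" and y = "\<lambda>n. p (s (k n))" and v = "\<lambda>n. v (s (k n))"
          and yt = "\<lambda>n. m (k n)", OF lm L cu])
      show "(\<lambda>n. s (k n)) \<longlonglongrightarrow> xbar" "(\<lambda>n. p (s (k n))) \<longlonglongrightarrow> yb" "(\<lambda>n. v (s (k n))) \<longlonglongrightarrow> u" "(\<lambda>n. m (k n)) \<longlonglongrightarrow> yb"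
        using LIMSEQ_ignore_initial_segment[OF sr, of N1] LIMSEQ_ignore_initial_segment[OF pr, of N1]
          LIMSEQ_ignore_initial_segment[OF vr, of N1] LIMSEQ_ignore_initial_segment[OF l, of N1] \<open>l = yb\<close>
        by (simp_all add: k_def)
      show "nonsingular_on (hess_yy (lagrangian f g u) ?z) (tangent_y g (?J - {}) ?z)" using ns by simp
      show "u $ j \<noteq> 0" if "j \<in> ?J - {}" for j using pos[of j] that by simp
      show "p (s (k n)) \<noteq> m (k n)" for n using no[of "k n"] my[of n] by simp
    qed (use sm ml in auto)
  qed
  have yp: "\<forall>\<^sub>F x in nhds xbar. y x = p x" using yp by simp
  have y': "(y has_vector_derivative p') (at xbar)"
    unfolding has_vector_derivative_def
    by (rule has_derivative_transform_eventually[OF p'[unfolded has_vector_derivative_def]])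
      (use yp y0 p0 in \<open>auto simp: eventually_at_filter elim: eventually_mono\<close>)
  have gj: "cgrad_y g j ?z \<bullet> p' = - cgrad_x g j ?z" if j: "j \<in> ?J" for j
  proof -
    have "((\<lambda>x. g (x, p x) $ j) has_real_derivative cgrad_x g j ?z + cgrad_y g j ?z \<bullet> p') (at xbar)"
      using has_derivative_along[OF g_C1 p', of j] unfolding cgrad_x_def cgrad_y_def p0 .
    moreover have "\<forall>\<^sub>F x in nhds xbar. g (x, p x) $ j = 0"
      using pm by eventually_elim (use j in \<open>auto simp: mpcc_set_def\<close>)
    then have "((\<lambda>x. g (x, p x) $ j) has_real_derivative 0) (at xbar)"
      by (subst DERIV_cong_ev[OF refl _ refl, of _ "\<lambda>_. 0"]) simp_all
    ultimately show ?thesis using DERIV_unique by fastforce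
  qed
  have "grad_y f ?z \<bullet> p' + (\<Sum>j\<in>?J. u $ j * (cgrad_y g j ?z \<bullet> p')) = (grad_y f ?z + (\<Sum>j\<in>?J. u $ j *\<^sub>R cgrad_y g j ?z)) \<bullet> p'"
    by (simp add: inner_add_left inner_sum_left)
  then have "grad_y f ?z \<bullet> p' + (\<Sum>j\<in>?J. u $ j * (cgrad_y g j ?z \<bullet> p')) = 0"
    using cu by (simp add: crit_multiplier_def)
  then have "grad_y f ?z \<bullet> p' = (\<Sum>j\<in>?J. u $ j * cgrad_x g j ?z)" using gj by (simp add: sum_negf)
  also have "\<dots> = (\<Sum>i\<in>UNIV. u $ i * cgrad_x g i ?z)" using off by (intro sum.mono_neutral_left) auto
  finally show ?thesis using that[OF y'] has_derivative_along[OF f_C1 y'] unfolding y0 by simp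
qed

end

context bilevel_lower_level
begin

lemma local_min_branchD:
  assumes "local_min_branch f g xbar yb y"
  obtains U N where "open U" "xbar \<in> U" "open N" "yb \<in> N"
    "\<And>x. x \<in> U \<Longrightarrow> local_min_on (\<lambda>v. f (x, v)) (feasible g x) (y x)" "\<And>x. x \<in> U \<Longrightarrow> y x \<in> feasible g x"
    "\<And>x w. x \<in> U \<Longrightarrow> w \<in> N \<Longrightarrow> w \<in> sol_set f g x \<Longrightarrow> w = y x"
proof -
  obtain U N where U: "open U" "xbar \<in> U" "open N" "yb \<in> N"
    and loc: "\<And>x. x \<in> U \<Longrightarrow> {v \<in> N. local_min_on (\<lambda>v. f (x, v)) (feasible g x) v} = {y x}"
    using assms unfolding local_min_branch_def by (elim conjE exE) (rule that, assumption+, blast)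
  have 1: "local_min_on (\<lambda>v. f (x, v)) (feasible g x) (y x)" if "x \<in> U" for x using loc[OF that] by blast
  show ?thesis
  proof (rule that[OF U 1])
    show "y x \<in> feasible g x" if "x \<in> U" for x using 1[OF that] by (simp add: local_min_on_def)
    show "w = y x" if "x \<in> U" "w \<in> N" "w \<in> sol_set f g x" for x w
      using loc[OF that(1)] that(2) sol_set_imp_local_min[OF that(3)] by blast
  qed
qed

text \<open>Where \<open>\<phi> \<ge> 0\<close> the branch \<open>y1\<close> is globally optimal and
  the minimality of \<open>F\<close> applies. Elsewhere \<open>f - V = - \<phi>\<close> is at least
  \<open>|D| / 2\<close> times the distance to \<open>xbar\<close>, while \<open>F\<close> along
  \<open>y1\<close> drops by at most \<open>|a| + 1\<close> times that distance, so a large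
  \<open>\<mu>\<close> compensates.\<close>

lemma case_II_case:
  fixes xbar :: real and ybar :: "real^'m"
  assumes F: "Ck_on 1 F UNIV" and min: "local_min_on F (sol_graph f g) (xbar, ybar)"
    and c2: "case_II f g xbar ybar ybar2"
    and b1: "local_min_branch f g xbar ybar y1" and b2: "local_min_branch f g xbar ybar2 y2"
  shows "(\<forall>\<^sub>F x in nhds xbar. opt_value f g x = ereal (min (f (x, y1 x)) (f (x, y2 x)))) \<and>
       (\<exists>u1 u2. M_KKT f g (xbar, ybar) = {u1} \<and> M_KKT f g (xbar, ybar2) = {u2} \<and>
          (\<forall>j\<in>active g (xbar, ybar). u1 $ j > 0) \<and>
          (\<exists>\<mu>>0.
             local_min_on
               (\<lambda>(x, y, u). ereal (F (x, y)) + ereal \<mu> * (ereal (f (x, y)) - opt_value f g x))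
               (nonsmooth_set f g (active g (xbar, ybar))) (xbar, ybar, u1) \<and>
             (\<exists>lam1 lam2 w \<xi>. 0 \<le> lam1 \<and> 0 \<le> lam2 \<and> lam1 + lam2 = 1 \<and>
                0 = grad_x F (xbar, ybar)
                    + \<mu> * (lam1 * (grad_x f (xbar, ybar) - grad_x f (xbar, ybar)
                                   - (\<Sum>i\<in>UNIV. u1 $ i * cgrad_x g i (xbar, ybar)))
                         + lam2 * (grad_x f (xbar, ybar) - grad_x f (xbar, ybar2)
                                   - (\<Sum>i\<in>UNIV. u2 $ i * cgrad_x g i (xbar, ybar2))))
                    - hess_xy (lagrangian f g u1) (xbar, ybar) \<bullet> w
                    + grad_x (\<lambda>z. \<xi> \<bullet> g z) (xbar, ybar) \<and>
                0 = grad_y F (xbar, ybar) + \<mu> *\<^sub>R grad_y f (xbar, ybar)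
                    - hess_yy (lagrangian f g u1) (xbar, ybar) *v w
                    + grad_y (\<lambda>z. \<xi> \<bullet> g z) (xbar, ybar) \<and>
                (\<forall>i. i \<notin> active g (xbar, ybar) \<longrightarrow> \<xi> $ i = 0) \<and>
                (\<forall>j\<in>active g (xbar, ybar). cgrad_y g j (xbar, ybar) \<bullet> w = 0))))"
proof -
  let ?J = "active g (xbar, ybar)" and ?z = "(xbar, ybar)" and ?z2 = "(xbar, ybar2)"
  obtain y1' y2' D where S: "sol_set f g xbar = {ybar, ybar2}" and ne: "ybar \<noteq> ybar2"
    and t: "type1 f g ?z" "type1 f g ?z2"
    and b': "local_min_branch f g xbar ybar y1'" "local_min_branch f g xbar ybar2 y2'"
    and D: "((\<lambda>x. f (x, y2' x) - f (x, y1' x)) has_real_derivative D) (at xbar)" "D \<noteq> 0"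
    using c2 unfolding case_II_def by blast
  have sol: "ybar \<in> sol_set f g xbar" "ybar2 \<in> sol_set f g xbar" using S by simp_all
  have S1: "sol_set f g xbar \<subseteq> {ybar, ybar2}" "sol_set f g xbar \<subseteq> {ybar2, ybar}" using S by auto
  note lm = sol_set_imp_local_min[OF sol(1)] and lm2 = sol_set_imp_local_min[OF sol(2)]
  obtain u1 where K1: "M_KKT f g ?z = {u1}" and u1: "crit_multiplier f g ?z u1" and L: "LICQ g ?z"
    and pos: "\<And>j. j \<in> ?J \<Longrightarrow> 0 < u1 $ j" and off: "\<And>j. j \<notin> ?J \<Longrightarrow> u1 $ j = 0"
    and ns: "nonsingular_on (hess_yy (lagrangian f g u1) ?z) (tangent_y g ?J ?z)"
    and pd: "\<And>d. d \<in> tangent_y g ?J ?z \<Longrightarrow> d \<bullet> (hess_yy (lagrangian f g u1) ?z *v d) \<le> 0 \<Longrightarrow> d = 0"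
    by (rule type1_data[OF lm t(1)]) (rule that, assumption+)
  obtain u2 where K2: "M_KKT f g ?z2 = {u2}" by (rule type1_data[OF lm2 t(2)]) (rule that, assumption)
  let ?s1 = "\<Sum>i\<in>UNIV. u1 $ i * cgrad_x g i ?z" and ?s2 = "\<Sum>i\<in>UNIV. u2 $ i * cgrad_x g i ?z2"
  obtain d1 where d1: "(y1 has_vector_derivative d1) (at xbar)" "((\<lambda>x. f (x, y1 x)) has_real_derivative grad_x f ?z + ?s1) (at xbar)"
    by (rule type1_branch[OF sol(1) S1(1) ne t(1) K1 b1]) (rule that, assumption+)
  obtain d2 where d2: "(y2 has_vector_derivative d2) (at xbar)" "((\<lambda>x. f (x, y2 x)) has_real_derivative grad_x f ?z2 + ?s2) (at xbar)"
    by (rule type1_branch[OF sol(2) S1(2) ne[symmetric] t(2) K2 b2]) (rule that, assumption+)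
  \<comment> \<open>The branches in the definition of \<open>case_II\<close> may be other functions
    than \<open>y1\<close> and \<open>y2\<close>. The slope formula involves only the data at the
    two solutions, so the difference of the slopes is \<open>D\<close> for either choice.\<close>
  obtain d1' where d1': "((\<lambda>x. f (x, y1' x)) has_real_derivative grad_x f ?z + ?s1) (at xbar)"
    by (rule type1_branch[OF sol(1) S1(1) ne t(1) K1 b'(1)]) (rule that, assumption+)
  obtain d2' where d2': "((\<lambda>x. f (x, y2' x)) has_real_derivative grad_x f ?z2 + ?s2) (at xbar)"
    by (rule type1_branch[OF sol(2) S1(2) ne[symmetric] t(2) K2 b'(2)]) (rule that, assumption+)
  have Deq: "D = (grad_x f ?z2 + ?s2) - (grad_x f ?z + ?s1)" by (rule DERIV_unique[OF D(1) DERIV_diff[OF d2' d1']])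
  define \<phi> where "\<phi> x = f (x, y2 x) - f (x, y1 x)" for x
  have d\<phi>: "(\<phi> has_real_derivative D) (at xbar)" unfolding \<phi>_def[abs_def] Deq by (rule DERIV_diff[OF d2(2) d1(2)])
  have y0: "y1 xbar = ybar" "y2 xbar = ybar2" using b1 b2 by (simp_all add: local_min_branch_def)
  have f12: "f ?z = f ?z2" using sol unfolding sol_set_def by (auto intro: antisym)
  have \<phi>0: "\<phi> xbar = 0" by (simp add: \<phi>_def y0 f12)
  have y1lim: "filterlim y1 (nhds ybar) (nhds xbar)"
    using has_vector_derivative_continuous[OF d1(1)]
    unfolding continuous_within tendsto_at_iff_tendsto_nhds unfolding y0 .
  obtain U1 N1 where U1: "open U1" "xbar \<in> U1" "open N1" "ybar \<in> N1"
    and lm1: "\<And>x. x \<in> U1 \<Longrightarrow> local_min_on (\<lambda>v. f (x, v)) (feasible g x) (y1 x)" and feas1: "\<And>x. x \<in> U1 \<Longrightarrow> y1 x \<in> feasible g x"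
    and eq1: "\<And>x w. x \<in> U1 \<Longrightarrow> w \<in> N1 \<Longrightarrow> w \<in> sol_set f g x \<Longrightarrow> w = y1 x"
    by (rule local_min_branchD[OF b1]) (rule that, assumption+)
  obtain U2 N2 where U2: "open U2" "xbar \<in> U2" "open N2" "ybar2 \<in> N2"
    and feas2: "\<And>x. x \<in> U2 \<Longrightarrow> y2 x \<in> feasible g x"
    and eq2: "\<And>x w. x \<in> U2 \<Longrightarrow> w \<in> N2 \<Longrightarrow> w \<in> sol_set f g x \<Longrightarrow> w = y2 x"
    by (rule local_min_branchD[OF b2]) (rule that, assumption+)
  have evU: "\<forall>\<^sub>F x in nhds xbar. x \<in> U1 \<and> x \<in> U2"
    using eventually_nhds_in_open[OF U1(1,2)] eventually_nhds_in_open[OF U2(1,2)] by eventually_elim blast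
  \<comment> \<open>Further solutions would accumulate at \<open>ybar\<close> or
    \<open>ybar2\<close>, inside the neighbourhoods in which the branches are the only local
    minimizers.\<close>
  have two: "\<forall>\<^sub>F x in nhds xbar. x \<in> UNIV \<longrightarrow> (\<forall>w\<in>sol_set f g x. w = y1 x \<or> w = y2 x)"
  proof (rule seq_in_eventually_nhds)
    fix s0 assume s0: "s0 \<longlonglongrightarrow> xbar" and no: "\<And>n. \<not> (\<forall>w\<in>sol_set f g (s0 n). w = y1 (s0 n) \<or> w = y2 (s0 n))"
    from eventually_sequentially_shift[OF eventually_compose_filterlim[OF evU s0]] obtain N0
      where N0: "\<And>n. s0 (n + N0) \<in> U1 \<and> s0 (n + N0) \<in> U2" by blast
    define s where "s n = s0 (n + N0)" for n
    have s: "s \<longlonglongrightarrow> xbar" using LIMSEQ_ignore_initial_segment[OF s0, of N0] by (simp add: s_def[abs_def])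
    have sU: "s n \<in> U1" "s n \<in> U2" for n using N0[of n] by (simp_all add: s_def)
    have "\<forall>n. \<exists>w. w \<in> sol_set f g (s n) \<and> w \<noteq> y1 (s n) \<and> w \<noteq> y2 (s n)" using no unfolding s_def by blast
    then obtain w where w: "\<forall>n. w n \<in> sol_set f g (s n) \<and> w n \<noteq> y1 (s n) \<and> w n \<noteq> y2 (s n)" by (rule choice[THEN exE])
    have wS: "w n \<in> sol_set f g (s n)" for n using w by blast
    obtain r l where rl: "strict_mono r" "(\<lambda>n. w (r n)) \<longlonglongrightarrow> l" "l \<in> sol_set f g xbar"
      by (rule sol_set_limit[OF s filterlim_compose[OF y1lim s] feas1[OF sU(1)] sol(1) wS]) (rule that, assumption+)
    have "l = ybar \<or> l = ybar2" using rl(3) S by simp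
    then show False
    proof
      assume l: "l = ybar"
      have "\<forall>\<^sub>F n in sequentially. w (r n) \<in> N1" using topological_tendstoD[OF rl(2) U1(3)] U1(4) l by simp
      from eventually_happens'[OF sequentially_bot this] obtain n where "w (r n) \<in> N1" by blast
      from eq1[OF sU(1) this wS] show False using w by blast
    next
      assume l: "l = ybar2"
      have "\<forall>\<^sub>F n in sequentially. w (r n) \<in> N2" using topological_tendstoD[OF rl(2) U2(3)] U2(4) l by simp
      from eventually_happens'[OF sequentially_bot this] obtain n where "w (r n) \<in> N2" by blast
      from eq2[OF sU(2) this wS] show False using w by blast
    qed
  qed
  have good: "\<forall>\<^sub>F x in nhds xbar. opt_value f g x = ereal (min (f (x, y1 x)) (f (x, y2 x))) \<and> (0 \<le> \<phi> x \<longrightarrow> y1 x \<in> sol_set f g x)"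
    using evU two
  proof eventually_elim
    case (elim x)
    have fe: "y1 x \<in> feasible g x" "y2 x \<in> feasible g x" using feas1 feas2 elim(1) by blast+
    obtain w where w: "w \<in> sol_set f g x" by (rule sol_set_exists[OF fe(1)]) (rule that, assumption)
    then have wf: "w \<in> feasible g x" and wm: "\<And>v. v \<in> feasible g x \<Longrightarrow> f (x, w) \<le> f (x, v)" by (simp_all add: sol_set_def)
    have w12: "w = y1 x \<or> w = y2 x" using elim(2) w by blast
    have "opt_value f g x = ereal (f (x, w))"
      unfolding opt_value_def by (rule antisym) (auto intro!: INF_lower2[OF wf] INF_greatest wm)
    moreover have m: "min (f (x, y1 x)) (f (x, y2 x)) = f (x, w)" using w12 wm[OF fe(1)] wm[OF fe(2)] by auto
    moreover have "y1 x \<in> sol_set f g x" if "0 \<le> \<phi> x"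
    proof -
      have "f (x, y1 x) \<le> f (x, w)" using that m by (simp add: \<phi>_def min_def)
      then show ?thesis using fe(1) wm unfolding sol_set_def by (auto intro: order_trans)
    qed
    ultimately show ?case by simp
  qed
  have near: "\<forall>\<^sub>F p in nhds (xbar, ybar, u1). p \<in> nonsmooth_set f g ?J \<longrightarrow> fst (snd p) = y1 (fst p)"
  proof (rule seq_in_eventually_nhds)
    fix s assume mem: "\<And>n. s n \<in> nonsmooth_set f g ?J" and s: "s \<longlonglongrightarrow> (xbar, ybar, u1)"
      and no: "\<And>n. fst (snd (s n)) \<noteq> y1 (fst (s n))"
    have lim: "(\<lambda>n. fst (s n)) \<longlonglongrightarrow> xbar" "(\<lambda>n. fst (snd (s n))) \<longlonglongrightarrow> ybar" "(\<lambda>n. snd (snd (s n))) \<longlonglongrightarrow> u1"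
      using tendsto_fst[OF s] tendsto_fst[OF tendsto_snd[OF s]] tendsto_snd[OF tendsto_snd[OF s]] by simp_all
    from eventually_sequentially_shift[OF eventually_compose_filterlim[OF evU lim(1)]] obtain N0
      where N0: "\<And>n. fst (s (n + N0)) \<in> U1 \<and> fst (s (n + N0)) \<in> U2" by blast
    note lim' = lim[THEN LIMSEQ_ignore_initial_segment, of N0]
    have sm: "(fst (s n), fst (snd (s n)), snd (snd (s n))) \<in> mpcc_set f g ?J {}" for n
    proof -
      have "grad_y f (fst (s n), fst (snd (s n))) + (\<Sum>i\<in>UNIV. snd (snd (s n)) $ i *\<^sub>R cgrad_y g i (fst (s n), fst (snd (s n)))) = 0"
        "\<forall>j\<in>?J. g (fst (s n), fst (snd (s n))) $ j = 0" and o: "\<forall>i. i \<notin> ?J \<longrightarrow> snd (snd (s n)) $ i = 0"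
        using mem[of n] unfolding nonsmooth_set_def case_prod_beta by simp_all
      then show ?thesis unfolding mpcc_set_def sum_active[OF o] mem_Collect_eq case_prod_conv by simp
    qed
    show False
    proof (rule mpcc_FJ_unique[where K = "{}" and yt = "\<lambda>n. y1 (fst (s (n + N0)))", OF lm L u1 _ _ _ _ _ lim' sm])
      show "nonsingular_on (hess_yy (lagrangian f g u1) ?z) (tangent_y g (?J - {}) ?z)" using ns by simp
      show "u1 $ j \<noteq> 0" if "j \<in> ?J - {}" for j using pos[of j] that by simp
      show "(\<lambda>n. y1 (fst (s (n + N0)))) \<longlonglongrightarrow> ybar" by (rule filterlim_compose[OF y1lim lim'(1)])
      show "local_min_on (\<lambda>v. f (fst (s (n + N0)), v)) (feasible g (fst (s (n + N0)))) (y1 (fst (s (n + N0))))" for n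
        using lm1 N0 by blast
      show "fst (snd (s (n + N0))) \<noteq> y1 (fst (s (n + N0)))" for n by (rule no)
    qed auto
  qed
  have Fmin: "\<forall>\<^sub>F x in nhds xbar. y1 x \<in> sol_set f g x \<longrightarrow> F ?z \<le> F (x, y1 x)"
  proof -
    obtain e where e: "e > 0" "\<And>x y. y \<in> sol_set f g x \<Longrightarrow> dist (x, y) ?z < e \<Longrightarrow> F ?z \<le> F (x, y)"
      using min unfolding local_min_on_def sol_graph_def by blast
    have "((\<lambda>x. (x, y1 x)) \<longlongrightarrow> ?z) (nhds xbar)" by (intro tendsto_Pair filterlim_ident y1lim)
    from tendstoD[OF this e(1)] show ?thesis by eventually_elim (use e(2) in blast)
  qed
  define a where "a = grad_x F ?z + grad_y F ?z \<bullet> d1"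
  have dF: "((\<lambda>x. F (x, y1 x)) has_real_derivative a) (at xbar)"
    using has_derivative_along[OF F d1(1)] unfolding a_def y0 .
  have "\<forall>\<^sub>F x in nhds xbar. opt_value f g x = ereal (min (f (x, y1 x)) (f (x, y2 x))) \<and> (0 \<le> \<phi> x \<longrightarrow> F ?z \<le> F (x, y1 x)) \<and>
      \<bar>\<phi> x - D * (x - xbar)\<bar> \<le> \<bar>D\<bar> / 2 * \<bar>x - xbar\<bar> \<and> \<bar>F (x, y1 x) - F ?z - a * (x - xbar)\<bar> \<le> \<bar>x - xbar\<bar>"
  proof -
    have "0 < \<bar>D\<bar> / 2" using D(2) by simp
    from good Fmin DERIV_approx[OF d\<phi> this] DERIV_approx[OF dF zero_less_one] show ?thesis
    proof eventually_elim
      case (elim x)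
      then show ?case unfolding \<phi>0 y0 mult_1_left diff_zero by blast
    qed
  qed
  then have all: "\<forall>\<^sub>F p in nhds (xbar, ybar, u1). opt_value f g (fst p) = ereal (min (f (fst p, y1 (fst p))) (f (fst p, y2 (fst p)))) \<and>
      (0 \<le> \<phi> (fst p) \<longrightarrow> F ?z \<le> F (fst p, y1 (fst p))) \<and>
      \<bar>\<phi> (fst p) - D * (fst p - xbar)\<bar> \<le> \<bar>D\<bar> / 2 * \<bar>fst p - xbar\<bar> \<and>
      \<bar>F (fst p, y1 (fst p)) - F ?z - a * (fst p - xbar)\<bar> \<le> \<bar>fst p - xbar\<bar>"
  proof (rule eventually_compose_filterlim)
    have "((\<lambda>p. fst p) \<longlongrightarrow> fst (xbar, ybar, u1)) (nhds (xbar, ybar, u1))" by (rule tendsto_fst[OF filterlim_ident])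
    then show "filterlim fst (nhds xbar) (nhds (xbar, ybar, u1))" by simp
  qed
  let ?H = "hess_yy (lagrangian f g u1) ?z"
  \<comment> \<open>Only one side of \<open>xbar\<close> is admissible: where
    \<open>D * (x - xbar) \<ge> 0\<close>, the estimate of \<open>\<phi>\<close> within half of its
    slope makes \<open>\<phi>\<close> nonnegative, so \<open>y1\<close> solves the lower level
    problem there.\<close>
  let ?C = "{0, (0, 0, D)} :: ((real^'m) \<times> (real^'p) \<times> real) set"
  have surj: "c1 = 0 \<and> c2 = 0 \<and> c3 = 0"
    if "c1 \<bullet> hess_xy (lagrangian f g u1) ?z + (\<Sum>j\<in>?J. c2 $ j * cgrad_x g j ?z) + c3 * 1 = 0"
      "?H *v c1 + (\<Sum>j\<in>?J. c2 $ j *\<^sub>R cgrad_y g j ?z) = 0"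
      "\<And>j. j \<in> ?J \<Longrightarrow> cgrad_y g j ?z \<bullet> c1 + c3 * (0::real^'p) $ j = 0"
      "\<And>j. j \<notin> ?J \<Longrightarrow> c2 $ j + c3 * (0::real^'p) $ j = 0" for c1 c2 and c3 :: real
    using that by (intro kkt_surjective[OF L pd]) simp_all
  obtain c1 c2 c3 where c: "grad_x F ?z = c1 \<bullet> hess_xy (lagrangian f g u1) ?z + (\<Sum>j\<in>?J. c2 $ j * cgrad_x g j ?z) + c3 * 1"
    "grad_y F ?z = ?H *v c1 + (\<Sum>j\<in>?J. c2 $ j *\<^sub>R cgrad_y g j ?z)"
    "\<And>j. j \<in> ?J \<Longrightarrow> cgrad_y g j ?z \<bullet> c1 + c3 * (0::real^'p) $ j = 0"
    "\<And>j. j \<notin> ?J \<Longrightarrow> c2 $ j + c3 * (0::real^'p) $ j = 0"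
    "\<And>e2 e3. (0, e2, e3) \<in> ?C \<Longrightarrow> 0 \<le> c2 \<bullet> e2 + c3 * e3"
  proof (rule kkt_multipliers[OF u1 F surj, where C = ?C])
    fix e2 :: "real^'p" and e3 :: real
    assume e: "(0, e2, e3) \<in> ?C"
    then have e2: "e2 = 0" and e3: "0 \<le> D * e3" by (auto simp: zero_prod_def)
    show "\<forall>\<^sub>F (x, y, v) in nhds (xbar, ybar, u1).
      (\<exists>t\<ge>0. grad_y f (x, y) + (\<Sum>j\<in>?J. v $ j *\<^sub>R cgrad_y g j (x, y)) = 0 \<and> (\<forall>j\<in>?J. g (x, y) $ j = t * e2 $ j) \<and>
        (\<forall>j. j \<notin> ?J \<longrightarrow> v $ j = t * e2 $ j) \<and> 1 * (x - xbar) + 0 \<bullet> (v - u1) = t * e3) \<longrightarrow> F ?z \<le> F (x, y)"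
      using near all
    proof eventually_elim
      case (elim p)
      obtain x y v where p: "p = (x, y, v)" by (cases p)
      have "F ?z \<le> F (x, y)" if t: "t \<ge> 0" "grad_y f (x, y) + (\<Sum>j\<in>?J. v $ j *\<^sub>R cgrad_y g j (x, y)) = 0"
        "\<forall>j\<in>?J. g (x, y) $ j = t * e2 $ j" "\<forall>j. j \<notin> ?J \<longrightarrow> v $ j = t * e2 $ j" "1 * (x - xbar) + 0 \<bullet> (v - u1) = t * e3" for t
      proof -
        have o: "\<forall>j. j \<notin> ?J \<longrightarrow> v $ j = 0" using t(4) by (simp add: e2)
        have "p \<in> nonsmooth_set f g ?J" unfolding p nonsmooth_set_def case_prod_conv mem_Collect_eq sum_active[OF o]
          using t(2,3) o by (simp add: e2)
        then have y: "y = y1 x" using elim(1) by (simp add: p)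
        have "D * (x - xbar) = t * (D * e3)" using t(5) by simp
        then have "0 \<le> D * (x - xbar)" using mult_nonneg_nonneg[OF t(1) e3] by (simp only:)
        then have "D * (x - xbar) = \<bar>D\<bar> * \<bar>x - xbar\<bar>" by (simp only: abs_mult[symmetric] abs_of_nonneg)
        moreover have "0 \<le> \<bar>D\<bar> * \<bar>x - xbar\<bar>" by simp
        moreover have "\<bar>\<phi> x - D * (x - xbar)\<bar> \<le> \<bar>D\<bar> * \<bar>x - xbar\<bar> / 2"
          using elim(2)[unfolded p fst_conv times_divide_eq_left] by blast
        moreover have "0 \<le> q" if "P = K" "0 \<le> K" "\<bar>q - P\<bar> \<le> K / 2" for P K q :: real using that by linarith
        ultimately have "0 \<le> \<phi> x" by blast
        then show ?thesis using elim(2) by (simp add: p y)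
      qed
      then show ?case unfolding p by blast
    qed
  qed (auto simp: zero_prod_def)
  have c2off: "\<forall>j. j \<notin> ?J \<longrightarrow> c2 $ j = 0" using c(4) by simp
  have c3: "0 \<le> c3 / D" using c(5)[of 0 D] by (simp add: zero_le_divide_iff zero_le_mult_iff)
  \<comment> \<open>The first summand makes the penalty outweigh the possible decrease of
    \<open>F\<close>; the second makes the weight \<open>lam\<close> at most 1.\<close>
  define \<mu> where "\<mu> = 2 * (\<bar>a\<bar> + 1) / \<bar>D\<bar> + c3 / D"
  have \<mu>1: "0 < 2 * (\<bar>a\<bar> + 1) / \<bar>D\<bar>" using D(2) by (intro divide_pos_pos) simp_all
  then have \<mu>: "0 < \<mu>" "c3 / D \<le> \<mu>" using c3 unfolding \<mu>_def by linarith+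
  have "2 * (\<bar>a\<bar> + 1) / \<bar>D\<bar> \<le> \<mu>" using c3 unfolding \<mu>_def by linarith
  then have "2 * (\<bar>a\<bar> + 1) / \<bar>D\<bar> * (\<bar>D\<bar> / 2) \<le> \<mu> * (\<bar>D\<bar> / 2)" by (intro mult_right_mono) simp_all
  then have \<mu>D: "\<bar>a\<bar> + 1 \<le> \<mu> * (\<bar>D\<bar> / 2)" using D(2) by simp
  \<comment> \<open>The weight of the second branch is chosen so that its excess slope, scaled by
    \<open>\<mu>\<close>, reproduces the multiplier \<open>c3\<close> of the coordinate
    \<open>x\<close>.\<close>
  define lam where "lam = c3 / D / \<mu>"
  have lam0: "0 \<le> lam" unfolding lam_def by (rule divide_nonneg_pos[OF c3 \<mu>(1)])
  have lam1: "lam \<le> 1" unfolding lam_def using \<mu> by (simp only: divide_le_eq_1_pos)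
  have "\<mu> * lam * D = c3" using \<mu>(1) D(2) by (simp add: lam_def)
  note lam = lam0 lam1 this
  \<comment> \<open>The part \<open>\<mu> *\<^sub>R u1\<close> cancels the penalty gradient in
    \<open>y\<close>, since \<open>grad_y f\<close> is minus the combination of the constraint
    gradients with coefficients \<open>u1\<close>. In \<open>x\<close> it cancels
    \<open>\<mu> * ?s1\<close> and leaves \<open>- \<mu> * lam * D = - c3\<close>.\<close>
  define \<xi> where "\<xi> = \<mu> *\<^sub>R u1 - c2"
  have \<xi>off: "\<forall>i. i \<notin> ?J \<longrightarrow> \<xi> $ i = 0" using c2off off by (simp add: \<xi>_def)
  have s1: "?s1 = (\<Sum>j\<in>?J. u1 $ j * cgrad_x g j ?z)" using off by (intro sum.mono_neutral_right) auto
  have \<xi>x: "grad_x (\<lambda>z. \<xi> \<bullet> g z) ?z = \<mu> * ?s1 - (\<Sum>j\<in>?J. c2 $ j * cgrad_x g j ?z)"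
    and \<xi>y: "grad_y (\<lambda>z. \<xi> \<bullet> g z) ?z = \<mu> *\<^sub>R (\<Sum>j\<in>?J. u1 $ j *\<^sub>R cgrad_y g j ?z) - (\<Sum>j\<in>?J. c2 $ j *\<^sub>R cgrad_y g j ?z)"
  proof -
    have "grad_x (\<lambda>z'. \<xi> \<bullet> g z') ?z = (\<Sum>j\<in>?J. \<xi> $ j * cgrad_x g j ?z)"
      "grad_y (\<lambda>z'. \<xi> \<bullet> g z') ?z = (\<Sum>j\<in>?J. \<xi> $ j *\<^sub>R cgrad_y g j ?z)"
      unfolding inner_eq grad_x_lag grad_y_lag sum_active[OF \<xi>off]
      using sum_active[OF \<xi>off, of "\<lambda>j. cgrad_x g j ?z"] by simp_all
    then show "grad_x (\<lambda>z. \<xi> \<bullet> g z) ?z = \<mu> * ?s1 - (\<Sum>j\<in>?J. c2 $ j * cgrad_x g j ?z)"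
      "grad_y (\<lambda>z. \<xi> \<bullet> g z) ?z = \<mu> *\<^sub>R (\<Sum>j\<in>?J. u1 $ j *\<^sub>R cgrad_y g j ?z) - (\<Sum>j\<in>?J. c2 $ j *\<^sub>R cgrad_y g j ?z)"
      unfolding s1 by (simp_all add: \<xi>_def left_diff_distrib scaleR_diff_left sum_subtractf sum_distrib_left scaleR_sum_right mult.assoc)
  qed
  have E1: "0 = grad_x F ?z + \<mu> * ((1 - lam) * (grad_x f ?z - grad_x f ?z - ?s1) + lam * (grad_x f ?z - grad_x f ?z2 - ?s2))
      - hess_xy (lagrangian f g u1) ?z \<bullet> c1 + grad_x (\<lambda>z. \<xi> \<bullet> g z) ?z"
  proof -
    have "\<mu> * ((1 - lam) * (grad_x f ?z - grad_x f ?z - ?s1) + lam * (grad_x f ?z - grad_x f ?z2 - ?s2)) = - (\<mu> * ?s1) - \<mu> * lam * D"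
      unfolding Deq by (simp add: algebra_simps)
    then show ?thesis unfolding lam(3) \<xi>x c(1) by (simp add: inner_commute)
  qed
  have E2: "0 = grad_y F ?z + \<mu> *\<^sub>R grad_y f ?z - ?H *v c1 + grad_y (\<lambda>z. \<xi> \<bullet> g z) ?z"
  proof -
    have "\<mu> *\<^sub>R grad_y f ?z + \<mu> *\<^sub>R (\<Sum>j\<in>?J. u1 $ j *\<^sub>R cgrad_y g j ?z) = 0"
      using u1 unfolding crit_multiplier_def scaleR_add_right[symmetric] by simp
    then show ?thesis unfolding \<xi>y c(2) by (simp add: algebra_simps)
  qed
  have kkt: "\<exists>lam1 lam2 w \<xi>. 0 \<le> lam1 \<and> 0 \<le> lam2 \<and> lam1 + lam2 = 1 \<and>
      0 = grad_x F ?z + \<mu> * (lam1 * (grad_x f ?z - grad_x f ?z - ?s1) + lam2 * (grad_x f ?z - grad_x f ?z2 - ?s2))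
        - hess_xy (lagrangian f g u1) ?z \<bullet> w + grad_x (\<lambda>z. \<xi> \<bullet> g z) ?z \<and>
      0 = grad_y F ?z + \<mu> *\<^sub>R grad_y f ?z - ?H *v w + grad_y (\<lambda>z. \<xi> \<bullet> g z) ?z \<and>
      (\<forall>i. i \<notin> ?J \<longrightarrow> \<xi> $ i = 0) \<and> (\<forall>j\<in>?J. cgrad_y g j ?z \<bullet> w = 0)"
    by (rule exI[of _ "1 - lam"], rule exI[of _ lam], rule exI[of _ c1], rule exI[of _ \<xi>], intro conjI E1 E2 \<xi>off)
      (use lam(1,2) c(3) in simp_all)
  let ?\<Theta> = "\<lambda>(x, y, u::real^'p). ereal (F (x, y)) + ereal \<mu> * (ereal (f (x, y)) - opt_value f g x)"
  have z\<Theta>: "?\<Theta> (xbar, ybar, u1) = ereal (F ?z)"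
    using eventually_nhds_x_imp_x[OF good] by (simp add: y0 f12)
  have "\<forall>\<^sub>F p in nhds (xbar, ybar, u1). p \<in> nonsmooth_set f g ?J \<longrightarrow> ?\<Theta> (xbar, ybar, u1) \<le> ?\<Theta> p"
    using near all
  proof eventually_elim
    case (elim p)
    show ?case
    proof
      assume pn: "p \<in> nonsmooth_set f g ?J"
      obtain x y v where p: "p = (x, y, v)" by (cases p)
      have y: "y = y1 x" using elim(1) pn by (simp add: p)
      note e = elim(2)[unfolded p fst_conv]
      have "F ?z \<le> F (x, y1 x) + \<mu> * (f (x, y1 x) - min (f (x, y1 x)) (f (x, y2 x)))"
      proof (cases "0 \<le> \<phi> x")
        case True
        then show ?thesis using e by (simp add: \<phi>_def)
      next
        case False
        have 1: "\<bar>D\<bar> / 2 * \<bar>x - xbar\<bar> \<le> - \<phi> x"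
        proof -
          have aux: "K / 2 \<le> - q" if "\<bar>P\<bar> = K" "\<bar>q - P\<bar> \<le> K / 2" "\<not> 0 \<le> q" for P K q :: real
            using that by linarith
          have "\<bar>\<phi> x - D * (x - xbar)\<bar> \<le> \<bar>D\<bar> * \<bar>x - xbar\<bar> / 2"
            using e[unfolded times_divide_eq_left] by blast
          then show ?thesis unfolding times_divide_eq_left by (rule aux[OF abs_mult _ False])
        qed
        have 2: "F ?z - F (x, y1 x) \<le> (\<bar>a\<bar> + 1) * \<bar>x - xbar\<bar>"
        proof -
          have aux: "A - B \<le> X + Y" if "\<bar>v\<bar> = X" "\<bar>B - A - v\<bar> \<le> Y" for A B v X Y :: real
            using that by linarith
          have "\<bar>F (x, y1 x) - F ?z - a * (x - xbar)\<bar> \<le> \<bar>x - xbar\<bar>" using e by blast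
          then show ?thesis unfolding distrib_right mult_1_left by (rule aux[OF abs_mult])
        qed
        also have "\<dots> \<le> \<mu> * (\<bar>D\<bar> / 2) * \<bar>x - xbar\<bar>" by (rule mult_right_mono[OF \<mu>D]) simp
        also have "\<dots> = \<mu> * (\<bar>D\<bar> / 2 * \<bar>x - xbar\<bar>)" by (rule mult.assoc)
        also have "\<dots> \<le> \<mu> * - \<phi> x" by (rule mult_left_mono[OF 1]) (use \<mu> in simp)
        also have "- \<phi> x = f (x, y1 x) - min (f (x, y1 x)) (f (x, y2 x))" using False by (simp add: \<phi>_def)
        finally show ?thesis by simp
      qed
      moreover have o: "opt_value f g x = ereal (min (f (x, y1 x)) (f (x, y2 x)))" using e by blast
      ultimately show "?\<Theta> (xbar, ybar, u1) \<le> ?\<Theta> p"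
        unfolding z\<Theta> unfolding p case_prod_conv y o
        by (simp only: ereal_minus(1) times_ereal.simps(1) plus_ereal.simps(1) ereal_less_eq(3))
    qed
  qed
  moreover have "(xbar, ybar, u1) \<in> nonsmooth_set f g ?J"
  proof -
    have o: "\<forall>i. i \<notin> ?J \<longrightarrow> u1 $ i = 0" using off by blast
    have "\<forall>j\<in>?J. g ?z $ j = 0" by (simp add: active_def)
    then show ?thesis
      unfolding nonsmooth_set_def mem_Collect_eq case_prod_conv sum_active[OF o]
      using u1 o by (simp add: crit_multiplier_def)
  qed
  ultimately have "local_min_on ?\<Theta> (nonsmooth_set f g ?J) (xbar, ybar, u1)"
    unfolding local_min_on_def eventually_nhds_metric by blast
  note lm\<Theta> = this
  have main: "\<exists>\<mu>>0. local_min_on (\<lambda>(x, y, u). ereal (F (x, y)) + ereal \<mu> * (ereal (f (x, y)) - opt_value f g x))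
        (nonsmooth_set f g ?J) (xbar, ybar, u1) \<and>
      (\<exists>lam1 lam2 w \<xi>. 0 \<le> lam1 \<and> 0 \<le> lam2 \<and> lam1 + lam2 = 1 \<and>
      0 = grad_x F ?z + \<mu> * (lam1 * (grad_x f ?z - grad_x f ?z - ?s1) + lam2 * (grad_x f ?z - grad_x f ?z2 - ?s2))
        - hess_xy (lagrangian f g u1) ?z \<bullet> w + grad_x (\<lambda>z. \<xi> \<bullet> g z) ?z \<and>
      0 = grad_y F ?z + \<mu> *\<^sub>R grad_y f ?z - ?H *v w + grad_y (\<lambda>z. \<xi> \<bullet> g z) ?z \<and>
      (\<forall>i. i \<notin> ?J \<longrightarrow> \<xi> $ i = 0) \<and> (\<forall>j\<in>?J. cgrad_y g j ?z \<bullet> w = 0))"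
    by (rule exI[of _ \<mu>], rule conjI[OF \<mu>(1) conjI[OF lm\<Theta> kkt]])
  have opt: "\<forall>\<^sub>F x in nhds xbar. opt_value f g x = ereal (min (f (x, y1 x)) (f (x, y2 x)))"
    using good by eventually_elim blast
  have posb: "\<forall>j\<in>?J. u1 $ j > 0" using pos by (rule ballI)
  show ?thesis
    by (rule conjI[OF opt], rule exI[of _ u1], rule exI[of _ u2], rule conjI[OF K1 conjI[OF K2 conjI[OF posb main]]])
qed

end

theorem theorem6p2:
  fixes F f :: "real \<times> (real^'m) \<Rightarrow> real"
    and g :: "real \<times> (real^'m) \<Rightarrow> real^'p"
    and xbar :: real and ybar :: "real^'m"
  assumes F_C1: "Ck_on 1 F UNIV"
    and f_C3: "Ck_on 3 f UNIV"
    and g_C3: "Ck_on 3 g UNIV"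
    and compact_levels:
      "\<And>xhat c. compact {(x, y). \<bar>x - xhat\<bar> \<le> 1 \<and> f (x, y) \<le> c \<and> (\<forall>j. g (x, y) $ j \<le> 0)}"
    and local_min: "local_min_on F (sol_graph f g) (xbar, ybar)"
    and simple: "simple_blpp f g xbar ybar"
  shows
    "(sol_set f g xbar = {ybar} \<and> type1 f g (xbar, ybar) \<longrightarrow>
       (\<exists>ubar. M_KKT f g (xbar, ybar) = {ubar} \<and>
          local_min_on (\<lambda>(x, y, u). F (x, y))
            {(x, y, u). grad_y f (x, y) + (\<Sum>j\<in>active g (xbar, ybar). u $ j *\<^sub>R cgrad_y g j (x, y)) = 0 \<and>
                        (\<forall>j\<in>active g (xbar, ybar). g (x, y) $ j = 0)}
            (xbar, ybar, ubar) \<and>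
          (\<exists>w \<xi>. star_system F (lagrangian f g ubar) g (xbar, ybar) w \<xi> \<and>
                 (\<forall>j\<in>active g (xbar, ybar). cgrad_y g j (xbar, ybar) \<bullet> w = 0))))
   \<and> (sol_set f g xbar = {ybar} \<and> type2 f g (xbar, ybar) \<longrightarrow>
       (\<exists>ubar. M_KKT f g (xbar, ybar) = {ubar} \<and>
          (\<exists>q. (q \<in> active g (xbar, ybar) \<and> ubar $ q = 0 \<and>
                (\<forall>j\<in>active g (xbar, ybar) - {q}. ubar $ j > 0)) \<and>
               (\<forall>q'. q' \<in> active g (xbar, ybar) \<and> ubar $ q' = 0 \<and>
                     (\<forall>j\<in>active g (xbar, ybar) - {q'}. ubar $ j > 0) \<longrightarrow> q' = q) \<and>
               local_min_on (\<lambda>(x, y, u). F (x, y)) (mpcc_set f g (active g (xbar, ybar)) {q})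
                 (xbar, ybar, ubar) \<and>
               (\<exists>w \<xi>. star_system F (lagrangian f g ubar) g (xbar, ybar) w \<xi> \<and>
                      (\<forall>j\<in>active g (xbar, ybar) - {q}. cgrad_y g j (xbar, ybar) \<bullet> w = 0) \<and>
                      cgrad_y g q (xbar, ybar) \<bullet> w \<le> 0 \<and> 0 \<le> \<xi> $ q))))
   \<and> (sol_set f g xbar = {ybar} \<and> type4 f g (xbar, ybar) \<longrightarrow>
       (\<exists>ubar. M_FJ f g (xbar, ybar) = {(0, ubar)} \<and>
          (\<forall>j\<in>active g (xbar, ybar). ubar $ j > 0) \<and>
          local_min_on (\<lambda>(x, y, u0, u). F (x, y))
            {(x, y, u0, u).
               u0 *\<^sub>R grad_y f (x, y) + (\<Sum>j\<in>active g (xbar, ybar). u $ j *\<^sub>R cgrad_y g j (x, y)) = 0 \<and>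
               (\<forall>j\<in>active g (xbar, ybar). g (x, y) $ j = 0) \<and>
               0 \<le> u0 \<and> u0 + (\<Sum>j\<in>active g (xbar, ybar). u $ j) = 1}
            (xbar, ybar, 0, ubar) \<and>
          (\<exists>w \<xi>. star_system F (\<lambda>z. ubar \<bullet> g z) g (xbar, ybar) w \<xi> \<and>
                 grad_y f (xbar, ybar) \<bullet> w \<le> 0 \<and>
                 (\<forall>j\<in>active g (xbar, ybar). cgrad_y g j (xbar, ybar) \<bullet> w = 0))))
   \<and> (sol_set f g xbar = {ybar} \<and> type5_1 f g (xbar, ybar) \<longrightarrow>
       (\<exists>ubar q \<mu>bar.
          ubar \<in> M_KKT f g (xbar, ybar) \<and> q \<in> active g (xbar, ybar) \<and> ubar $ q = 0 \<and>
          (\<forall>j\<in>active g (xbar, ybar) - {q}. ubar $ j > 0) \<and>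
          (\<forall>u' q'. u' \<in> M_KKT f g (xbar, ybar) \<and> q' \<in> active g (xbar, ybar) \<and> u' $ q' = 0 \<and>
                   (\<forall>j\<in>active g (xbar, ybar) - {q'}. u' $ j > 0) \<longrightarrow> u' = ubar) \<and>
          (\<forall>j\<in>active g (xbar, ybar). \<mu>bar $ j > 0) \<and>
          (\<forall>j. j \<notin> active g (xbar, ybar) \<longrightarrow> \<mu>bar $ j = 0) \<and>
          M_KKT f g (xbar, ybar) = {ubar + t *\<^sub>R \<mu>bar | t. 0 \<le> t} \<and>
          local_min_on (\<lambda>(x, y, u). F (x, y)) (mpcc_set f g (active g (xbar, ybar)) {q})
            (xbar, ybar, ubar) \<and>
          (\<exists>\<xi>. star_system F (lagrangian f g ubar) g (xbar, ybar) 0 \<xi> \<and>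
               (\<forall>j\<in>active g (xbar, ybar) - {q}. cgrad_y g j (xbar, ybar) \<bullet> 0 = 0) \<and>
               cgrad_y g q (xbar, ybar) \<bullet> 0 \<le> 0 \<and> 0 \<le> \<xi> $ q) \<and>
          local_min_on F
            {(x, y). (\<forall>j\<in>active g (xbar, ybar) - {q}. g (x, y) $ j = 0) \<and> g (x, y) $ q \<le> 0}
            (xbar, ybar) \<and>
          (\<exists>\<xi>. 0 = grad F (xbar, ybar) + grad (\<lambda>z. \<xi> \<bullet> g z) (xbar, ybar) \<and>
               (\<forall>i. i \<notin> active g (xbar, ybar) \<longrightarrow> \<xi> $ i = 0) \<and> 0 \<le> \<xi> $ q)))
   \<and> (sol_set f g xbar = {ybar} \<and> type5_2 f g (xbar, ybar) \<longrightarrow>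
       (\<exists>q r u1 u2.
          (q \<in> active g (xbar, ybar) \<and> r \<in> active g (xbar, ybar) \<and> q \<noteq> r \<and>
           u1 \<in> M_KKT f g (xbar, ybar) \<and> u2 \<in> M_KKT f g (xbar, ybar) \<and>
           u1 $ q = 0 \<and> (\<forall>j\<in>active g (xbar, ybar) - {q}. u1 $ j > 0) \<and>
           u2 $ r = 0 \<and> (\<forall>j\<in>active g (xbar, ybar) - {r}. u2 $ j > 0)) \<and>
          (\<forall>q' r' u1' u2'.
             q' \<in> active g (xbar, ybar) \<and> r' \<in> active g (xbar, ybar) \<and> q' \<noteq> r' \<and>
             u1' \<in> M_KKT f g (xbar, ybar) \<and> u2' \<in> M_KKT f g (xbar, ybar) \<and>
             u1' $ q' = 0 \<and> (\<forall>j\<in>active g (xbar, ybar) - {q'}. u1' $ j > 0) \<and>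
             u2' $ r' = 0 \<and> (\<forall>j\<in>active g (xbar, ybar) - {r'}. u2' $ j > 0)
             \<longrightarrow> {q', r'} = {q, r}) \<and>
          M_KKT f g (xbar, ybar) = closed_segment u1 u2 \<and>
          (\<forall>ubar\<in>M_KKT f g (xbar, ybar).
             local_min_on (\<lambda>(x, y, u). F (x, y)) (mpcc_set f g (active g (xbar, ybar)) {q, r})
               (xbar, ybar, ubar) \<and>
             (\<exists>w \<xi>. S_stationary F f g (xbar, ybar) ubar {q, r} w \<xi>) \<and>
             (\<forall>\<xi>. (\<exists>w. S_stationary F f g (xbar, ybar) ubar {q, r} w \<xi>) \<longleftrightarrow>
                  0 = grad F (xbar, ybar) + grad (\<lambda>z. \<xi> \<bullet> g z) (xbar, ybar) \<and>
                  (\<forall>i. i \<notin> active g (xbar, ybar) \<longrightarrow> \<xi> $ i = 0) \<and>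
                  (ubar = u1 \<longrightarrow> 0 \<le> \<xi> $ q) \<and> (ubar = u2 \<longrightarrow> 0 \<le> \<xi> $ r)))))
   \<and> (\<forall>ybar2 y1 y2.
       case_II f g xbar ybar ybar2 \<and>
       local_min_branch f g xbar ybar y1 \<and> local_min_branch f g xbar ybar2 y2 \<longrightarrow>
       (\<forall>\<^sub>F x in nhds xbar. opt_value f g x = ereal (min (f (x, y1 x)) (f (x, y2 x)))) \<and>
       (\<exists>u1 u2. M_KKT f g (xbar, ybar) = {u1} \<and> M_KKT f g (xbar, ybar2) = {u2} \<and>
          (\<forall>j\<in>active g (xbar, ybar). u1 $ j > 0) \<and>
          (\<exists>\<mu>>0.
             local_min_on
               (\<lambda>(x, y, u). ereal (F (x, y)) + ereal \<mu> * (ereal (f (x, y)) - opt_value f g x))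
               (nonsmooth_set f g (active g (xbar, ybar))) (xbar, ybar, u1) \<and>
             (\<exists>lam1 lam2 w \<xi>. 0 \<le> lam1 \<and> 0 \<le> lam2 \<and> lam1 + lam2 = 1 \<and>
                0 = grad_x F (xbar, ybar)
                    + \<mu> * (lam1 * (grad_x f (xbar, ybar) - grad_x f (xbar, ybar)
                                   - (\<Sum>i\<in>UNIV. u1 $ i * cgrad_x g i (xbar, ybar)))
                         + lam2 * (grad_x f (xbar, ybar) - grad_x f (xbar, ybar2)
                                   - (\<Sum>i\<in>UNIV. u2 $ i * cgrad_x g i (xbar, ybar2))))
                    - hess_xy (lagrangian f g u1) (xbar, ybar) \<bullet> w
                    + grad_x (\<lambda>z. \<xi> \<bullet> g z) (xbar, ybar) \<and>
                0 = grad_y F (xbar, ybar) + \<mu> *\<^sub>R grad_y f (xbar, ybar)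
                    - hess_yy (lagrangian f g u1) (xbar, ybar) *v w
                    + grad_y (\<lambda>z. \<xi> \<bullet> g z) (xbar, ybar) \<and>
                (\<forall>i. i \<notin> active g (xbar, ybar) \<longrightarrow> \<xi> $ i = 0) \<and>
                (\<forall>j\<in>active g (xbar, ybar). cgrad_y g j (xbar, ybar) \<bullet> w = 0)))))"
proof -
  have f3: "Ck_on (Suc 2) f UNIV" using f_C3 by (simp only: numeral_3_eq_3 numeral_2_eq_2)
  have g3: "Ck_on (Suc 2) (\<lambda>z. g z $ j) UNIV" for j
    using Ck_on_component[OF g_C3, of j] by (simp only: numeral_3_eq_3 numeral_2_eq_2)
  interpret bilevel_lower_level f g
    by unfold_locales (rule Ck_on_Suc_imp[OF f3] Ck_on_Suc_imp[OF g3] compact_levels)+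
  show ?thesis
    \<comment> \<open>The introduction rules also split the conclusion of Case II, so
      \<open>case_II_case\<close> is used through each of its two conjuncts.\<close>
    by (intro conjI impI allI; elim conjE;
        (rule type1_case[OF F_C1 local_min] type2_case[OF F_C1 local_min] type4_case[OF F_C1 local_min]
           type5_1_case[OF F_C1 local_min] type5_2_case[OF F_C1 local_min]
           case_II_case[OF F_C1 local_min, THEN conjunct1] case_II_case[OF F_C1 local_min, THEN conjunct2]; assumption))
qed

end
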